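(* Let $m\ge3$ and suppose that: the regularity condition of order $m$ holds; $q_\lambda+hp_\lambda\ge0$ on $H_T$ for all $h\in(0,h_0]$, $\lambda\in\Lambda_1$; $\sum_{\lambda\in\Lambda_1}\lambda q_\lambda=0$ on $H_T$; $c\ge c_0$ for a constant $c_0>0$; and the first and the second structural inequalities of order $m$ hold. Let $k\ge0$ and $l\in[0,m]$ be integers, and suppose one of the following conditions is met: (i) $m\ge3k+3+l$; (ii) $m\ge2k+3+l$, $\Lambda_1=-\Lambda_1$ and $q_\lambda=q_{-\lambda}$ for all $\lambda\in\Lambda_1$; (iii) $k$ is odd, $m\ge2k+2+l$, $\Lambda_1=-\Lambda_1$, and $q_\lambda=q_{-\lambda}$, $p_{-\lambda}=-p_\lambda$ for all $\lambda\in\Lambda_1$. Then for every multi-index $\alpha$ with $|\alpha|\le l$ the function $D^\alpha u_h$ is continuous on $H_T$ and $$D^\alpha u_h(t,x)=D^\alpha u^{(0)}(t,x)+\sum_{1\le j\le k}\frac{h^j}{j!}D^\alpha u^{(j)}(t,x)+h^{k+1}D^\alpha r_h(t,x)$$ for all $(t,x)\in H_T$, $h\in(0,h_0]$, where $r_h$ satisfies $$|D^\alpha r_h(t,x)|\le N(\|f\|_m+\|g\|_m)\qquad\text{for all }(t,x)\in H_T,\ h\in(0,h_0].$$ In each of the cases (i)–(iii) the constant $N$ depends only on $d$, $m$, $\delta$, $K$, $\tau_0$, $c_0$, $|\Lambda_1|$, $\|\Lambda_1\|$, $M_0,\dots,M_m$ (in particular not on $T$). In case (iii), $u^{(j)}=0$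 for all odd $j$ in the expansion.
   Context: Setting. Fix $d\ge1$, $h_0,T\in(0,\infty)$; $H_T=[0,T]\times\mathbb R^d$. $\Lambda_1\subset\mathbb R^d$ is a finite set with $0\notin\Lambda_1$, and $|\Lambda_1|^2:=\sum_{\lambda\in\Lambda_1}|\lambda|^2$. For $\lambda\in\Lambda_1$, $q_\lambda\ge0$, $p_\lambda$, and also $c$, are real Borel functions on $[0,\infty)\times\mathbb R^d$; $f$ is a real Borel function on $H_T$ and $g$ a real Borel function on $\mathbb R^d$. Spaces. $D^k\varphi$ is the collection of all $x$-partial derivatives of order $k$, $|D^k\varphi|^2=\sum_{|\alpha|=k}|D^\alpha\varphi|^2$. A bounded Borel function $\psi$ on $H_T$ belongs to $\mathfrak B^m$ if for each $t\in[0,T]$ the function $\psi(t,\cdot)$ is continuous on $\mathbb R^d$ and for all multi-indices $|\alpha|\le m$ the generalized derivatives $D^\alpha\psi$ in $x$ are bounded on $H_T$; then $\|\psi\|_m^2:=\sup_{H_T}\sum_{|\alpha|\le m}|D^\alpha\psi|^2$. The same notation is used for functions independent of $t$. Regularity condition of order $m$ (with constants $M_0,\dots,M_m$): $p_\lambda,q_\lambda,c,f,g\in\mathfrak B^m$ for all $\lambda\in\Lambda_1$ and, for $k=0,\dots,m$, $\sup_{H_T}\big(\sum_{\lambda\in\Lambda_1}(|D^kq_\lambda|^2+|D^kp_\lambda|^2)+|D^kc|^2\big)\le M_k^2$. Finite difference equation. $\delta_{h,\lambda}\varphi(x)=h^{-1}(\varphi(x+h\lambda)-\varphi(x))$, $L_h\varphi=\frac1h\sum_{\lambda\in\Lambda_1}q_\lambda\delta_{h,\lambda}\varphi+\sum_{\lambda\in\Lambda_1}p_\lambda\delta_{h,\lambda}\varphi-c\varphi$.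 Under the regularity condition, for each $h\in(0,h_0]$ the equation $u(t,x)=g(x)+\int_0^t(L_hu(s,x)+f(s,x))\,ds$, $(t,x)\in H_T$, has a unique bounded solution, denoted $u_h$. Coefficients of the expansion. $\partial_\lambda\varphi=\sum_i\lambda_iD_i\varphi$; $\mathcal L=\tfrac12\sum_{\lambda\in\Lambda_1}q_\lambda\partial_\lambda^2+\sum_{\lambda\in\Lambda_1}p_\lambda\partial_\lambda-c$; $\mathcal L^{(i)}=\frac1{(i+1)(i+2)}\sum_{\lambda\in\Lambda_1}q_\lambda\partial_\lambda^{i+2}+\frac1{i+1}\sum_{\lambda\in\Lambda_1}p_\lambda\partial_\lambda^{i+1}$, $i\ge1$. $u^{(0)}$ is the unique solution in $\mathfrak B^2$ (it lies in $\mathfrak B^m$) of $u(t,x)=g(x)+\int_0^t[\mathcal Lu+f](s,x)\,ds$ on $H_T$, and $u^{(1)},\dots,u^{(k)}$ is the unique solution of the system $u^{(j)}(t,x)=\int_0^t\big(\mathcal Lu^{(j)}+\sum_{i=1}^j\binom ji\mathcal L^{(i)}u^{(j-i)}\big)(s,x)\,ds$, $j=1,\dots,k$, with $u^{(j)}\in\mathfrak B^{m-3j}$ in case (i) and $u^{(j)}\in\mathfrak B^{m-2j}$ in cases (ii), (iii). Solutions of such an equation $u(t,x)=u(0,x)+\int_0^t[\mathcal Lu+F](s,x)\,ds$ are bounded continuous functions on $H_T$ in $\mathfrak B^2$ for which the equation holds, for every $t\in[0,T]$, after multiplication by any $\phi\in C_0^\infty(\mathbb R^d)$ and integration over $\mathbb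 R^d$. Structural notation. Fix $\tau_0>0$, numbers $\tau_\lambda\in[0,\infty)$ ($\lambda\in\Lambda_1$), $\delta\in(0,1]$, $K\in[1,\infty)$; $\|\Lambda_1\|^2:=\sum_{\lambda\in\Lambda_1}|\tau_\lambda\lambda|^2$. Let $\Lambda_2=\{\ell^1,\dots,\ell^d\}$ consist of distinct vectors not in $\Lambda_1$ and $\Lambda=\Lambda_1\cup\Lambda_2$. For $\lambda\in\Lambda_1$: $T_{h,\lambda}\varphi(x)=\varphi(x+h\lambda)$, $\bar\delta_{h,\lambda}=\tau_\lambda h^{-1}(T_{h,\lambda}-1)$; for $\ell^i\in\Lambda_2$: $T_{h,\ell^i}=1$ (identity), $\bar\delta_{h,\ell^i}=\tau_0D_i$. For $\lambda=(\lambda^1,\lambda^2)\in\Lambda^2$: $T_{h,\lambda}=T_{h,\lambda^1}T_{h,\lambda^2}$, $\bar\delta_{h,\lambda}=\bar\delta_{h,\lambda^1}\bar\delta_{h,\lambda^2}$. For $\mu\in\Lambda^k$, $k=1,2$: $Q_{h,\mu}\varphi=h^{-1}\sum_{\lambda\in\Lambda_1}(\bar\delta_{h,\mu}q_\lambda)\delta_{h,\lambda}\varphi$, $L^0_{h,\mu}\varphi=Q_{h,\mu}\varphi+\sum_{\lambda\in\Lambda_1}(\bar\delta_{h,\mu}p_\lambda)\delta_{h,\lambda}\varphi$. Further $A_h(\varphi)=2\sum_{\lambda\in\Lambda}(\bar\delta_{h,\lambda}\varphi)L^0_{h,\lambda}T_{h,\lambda}\varphi$, $\mathcal Q_h(\varphi)=\sum_{\lambda\in\Lambda_1}(q_\lambda+hp_\lambda)(\delta_{h,\lambda}\varphi)^2$.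 $\mathfrak K$ is the set of bounded operators $\mathcal K_h=\mathcal K_h(t)$ mapping the space of bounded Borel functions on $\mathbb R^d$ into itself, preserving nonnegativity, with $\mathcal K_h1\le1$. First structural inequality of order $m$ ($m\ge1$): for any $h\in(0,h_0]$ there is $\mathcal K_h=\mathcal K_{h,m}\in\mathfrak K$ such that on $H_T$, for all smooth $\varphi$, $$mA_h(\varphi)\le(1-\delta)\sum_{\lambda\in\Lambda}\mathcal Q_h(\bar\delta_{h,\lambda}\varphi)+K\mathcal Q_h(\varphi)+2(1-\delta)c\,\mathcal K_h\Big(\sum_{\lambda\in\Lambda}|\bar\delta_{h,\lambda}\varphi|^2\Big).$$ Second structural inequality of order $m$ ($m\ge2$): for any $h\in(0,h_0]$ and $n=1,\dots,m$ there is $\mathcal K_h=\mathcal K_{h,n}\in\mathfrak K$ such that on $H_T$, for all smooth $\varphi$, $$n\sum_{\nu\in\Lambda}A_h(\bar\delta_{h,\nu}\varphi)+n(n-1)\sum_{\lambda\in\Lambda^2}(\bar\delta_{h,\lambda}\varphi)Q_{h,\lambda}T_{h,\lambda}\varphi\le(1-\delta)\sum_{\lambda\in\Lambda^2}\mathcal Q_h(\bar\delta_{h,\lambda}\varphi)+K\sum_{\lambda\in\Lambda}\mathcal Q_h(\bar\delta_{h,\lambda}\varphi)$$ $$+2(1-\delta)c\,\mathcal K_h\Big(\sum_{\lambda\in\Lambda^2}|\bar\delta_{h,\lambda}\varphi|^2\Big)+K\mathcal K_h\Big(\sum_{\lambda\in\Lambda}|\bar\delta_{h,\lambda}\varphi|^2\Big).$$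 *)

theory Defs
  imports "HOL-Analysis.Analysis" "HOL-Probability.Essential_Supremum"
begin

section \<open>Smooth functions and generalized derivatives\<close>

definition pdiff :: "'d::finite \<Rightarrow> (real^'d \<Rightarrow> real) \<Rightarrow> real^'d \<Rightarrow> real" where
  "pdiff i \<phi> x = frechet_derivative \<phi> (at x) (axis i 1)"

definition smooth :: "(real^'d::finite \<Rightarrow> real) \<Rightarrow> bool" where
  "smooth \<phi> \<longleftrightarrow> (\<forall>is x. foldr pdiff is \<phi> differentiable (at x))"

definition test_function :: "(real^'d::finite \<Rightarrow> real) \<Rightarrow> bool" where
  "test_function \<phi> \<longleftrightarrow> smooth \<phi> \<and> compact (closure {x. \<phi> x \<noteq> 0})"

type_synonym 'd multiindex = "'d \<Rightarrow> nat"

definition mi_order :: "'d::finite multiindex \<Rightarrow> nat" where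
  "mi_order \<alpha> = (\<Sum>i\<in>UNIV. \<alpha> i)"

definition unit_index :: "'d \<Rightarrow> 'd multiindex" where
  "unit_index i = (\<lambda>_. 0)(i := 1)"

definition locally_integrable :: "(real^'d::finite \<Rightarrow> real) \<Rightarrow> bool" where
  "locally_integrable u \<longleftrightarrow> (\<forall>C. compact C \<longrightarrow> set_integrable lborel C u)"

text \<open>The classical derivative of order \<open>\<alpha>\<close> of a test function is written as an iterated
  partial derivative along a list of indices in which each \<open>i\<close> occurs \<open>\<alpha> i\<close> times; the order
  of the list is irrelevant because partial derivatives of smooth functions commute.\<close>

definition weak_deriv :: "'d::finite multiindex \<Rightarrow> (real^'d \<Rightarrow> real) \<Rightarrow> (real^'d \<Rightarrow> real) \<Rightarrow> bool" where
  "weak_deriv \<alpha> u v \<longleftrightarrow> locally_integrable u \<and> locally_integrable v \<and>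
     (\<forall>\<phi> is. test_function \<phi> \<and> count_list is = \<alpha> \<longrightarrow>
        (\<integral>x. u x * foldr pdiff is \<phi> x \<partial>lborel) = (-1) ^ mi_order \<alpha> * (\<integral>x. v x * \<phi> x \<partial>lborel))"

definition has_gen_deriv :: "'d::finite multiindex \<Rightarrow> (real^'d \<Rightarrow> real) \<Rightarrow> bool" where
  "has_gen_deriv \<alpha> u \<longleftrightarrow> (\<exists>v. weak_deriv \<alpha> u v)"

text \<open>\<open>gen_deriv \<alpha> u\<close> is the generalized derivative \<open>D\<^sup>\<alpha> u\<close>. It is determined up to null sets only;
  the continuous version is taken whenever there is one (so that for \<open>|\<alpha>|\<close> times
  continuously differentiable \<open>u\<close> it is the classical derivative), and \<open>D\<^sup>0 u\<close> is \<open>u\<close> itself. It is meaningful only if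
  \<open>has_gen_deriv \<alpha> u\<close>.\<close>

definition gen_deriv :: "'d::finite multiindex \<Rightarrow> (real^'d \<Rightarrow> real) \<Rightarrow> real^'d \<Rightarrow> real" where
  "gen_deriv \<alpha> u =
     (if \<alpha> = (\<lambda>_. 0) then u
      else if \<exists>v. weak_deriv \<alpha> u v \<and> continuous_on UNIV v
           then SOME v. weak_deriv \<alpha> u v \<and> continuous_on UNIV v
           else SOME v. weak_deriv \<alpha> u v)"

definition D1 :: "'d::finite \<Rightarrow> (real^'d \<Rightarrow> real) \<Rightarrow> real^'d \<Rightarrow> real" where
  "D1 i = gen_deriv (unit_index i)"

definition ddir :: "real^'d::finite \<Rightarrow> (real^'d \<Rightarrow> real) \<Rightarrow> real^'d \<Rightarrow> real" where
  "ddir v u x = (\<Sum>i\<in>UNIV. v $ i * D1 i u x)"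


section \<open>Function spaces and the regularity condition\<close>

text \<open>Derivatives of top order are defined almost everywhere in \<open>x\<close> only, so suprema over
  \<open>[0,T] \<times> \<real>\<^sup>d\<close> are essential suprema in \<open>x\<close>; for \<open>F t\<close> continuous this is the supremum.\<close>

definition xsup :: "real \<Rightarrow> (real \<Rightarrow> real^'d::finite \<Rightarrow> real) \<Rightarrow> ereal" where
  "xsup T F = (SUP t\<in>{0..T}. esssup lborel (\<lambda>x. ereal (F t x)))"

definition borel_on :: "real set \<Rightarrow> (real \<Rightarrow> real^'d::finite \<Rightarrow> real) \<Rightarrow> bool" where
  "borel_on I \<psi> \<longleftrightarrow> (\<lambda>(t, x). \<psi> t x) \<in> borel_measurable (restrict_space borel (I \<times> UNIV))"

definition bounded_HT :: "real \<Rightarrow> (real \<Rightarrow> real^'d::finite \<Rightarrow> real) \<Rightarrow> bool" where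
  "bounded_HT T \<psi> \<longleftrightarrow> (\<exists>C. \<forall>t\<in>{0..T}. \<forall>x. \<bar>\<psi> t x\<bar> \<le> C)"

definition in_B :: "real \<Rightarrow> nat \<Rightarrow> (real \<Rightarrow> real^'d::finite \<Rightarrow> real) \<Rightarrow> bool" where
  "in_B T m \<psi> \<longleftrightarrow> borel_on {0..T} \<psi> \<and> bounded_HT T \<psi> \<and>
     (\<forall>t\<in>{0..T}. continuous_on UNIV (\<psi> t)) \<and>
     (\<forall>\<alpha>. mi_order \<alpha> \<le> m \<longrightarrow>
        (\<forall>t\<in>{0..T}. has_gen_deriv \<alpha> (\<psi> t)) \<and> xsup T (\<lambda>t x. \<bar>gen_deriv \<alpha> (\<psi> t) x\<bar>) < \<infinity>)"

definition norm_B :: "real \<Rightarrow> nat \<Rightarrow> (real \<Rightarrow> real^'d::finite \<Rightarrow> real) \<Rightarrow> real" where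
  "norm_B T m \<psi> = sqrt (real_of_ereal (xsup T (\<lambda>t x. \<Sum>\<alpha> | mi_order \<alpha> \<le> m. (gen_deriv \<alpha> (\<psi> t) x)\<^sup>2)))"

definition Dk_sq :: "nat \<Rightarrow> (real^'d::finite \<Rightarrow> real) \<Rightarrow> real^'d \<Rightarrow> real" where
  "Dk_sq k u x = (\<Sum>\<alpha> | mi_order \<alpha> = k. (gen_deriv \<alpha> u x)\<^sup>2)"

definition regularity ::
  "real \<Rightarrow> (real^'d::finite) set \<Rightarrow> (real^'d \<Rightarrow> real \<Rightarrow> real^'d \<Rightarrow> real) \<Rightarrow>
   (real^'d \<Rightarrow> real \<Rightarrow> real^'d \<Rightarrow> real) \<Rightarrow> (real \<Rightarrow> real^'d \<Rightarrow> real) \<Rightarrow>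
   (real \<Rightarrow> real^'d \<Rightarrow> real) \<Rightarrow> (real^'d \<Rightarrow> real) \<Rightarrow> nat \<Rightarrow> (nat \<Rightarrow> real) \<Rightarrow> bool" where
  "regularity T \<Lambda>1 q p c f g m M \<longleftrightarrow>
     (\<forall>v\<in>\<Lambda>1. in_B T m (p v) \<and> in_B T m (q v)) \<and>
     in_B T m c \<and> in_B T m f \<and> in_B T m (\<lambda>_. g) \<and>
     (\<forall>k\<le>m. xsup T (\<lambda>t x. (\<Sum>v\<in>\<Lambda>1. Dk_sq k (q v t) x + Dk_sq k (p v t) x) + Dk_sq k (c t) x)
        \<le> ereal ((M k)\<^sup>2))"


section \<open>The finite difference equation\<close>

definition fdiff :: "real \<Rightarrow> real^'d::finite \<Rightarrow> (real^'d \<Rightarrow> real) \<Rightarrow> real^'d \<Rightarrow> real" where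
  "fdiff h v \<phi> x = (\<phi> (x + h *\<^sub>R v) - \<phi> x) / h"

definition L_h ::
  "(real^'d::finite) set \<Rightarrow> (real^'d \<Rightarrow> real \<Rightarrow> real^'d \<Rightarrow> real) \<Rightarrow>
   (real^'d \<Rightarrow> real \<Rightarrow> real^'d \<Rightarrow> real) \<Rightarrow> (real \<Rightarrow> real^'d \<Rightarrow> real) \<Rightarrow>
   real \<Rightarrow> real \<Rightarrow> (real^'d \<Rightarrow> real) \<Rightarrow> real^'d \<Rightarrow> real" where
  "L_h \<Lambda>1 q p c h t \<phi> x =
     (1 / h) * (\<Sum>v\<in>\<Lambda>1. q v t x * fdiff h v \<phi> x) + (\<Sum>v\<in>\<Lambda>1. p v t x * fdiff h v \<phi> x) - c t x * \<phi> x"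

definition fd_solution ::
  "real \<Rightarrow> (real^'d::finite) set \<Rightarrow> (real^'d \<Rightarrow> real \<Rightarrow> real^'d \<Rightarrow> real) \<Rightarrow>
   (real^'d \<Rightarrow> real \<Rightarrow> real^'d \<Rightarrow> real) \<Rightarrow> (real \<Rightarrow> real^'d \<Rightarrow> real) \<Rightarrow>
   (real \<Rightarrow> real^'d \<Rightarrow> real) \<Rightarrow> (real^'d \<Rightarrow> real) \<Rightarrow> real \<Rightarrow> (real \<Rightarrow> real^'d \<Rightarrow> real) \<Rightarrow> bool" where
  "fd_solution T \<Lambda>1 q p c f g h u \<longleftrightarrow> bounded_HT T u \<and>
     (\<forall>t\<in>{0..T}. \<forall>x.
        set_integrable lborel {0..t} (\<lambda>s. L_h \<Lambda>1 q p c h s (u s) x + f s x) \<and>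
        u t x = g x + (LINT s:{0..t}|lborel. L_h \<Lambda>1 q p c h s (u s) x + f s x))"


section \<open>The coefficients of the expansion\<close>

definition L_op ::
  "(real^'d::finite) set \<Rightarrow> (real^'d \<Rightarrow> real \<Rightarrow> real^'d \<Rightarrow> real) \<Rightarrow>
   (real^'d \<Rightarrow> real \<Rightarrow> real^'d \<Rightarrow> real) \<Rightarrow> (real \<Rightarrow> real^'d \<Rightarrow> real) \<Rightarrow>
   real \<Rightarrow> (real^'d \<Rightarrow> real) \<Rightarrow> real^'d \<Rightarrow> real" where
  "L_op \<Lambda>1 q p c t \<phi> x =
     (1 / 2) * (\<Sum>v\<in>\<Lambda>1. q v t x * (ddir v ^^ 2) \<phi> x) + (\<Sum>v\<in>\<Lambda>1. p v t x * ddir v \<phi> x) - c t x * \<phi> x"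

definition L_coef ::
  "(real^'d::finite) set \<Rightarrow> (real^'d \<Rightarrow> real \<Rightarrow> real^'d \<Rightarrow> real) \<Rightarrow>
   (real^'d \<Rightarrow> real \<Rightarrow> real^'d \<Rightarrow> real) \<Rightarrow> nat \<Rightarrow>
   real \<Rightarrow> (real^'d \<Rightarrow> real) \<Rightarrow> real^'d \<Rightarrow> real" where
  "L_coef \<Lambda>1 q p i t \<phi> x =
     1 / (real (i + 1) * real (i + 2)) * (\<Sum>v\<in>\<Lambda>1. q v t x * (ddir v ^^ (i + 2)) \<phi> x) +
     1 / real (i + 1) * (\<Sum>v\<in>\<Lambda>1. p v t x * (ddir v ^^ (i + 1)) \<phi> x)"

text \<open>Solutions of \<open>u(t,x) = v(x) + \<integral>\<^sub>0\<^sup>t [\<L>u + F](s,x) ds\<close>, the equation being tested against every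
  \<open>\<phi>\<close> in \<open>C\<^sub>0\<^sup>\<infinity>\<close>. The integration in \<open>x\<close> is carried out first, which makes the equation
  independent of the chosen versions of the generalized derivatives.\<close>

definition weak_solution ::
  "real \<Rightarrow> (real^'d::finite) set \<Rightarrow> (real^'d \<Rightarrow> real \<Rightarrow> real^'d \<Rightarrow> real) \<Rightarrow>
   (real^'d \<Rightarrow> real \<Rightarrow> real^'d \<Rightarrow> real) \<Rightarrow> (real \<Rightarrow> real^'d \<Rightarrow> real) \<Rightarrow>
   (real \<Rightarrow> real^'d \<Rightarrow> real) \<Rightarrow> (real^'d \<Rightarrow> real) \<Rightarrow> (real \<Rightarrow> real^'d \<Rightarrow> real) \<Rightarrow> bool" where
  "weak_solution T \<Lambda>1 q p c F v u \<longleftrightarrow>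
     in_B T 2 u \<and> continuous_on ({0..T} \<times> UNIV) (\<lambda>(t, x). u t x) \<and>
     (\<forall>t\<in>{0..T}. \<forall>\<phi>. test_function \<phi> \<longrightarrow>
        set_integrable lborel {0..t}
          (\<lambda>s. \<integral>x. \<phi> x * (L_op \<Lambda>1 q p c s (u s) x + F s x) \<partial>lborel) \<and>
        (\<integral>x. \<phi> x * u t x \<partial>lborel) = (\<integral>x. \<phi> x * v x \<partial>lborel) +
          (LINT s:{0..t}|lborel. \<integral>x. \<phi> x * (L_op \<Lambda>1 q p c s (u s) x + F s x) \<partial>lborel))"

definition expansion_coeffs ::
  "real \<Rightarrow> (real^'d::finite) set \<Rightarrow> (real^'d \<Rightarrow> real \<Rightarrow> real^'d \<Rightarrow> real) \<Rightarrow>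
   (real^'d \<Rightarrow> real \<Rightarrow> real^'d \<Rightarrow> real) \<Rightarrow> (real \<Rightarrow> real^'d \<Rightarrow> real) \<Rightarrow>
   (real \<Rightarrow> real^'d \<Rightarrow> real) \<Rightarrow> (real^'d \<Rightarrow> real) \<Rightarrow> nat \<Rightarrow> nat \<Rightarrow> nat \<Rightarrow>
   (nat \<Rightarrow> real \<Rightarrow> real^'d \<Rightarrow> real) \<Rightarrow> bool" where
  "expansion_coeffs T \<Lambda>1 q p c f g m r k U \<longleftrightarrow>
     weak_solution T \<Lambda>1 q p c f g (U 0) \<and>
     (\<forall>j\<in>{1..k}. in_B T (m - r * j) (U j) \<and>
        weak_solution T \<Lambda>1 q p c
          (\<lambda>s x. \<Sum>i=1..j. real (j choose i) * L_coef \<Lambda>1 q p i s (U (j - i) s) x) (\<lambda>_. 0) (U j))"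


section \<open>The structural inequalities\<close>

text \<open>The vectors \<open>e i\<close> (constituting \<open>\<Lambda>\<^sub>2\<close>) merely label the partial derivatives \<open>\<tau>0 D\<^sub>i\<close>. An element of
  \<open>\<Lambda>\<^sup>k\<close> is a list of length \<open>k\<close>.\<close>

definition sh1 :: "(real^'d::finite) set \<Rightarrow> real \<Rightarrow> real^'d \<Rightarrow> (real^'d \<Rightarrow> real) \<Rightarrow> real^'d \<Rightarrow> real" where
  "sh1 \<Lambda>1 h v \<phi> = (if v \<in> \<Lambda>1 then (\<lambda>x. \<phi> (x + h *\<^sub>R v)) else \<phi>)"

definition bdiff1 ::
  "(real^'d::finite) set \<Rightarrow> (real^'d \<Rightarrow> real) \<Rightarrow> real \<Rightarrow> ('d \<Rightarrow> real^'d) \<Rightarrow> real \<Rightarrow>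
   real^'d \<Rightarrow> (real^'d \<Rightarrow> real) \<Rightarrow> real^'d \<Rightarrow> real" where
  "bdiff1 \<Lambda>1 \<tau> \<tau>0 e h v \<phi> =
     (if v \<in> \<Lambda>1 then (\<lambda>x. \<tau> v / h * (\<phi> (x + h *\<^sub>R v) - \<phi> x)) else (\<lambda>x. \<tau>0 * D1 (inv e v) \<phi> x))"

definition sh :: "(real^'d::finite) set \<Rightarrow> real \<Rightarrow> (real^'d) list \<Rightarrow> (real^'d \<Rightarrow> real) \<Rightarrow> real^'d \<Rightarrow> real" where
  "sh \<Lambda>1 h \<mu> = foldr (sh1 \<Lambda>1 h) \<mu>"

definition bdiff ::
  "(real^'d::finite) set \<Rightarrow> (real^'d \<Rightarrow> real) \<Rightarrow> real \<Rightarrow> ('d \<Rightarrow> real^'d) \<Rightarrow> real \<Rightarrow>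
   (real^'d) list \<Rightarrow> (real^'d \<Rightarrow> real) \<Rightarrow> real^'d \<Rightarrow> real" where
  "bdiff \<Lambda>1 \<tau> \<tau>0 e h \<mu> = foldr (bdiff1 \<Lambda>1 \<tau> \<tau>0 e h) \<mu>"

definition words :: "'a set \<Rightarrow> nat \<Rightarrow> 'a list set" where
  "words \<Lambda> k = {\<mu>. set \<mu> \<subseteq> \<Lambda> \<and> length \<mu> = k}"

text \<open>In the next four definitions \<open>q\<close> and \<open>p\<close> are the coefficients at a fixed time.\<close>

definition Q_op ::
  "(real^'d::finite) set \<Rightarrow> (real^'d \<Rightarrow> real) \<Rightarrow> real \<Rightarrow> ('d \<Rightarrow> real^'d) \<Rightarrow>
   (real^'d \<Rightarrow> real^'d \<Rightarrow> real) \<Rightarrow> real \<Rightarrow> (real^'d) list \<Rightarrow> (real^'d \<Rightarrow> real) \<Rightarrow> real^'d \<Rightarrow> real" where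
  "Q_op \<Lambda>1 \<tau> \<tau>0 e q h \<mu> \<phi> x =
     (1 / h) * (\<Sum>v\<in>\<Lambda>1. bdiff \<Lambda>1 \<tau> \<tau>0 e h \<mu> (q v) x * fdiff h v \<phi> x)"

definition L0_op ::
  "(real^'d::finite) set \<Rightarrow> (real^'d \<Rightarrow> real) \<Rightarrow> real \<Rightarrow> ('d \<Rightarrow> real^'d) \<Rightarrow>
   (real^'d \<Rightarrow> real^'d \<Rightarrow> real) \<Rightarrow> (real^'d \<Rightarrow> real^'d \<Rightarrow> real) \<Rightarrow> real \<Rightarrow>
   (real^'d) list \<Rightarrow> (real^'d \<Rightarrow> real) \<Rightarrow> real^'d \<Rightarrow> real" where
  "L0_op \<Lambda>1 \<tau> \<tau>0 e q p h \<mu> \<phi> x =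
     Q_op \<Lambda>1 \<tau> \<tau>0 e q h \<mu> \<phi> x + (\<Sum>v\<in>\<Lambda>1. bdiff \<Lambda>1 \<tau> \<tau>0 e h \<mu> (p v) x * fdiff h v \<phi> x)"

definition A_form ::
  "(real^'d::finite) set \<Rightarrow> (real^'d \<Rightarrow> real) \<Rightarrow> real \<Rightarrow> ('d \<Rightarrow> real^'d) \<Rightarrow>
   (real^'d \<Rightarrow> real^'d \<Rightarrow> real) \<Rightarrow> (real^'d \<Rightarrow> real^'d \<Rightarrow> real) \<Rightarrow> real \<Rightarrow>
   (real^'d \<Rightarrow> real) \<Rightarrow> real^'d \<Rightarrow> real" where
  "A_form \<Lambda>1 \<tau> \<tau>0 e q p h \<phi> x =
     2 * (\<Sum>\<mu>\<in>words (\<Lambda>1 \<union> range e) 1.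
            bdiff \<Lambda>1 \<tau> \<tau>0 e h \<mu> \<phi> x * L0_op \<Lambda>1 \<tau> \<tau>0 e q p h \<mu> (sh \<Lambda>1 h \<mu> \<phi>) x)"

definition Q_form ::
  "(real^'d::finite) set \<Rightarrow> (real^'d \<Rightarrow> real^'d \<Rightarrow> real) \<Rightarrow> (real^'d \<Rightarrow> real^'d \<Rightarrow> real) \<Rightarrow>
   real \<Rightarrow> (real^'d \<Rightarrow> real) \<Rightarrow> real^'d \<Rightarrow> real" where
  "Q_form \<Lambda>1 q p h \<phi> x = (\<Sum>v\<in>\<Lambda>1. (q v x + h * p v x) * (fdiff h v \<phi> x)\<^sup>2)"

definition bdd_borel :: "(real^'d::finite \<Rightarrow> real) \<Rightarrow> bool" where
  "bdd_borel F \<longleftrightarrow> F \<in> borel_measurable borel \<and> bounded (range F)"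

definition in_KK :: "((real^'d::finite \<Rightarrow> real) \<Rightarrow> real^'d \<Rightarrow> real) \<Rightarrow> bool" where
  "in_KK \<K> \<longleftrightarrow>
     (\<forall>F. bdd_borel F \<longrightarrow> bdd_borel (\<K> F)) \<and>
     (\<forall>F G a b. bdd_borel F \<and> bdd_borel G \<longrightarrow>
        \<K> (\<lambda>x. a * F x + b * G x) = (\<lambda>x. a * \<K> F x + b * \<K> G x)) \<and>
     (\<exists>C. \<forall>F b. bdd_borel F \<and> (\<forall>x. \<bar>F x\<bar> \<le> b) \<longrightarrow> (\<forall>x. \<bar>\<K> F x\<bar> \<le> C * b)) \<and>
     (\<forall>F. bdd_borel F \<and> (\<forall>x. 0 \<le> F x) \<longrightarrow> (\<forall>x. 0 \<le> \<K> F x)) \<and>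
     (\<forall>x. \<K> (\<lambda>_. 1) x \<le> 1)"

definition grad_sq ::
  "(real^'d::finite) set \<Rightarrow> (real^'d \<Rightarrow> real) \<Rightarrow> real \<Rightarrow> ('d \<Rightarrow> real^'d) \<Rightarrow> real \<Rightarrow> nat \<Rightarrow>
   (real^'d \<Rightarrow> real) \<Rightarrow> real^'d \<Rightarrow> real" where
  "grad_sq \<Lambda>1 \<tau> \<tau>0 e h k \<phi> x = (\<Sum>\<mu>\<in>words (\<Lambda>1 \<union> range e) k. \<bar>bdiff \<Lambda>1 \<tau> \<tau>0 e h \<mu> \<phi> x\<bar>\<^sup>2)"

text \<open>The inequalities are required for those smooth \<open>\<phi>\<close> for which the arguments of the operators
  \<open>\<K>\<^sub>h\<close> are bounded, i.e. belong to the domain of these operators.\<close>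

definition structural1 ::
  "real \<Rightarrow> real \<Rightarrow> (real^'d::finite) set \<Rightarrow> (real^'d \<Rightarrow> real) \<Rightarrow> real \<Rightarrow> ('d \<Rightarrow> real^'d) \<Rightarrow>
   (real^'d \<Rightarrow> real \<Rightarrow> real^'d \<Rightarrow> real) \<Rightarrow> (real^'d \<Rightarrow> real \<Rightarrow> real^'d \<Rightarrow> real) \<Rightarrow>
   (real \<Rightarrow> real^'d \<Rightarrow> real) \<Rightarrow> real \<Rightarrow> real \<Rightarrow> nat \<Rightarrow> bool" where
  "structural1 T h0 \<Lambda>1 \<tau> \<tau>0 e q p c \<delta> K m \<longleftrightarrow>
     (\<forall>h\<in>{0<..h0}. \<exists>\<K> :: real \<Rightarrow> (real^'d \<Rightarrow> real) \<Rightarrow> real^'d \<Rightarrow> real.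
        \<forall>t\<in>{0..T}. in_KK (\<K> t) \<and>
          (let qt = (\<lambda>v. q v t); pt = (\<lambda>v. p v t); \<Lambda> = \<Lambda>1 \<union> range e;
               db = bdiff \<Lambda>1 \<tau> \<tau>0 e h; S = grad_sq \<Lambda>1 \<tau> \<tau>0 e h in
           \<forall>\<phi>. smooth \<phi> \<and> bounded (range (S 1 \<phi>)) \<longrightarrow> (\<forall>x.
             real m * A_form \<Lambda>1 \<tau> \<tau>0 e qt pt h \<phi> x
             \<le> (1 - \<delta>) * (\<Sum>\<mu>\<in>words \<Lambda> 1. Q_form \<Lambda>1 qt pt h (db \<mu> \<phi>) x)
               + K * Q_form \<Lambda>1 qt pt h \<phi> x
               + 2 * (1 - \<delta>) * c t x * \<K> t (S 1 \<phi>) x)))"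

definition structural2 ::
  "real \<Rightarrow> real \<Rightarrow> (real^'d::finite) set \<Rightarrow> (real^'d \<Rightarrow> real) \<Rightarrow> real \<Rightarrow> ('d \<Rightarrow> real^'d) \<Rightarrow>
   (real^'d \<Rightarrow> real \<Rightarrow> real^'d \<Rightarrow> real) \<Rightarrow> (real^'d \<Rightarrow> real \<Rightarrow> real^'d \<Rightarrow> real) \<Rightarrow>
   (real \<Rightarrow> real^'d \<Rightarrow> real) \<Rightarrow> real \<Rightarrow> real \<Rightarrow> nat \<Rightarrow> bool" where
  "structural2 T h0 \<Lambda>1 \<tau> \<tau>0 e q p c \<delta> K m \<longleftrightarrow>
     (\<forall>h\<in>{0<..h0}. \<forall>n\<in>{1..m}. \<exists>\<K> :: real \<Rightarrow> (real^'d \<Rightarrow> real) \<Rightarrow> real^'d \<Rightarrow> real.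
        \<forall>t\<in>{0..T}. in_KK (\<K> t) \<and>
          (let qt = (\<lambda>v. q v t); pt = (\<lambda>v. p v t); \<Lambda> = \<Lambda>1 \<union> range e;
               db = bdiff \<Lambda>1 \<tau> \<tau>0 e h; S = grad_sq \<Lambda>1 \<tau> \<tau>0 e h in
           \<forall>\<phi>. smooth \<phi> \<and> bounded (range (S 1 \<phi>)) \<and> bounded (range (S 2 \<phi>)) \<longrightarrow> (\<forall>x.
             real n * (\<Sum>\<nu>\<in>words \<Lambda> 1. A_form \<Lambda>1 \<tau> \<tau>0 e qt pt h (db \<nu> \<phi>) x)
             + real n * (real n - 1) *
                 (\<Sum>\<mu>\<in>words \<Lambda> 2. db \<mu> \<phi> x * Q_op \<Lambda>1 \<tau> \<tau>0 e qt h \<mu> (sh \<Lambda>1 h \<mu> \<phi>) x)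
             \<le> (1 - \<delta>) * (\<Sum>\<mu>\<in>words \<Lambda> 2. Q_form \<Lambda>1 qt pt h (db \<mu> \<phi>) x)
               + K * (\<Sum>\<mu>\<in>words \<Lambda> 1. Q_form \<Lambda>1 qt pt h (db \<mu> \<phi>) x)
               + 2 * (1 - \<delta>) * c t x * \<K> t (S 2 \<phi>) x
               + K * \<K> t (S 1 \<phi>) x)))"


section \<open>The three alternatives\<close>

definition sym_q ::
  "real \<Rightarrow> (real^'d::finite) set \<Rightarrow> (real^'d \<Rightarrow> real \<Rightarrow> real^'d \<Rightarrow> real) \<Rightarrow> bool" where
  "sym_q T \<Lambda>1 q \<longleftrightarrow> uminus ` \<Lambda>1 = \<Lambda>1 \<and> (\<forall>v\<in>\<Lambda>1. \<forall>t\<in>{0..T}. \<forall>x. q v t x = q (- v) t x)"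

definition antisym_p ::
  "real \<Rightarrow> (real^'d::finite) set \<Rightarrow> (real^'d \<Rightarrow> real \<Rightarrow> real^'d \<Rightarrow> real) \<Rightarrow> bool" where
  "antisym_p T \<Lambda>1 p \<longleftrightarrow> (\<forall>v\<in>\<Lambda>1. \<forall>t\<in>{0..T}. \<forall>x. p (- v) t x = - p v t x)"

definition case_i :: "nat \<Rightarrow> nat \<Rightarrow> nat \<Rightarrow> bool" where
  "case_i m k l \<longleftrightarrow> m \<ge> 3 * k + 3 + l"

definition case_ii ::
  "real \<Rightarrow> (real^'d::finite) set \<Rightarrow> (real^'d \<Rightarrow> real \<Rightarrow> real^'d \<Rightarrow> real) \<Rightarrow> nat \<Rightarrow> nat \<Rightarrow> nat \<Rightarrow> bool" where
  "case_ii T \<Lambda>1 q m k l \<longleftrightarrow> m \<ge> 2 * k + 3 + l \<and> sym_q T \<Lambda>1 q"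

definition case_iii ::
  "real \<Rightarrow> (real^'d::finite) set \<Rightarrow> (real^'d \<Rightarrow> real \<Rightarrow> real^'d \<Rightarrow> real) \<Rightarrow>
   (real^'d \<Rightarrow> real \<Rightarrow> real^'d \<Rightarrow> real) \<Rightarrow> nat \<Rightarrow> nat \<Rightarrow> nat \<Rightarrow> bool" where
  "case_iii T \<Lambda>1 q p m k l \<longleftrightarrow> odd k \<and> m \<ge> 2 * k + 2 + l \<and> sym_q T \<Lambda>1 q \<and> antisym_p T \<Lambda>1 p"

end

theory Submission
  imports Defs "HOL-Probability.Probability_Measure"
begin

text \<open>Everything rests on one discrete Bernstein estimate, uniform in the mesh size \<open>h\<close> and in \<open>T\<close>: for an
  explicit Euler discretization in time of the finite difference equation with smooth coefficients, the
  structural inequalities make the weighted sums of \<open>|\<delta>\<^sub>\<mu> u|\<^sup>2\<close> over words \<open>\<mu>\<close> in \<open>\<Lambda>\<close> obey a maximum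
  principle, and this bounds the \<open>x\<close>-derivatives of the solution up to order \<open>m\<close> by those of the data.
  Averaging the coefficients over short time intervals and mollifying them in \<open>x\<close> preserves the
  structural inequalities (in a supremum form), so the estimate passes to every approximate solution
  of the finite difference equation. Applied to \<open>u\<^sub>h\<close> it gives its smoothness; applied to mollifications
  of \<open>u\<^sup>(\<^sup>j\<^sup>)\<close>, which solve the finite difference equation up to a small error when \<open>h\<close> is small, it
  bounds the coefficients of the expansion; and applied to the remainder, whose right-hand side is a
  combination of Taylor remainders of the \<open>u\<^sup>(\<^sup>j\<^sup>)\<close>, it proves the theorem.\<close>


section \<open>Smooth functions\<close>

text \<open>The structural inequalities speak about smooth test functions and one time at a time,
  whereas the coefficients are merely measurable in t and have top derivatives only almost
  everywhere in x. Regularity is therefore measured by iterated differences (\<open>Xc\<close>):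
  such bounds follow from essential bounds on generalized derivatives and pass to averages and
  pointwise limits without choosing versions. Explicit Euler steps are used because for small steps
  each is, up to damping and source, a convex combination of values, which makes the maximum
  principle elementary, and because they keep iterates smooth. Quantities that blow up as h tends to
  0 restrict only the size of the time step, never the bound. Independence of T comes from c >= c0:
  the damping keeps a weighted square sum below a fixed level for any number of steps. At level k
  the structural inequalities leave the fraction \<delta> of the good quadratic form and K times the
  form of level k - 1; weighting level k by (K/\<delta>)^(n - k) lets these cancel. Coefficient
  bounds are used for linear combinations with unit coefficient vectors, which keeps the number of
  directions out of the constants.\<close>

type_synonym 'd fn = "(real, 'd) vec \<Rightarrow> real"

abbreviation pds :: "'d list => ('d::finite fn) => 'd fn"
 where "pds \<equiv> foldr pdiff"

lemma smoothD: "smooth \<phi> ==> \<phi> differentiable (at x)"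
 unfolding smooth_def by (drule spec[of _ "[]"]) simp

lemma smooth_pdiff: "smooth \<phi> ==> smooth (pdiff i \<phi>)"
 unfolding smooth_def
proof (intro allI)
 fix "is" x assume a: "\<forall>is x. foldr pdiff is \<phi> differentiable at x"
 show "foldr pdiff is (pdiff i \<phi>) differentiable at x"
  using a[rule_format, of "is @ [i]" x] by simp
qed

lemma smooth_pds: "smooth \<phi> ==> smooth (pds is \<phi>)"
 by (induction "is") (auto intro: smooth_pdiff)

text \<open>Smoothness quantifies over all iterated derivatives, so it is proved by exhibiting an
  invariant: a class of differentiable functions stable under every \<open>pdiff\<close>.\<close>

lemma smooth_closedI:
 assumes "P \<phi>" "!!\<phi> x. P \<phi> ==> \<phi> differentiable (at x)" "!!\<phi> i. P \<phi> ==> P (pdiff i \<phi>)"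
 shows "smooth \<phi>"
proof -
 have "P (pds is \<phi>)" for "is" by (induction "is") (auto intro: assms)
 then show ?thesis unfolding smooth_def using assms(2) by blast
qed

lemma pdiff_eqI: "(\<phi> has_derivative D) (at x) ==> pdiff i \<phi> x = D (axis i 1)"
 unfolding pdiff_def using frechet_derivative_at by metis

lemma differentiable_frechet:
 "\<phi> differentiable (at x) ==> (\<phi> has_derivative frechet_derivative \<phi> (at x)) (at x)"
 using frechet_derivative_works by blast

lemma frechet_expand:
 fixes \<phi> :: "'d::finite fn"
 assumes "\<phi> differentiable (at x)"
 shows "frechet_derivative \<phi> (at x) v = (\<Sum>i\<in>UNIV. v $ i * pdiff i \<phi> x)"
proof -
 interpret bounded_linear "frechet_derivative \<phi> (at x)"
  using differentiable_frechet[OF assms] has_derivative_bounded_linear by blast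
 have "v = (\<Sum>i\<in>UNIV. v $ i *\<^sub>R axis i 1)"
  using basis_expansion[of v] by (simp add: scalar_mult_eq_scaleR)
 then have "frechet_derivative \<phi> (at x) v = frechet_derivative \<phi> (at x) (\<Sum>i\<in>UNIV. v $ i *\<^sub>R axis i 1)"
  by simp
 also have "... = (\<Sum>i\<in>UNIV. v $ i * pdiff i \<phi> x)"
  by (simp add: sum scaleR pdiff_def)
 finally show ?thesis .
qed

lemma DERIV_line:
 fixes \<phi> :: "'d::finite fn"
 assumes "\<phi> differentiable (at (x + s *\<^sub>R v))"
 shows "((%s. \<phi> (x + s *\<^sub>R v)) has_real_derivative (\<Sum>i\<in>UNIV. v $ i * pdiff i \<phi> (x + s *\<^sub>R v))) (at s)"
proof -
 have 1: "((%s. x + s *\<^sub>R v) has_derivative (%r. r *\<^sub>R v)) (at s)"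
  by (auto intro!: derivative_eq_intros)
 have 2: "((%s. \<phi> (x + s *\<^sub>R v)) has_derivative (%r. frechet_derivative \<phi> (at (x + s *\<^sub>R v)) (r *\<^sub>R v))) (at s)"
  using has_derivative_compose[OF 1, of \<phi>] differentiable_frechet[OF assms] by blast
 have "(%r. frechet_derivative \<phi> (at (x + s *\<^sub>R v)) (r *\<^sub>R v)) = (*) (\<Sum>i\<in>UNIV. v $ i * pdiff i \<phi> (x + s *\<^sub>R v))"
  by (auto simp: frechet_expand[OF assms] fun_eq_iff sum_distrib_right sum_distrib_left mult_ac)
 then show ?thesis using 2 by (simp add: has_field_derivative_def)
qed

lemma sum_axis: "(\<Sum>i\<in>UNIV. (c *\<^sub>R axis j (1::real)) $ i * F i) = c * F j"
proof -
 have "(\<Sum>i\<in>UNIV. (c *\<^sub>R axis j (1::real)) $ i * F i) = (\<Sum>i\<in>UNIV. if i = j then c * F j else 0)"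
  by (intro sum.cong) (auto simp: axis_def)
 then show ?thesis by simp
qed

lemma mvt_line:
 fixes \<phi> :: "'d::finite fn"
 assumes "!!x. \<phi> differentiable (at x)"
 obtains \<theta> where "0 <= \<theta>" "\<theta> <= 1" "\<phi> (x + v) - \<phi> x = (\<Sum>i\<in>UNIV. v $ i * pdiff i \<phi> (x + \<theta> *\<^sub>R v))"
proof -
 have "\<exists>z. 0 < z \<and> z < 1 \<and> \<phi> (x + 1 *\<^sub>R v) - \<phi> (x + 0 *\<^sub>R v)
   = (1 - 0) * (\<Sum>i\<in>UNIV. v $ i * pdiff i \<phi> (x + z *\<^sub>R v))"
  by (rule MVT2) (auto intro: DERIV_line assms)
 then obtain z where "0 < z" "z < 1" "\<phi> (x + v) - \<phi> x = (\<Sum>i\<in>UNIV. v $ i * pdiff i \<phi> (x + z *\<^sub>R v))"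
  by auto
 then show ?thesis using that[of z] by simp
qed

lemma mvt_axis:
 fixes \<phi> :: "'d::finite fn"
 assumes "!!x. \<phi> differentiable (at x)"
 obtains \<theta> where "0 <= \<theta>" "\<theta> <= 1"
  "\<phi> (x + s *\<^sub>R axis i 1) - \<phi> x = s * pdiff i \<phi> (x + (\<theta> * s) *\<^sub>R axis i 1)"
proof -
 obtain \<theta> where *: "0 <= \<theta>" "\<theta> <= 1" "\<phi> (x + s *\<^sub>R axis i 1) - \<phi> x
   = (\<Sum>j\<in>UNIV. (s *\<^sub>R axis i 1) $ j * pdiff j \<phi> (x + \<theta> *\<^sub>R s *\<^sub>R axis i 1))"
  using mvt_line[OF assms] by blast
 show ?thesis using * that by (simp add: sum_axis del: vector_scaleR_component)
qed

lemma pdiff_const [simp]: "pdiff i (%_. c) = (%_. 0)"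
 by (rule ext, subst pdiff_eqI[where D="%_. 0"]) (auto intro: derivative_intros)

lemma pdiff_add:
 "\<phi> differentiable (at x) ==> \<psi> differentiable (at x) ==>
  pdiff i (%x. \<phi> x + \<psi> x) x = pdiff i \<phi> x + pdiff i \<psi> x"
 by (subst pdiff_eqI[OF has_derivative_add[OF differentiable_frechet differentiable_frechet]])
   (auto simp: pdiff_def)

lemma pdiff_mult:
 "\<phi> differentiable (at x) ==> \<psi> differentiable (at x) ==>
  pdiff i (%x. \<phi> x * \<psi> x) x = pdiff i \<phi> x * \<psi> x + \<phi> x * pdiff i \<psi> x"
 by (subst pdiff_eqI[OF has_derivative_mult[OF differentiable_frechet differentiable_frechet]])
   (auto simp: pdiff_def)

lemma pdiff_cmult:
 "\<phi> differentiable (at x) ==> pdiff i (%x. c * \<phi> x) x = c * pdiff i \<phi> x"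
 using pdiff_mult[of "%_. c" x \<phi> i] by simp

lemma differentiable_affine:
 fixes \<phi> :: "'d::finite fn"
 assumes "\<phi> differentiable (at (a + s *\<^sub>R x))"
 shows "(%x. \<phi> (a + s *\<^sub>R x)) differentiable (at x)"
  and "pdiff i (%x. \<phi> (a + s *\<^sub>R x)) x = s * pdiff i \<phi> (a + s *\<^sub>R x)"
proof -
 have 1: "((%x. a + s *\<^sub>R x) has_derivative (%r. s *\<^sub>R r)) (at x)"
  by (auto intro!: derivative_eq_intros)
 have 2: "((%x. \<phi> (a + s *\<^sub>R x)) has_derivative (%r. frechet_derivative \<phi> (at (a + s *\<^sub>R x)) (s *\<^sub>R r))) (at x)"
  using has_derivative_compose[OF 1, of \<phi>] differentiable_frechet[OF assms] by blast
 then show "(%x. \<phi> (a + s *\<^sub>R x)) differentiable (at x)" by (auto simp: differentiable_def)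
 show "pdiff i (%x. \<phi> (a + s *\<^sub>R x)) x = s * pdiff i \<phi> (a + s *\<^sub>R x)"
  using pdiff_eqI[OF 2, of i] linear_cmul[OF bounded_linear.linear[OF has_derivative_bounded_linear[OF differentiable_frechet[OF assms]]]]
  by (simp add: pdiff_def)
qed

lemma pds_affine:
 fixes \<phi> :: "'d::finite fn"
 assumes "smooth \<phi>"
 shows "pds is (%x. \<phi> (a + s *\<^sub>R x)) = (%x. s ^ length is * pds is \<phi> (a + s *\<^sub>R x))"
proof (induction "is")
 case (Cons i "is")
 have d: "pds is \<phi> differentiable (at x)" for x using assms smooth_pds smoothD by blast
 show ?case
  by (auto simp: Cons fun_eq_iff pdiff_cmult differentiable_affine d)
qed simp

lemma smooth_affine:
 fixes \<phi> :: "'d::finite fn"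
 assumes "smooth \<phi>" shows "smooth (%x. \<phi> (a + s *\<^sub>R x))"
 unfolding smooth_def pds_affine[OF assms]
 using differentiable_affine(1)[OF smoothD[OF smooth_pds[OF assms]]] by (intro allI differentiable_mult) auto

lemma smooth_shift: "smooth \<phi> ==> smooth (%x. \<phi> (x + a))" for \<phi> :: "'d::finite fn"
 using smooth_affine[of \<phi> a 1] by (simp add: add.commute)

lemma pds_shift:
 "smooth \<phi> ==> pds is (%x. \<phi> (x + a)) = (%x. pds is \<phi> (x + a))" for \<phi> :: "'d::finite fn"
 using pds_affine[of \<phi> "is" a 1] by (simp add: add.commute)

section \<open>Algebras of functions and closure properties of smoothness\<close>

inductive alg :: "(('d::finite fn) => bool) => ('d fn) => bool" for G where
 gen: "G \<phi> ==> alg G \<phi>"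
| add: "alg G \<phi> ==> alg G \<psi> ==> alg G (%x. \<phi> x + \<psi> x)"
| mult: "alg G \<phi> ==> alg G \<psi> ==> alg G (%x. \<phi> x * \<psi> x)"

text \<open>By the product rule the algebra generated by \<open>G\<close> is stable under
  differentiation as soon as the derivatives of generators fall back into it, so it serves as the
  invariant of \<open>smooth_closedI\<close>. This avoids a closed formula for iterated derivatives
  of products.\<close>

lemma alg_smooth:
 fixes G :: "('d::finite fn) => bool"
 assumes "!!\<phi> x. G \<phi> ==> \<phi> differentiable (at x)" "!!\<phi> i. G \<phi> ==> alg G (pdiff i \<phi>)" "alg G \<phi>"
 shows "smooth \<phi>"
 using assms(3)
proof (rule smooth_closedI[of "alg G"])
 show d: "\<psi> differentiable (at x)" if "alg G \<psi>" for \<psi> :: "'d fn" and x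
  using that by induction (auto intro: assms)
 show "alg G (pdiff i \<psi>)" if "alg G \<psi>" for \<psi> :: "'d fn" and i
  using that
 proof induction
  case (gen \<phi>) then show ?case by (rule assms)
 next
  case (add \<phi> \<psi>)
  have "pdiff i (%x. \<phi> x + \<psi> x) = (%x. pdiff i \<phi> x + pdiff i \<psi> x)"
   using add.hyps by (auto simp: pdiff_add d)
  then show ?case using alg.add[OF add.IH] by simp
 next
  case (mult \<phi> \<psi>)
  have "pdiff i (%x. \<phi> x * \<psi> x) = (%x. pdiff i \<phi> x * \<psi> x + \<phi> x * pdiff i \<psi> x)"
   using mult.hyps by (auto simp: pdiff_mult d)
  then show ?case using alg.add[OF alg.mult[OF mult.IH(1) mult.hyps(2)] alg.mult[OF mult.hyps(1) mult.IH(2)]] by simp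
 qed
qed

lemma smooth_const [simp]: "smooth (%_. c)"
 by (rule smooth_closedI[of "%\<phi>. \<exists>c. \<phi> = (%_. c)"]) auto

lemma smooth_add: "smooth \<phi> ==> smooth \<psi> ==> smooth (%x. \<phi> x + \<psi> x)"
 by (rule alg_smooth[of smooth, OF _ _ alg.add]) (auto intro: alg.gen smoothD smooth_pdiff)

lemma smooth_mult: "smooth \<phi> ==> smooth \<psi> ==> smooth (%x. \<phi> x * \<psi> x)"
 by (rule alg_smooth[of smooth, OF _ _ alg.mult]) (auto intro: alg.gen smoothD smooth_pdiff)

lemma smooth_cmult: "smooth \<phi> ==> smooth (%x. c * \<phi> x)"
 by (intro smooth_mult smooth_const)

lemma smooth_diff: "smooth \<phi> ==> smooth \<psi> ==> smooth (%x. \<phi> x - \<psi> x)"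
 using smooth_add[OF _ smooth_cmult[of \<psi> "-1"]] by simp

lemma smooth_sum: "(!!i. i \<in> A ==> smooth (F i)) ==> smooth (%x. \<Sum>i\<in>A. F i x)"
 by (induction A rule: infinite_finite_induct) (auto intro: smooth_add)

lemma smooth_continuous: "smooth \<phi> ==> continuous_on A \<phi>"
 by (meson smoothD differentiable_imp_continuous_on differentiable_on_def differentiable_at_withinI)

lemma pds_add:
 "smooth \<phi> ==> smooth \<psi> ==> pds is (%x. \<phi> x + \<psi> x) = (%x. pds is \<phi> x + pds is \<psi> x)"
proof (induction "is")
 case (Cons i "is") then show ?case by (auto intro!: ext simp: pdiff_add smoothD smooth_pds)
qed simp

lemma pds_cmult: "smooth \<phi> ==> pds is (%x. c * \<phi> x) = (%x. c * pds is \<phi> x)"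
proof (induction "is")
 case (Cons i "is") then show ?case by (auto intro!: ext simp: pdiff_cmult smoothD smooth_pds)
qed simp

lemma pds_diff:
 "smooth \<phi> ==> smooth \<psi> ==> pds is (%x. \<phi> x - \<psi> x) = (%x. pds is \<phi> x - pds is \<psi> x)"
 using pds_add[OF _ smooth_cmult[of \<psi> "-1"], of \<phi> "is"] pds_cmult[of \<psi> "is" "-1"] by simp

lemma pds_zero: "pds is (%x. 0) = (%x. 0)"
 by (induction "is") auto

lemma pds_sum:
 "(!!i. i \<in> A ==> smooth (F i)) ==> pds is (%x. \<Sum>i\<in>A. F i x) = (%x. \<Sum>i\<in>A. pds is (F i) x)"
 by (induction A rule: infinite_finite_induct) (auto simp: pds_add smooth_sum pds_zero)

text \<open>The second difference of \<phi> with step t in both directions does not depend on the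
  order of i and j, while two mean value theorems equate it with t*t times either mixed derivative
  at a point near x. Letting t tend to 0, continuity of the mixed derivatives identifies
  them.\<close>

lemma pdiff_commute:
 fixes \<phi> :: "'d::finite fn"
 assumes s: "smooth \<phi>"
 shows "pdiff i (pdiff j \<phi>) = pdiff j (pdiff i \<phi>)"
proof
 fix x
 have key: "\<exists>a b. \<bar>a\<bar> <= \<bar>t\<bar> \<and> \<bar>b\<bar> <= \<bar>t\<bar> \<and>
   (\<phi> (x + t *\<^sub>R axis i 1 + t *\<^sub>R axis j 1) - \<phi> (x + t *\<^sub>R axis i 1) - (\<phi> (x + t *\<^sub>R axis j 1) - \<phi> x))
   = t * t * pdiff j (pdiff i \<phi>) (x + a *\<^sub>R axis i 1 + b *\<^sub>R axis j 1)" for i j t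
 proof -
  define \<psi> where "\<psi> = (%y. \<phi> (y + t *\<^sub>R axis j 1) - \<phi> y)"
  have sp: "smooth \<psi>" unfolding \<psi>_def by (intro smooth_diff smooth_shift s)
  have pp: "pdiff i \<psi> y = pdiff i \<phi> (y + t *\<^sub>R axis j 1) - pdiff i \<phi> y" for y
   unfolding \<psi>_def using pds_diff[OF smooth_shift[OF s] s, of "[i]"] pds_shift[OF s, of "[i]"]
   by (simp add: fun_eq_iff)
  obtain \<theta> where \<theta>: "0 <= \<theta>" "\<theta> <= 1" "\<psi> (x + t *\<^sub>R axis i 1) - \<psi> x = t * pdiff i \<psi> (x + (\<theta> * t) *\<^sub>R axis i 1)"
   using mvt_axis[of \<psi>] smoothD[OF sp] by blast
  obtain \<theta>' where \<theta>': "0 <= \<theta>'" "\<theta>' <= 1" "pdiff i \<phi> (x + (\<theta> * t) *\<^sub>R axis i 1 + t *\<^sub>R axis j 1) - pdiff i \<phi> (x + (\<theta> * t) *\<^sub>R axis i 1)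
    = t * pdiff j (pdiff i \<phi>) (x + (\<theta> * t) *\<^sub>R axis i 1 + (\<theta>' * t) *\<^sub>R axis j 1)"
   using mvt_axis[of "pdiff i \<phi>"] smoothD[OF smooth_pdiff[OF s]] by blast
  have "\<bar>\<theta> * t\<bar> <= \<bar>t\<bar>" "\<bar>\<theta>' * t\<bar> <= \<bar>t\<bar>"
   using \<theta> \<theta>' by (auto simp: abs_mult mult_left_le_one_le)
  then show ?thesis using \<theta> \<theta>' pp unfolding \<psi>_def
   by (intro exI[of _ "\<theta> * t"] exI[of _ "\<theta>' * t"]) (simp add: algebra_simps)
 qed
 define t where "t = (%n::nat. 1 / real (Suc n))"
 have t0: "t \<longlonglongrightarrow> 0" unfolding t_def by (rule LIMSEQ_Suc[OF lim_1_over_n])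
 have tp: "t n > 0" for n by (simp add: t_def)
 have main: "\<exists>y. y \<longlonglongrightarrow> x \<and> (\<forall>n. (\<phi> (x + t n *\<^sub>R axis i 1 + t n *\<^sub>R axis j 1) - \<phi> (x + t n *\<^sub>R axis i 1) - (\<phi> (x + t n *\<^sub>R axis j 1) - \<phi> x))
   = t n * t n * pdiff j (pdiff i \<phi>) (y n))" for i j
 proof -
  define P where "P n a b \<longleftrightarrow> \<bar>a\<bar> <= \<bar>t n\<bar> \<and> \<bar>b\<bar> <= \<bar>t n\<bar> \<and>
   (\<phi> (x + t n *\<^sub>R axis i 1 + t n *\<^sub>R axis j 1) - \<phi> (x + t n *\<^sub>R axis i 1) - (\<phi> (x + t n *\<^sub>R axis j 1) - \<phi> x))
   = t n * t n * pdiff j (pdiff i \<phi>) (x + a *\<^sub>R axis i 1 + b *\<^sub>R axis j 1)" for n a b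
  have "\<forall>n. \<exists>a b. P n a b" unfolding P_def using key by blast
  then obtain a b where P: "!!n. P n (a n) (b n)" by metis
  have ab: "!!n. \<bar>a n\<bar> <= \<bar>t n\<bar>" "!!n. \<bar>b n\<bar> <= \<bar>t n\<bar>"
   "!!n. (\<phi> (x + t n *\<^sub>R axis i 1 + t n *\<^sub>R axis j 1) - \<phi> (x + t n *\<^sub>R axis i 1) - (\<phi> (x + t n *\<^sub>R axis j 1) - \<phi> x))
   = t n * t n * pdiff j (pdiff i \<phi>) (x + a n *\<^sub>R axis i 1 + b n *\<^sub>R axis j 1)"
   using P unfolding P_def by blast+
  have "a \<longlonglongrightarrow> 0" "b \<longlonglongrightarrow> 0"
   using ab(1,2) t0 by (auto intro!: Lim_null_comparison[where g="%n. \<bar>t n\<bar>"] tendsto_rabs_zero)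
  then have "(%n. x + a n *\<^sub>R axis i 1 + b n *\<^sub>R axis j 1) \<longlonglongrightarrow> x + 0 *\<^sub>R axis i 1 + 0 *\<^sub>R axis j 1"
   by (intro tendsto_intros)
  then show ?thesis using ab(3) by (intro exI[of _ "%n. x + a n *\<^sub>R axis i 1 + b n *\<^sub>R axis j 1"]) auto
 qed
 obtain y where y: "y \<longlonglongrightarrow> x" "!!n. (\<phi> (x + t n *\<^sub>R axis i 1 + t n *\<^sub>R axis j 1) - \<phi> (x + t n *\<^sub>R axis i 1) - (\<phi> (x + t n *\<^sub>R axis j 1) - \<phi> x))
   = t n * t n * pdiff j (pdiff i \<phi>) (y n)"
  using main[of i j] by blast
 obtain z where z: "z \<longlonglongrightarrow> x" "!!n. (\<phi> (x + t n *\<^sub>R axis j 1 + t n *\<^sub>R axis i 1) - \<phi> (x + t n *\<^sub>R axis j 1) - (\<phi> (x + t n *\<^sub>R axis i 1) - \<phi> x))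
   = t n * t n * pdiff i (pdiff j \<phi>) (z n)"
  using main[of j i] by blast
 have "t n * t n * pdiff j (pdiff i \<phi>) (y n) = t n * t n * pdiff i (pdiff j \<phi>) (z n)" for n
  unfolding y(2)[symmetric] z(2)[symmetric] by (simp add: add.commute add.left_commute)
 then have eq: "pdiff j (pdiff i \<phi>) (y n) = pdiff i (pdiff j \<phi>) (z n)" for n
  using tp[of n] by (metis mult_left_cancel mult_pos_pos less_irrefl)
 have c: "isCont (pdiff i (pdiff j \<phi>)) x" for i j
  by (intro differentiable_imp_continuous_within smoothD smooth_pdiff s)
 have "(%n. pdiff j (pdiff i \<phi>) (y n)) \<longlonglongrightarrow> pdiff j (pdiff i \<phi>) x"
  "(%n. pdiff i (pdiff j \<phi>) (z n)) \<longlonglongrightarrow> pdiff i (pdiff j \<phi>) x"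
  using isCont_tendsto_compose[OF c y(1)] isCont_tendsto_compose[OF c z(1)] by auto
 then show "pdiff i (pdiff j \<phi>) x = pdiff j (pdiff i \<phi>) x"
  unfolding eq using LIMSEQ_unique by blast
qed

lemma pds_pdiff_commute: "smooth \<phi> ==> pds is (pdiff i \<phi>) = pdiff i (pds is \<phi>)"
 by (induction "is") (auto simp: pdiff_commute smooth_pds)

lemma pds_mset: "smooth \<phi> ==> mset is = mset js ==> pds is \<phi> = pds js \<phi>"
proof (induction "is" arbitrary: js)
 case (Cons i "is")
 then have "i \<in> set js" by (metis list.set_intros(1) mset_eq_setD)
 then obtain a b where js: "js = a @ i # b" by (meson split_list)
 then have "mset is = mset (a @ b)" using Cons by simp
 then have "pds is \<phi> = pds (a @ b) \<phi>" using Cons by blast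
 then show ?case using js pds_pdiff_commute[OF smooth_pds[OF Cons.prems(1)]] by simp
qed auto

section \<open>Bounds on finite differences\<close>

text \<open>A pair (s, i) encodes the increment s along the i-th axis, so a list of pairs is an
  iterated difference with individual step sizes, and \<open>wt\<close> is the product of the
  steps.\<close>

definition dif :: "real \<times> 'd => ('d::finite fn) => 'd fn" where
 "dif p \<phi> x = \<phi> (x + fst p *\<^sub>R axis (snd p) 1) - \<phi> x"

abbreviation difs :: "(real \<times> 'd) list => ('d::finite fn) => 'd fn" where
 "difs \<equiv> foldr dif"

definition wt :: "(real \<times> 'd) list => real" where
 "wt ps = prod_list (map (%p. \<bar>fst p\<bar>) ps)"

text \<open>A bound on the derivatives of order k that makes sense for arbitrary functions: every
  mixed difference is compared with the product of its steps, whatever their sizes. For k = 0 it is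
  a sup bound, for k = 1 a Lipschitz bound.\<close>

definition dbd :: "nat => real => ('d::finite fn) => bool" where
 "dbd k C \<phi> \<longleftrightarrow> (\<forall>ps x. length ps = k --> \<bar>difs ps \<phi> x\<bar> <= C * wt ps)"

definition nb :: "nat => real => ('d::finite fn) => bool" where
 "nb k C \<phi> \<longleftrightarrow> (\<forall>is x. length is = k --> \<bar>pds is \<phi> x\<bar> <= C)"

text \<open>Plays the part of a ball of radius C among the functions with bounded generalized
  derivatives up to order n; the top order appears only as a Lipschitz bound for the order below
  it.\<close>

definition Xc :: "nat => real => ('d::finite fn) => bool" where
 "Xc n C \<phi> \<longleftrightarrow> (\<forall>k\<le>n. dbd k C \<phi>)"

lemma wt_simps [simp]: "wt [] = 1" "wt (p # ps) = \<bar>fst p\<bar> * wt ps" "wt (ps @ qs) = wt ps * wt qs"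
 by (auto simp: wt_def)

lemma wt_nonneg [simp]: "wt ps >= 0"
 by (induction ps) auto

lemma difs_add: "difs ps (%x. \<phi> x + \<psi> x) = (%x. difs ps \<phi> x + difs ps \<psi> x)"
 by (induction ps) (auto simp: dif_def fun_eq_iff)

lemma difs_cmult: "difs ps (%x. c * \<phi> x) = (%x. c * difs ps \<phi> x)"
 by (induction ps) (auto simp: dif_def fun_eq_iff algebra_simps)

lemma difs_zero: "difs ps (%x. 0) = (%x. 0)"
 by (induction ps) (auto simp: dif_def fun_eq_iff)

lemma difs_shift: "difs ps (%x. \<phi> (x + a)) = (%x. difs ps \<phi> (x + a))"
 by (induction ps) (auto simp: dif_def fun_eq_iff add_ac)

lemma difs_tendsto:
 assumes "!!x. ((%n. \<Phi> n x) \<longlongrightarrow> \<phi> x) F"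
 shows "((%n. difs ps (\<Phi> n) x) \<longlongrightarrow> difs ps \<phi> x) F"
 using assms by (induction ps arbitrary: x) (auto simp: dif_def intro!: tendsto_intros)

lemma difs_avg:
 assumes "!!x. integrable M (%w. \<Phi> w x)"
 shows "integrable M (%w. difs ps (\<Phi> w) x) \<and> difs ps (%x. \<integral>w. \<Phi> w x \<partial>M) x = (\<integral>w. difs ps (\<Phi> w) x \<partial>M)"
 using assms by (induction ps arbitrary: x) (auto simp: dif_def)

lemma dbdD: "dbd k C \<phi> ==> length ps = k ==> \<bar>difs ps \<phi> x\<bar> <= C * wt ps"
 unfolding dbd_def by blast

lemma dbd0: "dbd 0 C \<phi> \<longleftrightarrow> (\<forall>x. \<bar>\<phi> x\<bar> <= C)"
 unfolding dbd_def by auto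

lemma dbd_mono: "dbd k C \<phi> ==> C <= C' ==> dbd k C' \<phi>"
proof -
 assume a: "dbd k C \<phi>" "C <= C'"
 have "\<bar>difs ps \<phi> x\<bar> <= C' * wt ps" if "length ps = k" for ps x
  using dbdD[OF a(1) that, of x] mult_right_mono[OF a(2) wt_nonneg[of ps]] by linarith
 then show ?thesis unfolding dbd_def by blast
qed

lemma dbd_add: "dbd k C \<phi> ==> dbd k C' \<psi> ==> dbd k (C + C') (%x. \<phi> x + \<psi> x)"
proof -
 assume a: "dbd k C \<phi>" "dbd k C' \<psi>"
 have "\<bar>difs ps \<phi> x + difs ps \<psi> x\<bar> <= (C + C') * wt ps" if "length ps = k" for ps x
  using dbdD[OF a(1) that, of x] dbdD[OF a(2) that, of x] by (simp add: distrib_right)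
 then show ?thesis unfolding dbd_def difs_add by blast
qed

lemma dbd_cmult: "dbd k C \<phi> ==> dbd k (\<bar>c\<bar> * C) (%x. c * \<phi> x)"
 unfolding dbd_def difs_cmult by (simp add: abs_mult mult.assoc mult_left_mono)

lemma dbd_diff: "dbd k C \<phi> ==> dbd k C' \<psi> ==> dbd k (C + C') (%x. \<phi> x - \<psi> x)"
 using dbd_add[OF _ dbd_cmult[of k C' \<psi> "-1"]] by simp

lemma dbd_zero: "C >= 0 ==> dbd k C (%x. 0)"
 unfolding dbd_def by (simp add: difs_zero)

lemma dbd_sum: "(!!i. i \<in> A ==> dbd k (C i) (F i)) ==> dbd k (\<Sum>i\<in>A. C i) (%x. \<Sum>i\<in>A. F i x)"
 by (induction A rule: infinite_finite_induct) (auto intro: dbd_add dbd_zero)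

lemma dbd_shift: "dbd k C \<phi> ==> dbd k C (%x. \<phi> (x + a))"
 unfolding dbd_def difs_shift by blast

text \<open>Each inequality in \<open>dbd\<close> involves finitely many values of the function,
  hence survives pointwise convergence. This closedness carries bounds from smooth approximations to
  the functions of interest.\<close>

lemma dbd_lim:
 assumes "!!n. dbd k C (\<Phi> n)" "!!x. (%n. \<Phi> n x) \<longlonglongrightarrow> \<phi> x"
 shows "dbd k C \<phi>"
 unfolding dbd_def
proof (intro allI impI)
 fix ps :: "(real \<times> 'a) list" and x assume "length ps = k"
 then have "!!n. \<bar>difs ps (\<Phi> n) x\<bar> <= C * wt ps" using assms(1) dbdD by blast
 moreover have "(%n. \<bar>difs ps (\<Phi> n) x\<bar>) \<longlonglongrightarrow> \<bar>difs ps \<phi> x\<bar>"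
  by (intro tendsto_rabs difs_tendsto assms)
 ultimately show "\<bar>difs ps \<phi> x\<bar> <= C * wt ps" by (meson LIMSEQ_le_const2)
qed

text \<open>Iterated differences commute with the integral over w, and a probability measure does
  not enlarge a common bound.\<close>

lemma dbd_avg:
 assumes "prob_space M" "!!x. integrable M (%w. \<Phi> w x)" "!!w. w \<in> space M ==> dbd k C (\<Phi> w)"
 shows "dbd k C (%x. \<integral>w. \<Phi> w x \<partial>M)"
 unfolding dbd_def
proof (intro allI impI)
 interpret prob_space M by fact
 fix ps :: "(real \<times> 'b) list" and x assume l: "length ps = k"
 have i: "integrable M (%w. difs ps (\<Phi> w) x)" and
  e: "difs ps (%x. \<integral>w. \<Phi> w x \<partial>M) x = (\<integral>w. difs ps (\<Phi> w) x \<partial>M)"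
  using difs_avg[of M \<Phi> ps x, OF assms(2)] by auto
 have b: "\<bar>difs ps (\<Phi> w) x\<bar> <= C * wt ps" if "w \<in> space M" for w
  using assms(3)[OF that] l by (rule dbdD)
 have "\<bar>\<integral>w. difs ps (\<Phi> w) x \<partial>M\<bar> <= (\<integral>w. \<bar>difs ps (\<Phi> w) x\<bar> \<partial>M)"
  by (rule integral_abs_bound)
 also have "... <= (\<integral>w. C * wt ps \<partial>M)"
  by (rule integral_mono) (use i b in auto)
 finally show "\<bar>difs ps (%x. \<integral>w. \<Phi> w x \<partial>M) x\<bar> <= C * wt ps"
  using e by (simp add: prob_space)
qed

lemma dbd_Suc: "dbd (Suc k) C \<phi> \<longleftrightarrow> (\<forall>p. dbd k (C * \<bar>fst p\<bar>) (dif p \<phi>))"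
proof
 assume a: "dbd (Suc k) C \<phi>"
 show "\<forall>p. dbd k (C * \<bar>fst p\<bar>) (dif p \<phi>)"
  unfolding dbd_def
 proof (intro allI impI)
  fix p :: "real \<times> 'a" and ps :: "(real \<times> 'a) list" and x assume "length ps = k"
  then show "\<bar>difs ps (dif p \<phi>) x\<bar> <= C * \<bar>fst p\<bar> * wt ps"
   using dbdD[OF a, of "ps @ [p]" x] by (simp add: mult_ac)
 qed
next
 assume a: "\<forall>p. dbd k (C * \<bar>fst p\<bar>) (dif p \<phi>)"
 show "dbd (Suc k) C \<phi>" unfolding dbd_def
 proof (intro allI impI)
  fix qs :: "(real \<times> 'a) list" and x assume "length qs = Suc k"
  then obtain ps p where qs: "qs = ps @ [p]" "length ps = k"
   by (metis append_butlast_last_id length_0_conv length_append_singleton nat.inject nat.distinct(1))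
  then show "\<bar>difs qs \<phi> x\<bar> <= C * wt qs"
   using dbdD[OF a[rule_format, of p] qs(2), of x] by (simp add: mult_ac)
 qed
qed

lemma nb_Suc: "nb (Suc k) C \<phi> \<longleftrightarrow> (\<forall>i. nb k C (pdiff i \<phi>))"
proof
 assume a: "nb (Suc k) C \<phi>"
 show "\<forall>i. nb k C (pdiff i \<phi>)" unfolding nb_def
 proof (intro allI impI)
  fix i and "is" :: "'a list" and x assume "length is = k"
  then show "\<bar>pds is (pdiff i \<phi>) x\<bar> <= C" using a[unfolded nb_def, rule_format, of "is @ [i]" x] by simp
 qed
next
 assume a: "\<forall>i. nb k C (pdiff i \<phi>)"
 show "nb (Suc k) C \<phi>" unfolding nb_def
 proof (intro allI impI)
  fix js :: "'a list" and x assume "length js = Suc k"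
  then obtain "is" i where js: "js = is @ [i]" "length is = k"
   by (metis append_butlast_last_id length_0_conv length_append_singleton nat.inject nat.distinct(1))
  then show "\<bar>pds js \<phi> x\<bar> <= C" using a unfolding nb_def by simp
 qed
qed

lemma smooth_dif: "smooth \<phi> ==> smooth (dif p \<phi>)"
 unfolding dif_def by (intro smooth_diff smooth_shift)

lemma pds_dif: "smooth \<phi> ==> pds is (dif p \<phi>) = dif p (pds is \<phi>)"
 unfolding dif_def by (subst pds_diff) (auto intro: smooth_shift simp: pds_shift)

text \<open>One difference is traded for one derivative at a time: by the mean value theorem along
  an axis, the k-th derivatives of \<open>dif p \<phi>\<close> are bounded by C times the step, and
  differences commute with derivatives.\<close>

lemma nb_imp_dbd: "smooth \<phi> ==> nb k C \<phi> ==> dbd k C \<phi>"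
proof (induction k arbitrary: \<phi> C)
 case 0 then show ?case by (auto simp: nb_def dbd0)
next
 case (Suc k)
 show ?case unfolding dbd_Suc
 proof
  fix p :: "real \<times> 'a"
  have "nb k (C * \<bar>fst p\<bar>) (dif p \<phi>)" unfolding nb_def
  proof (intro allI impI)
   fix "is" :: "'a list" and x assume l: "length is = k"
   obtain \<theta> where \<theta>: "pds is \<phi> (x + fst p *\<^sub>R axis (snd p) 1) - pds is \<phi> x
     = fst p * pdiff (snd p) (pds is \<phi>) (x + (\<theta> * fst p) *\<^sub>R axis (snd p) 1)"
    using mvt_axis[of "pds is \<phi>"] smoothD[OF smooth_pds[OF Suc.prems(1)]] by blast
   have "\<bar>pds (snd p # is) \<phi> (x + (\<theta> * fst p) *\<^sub>R axis (snd p) 1)\<bar> <= C"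
    using Suc.prems(2) l unfolding nb_def by (metis length_Cons)
   from mult_right_mono[OF this, of "\<bar>fst p\<bar>"] show "\<bar>pds is (dif p \<phi>) x\<bar> <= C * \<bar>fst p\<bar>"
    unfolding pds_dif[OF Suc.prems(1)] dif_def \<theta>
    by (simp add: abs_mult mult.commute)
  qed
  then show "dbd k (C * \<bar>fst p\<bar>) (dif p \<phi>)" using Suc smooth_dif by blast
 qed
qed

lemma axis_quotient_tendsto:
 assumes "\<phi> differentiable (at x)"
 shows "(%n. real (Suc n) * dif (1 / real (Suc n), i) \<phi> x) \<longlonglongrightarrow> pdiff i \<phi> x"
proof -
 have "((%s. \<phi> (x + s *\<^sub>R axis i 1)) has_real_derivative pdiff i \<phi> x) (at 0)"
  using DERIV_line[of \<phi> x 0 "axis i 1"] assms sum_axis[of 1 i "%i. pdiff i \<phi> x"] by simp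
 then have "(%s. (\<phi> (x + s *\<^sub>R axis i 1) - \<phi> x) / s) \<midarrow>0\<rightarrow> pdiff i \<phi> x"
  by (simp add: DERIV_def)
 moreover have "filterlim (%n. 1 / real (Suc n)) (at 0) sequentially"
  unfolding filterlim_at using LIMSEQ_Suc[OF lim_1_over_n] by simp
 ultimately have "(%n. (\<phi> (x + (1 / real (Suc n)) *\<^sub>R axis i 1) - \<phi> x) / (1 / real (Suc n))) \<longlonglongrightarrow> pdiff i \<phi> x"
  by (rule filterlim_compose)
 then show ?thesis by (simp add: dif_def mult.commute)
qed

lemma dbd_quotient: "dbd (Suc k) C \<phi> ==> s \<noteq> 0 ==> dbd k C (%x. (1 / s) * dif (s, i) \<phi> x)"
 using dbd_cmult[of k "C * \<bar>s\<bar>" "dif (s, i) \<phi>" "1 / s"] by (simp add: dbd_Suc abs_mult)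

text \<open>Each derivative is the limit of \<open>dif\<close> divided by its step; the quotients
  satisfy the bound of order k uniformly, and \<open>dbd_lim\<close> transfers it.\<close>

lemma dbd_imp_nb: "smooth \<phi> ==> dbd k C \<phi> ==> nb k C \<phi>"
proof (induction k arbitrary: \<phi>)
 case 0 then show ?case by (auto simp: nb_def dbd0)
next
 case (Suc k)
 show ?case unfolding nb_Suc
 proof
  fix i
  have "dbd k C (pdiff i \<phi>)"
  proof (rule dbd_lim)
   show "dbd k C (%x. real (Suc n) * dif (1 / real (Suc n), i) \<phi> x)" for n
    using dbd_quotient[OF Suc.prems(2), of "1 / real (Suc n)" i] by simp
   show "(%n. real (Suc n) * dif (1 / real (Suc n), i) \<phi> x) \<longlonglongrightarrow> pdiff i \<phi> x" for x
    by (intro axis_quotient_tendsto smoothD Suc.prems)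
  qed
  then show "nb k C (pdiff i \<phi>)" using Suc smooth_pdiff by blast
 qed
qed

text \<open>The increment v is travelled coordinate by coordinate, and each coordinate is at most
  the norm of v; this is one source of the factor \<open>CARD('d)\<close> in the constants.\<close>

lemma dbd1_lipschitz:
 fixes \<phi> :: "'d::finite fn"
 assumes "dbd 1 C \<phi>"
 shows "\<bar>\<phi> (x + v) - \<phi> x\<bar> <= C * real CARD('d) * norm v"
proof -
 have C: "C >= 0"
  using assms[unfolded dbd_def, rule_format, of "[(1, undefined)]" 0] by (simp add: dif_def)
 have "\<bar>\<phi> (x + (\<Sum>i\<in>S. (v $ i) *\<^sub>R axis i 1)) - \<phi> x\<bar> <= C * (\<Sum>i\<in>S. \<bar>v $ i\<bar>)" if "finite S" for S
  using that
 proof induction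
  case (insert j S)
  have "\<bar>\<phi> (x + (\<Sum>i\<in>S. (v $ i) *\<^sub>R axis i 1) + (v $ j) *\<^sub>R axis j 1) - \<phi> (x + (\<Sum>i\<in>S. (v $ i) *\<^sub>R axis i 1))\<bar> <= C * \<bar>v $ j\<bar>"
   using dbdD[OF assms, of "[(v $ j, j)]"] by (simp add: dif_def)
  then show ?case using insert by (simp add: algebra_simps)
 qed auto
 from this[of UNIV] have "\<bar>\<phi> (x + v) - \<phi> x\<bar> <= C * (\<Sum>i\<in>UNIV. \<bar>v $ i\<bar>)"
  using basis_expansion[of v] by (simp add: scalar_mult_eq_scaleR)
 also have "... <= C * (\<Sum>i\<in>(UNIV::'d set). norm v)"
  by (intro mult_left_mono sum_mono C component_le_norm_cart)
 finally show ?thesis by (simp add: mult_ac)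
qed

lemma dbd1_continuous:
 fixes \<phi> :: "'d::finite fn"
 assumes "dbd 1 C \<phi>" shows "continuous_on A \<phi>"
proof (rule continuous_on_subset[of UNIV])
 have "C >= 0"
  using assms[unfolded dbd_def, rule_format, of "[(1, undefined)]" 0] by (simp add: dif_def)
 then have "(C * real CARD('d))-lipschitz_on UNIV \<phi>"
 proof (intro lipschitz_onI)
  fix x y show "dist (\<phi> x) (\<phi> y) <= C * real CARD('d) * dist x y"
   using dbd1_lipschitz[OF assms, of y "x - y"] by (simp add: dist_norm)
 qed simp
 then show "continuous_on UNIV \<phi>" by (rule lipschitz_on_continuous_on)
qed simp

section \<open>Mollifiers\<close>

text \<open>The powers of s in the denominator make the family closed under differentiation: the
  derivative of \<open>bexp n\<close> is a combination of \<open>bexp (n + 2)\<close> and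
  \<open>bexp (n + 1)\<close>.\<close>

definition bexp :: "nat => real => real" where
 "bexp n s = (if s > 0 then exp (- 1 / s) / s ^ n else 0)"

lemma power_le_exp_fact: "0 <= x ==> x ^ k <= fact k * exp (x::real)"
proof -
 assume x: "0 <= x"
 have "(%n. x ^ n / fact n) sums exp x" using exp_converges[of x] by (simp add: divide_inverse mult.commute)
 then have "x ^ k / fact k <= exp x"
  using sum_le_suminf[of "%n. x ^ n / fact n" "{k}"] x by (auto simp: sums_iff)
 then show ?thesis by (simp add: field_simps)
qed

text \<open>Exponential growth beats every power of 1/s. A bound by the square of s already yields
  that the derivative at 0 exists and vanishes.\<close>

lemma bexp_bound: "\<bar>bexp n s\<bar> <= fact (n + 2) * s\<^sup>2"
proof (cases "s > 0")
 case True
 have "(1 / s) ^ (n + 2) <= fact (n + 2) * exp (1 / s)"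
  using True by (intro power_le_exp_fact) auto
 then have "1 <= s ^ (n + 2) * (fact (n + 2) * exp (1 / s))"
  using True by (simp add: power_one_over field_simps)
 then have "exp (- 1 / s) <= (s ^ n * s ^ 2) * fact (n + 2)"
  using True by (simp add: exp_minus power_add divide_simps mult_ac power2_eq_square)
 then show ?thesis using True by (simp add: bexp_def field_simps)
qed (simp add: bexp_def)

lemma bexp_deriv: "(bexp n has_real_derivative (bexp (n + 2) s - real n * bexp (n + 1) s)) (at s)"
proof -
 consider "s > 0" | "s < 0" | "s = 0" by linarith
 then show ?thesis
 proof cases
  case 1
  have d: "((%s. exp (- 1 / s) / s ^ n) has_real_derivative
    (exp (- 1 / s) * (1 / s\<^sup>2) * s ^ n - exp (- 1 / s) * (real n * s ^ (n - 1))) / (s ^ n * s ^ n)) (at s)"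
   using 1 by (auto intro!: derivative_eq_intros simp: power2_eq_square)
  have "real n * s ^ (n - 1) = real n * s ^ n / s" using 1 by (cases n) (auto simp: mult.commute)
  then have "(exp (- 1 / s) * (1 / s\<^sup>2) * s ^ n - exp (- 1 / s) * (real n * s ^ (n - 1))) / (s ^ n * s ^ n)
   = bexp (n + 2) s - real n * bexp (n + 1) s"
   using 1 by (cases n) (simp_all add: bexp_def field_simps power_add power2_eq_square)
  with d have "((%s. exp (- 1 / s) / s ^ n) has_real_derivative (bexp (n + 2) s - real n * bexp (n + 1) s)) (at s)"
   by simp
  then show ?thesis
   by (rule DERIV_cong_ev[THEN iffD1, OF refl _ refl, rotated])
     (use 1 in \<open>auto simp: bexp_def intro!: eventually_mono[OF eventually_gt_at_top] eventually_nhds[THEN iffD2] exI[of _ "{0<..}"]\<close>)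
 next
  case 2
  have "((%s::real. 0::real) has_real_derivative 0) (at s)" by simp
  then have "(bexp n has_real_derivative 0) (at s)"
   by (rule DERIV_cong_ev[THEN iffD1, OF refl _ refl, rotated])
     (use 2 in \<open>auto simp: bexp_def intro!: eventually_nhds[THEN iffD2] exI[of _ "{..<0}"]\<close>)
  then show ?thesis using 2 by (simp add: bexp_def)
 next
  case 3
  have "((%h. (bexp n (0 + h) - bexp n 0) / h) \<longlongrightarrow> 0) (at 0)"
  proof (rule Lim_null_comparison[where g="%h. fact (n + 2) * \<bar>h\<bar>"])
   show "((%h. fact (n + 2) * \<bar>h\<bar>) \<longlongrightarrow> (0::real)) (at 0)"
    by (auto intro!: tendsto_eq_intros)
   show "\<forall>\<^sub>F h in at 0. norm ((bexp n (0 + h) - bexp n 0) / h) <= fact (n + 2) * \<bar>h\<bar>"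
   proof (intro always_eventually allI)
    fix h :: real
    show "norm ((bexp n (0 + h) - bexp n 0) / h) <= fact (n + 2) * \<bar>h\<bar>"
    proof -
     have "\<bar>bexp n h\<bar> <= (fact (n + 2) * \<bar>h\<bar>) * \<bar>h\<bar>"
      using bexp_bound[of n h] unfolding mult.assoc abs_mult_self_eq by (simp only: power2_eq_square)
     then show ?thesis by (cases "h = 0") (simp_all only: abs_divide bexp_def[of n 0] real_norm_def, simp_all add: pos_divide_le_eq)
    qed
   qed
  qed
  then show ?thesis using 3 by (simp add: DERIV_def bexp_def)
 qed
qed

lemma pdiff_component:
 "(%x::real^'d::finite. x $ j) differentiable (at x)" "pdiff i (%x::real^'d::finite. x $ j) = (%_. axis i 1 $ j)"
proof -
 have d: "((%x::real^'d::finite. x $ j) has_derivative (%x. x $ j)) (at x)" for x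
  by (intro bounded_linear_imp_has_derivative bounded_linear_vec_nth)
 then show "(%x::real^'d::finite. x $ j) differentiable (at x)" by (auto simp: differentiable_def)
 show "pdiff i (%x::real^'d::finite. x $ j) = (%_. axis i 1 $ j)"
  using pdiff_eqI[OF d] by auto
qed

text \<open>Generators whose derivatives stay in the generated algebra: differentiating the radial
  profile produces coordinates, constants and profiles with larger n.\<close>

definition bump_gen :: "real => ('d::finite fn) => bool" where
 "bump_gen r \<phi> \<longleftrightarrow> (\<exists>n. \<phi> = (%x. bexp n (r\<^sup>2 - x \<bullet> x))) \<or> (\<exists>j. \<phi> = (%x. x $ j)) \<or> (\<exists>c. \<phi> = (%_. c))"

lemma smooth_bump: "smooth (%x::real^'d::finite. bexp n (r\<^sup>2 - x \<bullet> x))"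
proof -
 have D: "((%x::real^'d. bexp n (r\<^sup>2 - x \<bullet> x)) has_derivative
   (%v. - 2 * (x \<bullet> v) * (bexp (n + 2) (r\<^sup>2 - x \<bullet> x) - real n * bexp (n + 1) (r\<^sup>2 - x \<bullet> x)))) (at x)" for n and x
 proof -
  have 1: "((%x::real^'d. r\<^sup>2 - x \<bullet> x) has_derivative (%v. - 2 * (x \<bullet> v))) (at x)"
   by (auto intro!: derivative_eq_intros simp: inner_commute)
  from has_derivative_compose[OF 1 bexp_deriv[of n "r\<^sup>2 - x \<bullet> x", THEN has_field_derivative_imp_has_derivative]]
  show ?thesis by (simp add: mult.commute)
 qed
 have b: "alg (bump_gen r) (%x::real^'d. bexp n (r\<^sup>2 - x \<bullet> x))" for n
  by (rule alg.gen) (auto simp: bump_gen_def)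
 have c: "alg (bump_gen r) (%x::real^'d. c)" for c
  by (rule alg.gen) (auto simp: bump_gen_def)
 have x: "alg (bump_gen r) (%x::real^'d. x $ j)" for j
  by (rule alg.gen) (auto simp: bump_gen_def)
 show ?thesis
 proof (rule alg_smooth[OF _ _ b])
  fix \<phi> :: "'d fn" and x assume "bump_gen r \<phi>"
  then show "\<phi> differentiable at x"
   unfolding bump_gen_def using D pdiff_component(1) by (auto simp: differentiable_def intro: derivative_intros)
 next
  fix \<phi> :: "'d fn" and i assume "bump_gen r \<phi>"
  then consider n where "\<phi> = (%x. bexp n (r\<^sup>2 - x \<bullet> x))" | j where "\<phi> = (%x. x $ j)" | k where "\<phi> = (%_. k)"
   unfolding bump_gen_def by blast
  then show "alg (bump_gen r) (pdiff i \<phi>)"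
  proof cases
   case 1
   have p: "pdiff i \<phi> = (%x. ((- 2) * x $ i) * (bexp (n + 2) (r\<^sup>2 - x \<bullet> x) + (- real n) * bexp (n + 1) (r\<^sup>2 - x \<bullet> x)))"
    unfolding 1 by (rule ext, subst pdiff_eqI[OF D]) (simp add: inner_axis algebra_simps)
   show ?thesis unfolding p by (rule alg.mult[OF alg.mult[OF c x] alg.add[OF b alg.mult[OF c b]]])
  qed (auto simp: pdiff_component intro: c)
 qed
qed

definition supp_in :: "real => ('d::finite fn) => bool" where
 "supp_in r k \<longleftrightarrow> (\<forall>y. r < norm y --> k y = 0)"

lemma supp_in_pdiff: "supp_in r (k :: 'd::finite fn) ==> supp_in r (pdiff i k)"
 unfolding supp_in_def
proof (intro allI impI)
 fix y :: "real^'d" assume k: "\<forall>y. r < norm y --> k y = 0" and y: "r < norm y"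
 have "open {y::real^'d. r < norm y}" by (intro open_Collect_less continuous_intros)
 then have "(k has_derivative (%_. 0)) (at y) \<longleftrightarrow> ((%_. 0) has_derivative (%_. 0)) (at y)"
  using y k by (intro iffI) (rule has_derivative_transform_within_open[where s="{y. r < norm y}"], auto)+
 then have "(k has_derivative (%_. 0)) (at y)" by simp
 then show "pdiff i k y = 0" by (rule pdiff_eqI)
qed

lemma supp_in_pds: "supp_in r k ==> supp_in r (pds is k)"
 by (induction "is") (auto intro: supp_in_pdiff)

lemma test_functionI: "smooth k ==> supp_in r k ==> test_function k"
proof -
 assume s: "smooth k" and k: "supp_in r k"
 have "{x. k x \<noteq> 0} \<subseteq> cball 0 r" using k by (force simp: supp_in_def)
 then have "bounded {x. k x \<noteq> 0}" using bounded_cball bounded_subset by blast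
 then show ?thesis using s by (simp add: test_function_def compact_closure)
qed

lemma test_functionE:
 assumes "test_function k" obtains r where "smooth k" "supp_in r k" "r > 0"
proof -
 have "bounded {x. k x \<noteq> 0}" "smooth k" using assms by (auto simp: test_function_def compact_closure)
 then obtain r where "r > 0" "\<forall>x\<in>{x. k x \<noteq> 0}. norm x <= r" using bounded_pos by blast
 then show ?thesis using that[of r] \<open>smooth k\<close> unfolding supp_in_def by force
qed

lemma supp_bounded:
 fixes k :: "'d::finite fn"
 assumes "continuous_on UNIV k" "supp_in r k"
 obtains B where "!!x. \<bar>k x\<bar> <= B" "B >= 0"
proof -
 have "compact (k ` cball 0 r)" by (intro compact_continuous_image continuous_on_subset[OF assms(1)]) auto
 then obtain B where "\<forall>x\<in>k ` cball 0 r. norm x <= B" using compact_imp_bounded bounded_iff by blast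
 then have "\<bar>k x\<bar> <= max B 0" for x
  using assms(2)[unfolded supp_in_def, rule_format, of x] by (cases "norm x <= r") force+
 then show ?thesis using that by fastforce
qed

lemma lborel_reflect:
 fixes F :: "'d::finite fn"
 assumes [measurable]: "F \<in> borel_measurable borel"
 shows "(LBINT y. F (x - y)) = (LBINT y. F y)"
  and "integrable lborel (%y. F (x - y)) \<longleftrightarrow> integrable lborel F"
proof -
 have eq: "lborel = distr lborel borel (%y::real^'d. x - y)"
  using lborel_affine[of "-1::real" x] by (simp add: density_1 cong: distr_cong)
 show "(LBINT y. F (x - y)) = (LBINT y. F y)"
  by (subst (2) eq, subst integral_distr) auto
 show "integrable lborel (%y. F (x - y)) \<longleftrightarrow> integrable lborel F"
  by (subst (2) eq, subst integrable_distr_eq) auto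
qed

section \<open>Convolution with compactly supported kernels\<close>

definition conv :: "('d::finite fn) => ('d fn) => 'd fn" where
 "conv k \<phi> x = (LBINT y. k (x - y) * \<phi> y)"

lemma locally_integrable_borel:
 assumes "locally_integrable (v :: 'd::finite fn)"
 shows "v \<in> borel_measurable borel"
proof (rule borel_measurable_LIMSEQ_real)
 fix n :: nat
 have "set_integrable lborel (cball 0 (real n)) v"
  using assms unfolding locally_integrable_def by auto
 then show "(%x. indicator (cball 0 (real n)) x *\<^sub>R v x) \<in> borel_measurable borel"
  unfolding set_integrable_def by auto
next
 fix x :: "real^'d"
 obtain N :: nat where "norm x <= real N" using real_arch_simple by blast
 then have "\<forall>n\<ge>N. indicator (cball 0 (real n)) x *\<^sub>R v x = v x" by (auto simp: indicator_def)
 then show "(%n. indicator (cball 0 (real n)) x *\<^sub>R v x) \<longlonglongrightarrow> v x"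
  by (intro tendsto_eventually eventually_sequentiallyI) blast
qed

lemma locally_integrable_bounded:
 fixes v :: "'d::finite fn"
 assumes [measurable]: "v \<in> borel_measurable borel" and b: "!!x. \<bar>v x\<bar> <= B"
 shows "locally_integrable v"
 unfolding locally_integrable_def set_integrable_def
proof (intro allI impI)
 fix C :: "(real^'d) set" assume C: "compact C"
 have [measurable]: "C \<in> sets borel" using C by (rule borel_compact)
 have "integrable lborel (%x. indicator C x *\<^sub>R B)"
  using C by (intro borel_integrable_compact continuous_intros)
 then show "integrable lborel (%x. indicator C x *\<^sub>R v x)"
  by (rule Bochner_Integration.integrable_bound)
    (measurable, use b in \<open>auto simp: indicator_def intro!: order_trans[OF b]\<close>)
qed

lemma locally_integrable_continuous:
 fixes v :: "'d::finite fn"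
 assumes "continuous_on UNIV v" shows "locally_integrable v"
 unfolding locally_integrable_def set_integrable_def
 using continuous_on_subset[OF assms] by (intro allI impI borel_integrable_compact) auto

lemma integrable_supp_mult:
 fixes v :: "'d::finite fn"
 assumes v: "locally_integrable v" and k: "continuous_on UNIV k" "supp_in r k"
 shows "integrable lborel (%y. k (x - y) * v y)"
proof -
 obtain B where B: "!!x. \<bar>k x\<bar> <= B" "B >= 0" using supp_bounded[OF k] by blast
 have [measurable]: "v \<in> borel_measurable borel" "k \<in> borel_measurable borel"
  using locally_integrable_borel[OF v] borel_measurable_continuous_onI[OF k(1)] by auto
 have "integrable lborel (%y. indicator (cball x r) y *\<^sub>R v y)"
  using v unfolding locally_integrable_def set_integrable_def by auto
 then have "integrable lborel (%y. B * (indicator (cball x r) y *\<^sub>R v y))" by simp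
 then show ?thesis
 proof (rule Bochner_Integration.integrable_bound)
  show "(%y. k (x - y) * v y) \<in> borel_measurable lborel" by measurable
  show "AE y in lborel. norm (k (x - y) * v y) <= norm (B * (indicator (cball x r) y *\<^sub>R v y))"
  proof (intro AE_I2)
   fix y
   show "norm (k (x - y) * v y) <= norm (B * (indicator (cball x r) y *\<^sub>R v y))"
    using B k(2)[unfolded supp_in_def, rule_format, of "x - y"]
    by (cases "y \<in> cball x r") (auto simp: abs_mult dist_norm intro!: mult_right_mono)
  qed
 qed
qed

lemma conv_commute:
 fixes \<phi> :: "'d::finite fn"
 assumes "\<phi> \<in> borel_measurable borel" "k \<in> borel_measurable borel"
 shows "conv k \<phi> x = (LBINT y. k y * \<phi> (x - y))"
 unfolding conv_def using lborel_reflect(1)[of "%y. k y * \<phi> (x - y)" x] assms by simp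

text \<open>For x in a unit ball around x0 the supports of all the functions y -> k (x - y) lie in
  one box, so the convolution is a parameter integral over a fixed compact set and can be
  differentiated under the integral sign.\<close>

lemma conv_derivative:
 fixes \<phi> :: "'d::finite fn"
 assumes k: "smooth k" "supp_in r k" and \<phi>: "continuous_on UNIV \<phi>"
 shows "conv k \<phi> differentiable (at x0)" "pdiff i (conv k \<phi>) x0 = conv (pdiff i k) \<phi> x0"
proof -
 obtain a b where ab: "cball x0 (1 + r) \<subseteq> cbox a (b::real^'d)"
  using bounded_subset_cbox_symmetric[OF bounded_cball] by metis
 have conv_cbox: "conv k \<phi> x = integral (cbox a b) (%y. k (x - y) * \<phi> y)"
  if k: "continuous_on UNIV k" "supp_in r k" and x: "x \<in> ball x0 1" for k x
 proof -
  have ki: "continuous_on (cbox a b) (%y. k (x - y) * \<phi> y)"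
   using continuous_on_subset[OF \<phi>] by (intro continuous_intros continuous_on_compose2[OF k(1)]) auto
  have z: "k (x - y) = 0" if "y \<notin> cbox a b" for y
  proof -
   have "y \<notin> cball x0 (1 + r)" using that ab by blast
   moreover have "dist x0 y <= dist x0 x + dist x y" by (rule dist_triangle)
   ultimately have "r < norm (x - y)" using x by (auto simp: dist_norm)
   then show ?thesis using k(2) by (simp add: supp_in_def)
  qed
  have "set_integrable lborel (cbox a b) (%y. k (x - y) * \<phi> y)"
   unfolding set_integrable_def using ki by (intro borel_integrable_compact) auto
  then have "integral (cbox a b) (%y. k (x - y) * \<phi> y) = (LINT y:cbox a b|lborel. k (x - y) * \<phi> y)"
   by (simp add: set_borel_integral_eq_integral)
  also have "... = conv k \<phi> x"
   unfolding conv_def set_lebesgue_integral_def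
   by (intro Bochner_Integration.integral_cong) (auto simp: indicator_def z)
  finally show ?thesis by simp
 qed
 define fx where "fx = (%x t. \<Sum>j\<in>UNIV. (pdiff j k (x - t) * \<phi> t) *\<^sub>R blinfun_inner_right (axis j 1 :: real^'d))"
 have fxa: "blinfun_apply (fx x t) v = (\<Sum>j\<in>UNIV. pdiff j k (x - t) * \<phi> t * v $ j)" for x t v
  unfolding fx_def by (simp add: blinfun.sum_left blinfun.scaleR_left inner_axis')
 have ck: "continuous_on UNIV k" and cpk: "!!j. continuous_on UNIV (pdiff j k)"
  using k smooth_continuous smooth_pdiff by blast+
 have D: "((%x. integral (cbox a b) (%y. k (x - y) * \<phi> y)) has_derivative integral (cbox a b) (fx x0)) (at x0 within ball x0 1)"
 proof (rule leibniz_rule)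
  fix x t :: "real^'d"
  have 1: "((%x. x - t) has_derivative (%v. v)) (at x within ball x0 1)" by (auto intro!: derivative_eq_intros)
  have "((%x. k (x - t) * \<phi> t) has_derivative (%v. frechet_derivative k (at (x - t)) v * \<phi> t)) (at x within ball x0 1)"
   by (intro has_derivative_mult_left has_derivative_compose[OF 1] differentiable_frechet smoothD k)
  then show "((%x. k (x - t) * \<phi> t) has_derivative blinfun_apply (fx x t)) (at x within ball x0 1)"
   by (rule has_derivative_eq_rhs) (auto simp: fxa fun_eq_iff frechet_expand smoothD k sum_distrib_right sum_distrib_left mult_ac)
 next
  fix x show "(%y. k (x - y) * \<phi> y) integrable_on cbox a b"
   using continuous_on_subset[OF \<phi>] by (intro integrable_continuous continuous_intros continuous_on_compose2[OF ck]) auto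
 next
  show "continuous_on (ball x0 1 \<times> cbox a b) (%(x, t). fx x t)"
   unfolding fx_def split_beta
   by (intro continuous_intros continuous_on_compose2[OF cpk] continuous_on_compose2[OF \<phi>]) auto
 qed auto
 then have D2: "((%x. integral (cbox a b) (%y. k (x - y) * \<phi> y)) has_derivative integral (cbox a b) (fx x0)) (at x0)"
  by (simp add: at_within_open[of x0 "ball x0 1"])
 have D3: "(conv k \<phi> has_derivative integral (cbox a b) (fx x0)) (at x0)"
  by (rule has_derivative_transform_within_open[OF D2, of "ball x0 1"]) (auto simp: conv_cbox[OF ck k(2)])
 then show "conv k \<phi> differentiable (at x0)" by (auto simp: differentiable_def)
 have fi: "fx x0 integrable_on cbox a b"
  unfolding fx_def using continuous_on_subset[OF \<phi>]
  by (intro integrable_continuous continuous_intros continuous_on_compose2[OF cpk]) auto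
 have "pdiff i (conv k \<phi>) x0 = blinfun_apply (integral (cbox a b) (fx x0)) (axis i 1)"
  by (rule pdiff_eqI[OF D3])
 also have "... = integral (cbox a b) (%t. blinfun_apply (fx x0 t) (axis i 1))"
  using integral_linear[OF fi bounded_linear_apply_blinfun[of "axis i 1"]] by (simp add: o_def)
 also have "... = integral (cbox a b) (%t. pdiff i k (x0 - t) * \<phi> t)"
 proof -
  have "(\<Sum>j\<in>UNIV. pdiff j k (x0 - t) * \<phi> t * (axis i 1 :: real^'d) $ j) = pdiff i k (x0 - t) * \<phi> t" for t
   using sum_axis[of 1 i "%j. pdiff j k (x0 - t) * \<phi> t"] by (simp add: mult_ac)
  then show ?thesis by (simp add: fxa)
 qed
 also have "... = conv (pdiff i k) \<phi> x0"
  using conv_cbox[OF cpk supp_in_pdiff[OF k(2)], of x0] by simp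
 finally show "pdiff i (conv k \<phi>) x0 = conv (pdiff i k) \<phi> x0" .
qed

lemma pds_conv:
 assumes k: "smooth k" "supp_in r k" and \<phi>: "continuous_on UNIV \<phi>"
 shows "pds is (conv k \<phi>) = conv (pds is k) \<phi>"
proof (induction "is")
 case (Cons i "is")
 then show ?case using conv_derivative(2)[OF smooth_pds[OF k(1)] supp_in_pds[OF k(2)] \<phi>] by auto
qed simp

lemma smooth_conv:
 assumes k: "smooth k" "supp_in r k" and \<phi>: "continuous_on UNIV \<phi>"
 shows "smooth (conv k \<phi>)"
 unfolding smooth_def pds_conv[OF assms]
 using conv_derivative(1)[OF smooth_pds[OF k(1)] supp_in_pds[OF k(2)] \<phi>] by blast

section \<open>Normalised mollifiers and approximation\<close>

definition moll :: "real => 'd::finite fn" where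
 "moll r x = bexp 0 (r\<^sup>2 - x \<bullet> x) / (\<integral>y. bexp 0 (r\<^sup>2 - y \<bullet> y) \<partial>(lborel :: (real^'d) measure))"

lemma bump_supp: "supp_in \<bar>r\<bar> (%x::real^'d::finite. bexp n (r\<^sup>2 - x \<bullet> x))"
 unfolding supp_in_def
proof (intro allI impI)
 fix y :: "real^'d" assume "\<bar>r\<bar> < norm y"
 then have "\<bar>r\<bar>\<^sup>2 < (norm y)\<^sup>2" by (intro power_strict_mono) auto
 then show "bexp n (r\<^sup>2 - y \<bullet> y) = 0" by (simp add: bexp_def power2_norm_eq_inner)
qed

context
 fixes r :: real assumes r: "r > 0"
begin

text \<open>A nonnegative function with zero integral vanishes almost everywhere, but the profile is
  positive on a ball of positive volume.\<close>

lemma bump_integral_pos: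
 "integrable lborel (%x::real^'d::finite. bexp 0 (r\<^sup>2 - x \<bullet> x))"
 "(\<integral>y. bexp 0 (r\<^sup>2 - y \<bullet> y) \<partial>(lborel :: (real^'d) measure)) > 0"
proof -
 let ?b = "%x::real^'d. bexp 0 (r\<^sup>2 - x \<bullet> x)"
 have nn: "?b x >= 0" for x by (simp add: bexp_def)
 have c: "continuous_on UNIV ?b" using smooth_bump smooth_continuous by blast
 have "integrable lborel (%y. ?b (0 - y) * 1)"
  by (intro integrable_supp_mult[OF _ c bump_supp] locally_integrable_continuous continuous_intros)
 then show i: "integrable lborel ?b" by simp
 have "(LBINT x. ?b x) \<noteq> 0"
 proof
  assume "(LBINT x. ?b x) = 0"
  then have "AE x in lborel. ?b x = 0" using integral_nonneg_eq_0_iff_AE[OF i] nn by blast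
  then have "AE x in lborel. x \<notin> ball (0::real^'d) r"
  proof (rule AE_mp, intro AE_I2 impI)
   fix x :: "real^'d" assume x: "?b x = 0"
   have "\<not> norm x < r"
   proof
    assume "norm x < r"
    then have "(norm x)\<^sup>2 < r\<^sup>2" by (intro power_strict_mono) auto
    then show False using x by (simp add: bexp_def power2_norm_eq_inner)
   qed
   then show "x \<notin> ball 0 r" by simp
  qed
  then have "emeasure lborel (ball (0::real^'d) r) = 0"
   by (subst (asm) AE_iff_measurable[OF _ refl]) (auto simp: ball_def)
  then show False using r emeasure_lborel_ball_finite[of "0::real^'d" r]
   by (auto simp: emeasure_ball unit_ball_vol_pos less_imp_le ennreal_eq_0_iff)
    (meson not_less unit_ball_vol_pos zero_less_power mult_pos_pos of_nat_0_le_iff)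
 qed
 moreover have "(LBINT x. ?b x) >= 0" using nn by simp
 ultimately show "(LBINT x. ?b x) > 0" by linarith
qed

lemma moll_smooth: "smooth (moll r :: 'd::finite fn)"
 unfolding moll_def[abs_def] divide_inverse by (intro smooth_mult smooth_bump smooth_const)

lemma moll_supp: "supp_in r (moll r :: 'd::finite fn)"
proof -
 have "supp_in \<bar>r\<bar> (%x::real^'d. bexp 0 (r\<^sup>2 - x \<bullet> x))" by (rule bump_supp)
 then show ?thesis using r unfolding supp_in_def moll_def by simp
qed

lemma moll_nonneg: "moll r (x :: real^'d::finite) >= 0"
 using bump_integral_pos(2) unfolding moll_def by (simp add: bexp_def less_imp_le)

lemma moll_integrable: "integrable lborel (moll r :: 'd::finite fn)"
 unfolding moll_def[abs_def] divide_inverse by (rule integrable_mult_left) (rule bump_integral_pos(1))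

lemma moll_integral: "(\<integral>x. moll r x \<partial>(lborel :: (real^'d::finite) measure)) = 1"
proof -
 have "(\<integral>y. bexp 0 (r\<^sup>2 - y \<bullet> y) \<partial>(lborel :: (real^'d) measure)) \<noteq> 0"
  using bump_integral_pos(2)[where 'd='d] by linarith
 then show ?thesis unfolding moll_def by simp
qed

lemma moll_continuous: "continuous_on A (moll r :: 'd::finite fn)"
 using moll_smooth smooth_continuous by blast

lemma moll_measurable [measurable]: "(moll r :: 'd::finite fn) \<in> borel_measurable borel"
 using moll_continuous borel_measurable_continuous_onI by blast

lemma moll_test: "test_function (%y. moll r (x - y :: real^'d::finite))"
proof (rule test_functionI)
 show "smooth (%y. moll r (x - y :: real^'d::finite))"
  using smooth_affine[OF moll_smooth, of x "-1"] by simp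
 show "supp_in (r + norm x) (%y. moll r (x - y :: real^'d::finite))"
  unfolding supp_in_def
 proof (intro allI impI)
  fix y :: "real^'d" assume "r + norm x < norm y"
  then have "r < norm (x - y)" using norm_triangle_sub[of y x] by (simp add: norm_minus_commute)
  then show "moll r (x - y) = 0" using moll_supp[unfolded supp_in_def, rule_format, of "x - y"] by simp
 qed
qed

lemma conv_moll_bound:
 fixes v :: "'d::finite fn"
 assumes v: "locally_integrable v" and b: "AE x in lborel. \<bar>v x\<bar> <= B"
 shows "\<bar>conv (moll r) v x\<bar> <= B"
proof -
 have i: "integrable lborel (%y. moll r (x - y) * v y)"
  by (rule integrable_supp_mult[OF v moll_continuous moll_supp])
 have m: "integrable lborel (%y. moll r (x - y))" "(LBINT y. moll r (x - y)) = 1"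
  using lborel_reflect[of "moll r" x] moll_integrable moll_integral by auto
 have "\<bar>conv (moll r) v x\<bar> <= (LBINT y. \<bar>moll r (x - y) * v y\<bar>)"
  unfolding conv_def by (rule integral_abs_bound)
 also have "... <= (LBINT y. moll r (x - y) * B)"
 proof (rule integral_mono_AE)
  show "AE y in lborel. \<bar>moll r (x - y) * v y\<bar> <= moll r (x - y) * B"
   using b
  proof (rule AE_mp, intro AE_I2 impI)
   fix y assume "\<bar>v y\<bar> <= B"
   then show "\<bar>moll r (x - y) * v y\<bar> <= moll r (x - y) * B"
    using moll_nonneg[of "x - y"] by (auto simp: abs_mult intro!: mult_left_mono)
  qed
 qed (use i m in auto)
 also have "... = B" using m by simp
 finally show ?thesis .
qed

text \<open>Since the kernel has mass one and vanishes beyond distance r, only the oscillation of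
  \<phi> about a within that distance matters. The reference value a is left free: it is \<phi> x
  for approximation and 0 for locating supports.\<close>

lemma conv_moll_approx:
 fixes \<phi> :: "'d::finite fn"
 assumes \<phi>: "continuous_on UNIV \<phi>" and b: "!!y. norm (y - x) <= r ==> \<bar>\<phi> y - a\<bar> <= B"
 shows "\<bar>conv (moll r) \<phi> x - a\<bar> <= B"
proof -
 have i: "integrable lborel (%y. moll r (x - y) * \<phi> y)"
  by (rule integrable_supp_mult[OF locally_integrable_continuous[OF \<phi>] moll_continuous moll_supp])
 have m: "integrable lborel (%y. moll r (x - y))" "(LBINT y. moll r (x - y)) = 1"
  using lborel_reflect[of "moll r" x] moll_integrable moll_integral by auto
 have i2: "integrable lborel (%y. moll r (x - y) * (\<phi> y - a))"
  using i m by (simp add: right_diff_distrib)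
 have "conv (moll r) \<phi> x - a = (LBINT y. moll r (x - y) * (\<phi> y - a))"
  unfolding conv_def using i m by (simp add: right_diff_distrib)
 then have "\<bar>conv (moll r) \<phi> x - a\<bar> <= (LBINT y. \<bar>moll r (x - y) * (\<phi> y - a)\<bar>)"
  using integral_abs_bound by metis
 also have "... <= (LBINT y. moll r (x - y) * B)"
 proof (rule integral_mono)
  fix y show "\<bar>moll r (x - y) * (\<phi> y - a)\<bar> <= moll r (x - y) * B"
  proof (cases "norm (x - y) <= r")
   case True
   then show ?thesis using b[of y] moll_nonneg[of "x - y"] by (auto simp: abs_mult norm_minus_commute intro!: mult_left_mono)
  next
   case False
   then show ?thesis using moll_supp[unfolded supp_in_def, rule_format, of "x - y"] by simp
  qed
 qed (use i2 m in auto)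
 also have "... = B" using m by simp
 finally show ?thesis .
qed

end

lemma conv_moll_tendsto:
 fixes \<phi> :: "'d::finite fn"
 assumes \<phi>: "continuous_on UNIV \<phi>"
 shows "(%n. conv (moll (1 / real (Suc n))) \<phi> x) \<longlonglongrightarrow> \<phi> x"
proof (rule LIMSEQ_I)
 fix e :: real assume e: "0 < e"
 obtain d where d: "d > 0" "!!y. dist y x < d ==> dist (\<phi> y) (\<phi> x) < e / 2"
  using \<phi> e unfolding continuous_on_iff by (metis UNIV_I half_gt_zero)
 obtain N where N: "1 / real (Suc N) < d" using d(1) by (metis nat_approx_posE)
 have "norm (conv (moll (1 / real (Suc n))) \<phi> x - \<phi> x) < e" if "n >= N" for n
 proof -
  have "1 / real (Suc n) <= 1 / real (Suc N)" using that by (simp add: frac_le)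
  then have "\<bar>conv (moll (1 / real (Suc n))) \<phi> x - \<phi> x\<bar> <= e / 2"
   using N d(2) by (intro conv_moll_approx[OF _ \<phi>]) (auto simp: dist_norm less_imp_le intro!: less_imp_le[of _ "e / 2"])
  then show ?thesis using e by simp
 qed
 then show "\<exists>no. \<forall>n\<ge>no. norm (conv (moll (1 / real (Suc n))) \<phi> x - \<phi> x) < e" by blast
qed

text \<open>Under this probability law mollification is the expectation of the translates of \<phi>,
  so that everything proved for averages (\<open>dbd_avg\<close>, \<open>rough_avg\<close>) applies
  to it.\<close>

definition moll_measure :: "real => (real^'d::finite) measure" where
 "moll_measure r = density lborel (%y. ennreal (moll r y))"

lemma prob_space_moll: "r > 0 ==> prob_space (moll_measure r :: (real^'d::finite) measure)"
proof
 assume r: "r > 0"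
 note moll_measurable[OF r, measurable]
 show "emeasure (moll_measure r) (space (moll_measure r :: (real^'d) measure)) = 1"
  using nn_integral_eq_integral[OF moll_integrable[OF r, where 'd='d]] moll_nonneg[OF r] moll_integral[OF r, where 'd='d]
  by (auto simp: moll_measure_def emeasure_density)
qed

lemma
 fixes \<phi> :: "'d::finite fn"
 assumes r: "r > 0" and \<phi>: "continuous_on UNIV \<phi>"
 shows integrable_moll_measure: "integrable (moll_measure r) (%y. \<phi> (x - y))"
  and conv_moll_measure: "conv (moll r) \<phi> x = (\<integral>y. \<phi> (x - y) \<partial>moll_measure r)"
proof -
 have [measurable]: "\<phi> \<in> borel_measurable borel" using \<phi> borel_measurable_continuous_onI by blast
 note moll_measurable[OF r, measurable]
 have "integrable lborel (%y. moll r (x - (x - y)) * \<phi> (x - y))"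
  using lborel_reflect(2)[of "%y. moll r (x - y) * \<phi> y" x]
   integrable_supp_mult[OF locally_integrable_continuous[OF \<phi>] moll_continuous[OF r] moll_supp[OF r], of x] by simp
 then show "integrable (moll_measure r) (%y. \<phi> (x - y))"
  unfolding moll_measure_def by (subst integrable_density) (auto simp: moll_nonneg[OF r])
 show "conv (moll r) \<phi> x = (\<integral>y. \<phi> (x - y) \<partial>moll_measure r)"
  unfolding moll_measure_def by (subst integral_density) (auto simp: conv_commute moll_nonneg[OF r])
qed

lemma dbd_conv_moll:
 fixes \<phi> :: "'d::finite fn"
 assumes r: "r > 0" and \<phi>: "continuous_on UNIV \<phi>" and d: "dbd k C \<phi>"
 shows "dbd k C (conv (moll r) \<phi>)"
proof -
 have "dbd k C (%x. \<phi> (x - y))" for y using dbd_shift[OF d, of "- y"] by simp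
 then have "dbd k C (%x. \<integral>y. \<phi> (x - y) \<partial>moll_measure r)"
  by (intro dbd_avg prob_space_moll r integrable_moll_measure \<phi>)
 moreover have "conv (moll r) \<phi> = (%x. \<integral>y. \<phi> (x - y) \<partial>moll_measure r)"
  using conv_moll_measure[OF r \<phi>] by blast
 ultimately show ?thesis by simp
qed

section \<open>Generalized derivatives\<close>

lemma integrable_supp:
 fixes v :: "'d::finite fn"
 assumes v: "locally_integrable v" and k: "continuous_on UNIV k" "supp_in r k"
 shows "integrable lborel (%y. k y * v y)"
proof -
 have "continuous_on UNIV (%y. k (- y))"
  by (intro continuous_on_compose2[OF k(1)] continuous_intros) auto
 moreover have "supp_in r (%y. k (- y))" using k(2) by (simp add: supp_in_def)
 ultimately show ?thesis using integrable_supp_mult[OF v, of "%y. k (- y)" r 0] by simp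
qed

text \<open>Convolving k with the constant 1 gives a constant function, whose derivative is 0 on the
  one hand and the integral of \<open>pdiff i k\<close> on the other.\<close>

lemma integral_pdiff_zero:
 assumes k: "smooth k" "supp_in r (k :: 'd::finite fn)"
 shows "(LBINT x. pdiff i k x) = 0"
proof -
 have m: "k \<in> borel_measurable borel" "pdiff i k \<in> borel_measurable borel"
  using k smooth_continuous smooth_pdiff borel_measurable_continuous_onI by blast+
 have "conv k (%_. 1) = (%_. LBINT x. k x)"
  using lborel_reflect(1)[OF m(1)] by (auto simp: conv_def)
 then have "conv (pdiff i k) (%_. 1) 0 = 0"
  using conv_derivative(2)[OF k, of "%_. 1" i 0] by simp
 then show ?thesis using lborel_reflect(1)[OF m(2), of 0] by (simp add: conv_def)
qed

lemma supp_in_mult: "supp_in r k ==> supp_in r (%x. \<phi> x * k x)"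
 by (auto simp: supp_in_def)

lemma integral_by_parts:
 fixes \<phi> :: "'d::finite fn"
 assumes \<phi>: "smooth \<phi>" and k: "smooth k" "supp_in r k"
 shows "(LBINT x. \<phi> x * pdiff i k x) = - (LBINT x. pdiff i \<phi> x * k x)"
proof -
 have "(LBINT x. pdiff i (%x. \<phi> x * k x) x) = 0"
  by (rule integral_pdiff_zero[OF smooth_mult[OF \<phi> k(1)] supp_in_mult[OF k(2)]])
 moreover have "pdiff i (%x. \<phi> x * k x) x = pdiff i \<phi> x * k x + \<phi> x * pdiff i k x" for x
  by (intro pdiff_mult smoothD assms)
 moreover have "integrable lborel (%x. k x * pdiff i \<phi> x)" "integrable lborel (%x. pdiff i k x * \<phi> x)"
  by (intro integrable_supp[of _ _ r] locally_integrable_continuous smooth_continuous smooth_pdiff supp_in_pdiff assms)+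
 ultimately show ?thesis by (simp add: mult.commute)
qed

lemma count_list_eq_count: "count_list is = count (mset is)"
 by (induction "is") auto

lemma count_list_mset: "count_list is = count_list js ==> mset is = mset js"
 by (simp add: count_list_eq_count count_inject)

lemma mi_order_count_list: "mi_order (count_list is) = length is"
proof -
 have "(\<Sum>i\<in>UNIV. count_list is i) = length is"
 proof (induction "is")
  case (Cons a "is")
  have "(\<Sum>i\<in>UNIV. count_list (a # is) i) = (\<Sum>i\<in>UNIV. count_list is i) + (\<Sum>i\<in>UNIV. if i = a then 1 else 0)"
   by (subst sum.distrib[symmetric]) (auto intro!: sum.cong)
  then show ?case using Cons by simp
 qed simp
 then show ?thesis by (simp add: mi_order_def)
qed

lemma ex_count_list:
 fixes \<alpha> :: "'d::finite => nat"
 obtains "is" where "count_list is = \<alpha>" "length is = mi_order \<alpha>"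
proof -
 have "finite {i. \<alpha> i > 0}" by simp
 then have "count (Abs_multiset \<alpha>) = \<alpha>" by (rule count_Abs_multiset)
 moreover obtain "is" where "mset is = Abs_multiset \<alpha>" using ex_mset by blast
 ultimately have "count_list is = \<alpha>" by (metis count_list_eq_count)
 then show ?thesis using that mi_order_count_list by metis
qed

lemma count_list_single: "count_list [i] = unit_index i"
 by (auto simp: unit_index_def)

lemma weak_derivD:
 assumes "weak_deriv (count_list is) u v" "smooth k" "supp_in r k"
 shows "(LBINT x. u x * pds is k x) = (-1) ^ length is * (LBINT x. v x * k x)"
 using assms test_functionI[of k r] unfolding weak_deriv_def by (simp add: mi_order_count_list)

lemma weak_derivI:
 assumes "locally_integrable u" "locally_integrable v"
  "!!k r. smooth k ==> supp_in r k ==> (LBINT x. u x * pds is k x) = (-1) ^ length is * (LBINT x. v x * k x)"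
 shows "weak_deriv (count_list is) u v"
 unfolding weak_deriv_def
proof (intro conjI allI impI assms(1,2))
 fix k :: "real^'a => real" and js :: "'a list" assume k: "test_function k \<and> count_list js = count_list is"
 then obtain r where r: "smooth k" "supp_in r k" using test_functionE by blast
 have "pds js k = pds is k" using k by (intro pds_mset r count_list_mset) simp
 then show "(LBINT x. u x * pds js k x) = (-1) ^ mi_order (count_list is) * (LBINT x. v x * k x)"
  using assms(3)[OF r] by (simp add: mi_order_count_list)
qed

lemma weak_deriv_Cons:
 assumes u: "weak_deriv (count_list is) u v" and v: "weak_deriv (unit_index i) v w"
 shows "weak_deriv (count_list (i # is)) u w"
proof (rule weak_derivI)
 show "locally_integrable u" "locally_integrable w" using u v by (auto simp: weak_deriv_def)
 fix k :: "real^'a => real" and r assume k: "smooth k" "supp_in r k"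
 have "(LBINT x. u x * pds (i # is) k x) = (LBINT x. u x * pds is (pdiff i k) x)"
  using pds_pdiff_commute[OF k(1)] by simp
 also have "... = (-1) ^ length is * (LBINT x. v x * pdiff i k x)"
  by (rule weak_derivD[OF u smooth_pdiff[OF k(1)] supp_in_pdiff[OF k(2)]])
 also have "(LBINT x. v x * pdiff i k x) = - (LBINT x. w x * k x)"
  using weak_derivD[of "[i]", OF _ k] v unfolding count_list_single by simp
 finally show "(LBINT x. u x * pds (i # is) k x) = (-1) ^ length (i # is) * (LBINT x. w x * k x)"
  by simp
qed

lemma weak_deriv_Nil:
 fixes u :: "'d::finite fn"
 assumes "locally_integrable u" shows "weak_deriv (%_. 0) u u"
proof -
 have "count_list ([] :: 'd list) = (%_. 0)" by auto
 then show ?thesis using weak_derivI[of u u "[]"] assms by (metis foldr_Nil id_apply list.size(3) mult_1 power_0)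
qed

lemma weak_deriv_smooth1:
 assumes "smooth \<phi>" shows "weak_deriv (unit_index i) \<phi> (pdiff i \<phi>)"
 unfolding count_list_single[symmetric]
 by (rule weak_derivI)
   (use assms integral_by_parts in \<open>auto intro!: locally_integrable_continuous smooth_continuous smooth_pdiff\<close>)

text \<open>The weak derivative is tested with the reflected and translated kernel y -> k (x - y).
  Reflection produces the same sign as integration by parts, so the two cancel.\<close>

lemma conv_pds_weak:
 assumes u: "weak_deriv (count_list is) u v" and k: "smooth k" "supp_in r k"
 shows "conv (pds is k) u x = conv k v x"
proof -
 define \<theta> where "\<theta> = (%y. k (x - y))"
 have \<theta>: "smooth \<theta>" unfolding \<theta>_def using smooth_affine[OF k(1), of x "-1"] by simp
 have p: "pds is \<theta> = (%y. (-1) ^ length is * pds is k (x - y))"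
  unfolding \<theta>_def using pds_affine[OF k(1), of "is" x "-1"] by simp
 have s: "supp_in (r + norm x) \<theta>"
  unfolding supp_in_def \<theta>_def
 proof (intro allI impI)
  fix y :: "real^'a" assume "r + norm x < norm y"
  then have "r < norm (x - y)" using norm_triangle_sub[of y x] by (simp add: norm_minus_commute)
  then show "k (x - y) = 0" using k(2) by (simp add: supp_in_def)
 qed
 have "(-1) ^ length is * conv (pds is k) u x = (LBINT y. u y * pds is \<theta> y)"
  unfolding p conv_def integral_mult_right_zero[symmetric] by (simp add: mult_ac)
 also have "... = (-1) ^ length is * (LBINT y. v y * \<theta> y)" by (rule weak_derivD[OF u \<theta> s])
 also have "(LBINT y. v y * \<theta> y) = conv k v x"
  unfolding conv_def \<theta>_def by (simp add: mult.commute)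
 finally show ?thesis by simp
qed

lemma pds_conv_weak:
 assumes u: "weak_deriv (count_list is) u v" "continuous_on UNIV u" and k: "smooth k" "supp_in r k"
 shows "pds is (conv k u) = conv k v"
 using conv_pds_weak[OF u(1) k] pds_conv[OF k u(2)] by auto

text \<open>Both versions have the same mollifications, which converge pointwise to them by
  continuity. This makes \<open>gen_deriv\<close> a determinate function whenever a continuous
  version exists.\<close>

lemma weak_deriv_unique:
 assumes "weak_deriv \<alpha> u v" "continuous_on UNIV v" "weak_deriv \<alpha> u w" "continuous_on UNIV w"
 shows "v = w"
proof
 fix x
 obtain "is" where is1: "count_list is = \<alpha>" using ex_count_list by blast
 have *: "conv (moll (1 / real (Suc n))) v x = conv (moll (1 / real (Suc n))) w x" for n
  using conv_pds_weak[of "is" u _ "moll (1 / real (Suc n))", OF _ moll_smooth moll_supp] assms is1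
  by (metis of_nat_0_less_iff zero_less_Suc zero_less_divide_1_iff)
 show "v x = w x"
  using conv_moll_tendsto[OF assms(2), of x] conv_moll_tendsto[OF assms(4), of x] unfolding * by (rule LIMSEQ_unique)
qed

lemma gen_deriv_eqI:
 assumes "weak_deriv \<alpha> u v" "continuous_on UNIV v" "continuous_on UNIV u"
 shows "gen_deriv \<alpha> u = v"
proof (cases "\<alpha> = (%_. 0)")
 case True
 then show ?thesis
  using weak_deriv_unique[of \<alpha> u u v] weak_deriv_Nil[of u] locally_integrable_continuous[OF assms(3)] assms
  by (simp add: gen_deriv_def)
next
 case False
 have "weak_deriv \<alpha> u (SOME v. weak_deriv \<alpha> u v \<and> continuous_on UNIV v) \<and> continuous_on UNIV (SOME v. weak_deriv \<alpha> u v \<and> continuous_on UNIV v)"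
  by (rule someI[of _ v]) (use assms in auto)
 then have "(SOME v. weak_deriv \<alpha> u v \<and> continuous_on UNIV v) = v"
  using weak_deriv_unique assms by blast
 then show ?thesis using False assms unfolding gen_deriv_def by auto
qed

lemma weak_deriv_gen_deriv:
 assumes "has_gen_deriv \<alpha> u" shows "weak_deriv \<alpha> u (gen_deriv \<alpha> u)"
proof (cases "\<alpha> = (%_. 0)")
 case True
 then show ?thesis using assms weak_deriv_Nil by (auto simp: gen_deriv_def has_gen_deriv_def weak_deriv_def)
next
 case False
 show ?thesis
 proof (cases "\<exists>v. weak_deriv \<alpha> u v \<and> continuous_on UNIV v")
  case True
  then show ?thesis using False someI_ex[OF True] by (simp add: gen_deriv_def)
 next
  case F: False
  then show ?thesis using False someI_ex[OF assms[unfolded has_gen_deriv_def]] by (simp only: gen_deriv_def if_False)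
 qed
qed

lemma D1_smooth: "smooth \<phi> ==> D1 i \<phi> = pdiff i \<phi>"
 unfolding D1_def by (intro gen_deriv_eqI weak_deriv_smooth1 smooth_continuous smooth_pdiff)

lemma weak_deriv_lin:
 assumes "weak_deriv \<alpha> u v" "weak_deriv \<alpha> u' v'"
 shows "weak_deriv \<alpha> (%x. a * u x + u' x) (%x. a * v x + v' x)"
proof -
 obtain "is" where is1: "count_list is = \<alpha>" using ex_count_list by blast
 have li: "locally_integrable u" "locally_integrable v" "locally_integrable u'" "locally_integrable v'"
  using assms by (auto simp: weak_deriv_def)
 have l: "locally_integrable (%x. a * f x + g x)" if "locally_integrable f" "locally_integrable g"
  for f g :: "real^'a => real"
  using that unfolding locally_integrable_def set_integrable_def
  by (auto simp: algebra_simps)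
 have "weak_deriv (count_list is) (%x. a * u x + u' x) (%x. a * v x + v' x)"
 proof (rule weak_derivI)
  fix k :: "real^'a => real" and r assume k: "smooth k" "supp_in r k"
  have i: "integrable lborel (%x. f x * pds js k x)" if "locally_integrable f" for f js
   using integrable_supp[OF that smooth_continuous[OF smooth_pds[OF k(1)]] supp_in_pds[OF k(2)], of js]
   by (simp add: mult.commute)
  have e: "(LBINT x. (a * f x + g x) * pds js k x) = a * (LBINT x. f x * pds js k x) + (LBINT x. g x * pds js k x)"
   if "locally_integrable f" "locally_integrable g" for f g js
   using i[OF that(1), of js] i[OF that(2), of js] by (simp add: distrib_right mult.assoc)
  show "(LBINT x. (a * u x + u' x) * pds is k x) = (-1) ^ length is * (LBINT x. (a * v x + v' x) * k x)"
   using e[OF li(1,3), of "is"] e[OF li(2,4), of "[]"] weak_derivD[of "is", OF _ k] assms is1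
   by (simp add: distrib_left)
 qed (use l li in auto)
 then show ?thesis using is1 by simp
qed

lemma weak_deriv_sum:
 assumes "finite A" "!!j. j \<in> A ==> weak_deriv \<alpha> (u j) (v j)"
 shows "weak_deriv \<alpha> (%x. \<Sum>j\<in>A. a j * u j x) (%x. \<Sum>j\<in>A. a j * v j x)"
 using assms
proof induction
 case empty
 have "weak_deriv \<alpha> (%x. 0) (%x. 0)"
  unfolding weak_deriv_def by (auto intro: locally_integrable_continuous)
 then show ?case by simp
next
 case (insert x F)
 show ?case
  using weak_deriv_lin[OF insert.prems[of x] insert.IH, of "a x"] insert.prems insert.hyps by simp
qed

text \<open>Mollification turns the essential bound on weak derivatives into a bound on classical
  derivatives, \<open>nb_imp_dbd\<close> turns that into differences, and differences pass to the
  limit. This is the entrance from the spaces of the statement into the classes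
  \<open>Xc\<close>.\<close>

lemma dbd_weak:
 assumes c: "continuous_on UNIV \<phi>"
  and w: "!!is. length is = k ==> \<exists>v. weak_deriv (count_list is) \<phi> v \<and> (AE x in lborel. \<bar>v x\<bar> <= C)"
 shows "dbd k C \<phi>"
proof (rule dbd_lim)
 fix n :: nat
 have r: "1 / real (Suc n) > 0" by simp
 have s: "smooth (conv (moll (1 / real (Suc n))) \<phi>)" by (rule smooth_conv[OF moll_smooth[OF r] moll_supp[OF r] c])
 have "nb k C (conv (moll (1 / real (Suc n))) \<phi>)"
  unfolding nb_def
 proof (intro allI impI)
  fix "is" :: "'a list" and x assume "length is = k"
  then obtain v where v: "weak_deriv (count_list is) \<phi> v" "AE x in lborel. \<bar>v x\<bar> <= C" using w by blast
  then have "pds is (conv (moll (1 / real (Suc n))) \<phi>) x = conv (moll (1 / real (Suc n))) v x"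
   using pds_conv_weak[OF v(1) c moll_smooth[OF r] moll_supp[OF r]] by simp
  then show "\<bar>pds is (conv (moll (1 / real (Suc n))) \<phi>) x\<bar> <= C"
   using conv_moll_bound[OF r _ v(2)] v(1) by (simp add: weak_deriv_def)
 qed
 then show "dbd k C (conv (moll (1 / real (Suc n))) \<phi>)" by (rule nb_imp_dbd[OF s])
next
 show "(%n. conv (moll (1 / real (Suc n))) \<phi> x) \<longlonglongrightarrow> \<phi> x" for x by (rule conv_moll_tendsto[OF c])
qed

section \<open>First derivatives of functions with bounded second differences\<close>

lemma nb_quotient:
 assumes s: "smooth \<psi>" and n: "nb 2 C \<psi>" and t: "t \<noteq> 0"
 shows "\<bar>pdiff i \<psi> x - dif (t, i) \<psi> x / t\<bar> <= C * \<bar>t\<bar>"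
proof -
 obtain \<theta> where \<theta>: "0 <= \<theta>" "\<theta> <= 1" "\<psi> (x + t *\<^sub>R axis i 1) - \<psi> x = t * pdiff i \<psi> (x + (\<theta> * t) *\<^sub>R axis i 1)"
  using mvt_axis[of \<psi>] smoothD[OF s] by blast
 have "nb 1 C (pdiff i \<psi>)" using n nb_Suc[of 1 C \<psi>] by (simp add: numeral_2_eq_2)
 then have "dbd 1 C (pdiff i \<psi>)" by (intro nb_imp_dbd smooth_pdiff s)
 from dbdD[OF this, of "[(\<theta> * t, i)]" x]
 have "\<bar>pdiff i \<psi> (x + (\<theta> * t) *\<^sub>R axis i 1) - pdiff i \<psi> x\<bar> <= C * \<bar>\<theta> * t\<bar>" by (simp add: dif_def)
 also have "... <= C * \<bar>t\<bar>"
 proof -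
  have "C >= 0" using n[unfolded nb_def, rule_format, of "[i,i]" x] by (simp add: numeral_2_eq_2)
  then show ?thesis using \<theta> by (intro mult_left_mono) (auto simp: abs_mult mult_left_le_one_le)
 qed
 finally show ?thesis using \<theta>(3) t by (simp add: dif_def)
qed

text \<open>Quotients with a fixed step converge along the mollifications and differ from the
  derivatives by at most C times the step, uniformly in the mollification, so the derivatives
  converge pointwise. The limit inherits the quotient estimate, is a weak derivative, and is
  continuous by the second-order bound; hence it is the version that \<open>D1\<close>
  selects.\<close>

lemma
 fixes \<phi> :: "'d::finite fn"
 assumes d1: "dbd 1 C1 \<phi>" and d2: "dbd 2 C \<phi>"
 shows D1_quotient: "!!t x. t \<noteq> 0 ==> \<bar>D1 i \<phi> x - dif (t, i) \<phi> x / t\<bar> <= C * \<bar>t\<bar>"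
  and D1_weak: "weak_deriv (unit_index i) \<phi> (D1 i \<phi>)"
  and D1_tendsto: "!!x. (%n. real (Suc n) * dif (1 / real (Suc n), i) \<phi> x) \<longlonglongrightarrow> D1 i \<phi> x"
  and D1_dbd: "!!k C'. dbd (Suc k) C' \<phi> ==> dbd k C' (D1 i \<phi>)"
proof -
 have c: "continuous_on UNIV \<phi>" by (rule dbd1_continuous[OF d1])
 define \<psi> where "\<psi> n = conv (moll (1 / real (Suc n))) \<phi>" for n
 have r: "1 / real (Suc n) > 0" for n by simp
 have s: "smooth (\<psi> n)" for n unfolding \<psi>_def by (rule smooth_conv[OF moll_smooth[OF r] moll_supp[OF r] c])
 have \<psi>d: "dbd k D (\<psi> n)" if "dbd k D \<phi>" for k D n
  unfolding \<psi>_def using that by (intro dbd_conv_moll r c)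
 have \<psi>l: "(%n. \<psi> n x) \<longlonglongrightarrow> \<phi> x" for x unfolding \<psi>_def by (rule conv_moll_tendsto[OF c])
 have C: "C >= 0" using dbdD[OF d2, of "[(1,i),(1,i)]" 0] by simp
 have C1: "C1 >= 0" using dbdD[OF d1, of "[(1,i)]" 0] by simp
 have q: "\<bar>pdiff i (\<psi> n) x - dif (t, i) (\<psi> n) x / t\<bar> <= C * \<bar>t\<bar>" if "t \<noteq> 0" for n t x
  by (rule nb_quotient[OF s dbd_imp_nb[OF s \<psi>d[OF d2]] that])
 have ql: "(%n. dif (t, i) (\<psi> n) x / t) \<longlonglongrightarrow> dif (t, i) \<phi> x / t" if "t \<noteq> 0" for t x
  unfolding dif_def by (intro tendsto_intros \<psi>l that)
 have "Cauchy (%n. pdiff i (\<psi> n) x)" for x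
 proof (rule CauchyI)
  fix e :: real assume e: "e > 0"
  \<comment> \<open>With this step the two quotient errors together cost less than half of e,
    leaving the other half for the convergence of the quotients.\<close>
  define t where "t = e / (4 * (C + 1))"
  have t: "t > 0" "C * \<bar>t\<bar> < e / 4 + 0" unfolding t_def using e C by (auto simp: field_simps)
  have "Cauchy (%n. dif (t, i) (\<psi> n) x / t)"
   using ql[of t x] t LIMSEQ_imp_Cauchy by blast
  then obtain M where M: "!!m n. m >= M ==> n >= M ==> norm (dif (t, i) (\<psi> m) x / t - dif (t, i) (\<psi> n) x / t) < e / 2"
   using CauchyD[of _ "e/2"] e by (meson half_gt_zero)
  have "norm (pdiff i (\<psi> m) x - pdiff i (\<psi> n) x) < e" if "m >= M" "n >= M" for m n
   using M[OF that] q[of t m x] q[of t n x] t unfolding real_norm_def by linarith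
  then show "\<exists>M. \<forall>m\<ge>M. \<forall>n\<ge>M. norm (pdiff i (\<psi> m) x - pdiff i (\<psi> n) x) < e" by blast
 qed
 then have "\<exists>L. (%n. pdiff i (\<psi> n) x) \<longlonglongrightarrow> L" for x using Cauchy_convergent_iff convergent_def by blast
 then obtain a where a: "!!x. (%n. pdiff i (\<psi> n) x) \<longlonglongrightarrow> a x" by metis
 have aq: "\<bar>a x - dif (t, i) \<phi> x / t\<bar> <= C * \<bar>t\<bar>" if t: "t \<noteq> 0" for t x
 proof (rule LIMSEQ_le_const2)
  show "(%n. \<bar>pdiff i (\<psi> n) x - dif (t, i) (\<psi> n) x / t\<bar>) \<longlonglongrightarrow> \<bar>a x - dif (t, i) \<phi> x / t\<bar>"
   by (intro tendsto_intros a ql t)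
 qed (use q t in auto)
 have at: "(%n. real (Suc n) * dif (1 / real (Suc n), i) \<phi> x) \<longlonglongrightarrow> a x" for x
 proof -
  have "(%n. a x - real (Suc n) * dif (1 / real (Suc n), i) \<phi> x) \<longlonglongrightarrow> 0"
  proof (rule Lim_null_comparison)
   show "\<forall>\<^sub>F n in sequentially. norm (a x - real (Suc n) * dif (1 / real (Suc n), i) \<phi> x) <= C * (1 / real (Suc n))"
    using aq[of "1 / real (Suc _)" x] by (auto simp: mult.commute)
   show "(%n. C * (1 / real (Suc n))) \<longlonglongrightarrow> 0"
    using tendsto_mult_right_zero[OF LIMSEQ_Suc[OF lim_1_over_n]] by blast
  qed
  from tendsto_diff[OF tendsto_const this, of "a x"] show ?thesis by simp
 qed
 have ad: "dbd k C' a" if "dbd (Suc k) C' \<phi>" for k C'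
 proof (rule dbd_lim[OF _ at])
  fix n show "dbd k C' (%x. real (Suc n) * dif (1 / real (Suc n), i) \<phi> x)"
   using dbd_quotient[OF that, of "1 / real (Suc n)" i] by simp
 qed
 have ac: "continuous_on UNIV a" using ad[of 1 C] d2 dbd1_continuous by (simp add: numeral_2_eq_2)
 have "weak_deriv (count_list [i]) \<phi> a"
 proof (rule weak_derivI)
  fix k r assume k: "smooth k" "supp_in r (k :: 'd fn)"
  have [measurable]: "\<phi> \<in> borel_measurable borel" "a \<in> borel_measurable borel" "k \<in> borel_measurable borel"
    "pdiff i k \<in> borel_measurable borel" "\<psi> n \<in> borel_measurable borel" "pdiff i (\<psi> n) \<in> borel_measurable borel" for n
   using c ac k s by (auto intro!: borel_measurable_continuous_onI smooth_continuous smooth_pdiff)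
  define B where "B = C1 * real CARD('d)"
  have B: "\<bar>\<psi> n x\<bar> <= \<bar>\<phi> x\<bar> + B" for n x
  proof -
   have "\<bar>\<psi> n x - \<phi> x\<bar> <= B" unfolding \<psi>_def
   proof (rule conv_moll_approx[OF r c])
    fix y assume y: "norm (y - x) <= 1 / real (Suc n)"
    have "1 / real (Suc n) <= 1" by simp
    then have n1: "norm (y - x) <= 1" using y by linarith
    have "\<bar>\<phi> y - \<phi> x\<bar> <= C1 * real CARD('d) * norm (y - x)" using dbd1_lipschitz[OF d1, of x "y - x"] by simp
    also have "... <= C1 * real CARD('d) * 1" using n1 C1 by (intro mult_left_mono) auto
    finally show "\<bar>\<phi> y - \<phi> x\<bar> <= B" by (simp add: B_def)
   qed
   then show ?thesis by linarith
  qed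
  have 1: "(%n. LBINT x. \<psi> n x * pdiff i k x) \<longlonglongrightarrow> (LBINT x. \<phi> x * pdiff i k x)"
  proof (rule integral_dominated_convergence[where w="%x. \<bar>pdiff i k x * (\<bar>\<phi> x\<bar> + B)\<bar>"])
   show "integrable lborel (%x. \<bar>pdiff i k x * (\<bar>\<phi> x\<bar> + B)\<bar>)"
    by (intro integrable_abs integrable_supp[of _ _ r] locally_integrable_continuous continuous_intros c smooth_continuous smooth_pdiff supp_in_pdiff k)
   show "AE x in lborel. (%n. \<psi> n x * pdiff i k x) \<longlonglongrightarrow> \<phi> x * pdiff i k x"
    by (intro AE_I2 tendsto_intros \<psi>l)
   show "AE x in lborel. norm (\<psi> n x * pdiff i k x) <= \<bar>pdiff i k x * (\<bar>\<phi> x\<bar> + B)\<bar>" for n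
   proof (intro AE_I2)
    fix x show "norm (\<psi> n x * pdiff i k x) <= \<bar>pdiff i k x * (\<bar>\<phi> x\<bar> + B)\<bar>"
     using mult_left_mono[OF B[of n x] abs_ge_zero[of "pdiff i k x"]] B[of n x] by (simp add: abs_mult mult.commute)
   qed
  qed auto
  have 2: "(%n. LBINT x. pdiff i (\<psi> n) x * k x) \<longlonglongrightarrow> (LBINT x. a x * k x)"
  proof (rule integral_dominated_convergence[where w="%x. \<bar>k x * C1\<bar>"])
   show "integrable lborel (%x. \<bar>k x * C1\<bar>)"
    by (intro integrable_abs integrable_supp[of _ _ r] locally_integrable_continuous continuous_intros smooth_continuous k)
   show "AE x in lborel. (%n. pdiff i (\<psi> n) x * k x) \<longlonglongrightarrow> a x * k x"
    by (intro AE_I2 tendsto_intros a)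
   show "AE x in lborel. norm (pdiff i (\<psi> n) x * k x) <= \<bar>k x * C1\<bar>" for n
   proof (intro AE_I2)
    fix x have "\<bar>pds [i] (\<psi> n) x\<bar> <= C1" using dbd_imp_nb[OF s \<psi>d[OF d1], of n] unfolding nb_def by (metis One_nat_def length_Cons list.size(3))
    then show "norm (pdiff i (\<psi> n) x * k x) <= \<bar>k x * C1\<bar>"
     using C1 mult_left_mono[of "\<bar>pdiff i (\<psi> n) x\<bar>" C1 "\<bar>k x\<bar>"] by (simp add: abs_mult mult.commute)
   qed
  qed auto
  have "(LBINT x. \<psi> n x * pdiff i k x) = - (LBINT x. pdiff i (\<psi> n) x * k x)" for n
   by (rule integral_by_parts[OF s k])
  with 1 tendsto_minus[OF 2] have "(LBINT x. \<phi> x * pdiff i k x) = - (LBINT x. a x * k x)"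
   using LIMSEQ_unique by force
  then show "(LBINT x. \<phi> x * pds [i] k x) = (-1) ^ length [i] * (LBINT x. a x * k x)" by simp
 qed (auto intro: locally_integrable_continuous c ac)
 then have w: "weak_deriv (unit_index i) \<phi> a" unfolding count_list_single .
 have e: "D1 i \<phi> = a" unfolding D1_def by (rule gen_deriv_eqI[OF w ac c])
 show "!!t x. t \<noteq> 0 ==> \<bar>D1 i \<phi> x - dif (t, i) \<phi> x / t\<bar> <= C * \<bar>t\<bar>" using aq e by simp
 show "weak_deriv (unit_index i) \<phi> (D1 i \<phi>)" using w e by simp
 show "!!x. (%n. real (Suc n) * dif (1 / real (Suc n), i) \<phi> x) \<longlonglongrightarrow> D1 i \<phi> x" using at e by simp
 show "!!k C'. dbd (Suc k) C' \<phi> ==> dbd k C' (D1 i \<phi>)" using ad e by simp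
qed

section \<open>Essential bounds for weak derivatives of Lipschitz functions\<close>

text \<open>Testing against smooth approximations of the indicator of a cube bounds the integral of
  z over the cube by C times its volume; differentiating the integral along shrinking cubes recovers
  the bound at almost every point.\<close>

lemma AE_bound_of_test_bound:
 fixes z :: "'d::finite fn"
 assumes z: "locally_integrable z" and C: "C >= 0"
  and b: "!!k r. smooth k ==> supp_in r k ==> \<bar>LBINT x. z x * k x\<bar> <= C * (LBINT x. \<bar>k x\<bar>)"
 shows "AE x in lborel. \<bar>z x\<bar> <= C"
proof -
 have zm [measurable]: "z \<in> borel_measurable borel" by (rule locally_integrable_borel[OF z])
 have zi: "set_integrable lborel (cbox a b) z" for a b using z unfolding locally_integrable_def by auto
 have cube: "\<bar>integral (cbox a b) z\<bar> <= C * measure lborel (cbox a b)" for a b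
 proof (cases "cbox a b = {}")
  case False
  define Q where "Q = cbox a b"
  have Q: "closed Q" "Q \<noteq> {}" "compact Q" "Q \<in> sets borel" using False by (auto simp: Q_def)
  obtain R where R: "!!y. y \<in> Q ==> norm y <= R" using compact_imp_bounded[OF Q(3)] bounded_iff by metis
  \<comment> \<open>A continuous cutoff falling from 1 on Q to 0 at distance 1/(n+1). Its Lipschitz
    constant is n+1, so mollifying at radius 1/(n+1)^2 changes it by at most 1/(n+1).\<close>
  define \<kappa> where "\<kappa> n y = max 0 (1 - real (Suc n) * infdist y Q)" for n y
  have \<kappa>c: "continuous_on UNIV (\<kappa> n)" for n unfolding \<kappa>_def by (intro continuous_intros)
  have \<kappa>01: "0 <= \<kappa> n y" "\<kappa> n y <= 1" for n y unfolding \<kappa>_def by (auto simp: infdist_nonneg)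
  have \<kappa>s: "\<kappa> n y = 0" if "R + 1 < norm y" for n y
  proof -
   obtain q where q: "q \<in> Q" "infdist y Q = dist y q" using infdist_attains_inf[OF Q(1,2)] by metis
   have "norm y <= norm q + dist y q" by (metis dist_norm norm_triangle_sub)
   then have "infdist y Q >= 1" using R[OF q(1)] that q by linarith
   then have "1 <= real (Suc n) * infdist y Q"
    using mult_mono[of 1 "real (Suc n)" 1 "infdist y Q"] by simp
   then show ?thesis by (simp add: \<kappa>_def)
  qed
  define k where "k n = conv (moll (1 / (real (Suc n))\<^sup>2)) (\<kappa> n)" for n
  have r: "1 / (real (Suc n))\<^sup>2 > 0" for n by simp
  have r1: "1 / (real (Suc n))\<^sup>2 <= 1" for n by simp
  have ks: "smooth (k n)" for n
   unfolding k_def by (rule smooth_conv[OF moll_smooth[OF r] moll_supp[OF r] \<kappa>c])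
  have kap: "\<bar>k n x - \<kappa> n x\<bar> <= 1 / real (Suc n)" for n x
   unfolding k_def
  proof (rule conv_moll_approx[OF r \<kappa>c])
   fix y assume y: "norm (y - x) <= 1 / (real (Suc n))\<^sup>2"
   have "\<bar>\<kappa> n y - \<kappa> n x\<bar> <= real (Suc n) * \<bar>infdist y Q - infdist x Q\<bar>"
   proof -
    have "\<bar>max 0 (1 - a) - max 0 (1 - b)\<bar> <= \<bar>a - b\<bar>" for a b :: real by (auto simp: max_def abs_if)
    from this[of "real (Suc n) * infdist y Q" "real (Suc n) * infdist x Q"] show ?thesis
     unfolding \<kappa>_def by (simp add: right_diff_distrib[symmetric] abs_mult del: of_nat_Suc)
   qed
   also have "... <= real (Suc n) * (1 / (real (Suc n))\<^sup>2)"
    using infdist_triangle_abs[of y Q x] y by (intro mult_left_mono) (auto simp: dist_norm)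
   also have "... = 1 / real (Suc n)" by (simp add: power2_eq_square)
   finally show "\<bar>\<kappa> n y - \<kappa> n x\<bar> <= 1 / real (Suc n)" .
  qed
  have k2: "\<bar>k n x\<bar> <= 2" for n x
  proof -
   have "1 / real (Suc n) <= 1" by simp
   then show ?thesis using kap[of n x] \<kappa>01[of n x] by linarith
  qed
  have ksupp: "supp_in (R + 2) (k n)" for n
   unfolding supp_in_def
  proof (intro allI impI)
   fix x :: "real^'d" assume x: "R + 2 < norm x"
   have "\<bar>k n x - 0\<bar> <= 0" unfolding k_def
   proof (rule conv_moll_approx[OF r \<kappa>c])
    fix y assume "norm (y - x) <= 1 / (real (Suc n))\<^sup>2"
    then have "norm (y - x) <= 1" using r1[of n] by linarith
    then have "R + 1 < norm y" using x norm_triangle_sub[of x y] by (simp add: norm_minus_commute)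
    then show "\<bar>\<kappa> n y - 0\<bar> <= 0" using \<kappa>s by simp
   qed
   then show "k n x = 0" by simp
  qed
  have klim: "(%n. k n x) \<longlonglongrightarrow> indicator Q x" for x
  proof -
   have l0: "(%n. 1 / real (Suc n)) \<longlonglongrightarrow> 0" by (rule LIMSEQ_Suc[OF lim_1_over_n])
   have "(%n. \<kappa> n x) \<longlonglongrightarrow> indicator Q x"
   proof (cases "x \<in> Q")
    case False
    then have p: "infdist x Q > 0" using Q in_closed_iff_infdist_zero[OF Q(1,2)] infdist_nonneg[of x Q] by (metis less_eq_real_def)
    obtain N where N: "1 / real (Suc N) < infdist x Q" using p by (metis nat_approx_posE)
    have "\<kappa> n x = 0" if "n >= N" for n
    proof -
     have "1 / real (Suc n) <= 1 / real (Suc N)" using that by (simp add: frac_le)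
     then have "1 / real (Suc n) <= infdist x Q" using N by linarith
     then have "1 <= real (Suc n) * infdist x Q" by (simp add: field_simps)
     then show ?thesis by (simp add: \<kappa>_def)
    qed
    then show ?thesis using False
     by (intro tendsto_eventually eventually_sequentiallyI[of N]) auto
   qed (simp add: \<kappa>_def)
   moreover have "(%n. k n x - \<kappa> n x) \<longlonglongrightarrow> 0"
    by (rule Lim_null_comparison[OF _ l0]) (use kap in auto)
   ultimately show ?thesis using tendsto_add by fastforce
  qed
  have km [measurable]: "k n \<in> borel_measurable borel" for n
   using ks smooth_continuous borel_measurable_continuous_onI by blast
  have iw: "integrable lborel (%x. indicator (cball 0 (R + 2)) x *\<^sub>R v x)" if "locally_integrable v" for v :: "'d fn"
   using that unfolding locally_integrable_def set_integrable_def by auto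
  have k2': "\<bar>k n x\<bar> <= 2 * indicator (cball 0 (R + 2)) x" for n x
   using k2[of n x] ksupp[of n, unfolded supp_in_def, rule_format, of x] by (auto simp: indicator_def)
  have l1: "(%n. LBINT x. z x * k n x) \<longlonglongrightarrow> (LBINT x. z x * indicator Q x)"
  proof (rule integral_dominated_convergence[where w="%x. 2 * \<bar>indicator (cball 0 (R + 2)) x *\<^sub>R z x\<bar>"])
   show "AE x in lborel. norm (z x * k n x) <= 2 * \<bar>indicator (cball 0 (R + 2)) x *\<^sub>R z x\<bar>" for n
   proof (intro AE_I2)
    fix x show "norm (z x * k n x) <= 2 * \<bar>indicator (cball 0 (R + 2)) x *\<^sub>R z x\<bar>"
     using mult_left_mono[OF k2'[of n x] abs_ge_zero[of "z x"]] by (simp add: abs_mult mult_ac)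
   qed
   show "AE x in lborel. (%n. z x * k n x) \<longlonglongrightarrow> z x * indicator Q x"
    by (intro AE_I2 tendsto_intros klim)
  qed (use Q iw[OF z] in auto)
  have l2: "(%n. LBINT x. \<bar>k n x\<bar>) \<longlonglongrightarrow> (\<integral>x. \<bar>indicator Q x\<bar> \<partial>(lborel :: (real^'d) measure))"
  proof (rule integral_dominated_convergence[where w="%x. indicator (cball 0 (R + 2)) x *\<^sub>R 2"])
   show "integrable lborel (%x::real^'d. indicator (cball 0 (R + 2)) x *\<^sub>R (2::real))"
    using iw[OF locally_integrable_continuous[of "%_. 2"]] by simp
   show "AE x in lborel. (%n. \<bar>k n x\<bar>) \<longlonglongrightarrow> \<bar>indicator Q x\<bar>"
    by (intro AE_I2 tendsto_intros klim)
  qed (use Q k2' in \<open>auto simp: mult.commute\<close>)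
  have "\<bar>LBINT x. z x * indicator Q x\<bar> <= C * (\<integral>x. \<bar>indicator Q x\<bar> \<partial>(lborel :: (real^'d) measure))"
   by (rule LIMSEQ_le[OF tendsto_rabs[OF l1] tendsto_mult[OF tendsto_const l2]]) (use b[OF ks ksupp] in auto)
  moreover have "(LBINT x. z x * indicator Q x) = integral Q z"
   using set_borel_integral_eq_integral(2)[OF zi, of a b] by (simp add: Q_def set_lebesgue_integral_def mult.commute)
  moreover have "(\<integral>x. \<bar>indicator Q x\<bar> \<partial>(lborel :: (real^'d) measure)) = measure lborel Q"
   using Q by (simp add: Q_def)
  ultimately show ?thesis by (simp add: Q_def)
 qed simp
 obtain N where N: "negligible N" "!!x e. x \<notin> N ==> 0 < e ==>
   \<exists>d>0. \<forall>h. 0 < h \<and> h < d --> norm (integral (cbox x (x + h *\<^sub>R One)) z /\<^sub>R h ^ DIM(real^'d) - z x) < e"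
  using integrable_ccontinuous_explicit[of z] set_borel_integral_eq_integral(1)[OF zi] by metis
 have "\<bar>z x\<bar> <= C" if xN: "x \<notin> N" for x
 proof (rule field_le_epsilon)
  fix e :: real assume e: "e > 0"
  obtain d where d: "d > 0" "!!h. 0 < h ==> h < d ==> norm (integral (cbox x (x + h *\<^sub>R One)) z /\<^sub>R h ^ DIM(real^'d) - z x) < e"
   using N(2)[OF xN e] by blast
  define h where "h = d / 2"
  have h: "0 < h" "h < d" using d by (auto simp: h_def)
  have ne: "cbox x (x + h *\<^sub>R One) \<noteq> {}" using h by (auto simp: box_ne_empty inner_add_left)
  have ct: "measure lborel (cbox x (x + h *\<^sub>R One)) = h ^ DIM(real^'d)"
   using h by (subst content_cbox'[OF ne]) (simp add: inner_add_left)
  have "\<bar>integral (cbox x (x + h *\<^sub>R One)) z /\<^sub>R h ^ DIM(real^'d)\<bar> <= C"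
   using cube[of x "x + h *\<^sub>R One"] h unfolding ct by (simp add: abs_mult field_simps)
  then show "\<bar>z x\<bar> <= C + e" using d(2)[OF h] unfolding real_norm_def by linarith
 qed
 then have "AE x in lebesgue. \<bar>z x\<bar> <= C"
  using N(1) unfolding negligible_iff_null_sets by (intro AE_I'[of N]) auto
 then show ?thesis unfolding AE_completion_iff .
qed

text \<open>The quotients of the convolution of w with a test function inherit the Lipschitz
  constant times the L1 norm of the kernel, and their limit is the pairing of z with the test
  function. It serves the second derivatives of solutions known only to lie in
  \<open>in_B T 2\<close>.\<close>

lemma weak_deriv_lipschitz_AE:
 fixes w :: "'d::finite fn"
 assumes w: "dbd 1 C w" and z: "weak_deriv (unit_index i) w z"
 shows "AE x in lborel. \<bar>z x\<bar> <= C"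
proof (rule AE_bound_of_test_bound)
 show "locally_integrable z" using z by (simp add: weak_deriv_def)
 show C: "C >= 0" using dbdD[OF w, of "[(1,i)]" 0] by simp
 have wc: "continuous_on UNIV w" by (rule dbd1_continuous[OF w])
 fix k :: "'d fn" and r assume k: "smooth k" "supp_in r k"
 \<comment> \<open>Reflected kernel: the integral of z against k is the convolution with k'
   evaluated at 0.\<close>
 define k' where "k' y = k (0 + (-1) *\<^sub>R y)" for y
 have k': "smooth k'" "supp_in r k'"
  unfolding k'_def using smooth_affine[OF k(1), of 0 "-1"] k(2) by (auto simp: supp_in_def)
 have [measurable]: "w \<in> borel_measurable borel" "k' \<in> borel_measurable borel" "k \<in> borel_measurable borel"
  using wc k k' smooth_continuous borel_measurable_continuous_onI by blast+
 define I where "I = (LBINT x. \<bar>k x\<bar>)"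
 have I: "I = (LBINT y. \<bar>k' y\<bar>)"
  unfolding I_def k'_def using lborel_reflect(1)[of "%y. \<bar>k y\<bar>" 0] by simp
 have ik: "integrable lborel (%y. \<bar>k' y\<bar>)"
 proof -
  have "integrable lborel (%y. k' y * 1)"
   by (rule integrable_supp[OF _ _ k'(2)]) (intro locally_integrable_continuous smooth_continuous k' continuous_intros)+
  then show ?thesis by simp
 qed
 have "(LBINT x. z x * k x) = conv k' z 0"
  unfolding conv_def k'_def by (simp add: mult.commute)
 also have "... = conv (pds [i] k') w 0"
  using conv_pds_weak[of "[i]" w z k' r 0] z k' unfolding count_list_single by simp
 also have "... = pdiff i (conv k' w) 0" using conv_derivative(2)[OF k' wc, of i 0] by simp
 finally have e: "(LBINT x. z x * k x) = pdiff i (conv k' w) 0" .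
 have cm: "conv k' w x = (LBINT y. k' y * w (x - y))" for x by (rule conv_commute) auto
 have int: "integrable lborel (%y. k' y * w (x - y))" for x
  using integrable_supp_mult[OF locally_integrable_continuous[OF wc] smooth_continuous[OF k'(1)] k'(2), of x]
   lborel_reflect(2)[of "%y. k' y * w (x - y)" x] by simp
 have db: "\<bar>dif (t, i) (conv k' w) x\<bar> <= C * \<bar>t\<bar> * I" for t x
 proof -
  have "dif (t, i) (conv k' w) x = (LBINT y. k' y * dif (t, i) w (x - y))"
   unfolding dif_def cm using int[of x] int[of "x + t *\<^sub>R axis i 1"] by (simp add: algebra_simps)
  also have "\<bar>...\<bar> <= (LBINT y. \<bar>k' y * dif (t, i) w (x - y)\<bar>)" by (rule integral_abs_bound)
  also have "... <= (LBINT y. \<bar>k' y\<bar> * (C * \<bar>t\<bar>))"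
  proof (rule integral_mono)
   have "integrable lborel (%y. k' y * dif (t, i) w (x - y))"
    unfolding dif_def using int[of x] int[of "x + t *\<^sub>R axis i 1"] by (simp add: algebra_simps)
   then show "integrable lborel (%y. \<bar>k' y * dif (t, i) w (x - y)\<bar>)" by (rule integrable_abs)
   show "integrable lborel (%y. \<bar>k' y\<bar> * (C * \<bar>t\<bar>))" using ik by simp
   fix y show "\<bar>k' y * dif (t, i) w (x - y)\<bar> <= \<bar>k' y\<bar> * (C * \<bar>t\<bar>)"
    using dbdD[OF w, of "[(t, i)]" "x - y"] by (simp add: abs_mult mult_left_mono)
  qed
  also have "... = C * \<bar>t\<bar> * I" using I by simp
  finally show ?thesis .
 qed
 have "(%n. \<bar>real (Suc n) * dif (1 / real (Suc n), i) (conv k' w) 0\<bar>) \<longlonglongrightarrow> \<bar>pdiff i (conv k' w) 0\<bar>"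
  by (intro tendsto_rabs axis_quotient_tendsto conv_derivative(1)[OF k' wc])
 then have "\<bar>pdiff i (conv k' w) 0\<bar> <= C * I"
 proof (rule LIMSEQ_le_const2, intro exI[of _ 0] allI impI)
  fix n show "\<bar>real (Suc n) * dif (1 / real (Suc n), i) (conv k' w) 0\<bar> <= C * I"
   using mult_left_mono[OF db[of "1 / real (Suc n)" 0], of "real (Suc n)"] by (simp add: abs_mult)
 qed
 then show "\<bar>LBINT x. z x * k x\<bar> <= C * (LBINT x. \<bar>k x\<bar>)" using e I_def by simp
qed

section \<open>Classes of functions with bounded differences\<close>

lemma XcD: "Xc n C \<phi> ==> k <= n ==> dbd k C \<phi>"
 by (simp add: Xc_def)

lemma Xc_le: "Xc n C \<phi> ==> n' <= n ==> Xc n' C \<phi>"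
 by (auto simp: Xc_def)

lemma Xc_mono: "Xc n C \<phi> ==> C <= C' ==> Xc n C' \<phi>"
 by (auto simp: Xc_def intro: dbd_mono)

lemma Xc_bound: "Xc n C \<phi> ==> \<bar>\<phi> x\<bar> <= C"
 using XcD[of n C \<phi> 0] by (auto simp: dbd0)

lemma Xc_nonneg: "Xc n C \<phi> ==> C >= 0"
 using Xc_bound[of n C \<phi> 0] by linarith

lemma Xc_continuous: "Xc n C \<phi> ==> 1 <= n ==> continuous_on A \<phi>"
 using XcD dbd1_continuous by blast

lemma Xc_lin: "Xc n C \<phi> ==> Xc n C' \<psi> ==> Xc n (\<bar>a\<bar> * C + C') (%x. a * \<phi> x + \<psi> x)"
 unfolding Xc_def using dbd_add[OF dbd_cmult] by blast

lemma Xc_cmult: "Xc n C \<phi> ==> Xc n (\<bar>a\<bar> * C) (%x. a * \<phi> x)"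
 unfolding Xc_def using dbd_cmult by blast

lemma Xc_add: "Xc n C \<phi> ==> Xc n C' \<psi> ==> Xc n (C + C') (%x. \<phi> x + \<psi> x)"
 unfolding Xc_def using dbd_add by blast

lemma Xc_diff: "Xc n C \<phi> ==> Xc n C' \<psi> ==> Xc n (C + C') (%x. \<phi> x - \<psi> x)"
 unfolding Xc_def using dbd_diff by blast

lemma Xc_sum: "(!!i. i \<in> A ==> Xc n (C i) (F i)) ==> Xc n (\<Sum>i\<in>A. C i) (%x. \<Sum>i\<in>A. F i x)"
 unfolding Xc_def by (intro allI impI dbd_sum) auto

lemma Xc_zero: "C >= 0 ==> Xc n C (%x. 0)"
 unfolding Xc_def by (auto intro: dbd_zero)

lemma Xc_shift: "Xc n C \<phi> ==> Xc n C (%x. \<phi> (x + a))"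
 unfolding Xc_def by (auto intro: dbd_shift)

lemma Xc_lim: "(!!j. Xc n C (\<Phi> j)) ==> (!!x. (%j. \<Phi> j x) \<longlonglongrightarrow> \<phi> x) ==> Xc n C \<phi>"
 unfolding Xc_def by (auto intro: dbd_lim)

lemma Xc_conv_moll: "r > 0 ==> continuous_on UNIV \<phi> ==> Xc n C \<phi> ==> Xc n C (conv (moll r) \<phi>)"
 unfolding Xc_def by (auto intro: dbd_conv_moll)

lemma Xc_avg:
 "prob_space M ==> (!!x. integrable M (%w. \<Phi> w x)) ==> (!!w. w \<in> space M ==> Xc n C (\<Phi> w)) ==>
  Xc n C (%x. \<integral>w. \<Phi> w x \<partial>M)"
 unfolding Xc_def by (auto intro!: dbd_avg)

lemma Xc_dif: "Xc (Suc n) C \<phi> ==> Xc n (C * \<bar>fst p\<bar>) (dif p \<phi>)"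
 unfolding Xc_def using dbd_Suc by (metis Suc_le_mono)

lemma Xc_D1: "Xc (Suc n) C \<phi> ==> 1 <= n ==> Xc n C (D1 i \<phi>)"
 unfolding Xc_def using D1_dbd[of C \<phi> C] by (metis One_nat_def Suc_le_mono one_le_numeral le_SucI numeral_2_eq_2 order_refl)

lemma
 assumes "Xc n C \<phi>" "2 <= n"
 shows Xc_D1_quotient: "t \<noteq> 0 ==> \<bar>D1 i \<phi> x - dif (t, i) \<phi> x / t\<bar> <= C * \<bar>t\<bar>"
  and Xc_D1_weak: "weak_deriv (unit_index i) \<phi> (D1 i \<phi>)"
  and Xc_D1_tendsto: "(%n. real (Suc n) * dif (1 / real (Suc n), i) \<phi> x) \<longlonglongrightarrow> D1 i \<phi> x"
 using D1_quotient[of C \<phi> C] D1_weak[of C \<phi> C] D1_tendsto[of C \<phi> C] XcD[OF assms(1)] assms(2) by force+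

lemma D1_lin:
 assumes "Xc n C \<phi>" "Xc n C' \<psi>" "2 <= n"
 shows "D1 i (%x. a * \<phi> x + \<psi> x) x = a * D1 i \<phi> x + D1 i \<psi> x"
proof -
 have "(%n. a * (real (Suc n) * dif (1 / real (Suc n), i) \<phi> x) + real (Suc n) * dif (1 / real (Suc n), i) \<psi> x) \<longlonglongrightarrow> a * D1 i \<phi> x + D1 i \<psi> x"
  by (intro tendsto_intros Xc_D1_tendsto[OF assms(1,3)] Xc_D1_tendsto[OF assms(2,3)])
 moreover have "(%n. real (Suc n) * dif (1 / real (Suc n), i) (%x. a * \<phi> x + \<psi> x) x) \<longlonglongrightarrow> D1 i (%x. a * \<phi> x + \<psi> x) x"
  by (rule Xc_D1_tendsto[OF Xc_lin[OF assms(1,2)] assms(3)])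
 ultimately show ?thesis
  using LIMSEQ_unique by (fastforce simp: dif_def algebra_simps)
qed

lemma D1_zero [simp]: "D1 i (%x. 0) = (%x. 0)"
 by (subst D1_smooth) auto

lemma D1_shift:
 assumes "Xc n C \<phi>" "2 <= n"
 shows "D1 i (%x. \<phi> (x + a)) x = D1 i \<phi> (x + a)"
 using LIMSEQ_unique[OF Xc_D1_tendsto[OF Xc_shift[OF assms(1), of a] assms(2), of i x]] Xc_D1_tendsto[OF assms, of i "x + a"]
 by (simp add: dif_def add_ac)

text \<open>Difference quotients commute with the average and are dominated by C, so dominated
  convergence passes to the derivative; measurability in w comes from the same limit.\<close>

lemma D1_avg:
 assumes M: "prob_space M" and i: "!!x. integrable M (%w. \<Phi> w x)"
  and X: "!!w. w \<in> space M ==> Xc n C (\<Phi> w)" and n: "2 <= n"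
 shows "integrable M (%w. D1 j (\<Phi> w) x)"
  and "D1 j (%x. \<integral>w. \<Phi> w x \<partial>M) x = (\<integral>w. D1 j (\<Phi> w) x \<partial>M)"
proof -
 interpret prob_space M by fact
 define q where "q k w = real (Suc k) * dif (1 / real (Suc k), j) (\<Phi> w) x" for k w
 have qi: "integrable M (q k)" for k unfolding q_def dif_def using i by auto
 have ql: "(%k. q k w) \<longlonglongrightarrow> D1 j (\<Phi> w) x" if "w \<in> space M" for w
  unfolding q_def by (rule Xc_D1_tendsto[OF X[OF that] n])
 have qb: "\<bar>q k w\<bar> <= C" if "w \<in> space M" for k w
 proof -
  have "\<bar>dif (1 / real (Suc k), j) (\<Phi> w) x\<bar> <= C * (1 / real (Suc k))"
   using dbdD[OF XcD[OF X[OF that], of 1], of "[(1 / real (Suc k), j)]" x] n by simp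
  then show ?thesis unfolding q_def abs_mult by (simp add: field_simps)
 qed
 have m: "(%w. D1 j (\<Phi> w) x) \<in> borel_measurable M"
  by (rule borel_measurable_LIMSEQ_real[OF ql]) (use qi in auto)
 have Db: "\<bar>D1 j (\<Phi> w) x\<bar> <= C" if "w \<in> space M" for w
  by (rule LIMSEQ_le_const2[OF tendsto_rabs[OF ql[OF that]]]) (use qb[OF that] in auto)
 show "integrable M (%w. D1 j (\<Phi> w) x)"
  by (rule integrable_const_bound[where B=C]) (use Db m in auto)
 have "(%k. \<integral>w. q k w \<partial>M) \<longlonglongrightarrow> (\<integral>w. D1 j (\<Phi> w) x \<partial>M)"
  by (rule integral_dominated_convergence[where w="%_. C"]) (use m qi ql qb in auto)
 moreover have "(\<integral>w. q k w \<partial>M) = real (Suc k) * dif (1 / real (Suc k), j) (%x. \<integral>w. \<Phi> w x \<partial>M) x" for k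
  unfolding q_def dif_def using i by simp
 moreover have "(%k. real (Suc k) * dif (1 / real (Suc k), j) (%x. \<integral>w. \<Phi> w x \<partial>M) x) \<longlonglongrightarrow> D1 j (%x. \<integral>w. \<Phi> w x \<partial>M) x"
  by (rule Xc_D1_tendsto[OF Xc_avg[OF M i X] n])
 ultimately show "D1 j (%x. \<integral>w. \<Phi> w x \<partial>M) x = (\<integral>w. D1 j (\<Phi> w) x \<partial>M)"
  using LIMSEQ_unique by simp
qed

lemma pdiff_conv_moll:
 assumes r: "r > 0" and X: "Xc n C \<phi>" "2 <= n"
 shows "pdiff i (conv (moll r) \<phi>) = conv (moll r) (D1 i \<phi>)"
proof -
 have c: "continuous_on UNIV \<phi>" by (rule Xc_continuous[OF X(1)]) (use X(2) in linarith)
 have "weak_deriv (count_list [i]) \<phi> (D1 i \<phi>)" unfolding count_list_single by (rule Xc_D1_weak[OF X])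
 from pds_conv_weak[OF this c moll_smooth[OF r] moll_supp[OF r]] show ?thesis by simp
qed

abbreviation D1s :: "'d list => ('d::finite fn) => 'd fn" where
 "D1s \<equiv> foldr D1"

text \<open>The strict inequality leaves at least a Lipschitz bound for the last derivative, so
  every version chosen by \<open>D1\<close> along the list is continuous and the top order n is
  never evaluated pointwise.\<close>

lemma D1s_props:
 fixes \<phi> :: "'d::finite fn"
 assumes X: "Xc n C \<phi>"
 shows "length is < n ==> Xc (n - length is) C (D1s is \<phi>) \<and> weak_deriv (count_list is) \<phi> (D1s is \<phi>)"
proof (induction "is")
 case Nil
 have "count_list ([] :: 'd list) = (%_. 0)" by auto
 moreover have "locally_integrable \<phi>"
  using Nil Xc_continuous[OF X, of UNIV] by (intro locally_integrable_continuous) simp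
 ultimately have "weak_deriv (count_list []) \<phi> \<phi>" using weak_deriv_Nil by metis
 then show ?case unfolding foldr_Nil id_apply list.size diff_zero using X by blast
next
 case (Cons i "is")
 then have l: "length is < n" "n - length is = Suc (n - length (i # is))" "1 <= n - length (i # is)" by auto
 have Y: "Xc (n - length is) C (D1s is \<phi>)" "weak_deriv (count_list is) \<phi> (D1s is \<phi>)"
  using Cons.IH[OF l(1)] by auto
 have "2 <= n - length is" using l by linarith
 show ?case
 proof
  show "Xc (n - length (i # is)) C (D1s (i # is) \<phi>)"
   using Xc_D1[of "n - length (i # is)" C "D1s is \<phi>" i] Y(1) l by simp
  show "weak_deriv (count_list (i # is)) \<phi> (D1s (i # is) \<phi>)"
   unfolding foldr_Cons o_apply by (rule weak_deriv_Cons[OF Y(2) Xc_D1_weak[OF Y(1) \<open>2 <= n - length is\<close>]])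
 qed
qed

lemmas Xc_D1s = D1s_props[THEN conjunct1] and D1s_weak = D1s_props[THEN conjunct2]

lemma gen_deriv_D1s:
 assumes "Xc n C \<phi>" "length is < n"
 shows "gen_deriv (count_list is) \<phi> = D1s is \<phi>"
 using D1s_weak[OF assms] Xc_continuous[OF assms(1)] assms(2) Xc_continuous[OF Xc_D1s[OF assms]]
 by (intro gen_deriv_eqI) auto

lemma D1s_bound:
 assumes "Xc n C \<phi>" "length is < n" "dbd (length is + j) B \<phi>"
 shows "dbd j B (D1s is \<phi>)"
 using assms(2,3)
proof (induction "is" arbitrary: j)
 case (Cons i "is")
 have X: "Xc (n - length is) C (D1s is \<phi>)" using Xc_D1s[OF assms(1)] Cons.prems by simp
 have "dbd (Suc j) B (D1s is \<phi>)" using Cons.IH[of "Suc j"] Cons.prems by simp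
 then show ?case using D1_dbd[of C "D1s is \<phi>" C j B i] XcD[OF X, of 1] XcD[OF X, of 2] Cons.prems by simp
qed simp

text \<open>The quotient error C/(k+1) is uniform in t and x, so the derivative is a uniform limit
  of jointly continuous functions.\<close>

lemma D1_joint_continuous:
 fixes U :: "real => 'd::finite fn"
 assumes c: "continuous_on (A \<times> UNIV) (%(t, x). U t x)" and X: "!!t. t \<in> A ==> Xc n C (U t)" and n: "2 <= n"
 shows "continuous_on (A \<times> UNIV) (%(t, x). D1 i (U t) x)"
proof (cases "A = {}")
 case False
 then have C: "C >= 0" using X Xc_nonneg by blast
 define q where "q k = (%(t, x). real (Suc k) * dif (1 / real (Suc k), i) (U t) x)" for k
 have cc: "continuous_on (A \<times> UNIV) (%p. U (fst p) (snd p + a))" for a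
  by (rule continuous_on_compose2[OF c, where f="%p. (fst p, snd p + a)", simplified split_beta fst_conv snd_conv])
    (auto intro!: continuous_intros)
 have qc: "continuous_on (A \<times> UNIV) (q k)" for k
  unfolding q_def dif_def split_beta fst_conv snd_conv using cc cc[of 0] by (intro continuous_intros) auto
 have u: "uniform_limit (A \<times> UNIV) q (%(t, x). D1 i (U t) x) sequentially"
 proof (rule uniform_limitI)
  fix e :: real assume e: "e > 0"
  obtain N where N: "1 / real (Suc N) < e / (C + 1)" using e C by (metis nat_approx_posE divide_pos_pos add_nonneg_pos zero_less_one)
  have "\<forall>p\<in>A \<times> UNIV. dist (q k p) (case p of (t, x) => D1 i (U t) x) < e" if "k >= N" for k
  proof clarify
   fix t x assume t: "t \<in> A"
   have "\<bar>D1 i (U t) x - dif (1 / real (Suc k), i) (U t) x / (1 / real (Suc k))\<bar> <= C * \<bar>1 / real (Suc k)\<bar>"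
    by (rule Xc_D1_quotient[OF X[OF t] n]) simp
   note qq = this
   have "1 / real (Suc k) <= 1 / real (Suc N)" using that by (simp add: frac_le)
   then have "1 / real (Suc k) < e / (C + 1)" using N by linarith
   then have "(C + 1) * (1 / real (Suc k)) < e" using C by (simp add: field_simps)
   moreover have "C * (1 / real (Suc k)) <= (C + 1) * (1 / real (Suc k))" by (intro mult_right_mono) auto
   ultimately have "C * (1 / real (Suc k)) < e" by linarith
   with qq show "dist (q k (t, x)) (D1 i (U t) x) < e"
    by (simp add: q_def dist_real_def abs_minus_commute mult.commute)
  qed
  then show "\<forall>\<^sub>F k in sequentially. \<forall>p\<in>A \<times> UNIV. dist (q k p) (case p of (t, x) => D1 i (U t) x) < e"
   by (intro eventually_sequentiallyI[of N])
 qed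
 show ?thesis by (rule uniform_limit_theorem[OF _ u]) (use qc in auto)
qed simp

text \<open>Choosing s as the normalised vector b turns the bound for all unit combinations into a
  Euclidean bound for the sum, in which the number of elements of V does not appear.\<close>

lemma dual_sum_bound:
 fixes a :: "'v => real"
 assumes V: "finite V" and M: "!!s. (\<Sum>v\<in>V. (s v)\<^sup>2) <= 1 ==> \<bar>\<Sum>v\<in>V. s v * a v\<bar> <= M"
 shows "\<bar>\<Sum>v\<in>V. a v * b v\<bar> <= M * sqrt (\<Sum>v\<in>V. (b v)\<^sup>2)"
proof (cases "(\<Sum>v\<in>V. (b v)\<^sup>2) = 0")
 case True
 then have "\<forall>v\<in>V. b v = 0" using V by (simp add: sum_nonneg_eq_0_iff)
 then show ?thesis by simp
next
 case False
 define S where "S = sqrt (\<Sum>v\<in>V. (b v)\<^sup>2)"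
 have S: "S > 0" "S\<^sup>2 = (\<Sum>v\<in>V. (b v)\<^sup>2)" using False sum_nonneg[of V "%v. (b v)\<^sup>2"] by (auto simp: S_def less_le)
 have "(\<Sum>v\<in>V. (b v / S)\<^sup>2) = 1" using S False by (simp add: power_divide sum_divide_distrib[symmetric])
 then have "\<bar>\<Sum>v\<in>V. b v / S * a v\<bar> <= M" by (intro M) simp
 moreover have "(\<Sum>v\<in>V. b v / S * a v) = (\<Sum>v\<in>V. a v * b v) / S" by (simp add: sum_divide_distrib mult.commute)
 ultimately have "\<bar>\<Sum>v\<in>V. a v * b v\<bar> / S <= M" using S(1) by (simp add: abs_divide)
 then show ?thesis using S(1) unfolding S_def[symmetric] by (simp add: pos_divide_le_eq)
qed

text \<open>Discrete Leibniz rule by induction on the order: the difference of a product is the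
  difference of the first factors times shifted second factors plus a term with the roles exchanged,
  whence a factor 2 per order. The first factors enter only through unit combinations, matching the
  square-sum form of the regularity condition.\<close>

lemma dbd_prod:
 fixes a b :: "'v => 'd::finite fn"
 assumes V: "finite V" and "!!v. v \<in> V ==> C v >= 0"
  and "!!j s. j <= k ==> (\<Sum>v\<in>V. (s v)\<^sup>2) <= 1 ==> dbd j M (%x. \<Sum>v\<in>V. s v * a v x)"
  and "!!j v. j <= k ==> v \<in> V ==> dbd j (C v) (b v)"
 shows "dbd k (2 ^ k * (M * sqrt (\<Sum>v\<in>V. (C v)\<^sup>2))) (%x. \<Sum>v\<in>V. a v x * b v x)"
 using assms(2-)
proof (induction k arbitrary: M C a b)
 case 0
 have M: "M >= 0" using 0(2)[of 0 "%_. 0"] by (simp add: dbd0)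
 have "\<bar>\<Sum>v\<in>V. a v x * b v x\<bar> <= M * sqrt (\<Sum>v\<in>V. (b v x)\<^sup>2)" for x
  using 0(2)[of 0] by (intro dual_sum_bound V) (auto simp: dbd0)
 moreover have "sqrt (\<Sum>v\<in>V. (b v x)\<^sup>2) <= sqrt (\<Sum>v\<in>V. (C v)\<^sup>2)" for x
 proof (intro real_sqrt_le_mono sum_mono)
  fix v assume "v \<in> V"
  then have "\<bar>b v x\<bar> <= C v" using 0(3)[of 0 v] by (simp add: dbd0)
  then show "(b v x)\<^sup>2 <= (C v)\<^sup>2" using power_mono[of "\<bar>b v x\<bar>" "C v" 2] by simp
 qed
 ultimately show ?case unfolding dbd0 using mult_left_mono[OF _ M] by (simp del: real_sqrt_le_iff) (meson order_trans)
next
 case (Suc k)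
 show ?case unfolding dbd_Suc
 proof
  fix p :: "real \<times> 'd"
  define S where "S = sqrt (\<Sum>v\<in>V. (C v)\<^sup>2)"
  define h where "h = (fst p *\<^sub>R axis (snd p) 1 :: real^'d)"
  have 1: "dbd k (2 ^ k * (M * \<bar>fst p\<bar> * sqrt (\<Sum>v\<in>V. (C v)\<^sup>2))) (%x. \<Sum>v\<in>V. dif p (a v) x * b v (x + h))"
  proof (rule Suc.IH)
   fix j and s :: "'v => real" assume "j <= k" "(\<Sum>v\<in>V. (s v)\<^sup>2) <= 1"
   then have "dbd (Suc j) M (%x. \<Sum>v\<in>V. s v * a v x)" using Suc.prems(2) by simp
   moreover have "dif p (%x. \<Sum>v\<in>V. s v * a v x) = (%x. \<Sum>v\<in>V. s v * dif p (a v) x)"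
    by (auto simp: dif_def sum_subtractf right_diff_distrib)
   ultimately show "dbd j (M * \<bar>fst p\<bar>) (%x. \<Sum>v\<in>V. s v * dif p (a v) x)" using dbd_Suc by metis
  qed (use Suc.prems in \<open>auto intro: dbd_shift\<close>)
  have 2: "dbd k (2 ^ k * (M * sqrt (\<Sum>v\<in>V. (C v * \<bar>fst p\<bar>)\<^sup>2))) (%x. \<Sum>v\<in>V. a v x * dif p (b v) x)"
  proof (rule Suc.IH)
   fix j v assume "j <= k" "v \<in> V"
   then have "dbd (Suc j) (C v) (b v)" using Suc.prems(3) by simp
   then show "dbd j (C v * \<bar>fst p\<bar>) (dif p (b v))" using dbd_Suc by metis
  qed (use Suc.prems in auto)
  have e: "sqrt (\<Sum>v\<in>V. (C v * \<bar>fst p\<bar>)\<^sup>2) = S * \<bar>fst p\<bar>"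
   by (simp add: S_def power_mult_distrib sum_distrib_right[symmetric] real_sqrt_mult)
  have "dif p (%x. \<Sum>v\<in>V. a v x * b v x) = (%x. (\<Sum>v\<in>V. dif p (a v) x * b v (x + h)) + (\<Sum>v\<in>V. a v x * dif p (b v) x))"
   by (auto simp: dif_def h_def sum_subtractf[symmetric] sum.distrib[symmetric] algebra_simps intro!: sum.cong)
  then show "dbd k (2 ^ Suc k * (M * sqrt (\<Sum>v\<in>V. (C v)\<^sup>2)) * \<bar>fst p\<bar>) (dif p (%x. \<Sum>v\<in>V. a v x * b v x))"
   using dbd_add[OF 1 2] unfolding e S_def[symmetric] by (simp add: algebra_simps)
 qed
qed

lemma Xc_prod:
 fixes a b :: "'v => 'd::finite fn"
 assumes V: "finite V" and a: "!!s. (\<Sum>v\<in>V. (s v)\<^sup>2) <= 1 ==> Xc n M (%x. \<Sum>v\<in>V. s v * a v x)"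
  and b: "!!v. v \<in> V ==> Xc n (C v) (b v)"
 shows "Xc n (2 ^ n * (M * sqrt (\<Sum>v\<in>V. (C v)\<^sup>2))) (%x. \<Sum>v\<in>V. a v x * b v x)"
 unfolding Xc_def
proof (intro allI impI)
 fix k assume k: "k <= n"
 have M: "M >= 0" using a[of "%_. 0"] Xc_nonneg by simp
 have "dbd k (2 ^ k * (M * sqrt (\<Sum>v\<in>V. (C v)\<^sup>2))) (%x. \<Sum>v\<in>V. a v x * b v x)"
 proof (rule dbd_prod[OF V])
  show "C v >= 0" if "v \<in> V" for v by (rule Xc_nonneg[OF b[OF that]])
  show "dbd j M (%x. \<Sum>v\<in>V. s v * a v x)" if "j <= k" "(\<Sum>v\<in>V. (s v)\<^sup>2) <= 1" for j s
   using XcD[OF a[OF that(2)], of j] that(1) k by simp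
  show "dbd j (C v) (b v)" if "j <= k" "v \<in> V" for j v
   using XcD[OF b[OF that(2)], of j] that(1) k by simp
 qed
 moreover have "2 ^ k * (M * sqrt (\<Sum>v\<in>V. (C v)\<^sup>2)) <= 2 ^ n * (M * sqrt (\<Sum>v\<in>V. (C v)\<^sup>2))"
  using k M by (intro mult_right_mono power_increasing mult_nonneg_nonneg real_sqrt_ge_zero sum_nonneg) auto
 ultimately show "dbd k (2 ^ n * (M * sqrt (\<Sum>v\<in>V. (C v)\<^sup>2))) (%x. \<Sum>v\<in>V. a v x * b v x)"
  by (rule dbd_mono)
qed

lemma Xc_mult:
 assumes "Xc n M a" "Xc n C b" shows "Xc n (2 ^ n * (M * C)) (%x. a x * b x)"
proof -
 have "Xc n (2 ^ n * (M * sqrt (\<Sum>v\<in>{()}. C\<^sup>2))) (%x. \<Sum>v\<in>{()}. a x * b x)"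
 proof (rule Xc_prod)
  fix s :: "unit => real" assume "(\<Sum>v\<in>{()}. (s v)\<^sup>2) <= 1"
  then have "\<bar>s ()\<bar> <= 1" by (simp add: abs_square_le_1)
  then have "\<bar>s ()\<bar> * M <= M" using Xc_nonneg[OF assms(1)] mult_right_mono[of "\<bar>s ()\<bar>" 1 M] by simp
  then show "Xc n M (%x. \<Sum>v\<in>{()}. s v * a x)" using Xc_mono[OF Xc_cmult[OF assms(1), of "s ()"]] by simp
 qed (use assms in auto)
 then show ?thesis using Xc_nonneg[OF assms(2)] by simp
qed

section \<open>The operators of the structural inequalities on smooth functions\<close>

text \<open>All ways to distribute the letters of a word over two subwords, with multiplicities: the
  index set of the Leibniz rule for a word of differences.\<close>

fun splits :: "'a list => ('a list \<times> 'a list) list" where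
 "splits [] = [([], [])]"
| "splits (v # \<mu>) = map (%(I, J). (v # I, J)) (splits \<mu>) @ map (%(I, J). (I, v # J)) (splits \<mu>)"

lemma length_splits: "length (splits \<mu>) = 2 ^ length \<mu>"
 by (induction \<mu>) auto

lemma splits_mset: "(I, J) \<in> set (splits \<mu>) ==> mset \<mu> = mset (I @ J)"
 by (induction \<mu> arbitrary: I J) auto

lemma splits_length: "(I, J) \<in> set (splits \<mu>) ==> length I + length J = length \<mu>"
 using splits_mset by (metis length_append size_mset)

lemma splits_Nil: "(\<Sum>(I, J)\<leftarrow>splits \<mu>. if I = [] then F J else (0::real)) = F \<mu>"
proof (induction \<mu> arbitrary: F)
 case (Cons v \<mu>)
 have "(\<Sum>(I, J)\<leftarrow>splits \<mu>. if I = [] then F (v # J) else (0::real)) = F (v # \<mu>)" by (rule Cons)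
 then show ?case by (simp add: o_def case_prod_unfold cong: if_cong)
qed simp

lemma words_0 [simp]: "words \<Lambda> 0 = {[]}"
 by (auto simp: words_def)

lemma words_Suc: "words \<Lambda> (Suc n) = (%(v, \<mu>). v # \<mu>) ` (\<Lambda> \<times> words \<Lambda> n)"
 by (force simp: words_def length_Suc_conv image_iff)

lemma finite_words [simp]: "finite \<Lambda> ==> finite (words \<Lambda> n)"
 unfolding words_def using finite_lists_length_eq by blast

lemma sum_words_Suc:
 "(\<Sum>\<mu>\<in>words \<Lambda> (Suc n). F \<mu>) = (\<Sum>v\<in>\<Lambda>. \<Sum>\<mu>\<in>words \<Lambda> n. F (v # \<mu>))"
 unfolding words_Suc
 by (subst sum.reindex) (auto simp: inj_on_def sum.cartesian_product case_prod_unfold intro!: sum.cong)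

lemma sum_words_add:
 "(\<Sum>\<mu>\<in>words \<Lambda> (i + j). F \<mu>) = (\<Sum>I\<in>words \<Lambda> i. \<Sum>J\<in>words \<Lambda> j. F (I @ J))"
 by (induction i arbitrary: F) (auto simp: sum_words_Suc)

text \<open>A pair of words of lengths j and n - j arises from exactly n choose j interleavings, so
  summing over all words of length n decouples the subwords. This produces the factors n and n(n -
  1) of the structural inequalities.\<close>

lemma sum_words_splits:
 fixes F :: "'a list => 'a list => real"
 shows "(\<Sum>\<mu>\<in>words \<Lambda> n. \<Sum>(I, J)\<leftarrow>splits \<mu>. if length I = j then F I J else 0)
  = real (n choose j) * (\<Sum>I\<in>words \<Lambda> j. \<Sum>J\<in>words \<Lambda> (n - j). F I J)"
proof (induction n arbitrary: j F)
 case 0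
 then show ?case by (cases j) auto
next
 case (Suc n)
 have split: "(\<Sum>\<mu>\<in>words \<Lambda> (Suc n). \<Sum>(I, J)\<leftarrow>splits \<mu>. if length I = j then F I J else 0)
   = (\<Sum>v\<in>\<Lambda>. \<Sum>\<mu>\<in>words \<Lambda> n. \<Sum>(I, J)\<leftarrow>splits \<mu>. if Suc (length I) = j then F (v # I) J else 0)
   + (\<Sum>v\<in>\<Lambda>. \<Sum>\<mu>\<in>words \<Lambda> n. \<Sum>(I, J)\<leftarrow>splits \<mu>. if length I = j then F I (v # J) else 0)"
  unfolding sum_words_Suc by (simp add: o_def case_prod_unfold sum.distrib cong: if_cong)
 have b: "(\<Sum>v\<in>\<Lambda>. \<Sum>\<mu>\<in>words \<Lambda> n. \<Sum>(I, J)\<leftarrow>splits \<mu>. if length I = j then F I (v # J) else 0)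
   = real (n choose j) * (\<Sum>I\<in>words \<Lambda> j. \<Sum>J\<in>words \<Lambda> (Suc (n - j)). F I J)"
  unfolding Suc.IH sum_words_Suc by (simp add: sum_distrib_left sum.swap[of _ \<Lambda>])
 show ?case
 proof (cases j)
  case 0
  then show ?thesis unfolding split b by (simp add: case_prod_unfold)
 next
  case (Suc i)
  have a: "(\<Sum>v\<in>\<Lambda>. \<Sum>\<mu>\<in>words \<Lambda> n. \<Sum>(I, J)\<leftarrow>splits \<mu>. if Suc (length I) = j then F (v # I) J else 0)
   = real (n choose i) * (\<Sum>I\<in>words \<Lambda> j. \<Sum>J\<in>words \<Lambda> (n - i). F I J)"
   unfolding Suc nat.inject Suc.IH sum_words_Suc by (simp add: sum_distrib_left)
  show ?thesis
  proof (cases "j <= n")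
   case True
   then have "Suc (n - j) = n - i" using Suc by simp
   then show ?thesis unfolding split a b using Suc by (simp add: algebra_simps)
  next
   case False
   then have "n choose j = 0" by (simp add: binomial_eq_0)
   then show ?thesis unfolding split a b using Suc \<open>n choose j = 0\<close> by (simp add: binomial_eq_0)
  qed
 qed
qed

section \<open>Leibniz calculus for words of differences and derivatives\<close>

locale fdops =
 fixes V :: "(real^'d::finite) set" and \<tau> :: "'d fn" and \<tau>0 :: real
  and e :: "'d => real^'d" and h :: real
 assumes fin: "finite V" and tau: "!!v. v \<in> V ==> \<tau> v >= 0" and tau0: "\<tau>0 > 0"
  and inje: "inj e" and disj: "range e \<inter> V = {}" and hpos: "h > 0"
begin

abbreviation \<Lambda> where "\<Lambda> \<equiv> V \<union> range e"
abbreviation D where "D \<equiv> bdiff V \<tau> \<tau>0 e h"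
abbreviation Dv where "Dv \<equiv> bdiff1 V \<tau> \<tau>0 e h"
abbreviation T where "T \<equiv> sh V h"
abbreviation S where "S \<equiv> grad_sq V \<tau> \<tau>0 e h"
abbreviation Wd where "Wd \<equiv> words \<Lambda>"

lemma finL [simp]: "finite \<Lambda>" using fin by simp

text \<open>Letters of \<open>range e\<close> stand for derivatives, which leave the argument
  unshifted.\<close>

definition sv where "sv v = (if v \<in> V then h *\<^sub>R v else 0)"
definition SV where "SV \<mu> = sum_list (map sv \<mu>)"

lemma SV_simps [simp]: "SV [] = 0" "SV (v # \<mu>) = sv v + SV \<mu>"
 by (auto simp: SV_def)

lemma T_eq: "T \<mu> \<phi> = (%x. \<phi> (x + SV \<mu>))"
 by (induction \<mu>) (auto simp: sh_def sh1_def sv_def add_ac)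

lemma Dv_eq: "smooth \<phi> ==> Dv v \<phi> =
  (if v \<in> V then (%x. \<tau> v / h * (\<phi> (x + h *\<^sub>R v) - \<phi> x)) else (%x. \<tau>0 * pdiff (inv e v) \<phi> x))"
 by (simp add: bdiff1_def D1_smooth)

lemma smooth_Dv: "smooth \<phi> ==> smooth (Dv v \<phi>)"
proof -
 assume s: "smooth \<phi>"
 have "smooth (%x. \<tau> v / h * (\<phi> (x + h *\<^sub>R v) - \<phi> x))" "smooth (%x. \<tau>0 * pdiff (inv e v) \<phi> x)"
  by (intro smooth_cmult smooth_diff smooth_shift smooth_pdiff s)+
 then show ?thesis unfolding Dv_eq[OF s] by auto
qed

lemma D_simps [simp]: "D [] \<phi> = \<phi>" "D (v # \<mu>) \<phi> = Dv v (D \<mu> \<phi>)" "D (I @ J) \<phi> = D I (D J \<phi>)"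
 by (auto simp: bdiff_def)

lemma smooth_D: "smooth \<phi> ==> smooth (D \<mu> \<phi>)"
 by (induction \<mu>) (auto intro: smooth_Dv)

lemma Dv_lin:
 assumes "smooth \<phi>" "smooth \<psi>"
 shows "Dv v (%x. a * \<phi> x + b * \<psi> x) = (%x. a * Dv v \<phi> x + b * Dv v \<psi> x)"
proof -
 have s: "smooth (%x. a * \<phi> x + b * \<psi> x)" using assms by (intro smooth_add smooth_cmult)
 have p: "pdiff i (%x. a * \<phi> x + b * \<psi> x) = (%x. a * pdiff i \<phi> x + b * pdiff i \<psi> x)" for i
  using pds_add[OF smooth_cmult[OF assms(1), of a] smooth_cmult[OF assms(2), of b], of "[i]"]
   pds_cmult[OF assms(1), of "[i]" a] pds_cmult[OF assms(2), of "[i]" b] by simp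
 show ?thesis unfolding Dv_eq[OF s] Dv_eq[OF assms(1)] Dv_eq[OF assms(2)]
  by (auto simp: p algebra_simps)
qed

lemma Dv_zero: "Dv v (%x. 0) = (%x. 0)"
 by (simp add: Dv_eq)

lemma Dv_shift: "smooth \<phi> ==> Dv v (%x. \<phi> (x + a)) = (%x. Dv v \<phi> (x + a))"
 using pds_shift[of \<phi> "[inv e v]" a] by (auto simp: Dv_eq smooth_shift add_ac)

lemma Dv_pdiff: "smooth \<phi> ==> Dv v (pdiff i \<phi>) = pdiff i (Dv v \<phi>)"
proof -
 assume s: "smooth \<phi>"
 have "pdiff i (%x. \<tau> v / h * (\<phi> (x + h *\<^sub>R v) - \<phi> x)) = (%x. \<tau> v / h * (pdiff i \<phi> (x + h *\<^sub>R v) - pdiff i \<phi> x))"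
  using pds_cmult[OF smooth_diff[OF smooth_shift[OF s, of "h *\<^sub>R v"] s], of "[i]" "\<tau> v / h"]
   pds_diff[OF smooth_shift[OF s, of "h *\<^sub>R v"] s, of "[i]"] pds_shift[OF s, of "[i]" "h *\<^sub>R v"] by simp
 moreover have "pdiff i (%x. \<tau>0 * pdiff (inv e v) \<phi> x) = (%x. \<tau>0 * pdiff (inv e v) (pdiff i \<phi>) x)"
  using pds_cmult[OF smooth_pdiff[OF s], of "[i]" \<tau>0 "inv e v"] by (simp add: pdiff_commute[OF s, of i])
 ultimately show ?thesis by (simp add: Dv_eq s smooth_pdiff)
qed

lemma Dv_commute: "smooth \<phi> ==> Dv v (Dv w \<phi>) = Dv w (Dv v \<phi>)"
proof -
 assume s: "smooth \<phi>"
 show ?thesis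
 proof (cases "w \<in> V")
  case True
  have "Dv v (Dv w \<phi>) = Dv v (%x. \<tau> w / h * \<phi> (x + h *\<^sub>R w) + (- (\<tau> w / h)) * \<phi> x)"
   by (simp add: Dv_eq[OF s] True algebra_simps)
  also have "... = (%x. \<tau> w / h * Dv v \<phi> (x + h *\<^sub>R w) + (- (\<tau> w / h)) * Dv v \<phi> x)"
   by (simp only: Dv_lin[OF smooth_shift[OF s] s] Dv_shift[OF s])
  also have "... = Dv w (Dv v \<phi>)" by (simp add: Dv_eq[OF smooth_Dv[OF s]] True algebra_simps)
  finally show ?thesis .
 next
  case False
  have "Dv v (Dv w \<phi>) = Dv v (%x. \<tau>0 * pdiff (inv e w) \<phi> x + 0 * 0)"
   by (simp add: Dv_eq[OF s] False)
  also have "... = (%x. \<tau>0 * pdiff (inv e w) (Dv v \<phi>) x)"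
   by (simp only: Dv_lin[OF smooth_pdiff[OF s] smooth_const] Dv_pdiff[OF s]) simp
  also have "... = Dv w (Dv v \<phi>)" by (simp add: Dv_eq[OF smooth_Dv[OF s]] False)
  finally show ?thesis .
 qed
qed

lemma D_Dv_commute: "smooth \<phi> ==> D \<mu> (Dv v \<phi>) = Dv v (D \<mu> \<phi>)"
 by (induction \<mu>) (auto simp: Dv_commute smooth_D)

lemma D_mset: "smooth \<phi> ==> mset I = mset J ==> D I \<phi> = D J \<phi>"
proof (induction I arbitrary: J)
 case (Cons i I)
 then have "i \<in> set J" by (metis list.set_intros(1) mset_eq_setD)
 then obtain a b where J: "J = a @ i # b" by (meson split_list)
 then have "mset I = mset (a @ b)" using Cons by simp
 then have "D I \<phi> = D (a @ b) \<phi>" using Cons by blast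
 then show ?case using J D_Dv_commute[OF smooth_D[OF Cons.prems(1)]] by simp
qed auto

lemma D_pds: "smooth \<phi> ==> D \<mu> (pds is \<phi>) = pds is (D \<mu> \<phi>)"
proof (induction \<mu>)
 case (Cons v \<mu>)
 have "Dv v (pds is \<psi>) = pds is (Dv v \<psi>)" if "smooth \<psi>" for \<psi>
  using that by (induction "is") (auto simp: Dv_pdiff smooth_pds)
 then show ?case using Cons smooth_D by simp
qed simp

lemma D_lin:
 assumes "smooth \<phi>" "smooth \<psi>"
 shows "D \<mu> (%x. a * \<phi> x + b * \<psi> x) = (%x. a * D \<mu> \<phi> x + b * D \<mu> \<psi> x)"
 by (induction \<mu>) (auto simp: Dv_lin smooth_D assms)

lemma D_add: "smooth \<phi> ==> smooth \<psi> ==> D \<mu> (%x. \<phi> x + \<psi> x) = (%x. D \<mu> \<phi> x + D \<mu> \<psi> x)"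
 using D_lin[of \<phi> \<psi> \<mu> 1 1] by simp

lemma D_cmult: "smooth \<phi> ==> D \<mu> (%x. a * \<phi> x) = (%x. a * D \<mu> \<phi> x)"
 using D_lin[of \<phi> \<phi> \<mu> a 0] by simp

lemma D_zero: "D \<mu> (%x. 0) = (%x. 0)"
 by (induction \<mu>) (auto simp: Dv_zero)

lemma D_sum: "(!!j. j \<in> A ==> smooth (F j)) ==> D \<mu> (%x. \<Sum>j\<in>A. F j x) = (%x. \<Sum>j\<in>A. D \<mu> (F j) x)"
 by (induction A rule: infinite_finite_induct) (auto simp: D_zero D_add smooth_sum)

lemma smooth_sum_list: "(!!p. p \<in> set ps ==> smooth (F p)) ==> smooth (%x. \<Sum>p\<leftarrow>ps. F p x)"
 by (induction ps) (auto intro: smooth_add)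

lemma Dv_sum_list:
 "(!!p. p \<in> set ps ==> smooth (F p)) ==> Dv v (%x. \<Sum>p\<leftarrow>ps. F p x) = (%x. \<Sum>p\<leftarrow>ps. Dv v (F p) x)"
proof (induction ps)
 case (Cons p ps)
 then show ?case
  using Dv_lin[of "F p" "%x. \<Sum>p\<leftarrow>ps. F p x" v 1 1] smooth_sum_list[of ps F] by simp
qed (simp add: Dv_zero)

lemma D_shift: "smooth \<phi> ==> D \<mu> (%x. \<phi> (x + a)) = (%x. D \<mu> \<phi> (x + a))"
 by (induction \<mu>) (auto simp: Dv_shift smooth_D)

text \<open>For a difference the second factor is evaluated at the shifted point; for a derivative
  \<open>sv v\<close> is 0. One formula thus covers both kinds of letters.\<close>

lemma Dv_mult:
 assumes "smooth a" "smooth b"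
 shows "Dv v (%x. a x * b x) x = Dv v a x * b (x + sv v) + a x * Dv v b x"
 using pdiff_mult[OF smoothD[OF assms(1)] smoothD[OF assms(2)], of "inv e v" x]
 by (auto simp: Dv_eq assms smooth_mult sv_def algebra_simps)

lemma D_mult:
 assumes a: "smooth a" and b: "smooth b"
 shows "D \<mu> (%x. a x * b x) = (%x. \<Sum>(I, J)\<leftarrow>splits \<mu>. D I a x * D J b (x + SV I))"
proof (induction \<mu>)
 case (Cons v \<mu>)
 have s: "smooth (case p of (I, J) => %x. D I a x * D J b (x + SV I))" for p
  by (auto split: prod.split intro!: smooth_mult smooth_shift smooth_D a b)
 have st: "Dv v (%x. D I a x * D J b (x + SV I)) x
   = D (v # I) a x * D J b (x + SV (v # I)) + D I a x * D (v # J) b (x + SV I)" for I J x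
  using Dv_mult[OF smooth_D[OF a, of I] smooth_shift[OF smooth_D[OF b, of J], of "SV I"], of v x]
  by (simp add: Dv_shift[OF smooth_D[OF b]] add_ac)
 have "D (v # \<mu>) (%x. a x * b x) = Dv v (%x. \<Sum>p\<leftarrow>splits \<mu>. (case p of (I, J) => %x. D I a x * D J b (x + SV I)) x)"
  by (simp add: Cons case_prod_unfold)
 also have "... = (%x. \<Sum>p\<leftarrow>splits \<mu>. Dv v (case p of (I, J) => %x. D I a x * D J b (x + SV I)) x)"
  by (rule Dv_sum_list[OF s])
 also have "... = (%x. \<Sum>(I, J)\<leftarrow>splits \<mu>. D (v # I) a x * D J b (x + SV (v # I)) + D I a x * D (v # J) b (x + SV I))"
  by (rule ext, rule arg_cong[where f=sum_list], rule map_cong) (auto simp: st case_prod_unfold)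
 also have "... = (%x. \<Sum>(I, J)\<leftarrow>splits (v # \<mu>). D I a x * D J b (x + SV I))"
  by (simp add: sum_list_addf case_prod_unfold o_def)
 finally show ?case .
qed simp

lemma fdiff_eq: "fdiff h v \<phi> = (%x. (1 / h) * \<phi> (x + h *\<^sub>R v) + (- (1 / h)) * \<phi> x)"
 by (auto simp: fdiff_def diff_divide_distrib)

lemma smooth_fdiff: "smooth \<phi> ==> smooth (fdiff h v \<phi>)"
 unfolding fdiff_eq by (intro smooth_add smooth_cmult smooth_shift)

lemma D_fdiff: "smooth \<phi> ==> D \<mu> (fdiff h v \<phi>) = fdiff h v (D \<mu> \<phi>)"
 unfolding fdiff_eq by (simp only: D_lin smooth_shift D_shift)

lemma fdiff_shift: "fdiff h v (%x. \<phi> (x + a)) x = fdiff h v \<phi> (x + a)"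
 by (simp add: fdiff_def add_ac)

text \<open>The difference operator with coefficients frozen in time; the dummy time 0 only serves
  to reuse \<open>L_h\<close>.\<close>

definition Lop where "Lop q p c \<phi> x = L_h V (%v _. q v) (%v _. p v) (%_. c) h 0 \<phi> x"

lemma Lop_eq: "Lop q p c \<phi> x = (\<Sum>v\<in>V. (q v x / h + p v x) * fdiff h v \<phi> x) - c x * \<phi> x"
 by (simp add: Lop_def L_h_def sum_distrib_left sum.distrib[symmetric] algebra_simps)

definition smooth_coef where
 "smooth_coef q p c \<longleftrightarrow> (\<forall>v\<in>V. smooth (q v) \<and> smooth (p v)) \<and> smooth c"

lemma smooth_Lop: "smooth_coef q p c ==> smooth \<phi> ==> smooth (Lop q p c \<phi>)"
 unfolding Lop_eq[abs_def] smooth_coef_def divide_inverse mult.commute[of _ "inverse h"]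
 by (intro smooth_diff smooth_sum smooth_mult[of "%x. _ x + _ x"] smooth_mult smooth_add smooth_cmult smooth_fdiff) auto

text \<open>What remains of the Leibniz expansion besides the operator itself and the two families
  handled by the structural inequalities. In each term the total order falling on \<phi> is below
  the length of the word: at least one letter is lost to c, two to p against one difference gained,
  three to q against two orders gained.\<close>

definition Er where
 "Er q p c \<phi> I J x =
  (if 1 <= length I then - (D I c x * D J \<phi> (x + SV I)) else 0)
  + (if 2 <= length I then \<Sum>v\<in>V. D I (p v) x * fdiff h v (D J \<phi>) (x + SV I) else 0)
  + (if 3 <= length I then Q_op V \<tau> \<tau>0 e q h I (T I (D J \<phi>)) x else 0)"

lemma Q_op_eq: "Q_op V \<tau> \<tau>0 e q h I (T I \<psi>) x = (\<Sum>v\<in>V. D I (q v) x / h * fdiff h v \<psi> (x + SV I))"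
 by (simp add: Q_op_def T_eq fdiff_shift sum_distrib_left mult_ac)

lemma L0_op_eq: "L0_op V \<tau> \<tau>0 e q p h I (T I \<psi>) x = (\<Sum>v\<in>V. (D I (q v) x / h + D I (p v) x) * fdiff h v \<psi> (x + SV I))"
 unfolding L0_op_def Q_op_eq by (simp add: T_eq fdiff_shift sum.distrib[symmetric] distrib_right)

lemma D_Lop_term:
 assumes c: "smooth_coef q p c" and s: "smooth \<phi>"
 shows "D \<mu> (Lop q p c \<phi>) x = (\<Sum>(I, J)\<leftarrow>splits \<mu>.
   (\<Sum>v\<in>V. (D I (q v) x / h + D I (p v) x) * fdiff h v (D J \<phi>) (x + SV I)) - D I c x * D J \<phi> (x + SV I))"
proof -
 define a where "a v x = (1 / h) * q v x + 1 * p v x" for v x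
 have sa: "smooth (a v)" if "v \<in> V" for v
  using c that unfolding a_def smooth_coef_def by (intro smooth_add smooth_cmult) auto
 have Da: "D I (a v) = (%x. D I (q v) x / h + D I (p v) x)" if "v \<in> V" for I v
  using c that unfolding a_def smooth_coef_def by (simp only: D_lin) simp
 have sc: "smooth c" using c by (simp add: smooth_coef_def)
 have "Lop q p c \<phi> = (%x. 1 * (\<Sum>v\<in>V. a v x * fdiff h v \<phi> x) + (- 1) * (c x * \<phi> x))"
  by (auto simp: Lop_eq a_def)
 then have "D \<mu> (Lop q p c \<phi>) x = (\<Sum>v\<in>V. D \<mu> (%x. a v x * fdiff h v \<phi> x) x) - D \<mu> (%x. c x * \<phi> x) x"
  by (simp only: D_lin[OF smooth_sum[OF smooth_mult[OF sa smooth_fdiff[OF s]]] smooth_mult[OF sc s]])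
    (subst D_sum, auto intro: smooth_mult sa smooth_fdiff s)
 also have "... = (\<Sum>v\<in>V. \<Sum>(I, J)\<leftarrow>splits \<mu>. D I (a v) x * fdiff h v (D J \<phi>) (x + SV I)) - (\<Sum>(I, J)\<leftarrow>splits \<mu>. D I c x * D J \<phi> (x + SV I))"
  by (simp add: D_mult sa sc s smooth_fdiff D_fdiff)
 also have "... = (\<Sum>(I, J)\<leftarrow>splits \<mu>. (\<Sum>v\<in>V. D I (a v) x * fdiff h v (D J \<phi>) (x + SV I)) - D I c x * D J \<phi> (x + SV I))"
  by (simp add: case_prod_unfold sum_list_subtractf) (simp add: sum_list_sum_nth sum.swap[of _ V])
 also have "... = (\<Sum>(I, J)\<leftarrow>splits \<mu>. (\<Sum>v\<in>V. (D I (q v) x / h + D I (p v) x) * fdiff h v (D J \<phi>) (x + SV I)) - D I c x * D J \<phi> (x + SV I))"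
  by (rule arg_cong[where f=sum_list], rule map_cong) (auto simp: Da)
 finally show ?thesis .
qed

text \<open>The Leibniz sum is sorted by the number of letters falling on the coefficients: none
  gives the operator itself, one on q or p gives \<open>L0_op\<close>, two on q give
  \<open>Q_op\<close>, and the rest is \<open>Er\<close>.\<close>

lemma D_Lop:
 assumes c: "smooth_coef q p c" and s: "smooth \<phi>"
 shows "D \<mu> (Lop q p c \<phi>) x = Lop q p c (D \<mu> \<phi>) x
  + (\<Sum>(I, J)\<leftarrow>splits \<mu>. if length I = 1 then L0_op V \<tau> \<tau>0 e q p h I (T I (D J \<phi>)) x else 0)
  + (\<Sum>(I, J)\<leftarrow>splits \<mu>. if length I = 2 then Q_op V \<tau> \<tau>0 e q h I (T I (D J \<phi>)) x else 0)
  + (\<Sum>(I, J)\<leftarrow>splits \<mu>. Er q p c \<phi> I J x)"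
proof -
 have t: "(\<Sum>v\<in>V. (D I (q v) x / h + D I (p v) x) * fdiff h v (D J \<phi>) (x + SV I)) - D I c x * D J \<phi> (x + SV I)
  = (if I = [] then Lop q p c (D J \<phi>) x else 0) + (if length I = 1 then L0_op V \<tau> \<tau>0 e q p h I (T I (D J \<phi>)) x else 0)
  + (if length I = 2 then Q_op V \<tau> \<tau>0 e q h I (T I (D J \<phi>)) x else 0) + Er q p c \<phi> I J x" for I J
 proof -
  consider "I = []" | "length I = 1" | "length I = 2" | "3 <= length I"
   by (cases I) (auto simp: numeral_2_eq_2 numeral_3_eq_3 Suc_le_eq, metis One_nat_def Suc_lessI Suc_1 length_greater_0_conv numeral_2_eq_2)
  then show ?thesis
   by cases (auto simp: Er_def Lop_eq L0_op_eq Q_op_eq sum.distrib distrib_right)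
 qed
 show ?thesis unfolding D_Lop_term[OF c s] t case_prod_unfold sum_list_addf
  using splits_Nil[of "%J. Lop q p c (D J \<phi>) x" \<mu>] by (simp add: case_prod_unfold)
qed

end

section \<open>Bernstein estimates for the Euler scheme\<close>

lemma sum_power_le:
 fixes a :: "'v => real"
 assumes "finite V" "!!v. v \<in> V ==> a v >= 0" "1 <= r"
 shows "(\<Sum>v\<in>V. a v ^ r) <= (\<Sum>v\<in>V. a v) ^ r"
proof -
 obtain k where r: "r = Suc k" using assms(3) by (cases r) auto
 have "(\<Sum>v\<in>V. a v ^ r) <= (\<Sum>v\<in>V. a v * (\<Sum>v\<in>V. a v) ^ k)"
  unfolding r power_Suc
  by (intro sum_mono mult_left_mono power_mono) (use assms member_le_sum[of _ V a] in auto)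
 also have "... = (\<Sum>v\<in>V. a v) ^ r" by (simp add: r sum_distrib_right[symmetric])
 finally show ?thesis .
qed

text \<open>For r >= 1 a sum of powers is at most the power of the sum, so the set V enters only
  through the square sum of its norms.\<close>

lemma sqrt_sum_power_le:
 assumes "finite V" "(\<Sum>v\<in>V. (norm v)\<^sup>2) <= s\<^sup>2" "s >= 0" "C >= 0" "1 <= r"
 shows "sqrt (\<Sum>v\<in>V. (C * norm v ^ r)\<^sup>2) <= C * s ^ r"
proof -
 have "(\<Sum>v\<in>V. (C * norm v ^ r)\<^sup>2) = C\<^sup>2 * (\<Sum>v\<in>V. ((norm v)\<^sup>2) ^ r)"
  by (simp add: sum_distrib_left power_mult_distrib power_mult[symmetric] mult.commute)
 also have "... <= C\<^sup>2 * (\<Sum>v\<in>V. (norm v)\<^sup>2) ^ r"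
  using assms by (intro mult_left_mono sum_power_le) auto
 also have "... <= C\<^sup>2 * (s\<^sup>2) ^ r"
  using assms by (intro mult_left_mono power_mono sum_nonneg) auto
 also have "... = (C * s ^ r)\<^sup>2" by (simp add: power_mult_distrib power_mult[symmetric] mult.commute)
 finally show ?thesis using assms by (intro real_le_lsqrt) auto
qed

lemma nb_mono: "nb k A \<phi> ==> A <= B ==> nb k B \<phi>"
 unfolding nb_def using order_trans by blast

lemma nb0: "nb 0 A \<phi> \<longleftrightarrow> (\<forall>x. \<bar>\<phi> x\<bar> <= A)"
 by (auto simp: nb_def)

lemma nb_pds: "nb (length is + k) A \<phi> ==> nb k A (pds is \<phi>)"
 unfolding nb_def
proof (intro allI impI)
 fix js :: "'a list" and x assume a: "\<forall>js x. length js = length is + k --> \<bar>pds js \<phi> x\<bar> <= A" "length js = k"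
 then show "\<bar>pds js (pds is \<phi>) x\<bar> <= A" using a(1)[rule_format, of "js @ is" x] by simp
qed

lemma two_mult_le: "(\<gamma>::real) > 0 ==> 2 * a * b <= \<gamma> * a\<^sup>2 + b\<^sup>2 / \<gamma>"
proof -
 assume g: "\<gamma> > 0"
 have "0 <= (\<gamma> * a - b)\<^sup>2 / \<gamma>" using g by simp
 also have "... = \<gamma> * a\<^sup>2 + b\<^sup>2 / \<gamma> - 2 * a * b" using g by (simp add: power2_eq_square field_simps)
 finally show ?thesis by simp
qed

section \<open>Weights of words and bounds for difference operators\<close>

context fdops
begin

text \<open>The factor by which a letter can enlarge a derivative bound: if the derivatives one
  order higher are bounded by A, applying the letter gives at most \<open>wv v * A\<close>,
  uniformly in h.\<close>

definition wv where "wv v = (if v \<in> V then (real CARD('d)) * norm (\<tau> v *\<^sub>R v) else \<tau>0)"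
definition wg where "wg \<mu> = prod_list (map wv \<mu>)"

lemma wv_nonneg: "wv v >= 0" using tau0 by (simp add: wv_def)

lemma wg_simps [simp]: "wg [] = 1" "wg (v # \<mu>) = wv v * wg \<mu>" "wg (I @ J) = wg I * wg J"
 by (auto simp: wg_def)

lemma wg_nonneg: "wg \<mu> >= 0" by (induction \<mu>) (auto simp: wv_nonneg)

lemma wg_splits: "(I, J) \<in> set (splits \<mu>) ==> wg I * wg J = wg \<mu>"
proof -
 assume "(I, J) \<in> set (splits \<mu>)"
 then have "mset \<mu> = mset (I @ J)" by (rule splits_mset)
 then have "image_mset wv (mset \<mu>) = image_mset wv (mset (I @ J))" by simp
 then have "prod_mset (mset (map wv \<mu>)) = prod_mset (mset (map wv (I @ J)))" by (simp only: mset_map)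
 then have "wg \<mu> = wg (I @ J)" by (simp only: prod_mset_prod_list wg_def)
 then show ?thesis by simp
qed

lemma sum_wg: "(\<Sum>\<mu>\<in>Wd k. (wg \<mu>)\<^sup>2) = (\<Sum>v\<in>\<Lambda>. (wv v)\<^sup>2) ^ k"
proof (induction k)
 case (Suc k)
 have "(\<Sum>\<mu>\<in>Wd (Suc k). (wg \<mu>)\<^sup>2) = (\<Sum>v\<in>\<Lambda>. (wv v)\<^sup>2 * (\<Sum>\<mu>\<in>Wd k. (wg \<mu>)\<^sup>2))"
  unfolding sum_words_Suc by (simp add: power_mult_distrib sum_distrib_left)
 then show ?case by (simp add: Suc sum_distrib_right[symmetric])
qed simp

lemma nb_Dv:
 assumes s: "smooth \<phi>" and n: "nb (Suc k) A \<phi>"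
 shows "nb k (wv v * A) (Dv v \<phi>)"
 unfolding nb_def
proof (intro allI impI)
 fix "is" :: "'d list" and x assume l: "length is = k"
 define \<psi> where "\<psi> = pds is \<phi>"
 have sp: "smooth \<psi>" unfolding \<psi>_def by (rule smooth_pds[OF s])
 have n1: "nb 1 A \<psi>" unfolding \<psi>_def using n l by (intro nb_pds) simp
 have A: "A >= 0" using n1[unfolded nb_def, rule_format, of "[undefined]" x] by simp
 have e: "pds is (Dv v \<phi>) x = Dv v \<psi> x" using D_pds[OF s, of "[v]" "is"] by (simp add: \<psi>_def)
 show "\<bar>pds is (Dv v \<phi>) x\<bar> <= wv v * A"
 proof (cases "v \<in> V")
  case True
  have "\<bar>\<psi> (x + h *\<^sub>R v) - \<psi> x\<bar> <= A * (real CARD('d)) * norm (h *\<^sub>R v)"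
   by (rule dbd1_lipschitz[OF nb_imp_dbd[OF sp n1]])
  then have "\<bar>\<tau> v / h * (\<psi> (x + h *\<^sub>R v) - \<psi> x)\<bar> <= \<tau> v / h * (A * (real CARD('d)) * norm (h *\<^sub>R v))"
   unfolding abs_mult using tau[OF True] hpos by (intro mult_mono) auto
  also have "... = wv v * A" using hpos tau[OF True] True by (simp add: wv_def)
  finally show ?thesis unfolding e Dv_eq[OF sp] using True by simp
 next
  case False
  have "\<bar>pdiff (inv e v) \<psi> x\<bar> <= A" using n1[unfolded nb_def, rule_format, of "[inv e v]" x] by simp
  then show ?thesis unfolding e Dv_eq[OF sp] using False tau0 by (simp add: wv_def abs_mult)
 qed
qed

lemma nb_D: "smooth \<phi> ==> nb (length \<mu> + k) A \<phi> ==> nb k (wg \<mu> * A) (D \<mu> \<phi>)"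
proof (induction \<mu> arbitrary: k)
 case (Cons v \<mu>)
 then have "nb (Suc k) (wg \<mu> * A) (D \<mu> \<phi>)" by simp
 from nb_Dv[OF smooth_D[OF Cons.prems(1)] this] show ?case by (simp add: mult.assoc)
qed simp

lemma fdiff_bound0: "nb 0 A \<psi> ==> \<bar>fdiff h v \<psi> x\<bar> <= 2 / h * A"
proof -
 assume "nb 0 A \<psi>"
 then have "\<bar>\<psi> (x + h *\<^sub>R v)\<bar> <= A" "\<bar>\<psi> x\<bar> <= A" unfolding nb0 by auto
 then have "\<bar>\<psi> (x + h *\<^sub>R v) - \<psi> x\<bar> <= 2 * A" by linarith
 then show ?thesis using hpos by (simp add: fdiff_def field_simps)
qed

lemma fdiff_bound1:
 fixes \<psi> :: "'d fn"
 assumes "smooth \<psi>" "nb 1 A \<psi>" shows "\<bar>fdiff h v \<psi> x\<bar> <= A * (real CARD('d)) * norm v"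
proof -
 have "\<bar>\<psi> (x + h *\<^sub>R v) - \<psi> x\<bar> <= A * (real CARD('d)) * norm (h *\<^sub>R v)"
  by (rule dbd1_lipschitz[OF nb_imp_dbd[OF assms]])
 then show ?thesis using hpos by (simp add: fdiff_def field_simps)
qed

text \<open>Prepares the cancellation that tames the factor 1/h in front of q: as the sum of all
  \<lambda> q_\<lambda> vanishes, the directional derivative may be subtracted from the quotient,
  and what is left is of order h.\<close>

lemma fdiff_bound2:
 fixes \<psi> :: "'d fn"
 assumes s: "smooth \<psi>" and n: "nb 2 A \<psi>"
 shows "\<bar>fdiff h v \<psi> x - (\<Sum>i\<in>UNIV. v $ i * pdiff i \<psi> x)\<bar> <= h * (A * (real CARD('d))\<^sup>2 * (norm v)\<^sup>2)"
proof -
 obtain \<theta> where \<theta>: "0 <= \<theta>" "\<theta> <= 1" "\<psi> (x + h *\<^sub>R v) - \<psi> x = (\<Sum>i\<in>UNIV. (h *\<^sub>R v) $ i * pdiff i \<psi> (x + \<theta> *\<^sub>R h *\<^sub>R v))"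
  using mvt_line[of \<psi>] smoothD[OF s] by blast
 have "fdiff h v \<psi> x = (\<Sum>i\<in>UNIV. v $ i * pdiff i \<psi> (x + \<theta> *\<^sub>R h *\<^sub>R v))"
  unfolding fdiff_def \<theta>(3) using hpos by (simp add: sum_divide_distrib)
 then have "fdiff h v \<psi> x - (\<Sum>i\<in>UNIV. v $ i * pdiff i \<psi> x) = (\<Sum>i\<in>UNIV. v $ i * (pdiff i \<psi> (x + \<theta> *\<^sub>R h *\<^sub>R v) - pdiff i \<psi> x))"
  by (simp add: sum_subtractf right_diff_distrib)
 also have "\<bar>...\<bar> <= (\<Sum>i\<in>(UNIV::'d set). norm v * (A * (real CARD('d)) * (h * norm v)))"
 proof (rule order_trans[OF sum_abs sum_mono])
  fix i
  have "nb 1 A (pdiff i \<psi>)" using n nb_Suc[of 1 A \<psi>] by (simp add: numeral_2_eq_2)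
  then have "dbd 1 A (pdiff i \<psi>)" by (intro nb_imp_dbd smooth_pdiff s)
  then have 1: "\<bar>pdiff i \<psi> (x + \<theta> *\<^sub>R h *\<^sub>R v) - pdiff i \<psi> x\<bar> <= A * (real CARD('d)) * norm (\<theta> *\<^sub>R h *\<^sub>R v)"
   by (rule dbd1_lipschitz)
  have A: "A >= 0" using n[unfolded nb_def, rule_format, of "[i,i]" x] by simp
  have "norm (\<theta> *\<^sub>R h *\<^sub>R v) <= h * norm v" using \<theta> hpos by (simp add: mult_left_le_one_le)
  then have "A * (real CARD('d)) * norm (\<theta> *\<^sub>R h *\<^sub>R v) <= A * (real CARD('d)) * (h * norm v)" using A by (intro mult_left_mono) auto
  then show "\<bar>v $ i * (pdiff i \<psi> (x + \<theta> *\<^sub>R h *\<^sub>R v) - pdiff i \<psi> x)\<bar> <= norm v * (A * (real CARD('d)) * (h * norm v))"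
   unfolding abs_mult using 1 by (intro mult_mono component_le_norm_cart) auto
 qed
 also have "... = h * (A * (real CARD('d))\<^sup>2 * (norm v)\<^sup>2)" by (simp add: power2_eq_square mult_ac)
 finally show ?thesis .
qed

text \<open>Coefficients are read at x and the test function at z, so that for fixed \<phi> and z
  the form is linear in the coefficients near x. At z = x it is the form of the structural
  inequalities.\<close>

definition AFz where
 "AFz q p \<phi> x z = 2 * (\<Sum>\<mu>\<in>Wd 1. D \<mu> \<phi> z * (\<Sum>v\<in>V. (D \<mu> (q v) x / h + D \<mu> (p v) x) * fdiff h v (T \<mu> \<phi>) z))"
definition QFz where
 "QFz q p \<phi> x z = (\<Sum>v\<in>V. (q v x + h * p v x) * (fdiff h v \<phi> z)\<^sup>2)"
definition QOz where
 "QOz q \<mu> \<psi> x z = (\<Sum>v\<in>V. D \<mu> (q v) x / h * fdiff h v \<psi> z)"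

lemma AFz_eq: "AFz q p \<phi> x x = A_form V \<tau> \<tau>0 e q p h \<phi> x"
 unfolding AFz_def A_form_def L0_op_def Q_op_def
 by (simp add: sum_distrib_left sum.distrib[symmetric] distrib_right distrib_left mult_ac)

lemma QFz_eq: "QFz q p \<phi> x x = Q_form V q p h \<phi> x"
 by (simp add: QFz_def Q_form_def)

lemma QOz_eq: "QOz q \<mu> \<psi> x x = Q_op V \<tau> \<tau>0 e q h \<mu> \<psi> x"
 by (simp add: QOz_def Q_op_def sum_distrib_left mult_ac)

end

text \<open>Apart from h, the parameters are quantities on which the final constant may depend: s1
  bounds the size of V, W2 the total squared weight of the letters, and Mx will bound the
  coefficients and their derivatives.\<close>

locale scheme = fdops V \<tau> \<tau>0 e h for V :: "(real^'d::finite) set" and \<tau> :: "'d fn" and \<tau>0 :: real and e :: "'d => real^'d" and h :: real +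
 fixes \<delta> K c0 s1 W2 Mx :: real and m :: nat
 assumes d0: "0 < \<delta>" and d1: "\<delta> <= 1" and K1: "K >= 1" and c0pos: "c0 > 0"
  and s1: "s1 >= 0" "(\<Sum>v\<in>V. (norm v)\<^sup>2) <= s1\<^sup>2"
  and W2: "(\<Sum>v\<in>\<Lambda>. (wv v)\<^sup>2) <= W2"
  and Mx: "Mx >= 0"
begin

text \<open>In the structural inequalities the operators \<open>\<K>\<^sub>h\<close> are replaced by suprema, and the coefficients
 and the test functions are evaluated at different points: in this form the inequalities
 survive averaging of the coefficients.\<close>

definition SI1 where
 "SI1 q p c \<longleftrightarrow> (\<forall>\<phi> B x z. smooth \<phi> \<and> (\<forall>y. S 1 \<phi> y <= B) -->
   AFz q p \<phi> x z <= (1 - \<delta>) * (\<Sum>\<mu>\<in>Wd 1. QFz q p (D \<mu> \<phi>) x z) + K * QFz q p \<phi> x z + 2 * (1 - \<delta>) * c x * B)"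

definition SI2 where
 "SI2 n q p c \<longleftrightarrow> (\<forall>X (\<phi> :: (real^'d) list => 'd fn) B1 B2 x z.
   finite X \<and> (\<forall>\<rho>\<in>X. smooth (\<phi> \<rho>)) \<and> (\<forall>y. (\<Sum>\<rho>\<in>X. S 2 (\<phi> \<rho>) y) <= B2) \<and> (\<forall>y. (\<Sum>\<rho>\<in>X. S 1 (\<phi> \<rho>) y) <= B1) -->
   (\<Sum>\<rho>\<in>X. real n * (\<Sum>\<nu>\<in>Wd 1. AFz q p (D \<nu> (\<phi> \<rho>)) x z)
    + real n * (real n - 1) * (\<Sum>\<mu>\<in>Wd 2. D \<mu> (\<phi> \<rho>) z * QOz q \<mu> (T \<mu> (\<phi> \<rho>)) x z))
   <= (\<Sum>\<rho>\<in>X. (1 - \<delta>) * (\<Sum>\<mu>\<in>Wd 2. QFz q p (D \<mu> (\<phi> \<rho>)) x z) + K * (\<Sum>\<mu>\<in>Wd 1. QFz q p (D \<mu> (\<phi> \<rho>)) x z))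
    + 2 * (1 - \<delta>) * c x * B2 + K * B1)"

definition coef_ok where
 "coef_ok q p c \<longleftrightarrow> smooth_coef q p c \<and>
  (\<forall>s k. (\<Sum>v\<in>V. (s v)\<^sup>2) <= 1 \<and> k <= m --> nb k Mx (%x. \<Sum>v\<in>V. s v * q v x) \<and> nb k Mx (%x. \<Sum>v\<in>V. s v * p v x)) \<and>
  (\<forall>k\<le>m. nb k Mx c) \<and> (\<forall>x i. (\<Sum>v\<in>V. v $ i * q v x) = 0) \<and>
  (\<forall>v\<in>V. \<forall>x. q v x + h * p v x >= 0) \<and> (\<forall>x. c x >= c0) \<and> SI1 q p c \<and> (\<forall>n\<in>{2..m}. SI2 n q p c)"

context
 fixes q p :: "real^'d => 'd fn" and c :: "'d fn"
 assumes ok: "coef_ok q p c"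
begin

lemma sm: "smooth_coef q p c" "v \<in> V ==> smooth (q v)" "v \<in> V ==> smooth (p v)" "smooth c"
 using ok by (auto simp: coef_ok_def smooth_coef_def)

text \<open>Unit combinations commute with D I, so \<open>dual_sum_bound\<close> gives a Euclidean
  bound with no factor depending on the number of directions.\<close>

lemma coef_sum_bound:
 assumes l: "length I <= m"
 shows "\<bar>\<Sum>v\<in>V. D I (q v) x * b v\<bar> <= wg I * Mx * sqrt (\<Sum>v\<in>V. (b v)\<^sup>2)"
  and "\<bar>\<Sum>v\<in>V. D I (p v) x * b v\<bar> <= wg I * Mx * sqrt (\<Sum>v\<in>V. (b v)\<^sup>2)"
proof -
 have gen: "\<bar>\<Sum>v\<in>V. D I (r v) x * b v\<bar> <= wg I * Mx * sqrt (\<Sum>v\<in>V. (b v)\<^sup>2)"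
  if r: "!!v. v \<in> V ==> smooth (r v)" "!!s. (\<Sum>v\<in>V. (s v)\<^sup>2) <= 1 ==> nb (length I) Mx (%x. \<Sum>v\<in>V. s v * r v x)" for r
 proof (rule dual_sum_bound[OF fin])
  fix s :: "'d fn" assume s: "(\<Sum>v\<in>V. (s v)\<^sup>2) <= 1"
  have "nb 0 (wg I * Mx) (D I (%x. \<Sum>v\<in>V. s v * r v x))"
   using r(2)[OF s] r(1) by (intro nb_D smooth_sum smooth_cmult) auto
  moreover have "D I (%x. \<Sum>v\<in>V. s v * r v x) = (%x. \<Sum>v\<in>V. s v * D I (r v) x)"
   using r(1) by (subst D_sum) (auto intro: smooth_cmult simp: D_cmult)
  ultimately show "\<bar>\<Sum>v\<in>V. s v * D I (r v) x\<bar> <= wg I * Mx" by (simp add: nb0)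
 qed
 show "\<bar>\<Sum>v\<in>V. D I (q v) x * b v\<bar> <= wg I * Mx * sqrt (\<Sum>v\<in>V. (b v)\<^sup>2)"
  by (rule gen) (use sm ok l in \<open>auto simp: coef_ok_def\<close>)
 show "\<bar>\<Sum>v\<in>V. D I (p v) x * b v\<bar> <= wg I * Mx * sqrt (\<Sum>v\<in>V. (b v)\<^sup>2)"
  by (rule gen) (use sm ok l in \<open>auto simp: coef_ok_def\<close>)
qed

lemma D_q_cancel: "(\<Sum>v\<in>V. D I (q v) x * v $ i) = 0"
proof -
 have "(%x. \<Sum>v\<in>V. v $ i * q v x) = (%x. 0)" using ok by (simp add: coef_ok_def)
 then have "D I (%x. \<Sum>v\<in>V. v $ i * q v x) x = 0" by (simp add: D_zero)
 then show ?thesis using sm by (simp add: D_sum smooth_cmult D_cmult mult.commute)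
qed

definition "Ce = Mx * (1 + (real CARD('d)) * s1 + ((real CARD('d)) * s1)\<^sup>2)"

lemma Ce: "Ce >= 0" unfolding Ce_def using Mx s1 by simp

lemma sqrt_const_bound:
 assumes "!!v. v \<in> V ==> \<bar>b v\<bar> <= C * norm v ^ r" "C >= 0" "1 <= r"
 shows "sqrt (\<Sum>v\<in>V. (b v)\<^sup>2) <= C * s1 ^ r"
proof -
 have "sqrt (\<Sum>v\<in>V. (b v)\<^sup>2) <= sqrt (\<Sum>v\<in>V. (C * norm v ^ r)\<^sup>2)"
 proof (intro real_sqrt_le_mono sum_mono)
  fix v assume "v \<in> V"
  then show "(b v)\<^sup>2 <= (C * norm v ^ r)\<^sup>2" using power_mono[OF assms(1)[of v] abs_ge_zero, of 2] by simp
 qed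
 also have "... <= C * s1 ^ r" by (rule sqrt_sum_power_le[OF fin s1(2,1) assms(2,3)])
 finally show ?thesis .
qed

text \<open>Only derivatives of \<phi> of order below n occur. For p each first difference costs one
  order; for q the factor 1/h is absorbed by subtracting the directional derivative, whose sum
  against D I q is zero, and this costs two orders.\<close>

lemma Er_bound:
 assumes s: "smooth \<phi>" and n: "!!j. j < n ==> nb j A \<phi>" and IJ: "length I + length J = n" and nm: "n <= m" and A: "A >= 0"
 shows "\<bar>Er q p c \<phi> I J x\<bar> <= wg I * wg J * (Ce * A)"
proof -
 have lI: "length I <= m" using IJ nm by simp
 have sJ: "smooth (D J \<phi>)" by (rule smooth_D[OF s])
 have nJ: "nb k (wg J * A) (D J \<phi>)" if "k < length I" for k
  using n[of "length J + k"] that IJ by (intro nb_D s) auto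
 have wA: "wg J * A >= 0" using wg_nonneg A by simp
 have C: "\<bar>D I c x * D J \<phi> (x + SV I)\<bar> <= wg I * wg J * (Mx * A)" if "1 <= length I"
 proof -
  have "nb (length I) Mx c" using ok lI by (simp add: coef_ok_def)
  then have "nb 0 (wg I * Mx) (D I c)" by (intro nb_D sm) simp
  then have "\<bar>D I c x\<bar> <= wg I * Mx" by (simp add: nb0)
  moreover have "\<bar>D J \<phi> (x + SV I)\<bar> <= wg J * A" using nJ[of 0] that unfolding nb0 by force
  ultimately have "\<bar>D I c x * D J \<phi> (x + SV I)\<bar> <= (wg I * Mx) * (wg J * A)"
   unfolding abs_mult by (intro mult_mono) (use wg_nonneg Mx in auto)
  then show ?thesis by (simp add: mult_ac)
 qed
 have P: "\<bar>\<Sum>v\<in>V. D I (p v) x * fdiff h v (D J \<phi>) (x + SV I)\<bar> <= wg I * wg J * (Mx * ((real CARD('d)) * s1) * A)" if "2 <= length I"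
 proof -
  have "sqrt (\<Sum>v\<in>V. (fdiff h v (D J \<phi>) (x + SV I))\<^sup>2) <= (wg J * A * (real CARD('d))) * s1 ^ 1"
   using fdiff_bound1[OF sJ nJ[of 1]] that wA by (intro sqrt_const_bound) auto
  then have "wg I * Mx * sqrt (\<Sum>v\<in>V. (fdiff h v (D J \<phi>) (x + SV I))\<^sup>2) <= wg I * Mx * ((wg J * A * (real CARD('d))) * s1 ^ 1)"
   by (intro mult_left_mono) (use wg_nonneg Mx in auto)
  then show ?thesis using coef_sum_bound(2)[OF lI, of x "%v. fdiff h v (D J \<phi>) (x + SV I)"] by (simp add: mult_ac)
 qed
 have Q: "\<bar>Q_op V \<tau> \<tau>0 e q h I (T I (D J \<phi>)) x\<bar> <= wg I * wg J * (Mx * ((real CARD('d)) * s1)\<^sup>2 * A)" if "3 <= length I"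
 proof -
  define b where "b v = fdiff h v (D J \<phi>) (x + SV I) - (\<Sum>i\<in>UNIV. v $ i * pdiff i (D J \<phi>) (x + SV I))" for v
  have z: "(\<Sum>v\<in>V. D I (q v) x * (\<Sum>i\<in>UNIV. v $ i * pdiff i (D J \<phi>) (x + SV I))) = 0"
  proof -
   have "(\<Sum>v\<in>V. D I (q v) x * (\<Sum>i\<in>UNIV. v $ i * pdiff i (D J \<phi>) (x + SV I)))
    = (\<Sum>i\<in>UNIV. (\<Sum>v\<in>V. D I (q v) x * v $ i) * pdiff i (D J \<phi>) (x + SV I))"
    by (simp add: sum_distrib_left sum_distrib_right sum.swap[of _ V] mult_ac)
   then show ?thesis by (simp add: D_q_cancel)
  qed
  have e: "Q_op V \<tau> \<tau>0 e q h I (T I (D J \<phi>)) x = (\<Sum>v\<in>V. D I (q v) x * (b v / h))"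
  proof -
   have "(\<Sum>v\<in>V. D I (q v) x * (b v / h)) = (\<Sum>v\<in>V. D I (q v) x * b v) / h" by (simp add: sum_divide_distrib)
   also have "(\<Sum>v\<in>V. D I (q v) x * b v) = (\<Sum>v\<in>V. D I (q v) x * fdiff h v (D J \<phi>) (x + SV I))"
    using z unfolding b_def by (simp add: right_diff_distrib sum_subtractf)
   finally show ?thesis by (simp add: Q_op_eq sum_divide_distrib)
  qed
  have "\<bar>b v / h\<bar> <= (wg J * A * (real CARD('d))\<^sup>2) * norm v ^ 2" for v
   using fdiff_bound2[OF sJ nJ[of 2], of v "x + SV I"] that hpos unfolding b_def
   by (simp add: pos_divide_le_eq mult_ac)
  then have "sqrt (\<Sum>v\<in>V. (b v / h)\<^sup>2) <= (wg J * A * (real CARD('d))\<^sup>2) * s1 ^ 2"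
   using wA by (intro sqrt_const_bound) auto
  then have "wg I * Mx * sqrt (\<Sum>v\<in>V. (b v / h)\<^sup>2) <= wg I * Mx * ((wg J * A * (real CARD('d))\<^sup>2) * s1 ^ 2)"
   by (intro mult_left_mono) (use wg_nonneg Mx in auto)
  then show ?thesis using coef_sum_bound(1)[OF lI, of x "%v. b v / h"] unfolding e by (simp add: mult_ac power_mult_distrib)
 qed
 have pos: "wg I * wg J * (Mx * A) >= 0" "wg I * wg J * (Mx * ((real CARD('d)) * s1) * A) >= 0" "wg I * wg J * (Mx * ((real CARD('d)) * s1)\<^sup>2 * A) >= 0"
  using wg_nonneg Mx A s1 by simp_all
 have "\<bar>Er q p c \<phi> I J x\<bar> <= wg I * wg J * (Mx * A) + wg I * wg J * (Mx * ((real CARD('d)) * s1) * A) + wg I * wg J * (Mx * ((real CARD('d)) * s1)\<^sup>2 * A)"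
  unfolding Er_def using C P Q pos by (intro order_trans[OF abs_triangle_ineq] add_mono) auto
 also have "... = wg I * wg J * (Ce * A)" by (simp add: Ce_def algebra_simps)
 finally show ?thesis .
qed

lemma sum_list_abs_le:
 fixes F :: "'b => real"
 assumes "!!p. p \<in> set ps ==> \<bar>F p\<bar> <= C"
 shows "\<bar>\<Sum>p\<leftarrow>ps. F p\<bar> <= real (length ps) * C"
 using assms
proof (induction ps)
 case (Cons a ps)
 then have "\<bar>F a\<bar> <= C" "\<bar>\<Sum>p\<leftarrow>ps. F p\<bar> <= real (length ps) * C" by auto
 then show ?case using abs_triangle_ineq[of "F a" "\<Sum>p\<leftarrow>ps. F p"] by (simp add: algebra_simps)
qed simp

lemma E_bound:
 assumes s: "smooth \<phi>" and n: "!!j. j < n ==> nb j A \<phi>" and \<mu>: "length \<mu> = n" and nm: "n <= m" and A: "A >= 0"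
 shows "\<bar>\<Sum>(I, J)\<leftarrow>splits \<mu>. Er q p c \<phi> I J x\<bar> <= wg \<mu> * (2 ^ m * Ce * A)"
proof -
 have "\<bar>\<Sum>r\<leftarrow>splits \<mu>. (case r of (I, J) => Er q p c \<phi> I J x)\<bar> <= real (length (splits \<mu>)) * (wg \<mu> * (Ce * A))"
 proof (rule sum_list_abs_le)
  fix r assume r: "r \<in> set (splits \<mu>)"
  obtain I J where IJ: "r = (I, J)" by fastforce
  show "\<bar>case r of (I, J) => Er q p c \<phi> I J x\<bar> <= wg \<mu> * (Ce * A)"
   using Er_bound[OF s n _ nm A, of I J x] splits_length[of I J \<mu>] wg_splits[of I J \<mu>] r \<mu> IJ by simp
 qed
 also have "... <= 2 ^ m * (wg \<mu> * (Ce * A))"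
  using \<mu> nm A Ce wg_nonneg by (intro mult_right_mono) (auto simp: length_splits)
 finally show ?thesis by (simp add: mult_ac)
qed

definition "Ch = Mx * ((1 / h + 1) * (2 / h) * sqrt (real (card V)) + 1)"

lemma Ch: "Ch >= 0" unfolding Ch_def using Mx hpos by simp

text \<open>A crude bound whose constant blows up as h tends to 0. It controls only the quadratic
  remainder of an Euler step and so restricts nothing but the step size.\<close>

lemma D_Lop_bound:
 assumes s: "smooth \<phi>" and n: "!!j. j <= n ==> nb j A \<phi>" and \<mu>: "length \<mu> = n" and nm: "n <= m" and A: "A >= 0"
 shows "\<bar>D \<mu> (Lop q p c \<phi>) x\<bar> <= wg \<mu> * (2 ^ m * Ch * A)"
proof -
 have "\<bar>\<Sum>r\<leftarrow>splits \<mu>. (case r of (I, J) => (\<Sum>v\<in>V. (D I (q v) x / h + D I (p v) x) * fdiff h v (D J \<phi>) (x + SV I)) - D I c x * D J \<phi> (x + SV I))\<bar>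
  <= real (length (splits \<mu>)) * (wg \<mu> * (Ch * A))"
 proof (rule sum_list_abs_le)
  fix r assume r: "r \<in> set (splits \<mu>)"
  obtain I J where IJ: "r = (I, J)" by fastforce
  have l: "length I + length J = n" "wg I * wg J = wg \<mu>" using splits_length wg_splits r IJ \<mu> by auto
  have lI: "length I <= m" using l nm by simp
  have nJ: "nb 0 (wg J * A) (D J \<phi>)" using n[of "length J"] l by (intro nb_D s) auto
  have wA: "wg J * A >= 0" using wg_nonneg A by simp
  define F where "F v = fdiff h v (D J \<phi>) (x + SV I)" for v
  have "sqrt (\<Sum>v\<in>V. (F v)\<^sup>2) <= sqrt (\<Sum>v\<in>V. (2 / h * (wg J * A))\<^sup>2)"
  proof (intro real_sqrt_le_mono sum_mono)
   fix v show "(F v)\<^sup>2 <= (2 / h * (wg J * A))\<^sup>2"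
    using power_mono[OF fdiff_bound0[OF nJ, of v "x + SV I"] abs_ge_zero, of 2] by (simp add: F_def)
  qed
  also have "... = sqrt (real (card V)) * (2 / h * (wg J * A))"
   using wA hpos by (simp add: real_sqrt_mult)
  finally have F: "sqrt (\<Sum>v\<in>V. (F v)\<^sup>2) <= sqrt (real (card V)) * (2 / h * (wg J * A))" .
  have wM: "wg I * Mx >= 0" using wg_nonneg Mx by simp
  let ?G = "wg I * Mx * (sqrt (real (card V)) * (2 / h * (wg J * A)))"
  have q: "\<bar>\<Sum>v\<in>V. D I (q v) x * F v\<bar> <= ?G" "\<bar>\<Sum>v\<in>V. D I (p v) x * F v\<bar> <= ?G"
   using coef_sum_bound[OF lI, of x F] mult_left_mono[OF F wM] by auto
  have "nb (length I) Mx c" using ok lI by (simp add: coef_ok_def)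
  then have "nb 0 (wg I * Mx) (D I c)" by (intro nb_D sm) simp
  then have cb: "\<bar>D I c x * D J \<phi> (x + SV I)\<bar> <= (wg I * Mx) * (wg J * A)"
   unfolding abs_mult using nJ wM by (intro mult_mono) (auto simp: nb0)
  have "(\<Sum>v\<in>V. (D I (q v) x / h + D I (p v) x) * F v) = (\<Sum>v\<in>V. D I (q v) x * F v) / h + (\<Sum>v\<in>V. D I (p v) x * F v)"
   by (simp add: sum.distrib[symmetric] sum_divide_distrib distrib_right)
  moreover have "\<bar>(\<Sum>v\<in>V. D I (q v) x * F v) / h\<bar> <= ?G / h"
   using divide_right_mono[OF q(1), of h] hpos by (simp only: abs_divide) simp
  ultimately have "\<bar>(\<Sum>v\<in>V. (D I (q v) x / h + D I (p v) x) * F v) - D I c x * D J \<phi> (x + SV I)\<bar> <= ?G / h + ?G + (wg I * Mx) * (wg J * A)"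
   using q(2) cb by linarith
  also have "... = wg I * wg J * (Ch * A)" by (simp add: Ch_def algebra_simps add_divide_distrib)
  finally show "\<bar>case r of (I, J) => (\<Sum>v\<in>V. (D I (q v) x / h + D I (p v) x) * fdiff h v (D J \<phi>) (x + SV I)) - D I c x * D J \<phi> (x + SV I)\<bar> <= wg \<mu> * (Ch * A)"
   by (simp add: IJ F_def l)
 qed
 also have "... <= 2 ^ m * (wg \<mu> * (Ch * A))"
  using \<mu> nm A Ch wg_nonneg by (intro mult_right_mono) (auto simp: length_splits)
 finally show ?thesis unfolding D_Lop_term[OF sm(1) s] by (simp add: mult_ac)
qed

abbreviation L0 where "L0 \<equiv> Lop q p (%_. 0)"
abbreviation QS where "QS k \<phi> x \<equiv> (\<Sum>\<mu>\<in>Wd k. Q_form V q p h (D \<mu> \<phi>) x)"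

lemma L0_lin: "L0 (%x. \<Sum>j\<in>A. a j * F j x) x = (\<Sum>j\<in>A. a j * L0 (F j) x)"
proof -
 have "fdiff h v (%x. \<Sum>j\<in>A. a j * F j x) x = (\<Sum>j\<in>A. a j * fdiff h v (F j) x)" for v
  by (simp add: fdiff_def sum_subtractf[symmetric] sum_divide_distrib right_diff_distrib)
 then show ?thesis
  by (simp add: Lop_eq sum_distrib_left sum.swap[of _ V] mult_ac)
qed

lemma Lop_square: "2 * \<psi> x * Lop q p c \<psi> x = L0 (%y. (\<psi> y)\<^sup>2) x - Q_form V q p h \<psi> x - 2 * c x * (\<psi> x)\<^sup>2"
proof -
 have "2 * \<psi> x * ((q v x / h + p v x) * fdiff h v \<psi> x) = (q v x / h + p v x) * fdiff h v (%y. (\<psi> y)\<^sup>2) x - (q v x + h * p v x) * (fdiff h v \<psi> x)\<^sup>2" for v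
 proof -
  define X Y where "X = \<psi> (x + h *\<^sub>R v)" "Y = \<psi> x"
  define a b where "a = q v x" "b = p v x"
  have "2 * Y * ((a / h + b) * ((X - Y) / h)) = (a / h + b) * ((X\<^sup>2 - Y\<^sup>2) / h) - (a + h * b) * ((X - Y) / h)\<^sup>2"
   using hpos by (simp add: field_simps power2_eq_square)
  then show ?thesis by (simp add: fdiff_def X_Y_def a_b_def)
 qed
 then have "(\<Sum>v\<in>V. 2 * \<psi> x * ((q v x / h + p v x) * fdiff h v \<psi> x)) = (\<Sum>v\<in>V. (q v x / h + p v x) * fdiff h v (%y. (\<psi> y)\<^sup>2) x) - Q_form V q p h \<psi> x"
  by (simp add: Q_form_def sum_subtractf)
 then show ?thesis by (simp add: Lop_eq sum_distrib_left right_diff_distrib power2_eq_square mult_ac)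
qed

lemma S_eq: "S k \<phi> = (%x. \<Sum>\<mu>\<in>Wd k. (D \<mu> \<phi> x)\<^sup>2)"
 by (auto simp: grad_sq_def)

lemma QS_nonneg: "QS k \<phi> x >= 0"
 unfolding Q_form_def using ok by (intro sum_nonneg) (auto simp: coef_ok_def)

lemma level_id:
 assumes s: "smooth \<phi>"
 shows "(\<Sum>\<mu>\<in>Wd k. 2 * D \<mu> \<phi> x * D \<mu> (Lop q p c \<phi>) x) =
  L0 (S k \<phi>) x - QS k \<phi> x - 2 * c x * S k \<phi> x
  + (\<Sum>\<mu>\<in>Wd k. 2 * D \<mu> \<phi> x * (\<Sum>(I, J)\<leftarrow>splits \<mu>. if length I = 1 then L0_op V \<tau> \<tau>0 e q p h I (T I (D J \<phi>)) x else 0))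
  + (\<Sum>\<mu>\<in>Wd k. 2 * D \<mu> \<phi> x * (\<Sum>(I, J)\<leftarrow>splits \<mu>. if length I = 2 then Q_op V \<tau> \<tau>0 e q h I (T I (D J \<phi>)) x else 0))
  + (\<Sum>\<mu>\<in>Wd k. 2 * D \<mu> \<phi> x * (\<Sum>(I, J)\<leftarrow>splits \<mu>. Er q p c \<phi> I J x))"
proof -
 have "L0 (S k \<phi>) x = (\<Sum>\<mu>\<in>Wd k. L0 (%y. (D \<mu> \<phi> y)\<^sup>2) x)"
  unfolding S_eq using L0_lin[of "%_. 1" "%\<mu> y. (D \<mu> \<phi> y)\<^sup>2" "Wd k" x] by simp
 then have "(\<Sum>\<mu>\<in>Wd k. 2 * D \<mu> \<phi> x * Lop q p c (D \<mu> \<phi>) x) = L0 (S k \<phi>) x - QS k \<phi> x - 2 * c x * S k \<phi> x"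
  unfolding Lop_square by (simp add: S_eq sum_subtractf sum_distrib_left)
 then show ?thesis unfolding D_Lop[OF sm(1) s] by (simp only: distrib_left sum.distrib)
qed

lemma comb:
 assumes s: "smooth \<phi>"
 shows "(\<Sum>\<mu>\<in>Wd n. 2 * D \<mu> \<phi> x * (\<Sum>(I, J)\<leftarrow>splits \<mu>. if length I = j then G I J else 0))
  = 2 * real (n choose j) * (\<Sum>J\<in>Wd (n - j). \<Sum>I\<in>Wd j. D I (D J \<phi>) x * G I J)"
proof -
 have "(\<Sum>\<mu>\<in>Wd n. 2 * D \<mu> \<phi> x * (\<Sum>(I, J)\<leftarrow>splits \<mu>. if length I = j then G I J else 0))
  = (\<Sum>\<mu>\<in>Wd n. (\<Sum>(I, J)\<leftarrow>splits \<mu>. if length I = j then 2 * D I (D J \<phi>) x * G I J else 0))"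
 proof (rule sum.cong[OF refl])
  fix \<mu>
  have "2 * D \<mu> \<phi> x * (\<Sum>(I, J)\<leftarrow>splits \<mu>. if length I = j then G I J else 0)
   = (\<Sum>(I, J)\<leftarrow>splits \<mu>. 2 * D \<mu> \<phi> x * (if length I = j then G I J else 0))"
   by (simp add: sum_list_const_mult[symmetric] case_prod_unfold)
  also have "... = (\<Sum>(I, J)\<leftarrow>splits \<mu>. if length I = j then 2 * D I (D J \<phi>) x * G I J else 0)"
  proof (rule arg_cong[where f=sum_list], rule map_cong[OF refl])
   fix r assume r: "r \<in> set (splits \<mu>)"
   obtain I J where IJ: "r = (I, J)" by fastforce
   have "D \<mu> \<phi> = D (I @ J) \<phi>" using splits_mset[of I J \<mu>] r IJ by (intro D_mset s) auto
   then show "(case r of (I, J) => 2 * D \<mu> \<phi> x * (if length I = j then G I J else 0)) = (case r of (I, J) => if length I = j then 2 * D I (D J \<phi>) x * G I J else 0)"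
    by (simp add: IJ)
  qed
  finally show "2 * D \<mu> \<phi> x * (\<Sum>(I, J)\<leftarrow>splits \<mu>. if length I = j then G I J else 0) = ..." .
 qed
 also have "... = real (n choose j) * (\<Sum>I\<in>Wd j. \<Sum>J\<in>Wd (n - j). 2 * D I (D J \<phi>) x * G I J)"
  by (rule sum_words_splits)
 also have "... = 2 * real (n choose j) * (\<Sum>J\<in>Wd (n - j). \<Sum>I\<in>Wd j. D I (D J \<phi>) x * G I J)"
  by (subst sum.swap) (simp add: sum_distrib_left mult_ac)
 finally show ?thesis .
qed

lemma comb1:
 assumes s: "smooth \<phi>"
 shows "(\<Sum>\<mu>\<in>Wd (Suc n). 2 * D \<mu> \<phi> x * (\<Sum>(I, J)\<leftarrow>splits \<mu>. if length I = 1 then L0_op V \<tau> \<tau>0 e q p h I (T I (D J \<phi>)) x else 0))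
  = real (Suc n) * (\<Sum>J\<in>Wd n. AFz q p (D J \<phi>) x x)"
 unfolding comb[OF s] AFz_eq A_form_def by (simp add: sum_distrib_left algebra_simps)

lemma comb2:
 assumes s: "smooth \<phi>"
 shows "(\<Sum>\<mu>\<in>Wd (Suc (Suc n)). 2 * D \<mu> \<phi> x * (\<Sum>(I, J)\<leftarrow>splits \<mu>. if length I = 2 then Q_op V \<tau> \<tau>0 e q h I (T I (D J \<phi>)) x else 0))
  = real (Suc (Suc n)) * (real (Suc (Suc n)) - 1) * (\<Sum>J\<in>Wd n. \<Sum>I\<in>Wd 2. D I (D J \<phi>) x * QOz q I (T I (D J \<phi>)) x x)"
proof -
 have "2 * (Suc (Suc n) choose 2) = Suc (Suc n) * Suc n" by (simp add: choose_two)
 then have "2 * real (Suc (Suc n) choose 2) = real (Suc (Suc n)) * real (Suc n)" by (metis of_nat_mult of_nat_numeral)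
 then show ?thesis unfolding comb[OF s] QOz_eq by simp
qed

text \<open>The terms with one letter on q or p, or two letters on q, are the left sides of the
  structural inequalities at order k; they consume all but the fraction \<delta> of the good form at
  level k. Left behind are K times the good form one level lower and the suprema \<open>Bk\<close>
  and \<open>Bk'\<close>.\<close>

lemma level_ineq:
 assumes s: "smooth \<phi>" and km: "k <= m" and Bk: "!!y. S k \<phi> y <= Bk" and Bk': "!!y. 1 <= k ==> S (k - 1) \<phi> y <= Bk'" and B0: "Bk' >= 0"
 shows "(\<Sum>\<mu>\<in>Wd k. 2 * D \<mu> \<phi> x * D \<mu> (Lop q p c \<phi>) x) <=
  L0 (S k \<phi>) x - 2 * c x * S k \<phi> x - \<delta> * QS k \<phi> x + (if k = 0 then 0 else K * QS (k - 1) \<phi> x)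
  + 2 * (1 - \<delta>) * c x * Bk + K * Bk' + (\<Sum>\<mu>\<in>Wd k. 2 * D \<mu> \<phi> x * (\<Sum>(I, J)\<leftarrow>splits \<mu>. Er q p c \<phi> I J x))"
proof -
 have cx: "c x >= 0" proof -
  have "c0 <= c x" using ok by (simp add: coef_ok_def)
  then show ?thesis using c0pos by linarith
 qed
 have Bk0: "Bk >= 0" proof -
  have "0 <= S k \<phi> x" by (simp add: S_eq sum_nonneg)
  then show ?thesis using Bk[of x] by linarith
 qed
 have cB: "2 * (1 - \<delta>) * c x * Bk >= 0" using cx Bk0 d1 by simp
 have KB: "K * Bk' >= 0" using K1 B0 by simp
 consider "k = 0" | "k = 1" | n where "k = Suc (Suc n)" by (metis One_nat_def not0_implies_Suc)
 then show ?thesis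
 proof cases
  case 1
  have "\<delta> * QS k \<phi> x <= QS k \<phi> x" using mult_right_mono[OF d1 QS_nonneg] by simp
  then show ?thesis unfolding level_id[OF s] using 1 cB KB by simp
 next
  case 2
  have "AFz q p \<phi> x x <= (1 - \<delta>) * (\<Sum>\<mu>\<in>Wd 1. QFz q p (D \<mu> \<phi>) x x) + K * QFz q p \<phi> x x + 2 * (1 - \<delta>) * c x * Bk"
  proof -
   have "SI1 q p c" using ok by (simp add: coef_ok_def)
   from this[unfolded SI1_def, rule_format, of \<phi> Bk x x] show ?thesis using s Bk 2 by simp
  qed
  moreover have "(\<Sum>\<mu>\<in>Wd 1. 2 * D \<mu> \<phi> x * (\<Sum>(I, J)\<leftarrow>splits \<mu>. if length I = 1 then L0_op V \<tau> \<tau>0 e q p h I (T I (D J \<phi>)) x else 0)) = AFz q p \<phi> x x"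
   using comb1[OF s, of x 0] by simp
  moreover have "(\<Sum>\<mu>\<in>Wd 1. 2 * D \<mu> \<phi> x * (\<Sum>(I, J)\<leftarrow>splits \<mu>. if length I = 2 then Q_op V \<tau> \<tau>0 e q h I (T I (D J \<phi>)) x else 0)) = 0"
   unfolding comb[OF s] by simp
  moreover have "(1 - \<delta>) * QS 1 \<phi> x = QS 1 \<phi> x - \<delta> * QS 1 \<phi> x" by (simp add: left_diff_distrib)
  ultimately show ?thesis unfolding level_id[OF s] QFz_eq 2 using KB by simp
 next
  case (3 n)
  \<comment> \<open>Words of length k are split into two letters and a word \<rho> of length k - 2;
    the inequality is applied to the whole family D \<rho> \<phi>.\<close>
  have SI: "SI2 k q p c" using ok km 3 by (simp add: coef_ok_def)
  have sums: "(\<Sum>\<rho>\<in>Wd n. \<Sum>\<mu>\<in>Wd j. F (D \<mu> (D \<rho> \<phi>))) = (\<Sum>\<mu>\<in>Wd (j + n). F (D \<mu> \<phi>))" for j and F :: "('d fn) => real"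
   unfolding sum_words_add by (subst sum.swap) simp
  have S2: "(\<Sum>\<rho>\<in>Wd n. S 2 (D \<rho> \<phi>) y) <= Bk" for y
   using Bk[of y] sums[of "%\<psi>. (\<psi> y)\<^sup>2" 2] by (simp add: S_eq 3)
  have S1: "(\<Sum>\<rho>\<in>Wd n. S 1 (D \<rho> \<phi>) y) <= Bk'" for y
   using Bk'[of y] sums[of "%\<psi>. (\<psi> y)\<^sup>2" 1] by (simp add: S_eq 3)
  have "(\<Sum>\<rho>\<in>Wd n. real k * (\<Sum>\<nu>\<in>Wd 1. AFz q p (D \<nu> (D \<rho> \<phi>)) x x)
    + real k * (real k - 1) * (\<Sum>\<mu>\<in>Wd 2. D \<mu> (D \<rho> \<phi>) x * QOz q \<mu> (T \<mu> (D \<rho> \<phi>)) x x))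
   <= (\<Sum>\<rho>\<in>Wd n. (1 - \<delta>) * (\<Sum>\<mu>\<in>Wd 2. QFz q p (D \<mu> (D \<rho> \<phi>)) x x) + K * (\<Sum>\<mu>\<in>Wd 1. QFz q p (D \<mu> (D \<rho> \<phi>)) x x))
    + 2 * (1 - \<delta>) * c x * Bk + K * Bk'"
   using SI[unfolded SI2_def, rule_format, of "Wd n" "%\<rho>. D \<rho> \<phi>" Bk Bk' x x]
    S1 S2 smooth_D[OF s] finite_words[OF finL] by blast
  then have "real k * (\<Sum>\<rho>\<in>Wd n. \<Sum>\<nu>\<in>Wd 1. AFz q p (D \<nu> (D \<rho> \<phi>)) x x)
    + real k * (real k - 1) * (\<Sum>\<rho>\<in>Wd n. \<Sum>\<mu>\<in>Wd 2. D \<mu> (D \<rho> \<phi>) x * QOz q \<mu> (T \<mu> (D \<rho> \<phi>)) x x)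
   <= (1 - \<delta>) * (\<Sum>\<rho>\<in>Wd n. \<Sum>\<mu>\<in>Wd 2. QFz q p (D \<mu> (D \<rho> \<phi>)) x x) + K * (\<Sum>\<rho>\<in>Wd n. \<Sum>\<mu>\<in>Wd 1. QFz q p (D \<mu> (D \<rho> \<phi>)) x x)
    + 2 * (1 - \<delta>) * c x * Bk + K * Bk'"
   by (simp only: sum.distrib sum_distrib_left)
  moreover have "real k * (\<Sum>\<rho>\<in>Wd n. \<Sum>\<nu>\<in>Wd 1. AFz q p (D \<nu> (D \<rho> \<phi>)) x x) = real (Suc (Suc n)) * (\<Sum>J\<in>Wd (Suc n). AFz q p (D J \<phi>) x x)"
   using sums[of "%\<psi>. AFz q p \<psi> x x" 1] by (simp add: 3)
  moreover have "(\<Sum>\<rho>\<in>Wd n. \<Sum>\<mu>\<in>Wd 2. QFz q p (D \<mu> (D \<rho> \<phi>)) x x) = QS k \<phi> x"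
   using sums[of "%\<psi>. QFz q p \<psi> x x" 2] by (simp add: 3 QFz_eq)
  moreover have "(\<Sum>\<rho>\<in>Wd n. \<Sum>\<mu>\<in>Wd 1. QFz q p (D \<mu> (D \<rho> \<phi>)) x x) = QS (k - 1) \<phi> x"
   using sums[of "%\<psi>. QFz q p \<psi> x x" 1] by (simp add: 3 QFz_eq)
  moreover have "(1 - \<delta>) * QS k \<phi> x = QS k \<phi> x - \<delta> * QS k \<phi> x" by (simp add: left_diff_distrib)
  ultimately show ?thesis unfolding level_id[OF s] using comb1[OF s, of x "Suc n"] comb2[OF s, of x n] 3 by simp
 qed
qed

end

end

section \<open>Constants of the induction over the order of derivatives\<close>

definition Ecst :: "real => nat => real => real => real => real" where
 "Ecst d m s1 Mx A = 2 ^ m * (Mx * (1 + d * s1 + (d * s1)\<^sup>2)) * A + 1"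

text \<open>Forcing in the inequality for the weighted sum when the data are bounded by 1 and lower
  derivatives by A. The first summand collects the at most m lower levels; the rest comes from the
  top level, where Young's inequality may spend only half of the damping, \<delta> c0.\<close>

definition Pcst where
 "Pcst d m \<delta> K c0 s1 W2 Mx A =
   real m * ((K / \<delta>) ^ m * ((2 * Mx + K + 1) * ((1 + W2) ^ m * A\<^sup>2) + (1 + W2) ^ m * (Ecst d m s1 Mx A)\<^sup>2))
   + K * ((1 + W2) ^ m * A\<^sup>2) + (1 + W2) ^ m * (Ecst d m s1 Mx A)\<^sup>2 / (\<delta> * c0)"

text \<open>The level that Euler steps cannot exceed: the first summand makes the remaining damping
  outweigh the forcing and the quadratic remainder (the + 1), the second dominates the weighted sum
  of the initial data.\<close>

definition Rcst where
 "Rcst d m \<delta> K c0 s1 W2 Mx A =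
   (Pcst d m \<delta> K c0 s1 W2 Mx A + 1) / (\<delta> * c0) + real (m + 1) * ((K / \<delta>) ^ m * (1 + W2) ^ m)"

text \<open>The bound for all orders up to n is the input A for order n + 1; the power of \<tau>0
  converts square sums over words back into partial derivatives.\<close>

primrec Bcst where
 "Bcst d m \<delta> K \<tau>0 c0 s1 W2 Mx 0 = 1 + sqrt (Rcst d m \<delta> K c0 s1 W2 Mx 1)"
| "Bcst d m \<delta> K \<tau>0 c0 s1 W2 Mx (Suc n) = Bcst d m \<delta> K \<tau>0 c0 s1 W2 Mx n
   + sqrt (Rcst d m \<delta> K c0 s1 W2 Mx (Bcst d m \<delta> K \<tau>0 c0 s1 W2 Mx n)) / \<tau>0 ^ Suc n"

section \<open>Weighted square sums and a single Euler step\<close>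

context scheme
begin

abbreviation "bt \<equiv> K / \<delta>"
abbreviation "Wm \<equiv> (1 + W2) ^ m"
definition "EE A = Ecst (real CARD('d)) m s1 Mx A"
definition "PP A = Pcst (real CARD('d)) m \<delta> K c0 s1 W2 Mx A"
definition "RR A = Rcst (real CARD('d)) m \<delta> K c0 s1 W2 Mx A"
definition "BB n = Bcst (real CARD('d)) m \<delta> K \<tau>0 c0 s1 W2 Mx n"

lemma W20: "W2 >= 0"
 using W2 sum_nonneg[of \<Lambda> "%v. (wv v)\<^sup>2"] by simp

lemma bt1: "bt >= 1" using d0 d1 K1 by (simp add: field_simps)

lemma Wm1: "Wm >= 1" using W20 by (simp add: one_le_power)

lemma EE1: "A >= 0 ==> EE A >= 1"
 unfolding EE_def Ecst_def using Mx s1 by simp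

lemma PP0: "A >= 0 ==> PP A >= 0"
 unfolding PP_def Pcst_def using Mx K1 W20 d0 c0pos by simp

lemma RR_ge: "A >= 0 ==> RR A >= (PP A + 1) / (\<delta> * c0)" "A >= 0 ==> RR A >= real (m + 1) * (bt ^ m * Wm)"
proof -
 assume A: "A >= 0"
 have "(PP A + 1) / (\<delta> * c0) >= 0" using PP0[OF A] d0 c0pos by simp
 moreover have "real (m + 1) * (bt ^ m * Wm) >= 0" using bt1 Wm1 by simp
 ultimately show "RR A >= (PP A + 1) / (\<delta> * c0)" "RR A >= real (m + 1) * (bt ^ m * Wm)"
  unfolding RR_def Rcst_def PP_def by auto
qed

lemma RR0: "A >= 0 ==> RR A >= 0"
 using RR_ge(1)[of A] PP0[of A] d0 c0pos by (smt (verit) divide_nonneg_pos mult_pos_pos)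

text \<open>The ratio K/\<delta> is the amount of the form of level k - 1 demanded at level k
  divided by what level k - 1 still offers; see \<open>telescope\<close>.\<close>

definition w where "w n \<phi> x = (\<Sum>k\<le>n. bt ^ (n - k) * S k \<phi> x)"

lemma S_nonneg: "S k \<phi> x >= 0" by (simp add: grad_sq_def sum_nonneg)

lemma w_ge: "S n \<phi> x <= w n \<phi> x"
proof -
 have "bt ^ (n - n) * S n \<phi> x <= w n \<phi> x"
  unfolding w_def using bt1 S_nonneg by (intro member_le_sum) auto
 then show ?thesis by simp
qed

lemma sum_wg_le: "k <= m ==> (\<Sum>\<mu>\<in>Wd k. (wg \<mu>)\<^sup>2) <= Wm"
proof -
 assume k: "k <= m"
 have "(\<Sum>\<mu>\<in>Wd k. (wg \<mu>)\<^sup>2) <= (1 + W2) ^ k"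
  unfolding sum_wg using W2 by (intro power_mono sum_nonneg) auto
 also have "... <= Wm" using k W20 by (intro power_increasing) auto
 finally show ?thesis .
qed

lemma sum_sq_le:
 assumes k: "k <= m" and F: "!!\<mu>. \<mu> \<in> Wd k ==> \<bar>F \<mu>\<bar> <= wg \<mu> * C" and C: "C >= 0"
 shows "(\<Sum>\<mu>\<in>Wd k. (F \<mu>)\<^sup>2) <= Wm * C\<^sup>2"
proof -
 have "(\<Sum>\<mu>\<in>Wd k. (F \<mu>)\<^sup>2) <= (\<Sum>\<mu>\<in>Wd k. (wg \<mu>)\<^sup>2 * C\<^sup>2)"
  using power_mono[OF F abs_ge_zero, of _ 2] by (intro sum_mono) (simp add: power_mult_distrib)
 also have "... = (\<Sum>\<mu>\<in>Wd k. (wg \<mu>)\<^sup>2) * C\<^sup>2" by (simp add: sum_distrib_right)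
 also have "... <= Wm * C\<^sup>2" using sum_wg_le[OF k] by (intro mult_right_mono) auto
 finally show ?thesis .
qed

lemma words_length: "\<mu> \<in> Wd k ==> length \<mu> = k" by (simp add: words_def)

lemma S_bound:
 assumes "smooth \<phi>" "nb k C \<phi>" "k <= m" "C >= 0"
 shows "S k \<phi> y <= Wm * C\<^sup>2"
 unfolding grad_sq_def power2_abs
proof (rule sum_sq_le[OF assms(3) _ assms(4)])
 fix \<mu> assume "\<mu> \<in> Wd k"
 then have "nb 0 (wg \<mu> * C) (D \<mu> \<phi>)" using assms by (intro nb_D) (auto simp: words_length)
 then show "\<bar>D \<mu> \<phi> y\<bar> <= wg \<mu> * C" by (simp add: nb0)
qed

text \<open>Words made of the letters e i are pure partial derivatives times powers of \<tau>0, so a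
  single summand of \<open>S n\<close> controls each derivative. This is how bounds on words return
  to bounds on derivatives.\<close>

lemma nb_of_S:
 assumes s: "smooth \<phi>" and R: "!!y. S n \<phi> y <= R"
 shows "nb n (sqrt R / \<tau>0 ^ n) \<phi>"
 unfolding nb_def
proof (intro allI impI)
 fix "is" :: "'d list" and x assume l: "length is = n"
 have nd: "e i \<notin> V" for i using disj by auto
 have e: "D (map e is) \<phi> = (%x. \<tau>0 ^ length is * pds is \<phi> x)" for "is"
 proof (induction "is")
  case (Cons i "is")
  have "D (map e (i # is)) \<phi> = Dv (e i) (%x. \<tau>0 ^ length is * pds is \<phi> x)" using Cons by simp
  also have "... = (%x. \<tau>0 ^ length (i # is) * pds (i # is) \<phi> x)"
   using pds_cmult[OF smooth_pds[OF s, of "is"], of "[i]" "\<tau>0 ^ length is"] nd inje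
   by (subst Dv_eq) (auto intro: smooth_cmult smooth_pds s)
  finally show ?case .
 qed simp
 have "map e is \<in> Wd n" using l by (auto simp: words_def)
 then have "\<bar>D (map e is) \<phi> x\<bar>\<^sup>2 <= S n \<phi> x" unfolding grad_sq_def by (intro member_le_sum finite_words finL) auto
 then have "(\<tau>0 ^ n * pds is \<phi> x)\<^sup>2 <= R" using R[of x] l by (simp add: e)
 then have "\<bar>\<tau>0 ^ n * pds is \<phi> x\<bar> <= sqrt R" using real_le_rsqrt by (simp add: real_le_rsqrt)
 then show "\<bar>pds is \<phi> x\<bar> <= sqrt R / \<tau>0 ^ n" using tau0 by (simp add: abs_mult field_simps)
qed

text \<open>The additional factor K/\<delta> at level k - 1 makes its term with -\<delta> cancel the
  term with +K produced by level k; only the top term survives, with a favourable sign.\<close>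

lemma telescope: "(\<Sum>k\<le>n. bt ^ (n - k) * (- \<delta> * F k + (if k = 0 then 0 else K * F (k - 1)))) = - \<delta> * F n"
proof (induction n)
 case (Suc n)
 have "(\<Sum>k\<le>Suc n. bt ^ (Suc n - k) * (- \<delta> * F k + (if k = 0 then 0 else K * F (k - 1))))
  = bt * (\<Sum>k\<le>n. bt ^ (n - k) * (- \<delta> * F k + (if k = 0 then 0 else K * F (k - 1)))) + (- \<delta> * F (Suc n) + K * F n)"
  by (simp add: sum_distrib_left Suc_diff_le mult.assoc)
 also have "... = - \<delta> * F (Suc n)" unfolding Suc using d0 by simp
 finally show ?case .
qed simp

text \<open>Reciprocal of the admissible time step: the first part turns the step into a convex
  combination in \<open>max_step\<close>, the second keeps \<kappa> times the weighted sum of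
  squared increments below B^2.\<close>

definition "Xi n A = 2 * Mx + (1 + h) * Mx * sqrt (real (card V)) / h\<^sup>2
  + real (m + 1) * (bt ^ m * (Wm * (2 ^ m * Ch * (A + sqrt (RR A) / \<tau>0 ^ n) + 1)\<^sup>2))"

lemma bt_pow: "k <= n ==> n <= m ==> bt ^ (n - k) <= bt ^ m"
 using bt1 by (intro power_increasing) auto

context
 fixes q p :: "real^'d => 'd fn" and c :: "'d fn"
 assumes ok: "coef_ok q p c"
begin

text \<open>Below the threshold on \<kappa> the new value is a combination of values of F with
  nonnegative weights of total 1 - 2 \<kappa> c x, the sign of the weights coming from q + h p >=
  0.\<close>

lemma max_step:
 assumes F: "!!y. F y <= R" and \<kappa>: "0 <= \<kappa>" "\<kappa> * (2 * Mx + (1 + h) * Mx * sqrt (real (card V)) / h\<^sup>2) <= 1"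
 shows "F x + \<kappa> * (Lop q p (%_. 0) F x - 2 * c x * F x) <= (1 - 2 * \<kappa> * c x) * R"
proof -
 define \<alpha> where "\<alpha> = (\<Sum>v\<in>V. q v x + h * p v x) / h\<^sup>2"
 have a0: "q v x + h * p v x >= 0" if "v \<in> V" for v using ok that by (simp add: coef_ok_def)
 have "(q v x / h + p v x) * fdiff h v F x <= ((q v x + h * p v x) / h\<^sup>2) * (R - F x)" if "v \<in> V" for v
 proof -
  have "(q v x / h + p v x) * fdiff h v F x = ((q v x + h * p v x) / h\<^sup>2) * (F (x + h *\<^sub>R v) - F x)"
   using hpos by (simp add: fdiff_def field_simps power2_eq_square)
  also have "... <= ((q v x + h * p v x) / h\<^sup>2) * (R - F x)"
   using a0[OF that] F by (intro mult_left_mono) auto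
  finally show ?thesis .
 qed
 then have "Lop q p (%_. 0) F x <= (\<Sum>v\<in>V. ((q v x + h * p v x) / h\<^sup>2) * (R - F x))"
  unfolding Lop_eq by (simp add: sum_mono)
 also have "... = \<alpha> * (R - F x)" by (simp add: \<alpha>_def sum_distrib_right sum_divide_distrib)
 finally have L: "Lop q p (%_. 0) F x <= \<alpha> * (R - F x)" .
 have "\<bar>\<Sum>v\<in>V. q v x\<bar> <= Mx * sqrt (real (card V))" "\<bar>\<Sum>v\<in>V. p v x\<bar> <= Mx * sqrt (real (card V))"
  using coef_sum_bound[OF ok, of "[]" x "%_. 1"] by simp_all
 moreover from this(2) have "h * (\<Sum>v\<in>V. p v x) <= h * (Mx * sqrt (real (card V)))" using hpos by (intro mult_left_mono) auto
 ultimately have "(\<Sum>v\<in>V. q v x + h * p v x) <= (1 + h) * Mx * sqrt (real (card V))"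
  by (simp add: sum.distrib sum_distrib_left[symmetric] algebra_simps)
 then have \<alpha>: "\<alpha> <= (1 + h) * Mx * sqrt (real (card V)) / h\<^sup>2" unfolding \<alpha>_def by (intro divide_right_mono) auto
 have "nb 0 Mx c" using ok by (simp add: coef_ok_def)
 then have "c x <= Mx" by (auto simp: nb0 abs_le_iff)
 then have "\<kappa> * (2 * c x + \<alpha>) <= 1"
  using \<alpha> \<kappa> mult_left_mono[of "2 * c x + \<alpha>" "2 * Mx + (1 + h) * Mx * sqrt (real (card V)) / h\<^sup>2" \<kappa>] by linarith
 then have "0 <= (1 - \<kappa> * \<alpha> - 2 * \<kappa> * c x) * (R - F x)" using F by (intro mult_nonneg_nonneg) (auto simp: algebra_simps)
 moreover have "F x + \<kappa> * (Lop q p (%_. 0) F x - 2 * c x * F x) <= F x + \<kappa> * (\<alpha> * (R - F x) - 2 * c x * F x)"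
  using L \<kappa> by (intro add_left_mono mult_left_mono) auto
 ultimately show ?thesis by (simp add: algebra_simps)
qed

text \<open>The square of D \<mu> of an Euler step has a part linear in \<kappa>, handled by
  \<open>level_ineq\<close> and Young's inequality, and a quadratic part absorbed by the step
  restriction. The maximum principle yields damping 2 c R, the supremum at the top level takes back
  2 (1 - \<delta>) c R, and the remaining 2 \<delta> c R beats the forcing by the choice of
  \<open>RR\<close>.\<close>

lemma step_point:
 assumes su: "smooth u" and sf: "smooth f" and nm: "n <= m" and B: "B >= 0" and A: "A >= 1"
  and low: "!!k. k < n ==> nb k (A * B) u" and nf: "!!k. k <= n ==> nb k B f"
  and wR: "!!y. w n u y <= RR A * B\<^sup>2" and \<kappa>: "\<kappa> > 0" "\<kappa> * Xi n A <= 1"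
 shows "w n (%x. u x + \<kappa> * (Lop q p c u x + f x)) x <= RR A * B\<^sup>2"
proof -
 define R where "R = RR A * B\<^sup>2"
 define g where "g \<mu> = D \<mu> (Lop q p c u) x + D \<mu> f x" for \<mu>
 define X where "X k = (\<Sum>\<mu>\<in>Wd k. 2 * D \<mu> u x * g \<mu>)" for k
 define Y where "Y k = (\<Sum>\<mu>\<in>Wd k. (g \<mu>)\<^sup>2)" for k
 define Q where "Q k = (\<Sum>\<mu>\<in>Wd k. Q_form V q p h (D \<mu> u) x)" for k
 have A0: "A >= 0" and AB: "A * B >= 0" using A B by auto
 have R0: "R >= 0" using RR0[OF A0] by (simp add: R_def)
 have sL: "smooth (Lop q p c u)" by (rule smooth_Lop[OF sm(1)[OF ok] su])
 have cx: "c0 <= c x" "c x <= Mx" using ok by (auto simp: coef_ok_def nb0 abs_le_iff)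
 have dc: "\<delta> * c0 > 0" using d0 c0pos by simp
 have Df: "\<bar>D \<mu> f x\<bar> <= wg \<mu> * B" if "\<mu> \<in> Wd k" "k <= n" for \<mu> k
 proof -
  have "nb 0 (wg \<mu> * B) (D \<mu> f)" using nf[of k] that by (intro nb_D sf) (auto simp: words_length)
  then show ?thesis by (simp add: nb0)
 qed
 have Slow: "S k u y <= Wm * A\<^sup>2 * B\<^sup>2" if "k < n" for k y
  using S_bound[OF su low[OF that] _ AB, of y] that nm by (simp add: power_mult_distrib mult.assoc)
 have Sn: "S n u y <= R" for y using w_ge[of n u y] wR[of y] by (simp add: R_def)
 have WAB0: "Wm * A\<^sup>2 * B\<^sup>2 >= 0" using Wm1 by simp
 \<comment> \<open>Suprema inserted for the \<K> terms: already known at lower levels, the assumed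
   level R at the top.\<close>
 define Sb where "Sb k = (if k < n then Wm * A\<^sup>2 * B\<^sup>2 else R)" for k
 \<comment> \<open>Young parameters: at the top level only \<delta> c0 may be taken from the
   damping; at lower levels S k is already bounded, so 1 will do.\<close>
 define \<gamma> where "\<gamma> k = (if k < n then 1 else \<delta> * c0)" for k
 define Z where "Z k = 2 * (1 - \<delta>) * c x * Sb k + K * (Wm * A\<^sup>2 * B\<^sup>2) + \<gamma> k * S k u x + Wm * (EE A * B)\<^sup>2 / \<gamma> k" for k
 have X: "X k <= Lop q p (%_. 0) (S k u) x - 2 * c x * S k u x + (- \<delta> * Q k + (if k = 0 then 0 else K * Q (k - 1))) + Z k"
  if k: "k <= n" for k
 proof -
  have km: "k <= m" using k nm by simp
  define E where "E \<mu> = (\<Sum>(I, J)\<leftarrow>splits \<mu>. Er q p c u I J x) + D \<mu> f x" for \<mu>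
  have E: "\<bar>E \<mu>\<bar> <= wg \<mu> * (EE A * B)" if \<mu>: "\<mu> \<in> Wd k" for \<mu>
  proof -
   have "\<bar>\<Sum>(I, J)\<leftarrow>splits \<mu>. Er q p c u I J x\<bar> <= wg \<mu> * (2 ^ m * Ce * (A * B))"
    using low k by (intro E_bound[OF ok su _ words_length[OF \<mu>] km AB]) auto
   then have "\<bar>E \<mu>\<bar> <= wg \<mu> * (2 ^ m * Ce * (A * B)) + wg \<mu> * B"
    unfolding E_def using Df[OF \<mu> k] by linarith
   also have "... = wg \<mu> * (EE A * B)" by (simp add: EE_def Ecst_def Ce_def[OF ok] algebra_simps)
   finally show ?thesis .
  qed
  have E2: "(\<Sum>\<mu>\<in>Wd k. (E \<mu>)\<^sup>2) <= Wm * (EE A * B)\<^sup>2"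
   using EE1[OF A0] B by (intro sum_sq_le[OF km E]) auto
  have \<gamma>: "\<gamma> k > 0" using dc by (simp add: \<gamma>_def)
  have "(\<Sum>\<mu>\<in>Wd k. 2 * D \<mu> u x * E \<mu>) <= (\<Sum>\<mu>\<in>Wd k. \<gamma> k * (D \<mu> u x)\<^sup>2 + (E \<mu>)\<^sup>2 / \<gamma> k)"
   by (intro sum_mono two_mult_le \<gamma>)
  also have "... = \<gamma> k * S k u x + (\<Sum>\<mu>\<in>Wd k. (E \<mu>)\<^sup>2) / \<gamma> k"
   by (simp add: grad_sq_def sum.distrib sum_distrib_left sum_divide_distrib)
  also have "... <= \<gamma> k * S k u x + Wm * (EE A * B)\<^sup>2 / \<gamma> k"
   using E2 \<gamma> by (intro add_left_mono divide_right_mono) auto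
  finally have EX: "(\<Sum>\<mu>\<in>Wd k. 2 * D \<mu> u x * E \<mu>) <= \<gamma> k * S k u x + Wm * (EE A * B)\<^sup>2 / \<gamma> k" .
  have "(\<Sum>\<mu>\<in>Wd k. 2 * D \<mu> u x * D \<mu> (Lop q p c u) x) <=
   Lop q p (%_. 0) (S k u) x - 2 * c x * S k u x - \<delta> * Q k + (if k = 0 then 0 else K * Q (k - 1))
   + 2 * (1 - \<delta>) * c x * Sb k + K * (Wm * A\<^sup>2 * B\<^sup>2) + (\<Sum>\<mu>\<in>Wd k. 2 * D \<mu> u x * (\<Sum>(I, J)\<leftarrow>splits \<mu>. Er q p c u I J x))"
   unfolding Q_def
  proof (rule level_ineq[OF ok su km])
   show "S k u y <= Sb k" for y using Slow Sn k unfolding Sb_def by (cases "k < n") auto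
   show "S (k - 1) u y <= Wm * A\<^sup>2 * B\<^sup>2" if "1 <= k" for y using that k by (intro Slow) auto
  qed (rule WAB0)
  moreover have "X k = (\<Sum>\<mu>\<in>Wd k. 2 * D \<mu> u x * D \<mu> (Lop q p c u) x) + (\<Sum>\<mu>\<in>Wd k. 2 * D \<mu> u x * D \<mu> f x)"
   unfolding X_def g_def by (simp add: distrib_left sum.distrib)
  moreover have "(\<Sum>\<mu>\<in>Wd k. 2 * D \<mu> u x * E \<mu>) = (\<Sum>\<mu>\<in>Wd k. 2 * D \<mu> u x * (\<Sum>(I, J)\<leftarrow>splits \<mu>. Er q p c u I J x)) + (\<Sum>\<mu>\<in>Wd k. 2 * D \<mu> u x * D \<mu> f x)"
   unfolding E_def by (simp add: distrib_left sum.distrib)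
  ultimately show ?thesis using EX unfolding Z_def by linarith
 qed
 \<comment> \<open>A bound for all orders up to n including the top one, read off from the
   assumption on w. It enters only the quadratic remainder.\<close>
 define a where "a = A + sqrt (RR A) / \<tau>0 ^ n"
 have aA: "A <= a" using RR0[OF A0] tau0 by (simp add: a_def)
 have all: "nb k (a * B) u" if "k <= n" for k
 proof (cases "k < n")
  case True
  then show ?thesis using low[OF True] aA B by (intro nb_mono[OF low[OF True]] mult_right_mono) auto
 next
  case False
  have "sqrt R / \<tau>0 ^ n = sqrt (RR A) / \<tau>0 ^ n * B" using B by (simp add: R_def real_sqrt_mult)
  also have "... <= a * B" using A B by (intro mult_right_mono) (auto simp: a_def)
  finally show ?thesis using nb_mono[OF nb_of_S[OF su Sn]] False that by auto
 qed
 have aB: "a * B >= 0" using aA A0 B by simp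
 define hb where "hb = 2 ^ m * Ch * a + 1"
 have hb: "hb >= 0" unfolding hb_def using Ch[OF ok] aA A0 by simp
 have Y: "Y k <= Wm * hb\<^sup>2 * B\<^sup>2" if k: "k <= n" for k
 proof -
  have km: "k <= m" using k nm by simp
  have "\<bar>g \<mu>\<bar> <= wg \<mu> * (hb * B)" if \<mu>: "\<mu> \<in> Wd k" for \<mu>
  proof -
   have "\<bar>D \<mu> (Lop q p c u) x\<bar> <= wg \<mu> * (2 ^ m * Ch * (a * B))"
    using all k by (intro D_Lop_bound[OF ok su _ words_length[OF \<mu>] km aB]) auto
   then have "\<bar>g \<mu>\<bar> <= wg \<mu> * (2 ^ m * Ch * (a * B)) + wg \<mu> * B" unfolding g_def using Df[OF \<mu> k] by linarith
   then show ?thesis by (simp add: hb_def algebra_simps)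
  qed
  then have "Y k <= Wm * (hb * B)\<^sup>2" unfolding Y_def using hb B by (intro sum_sq_le[OF km]) auto
  then show ?thesis by (simp add: power_mult_distrib mult.assoc)
 qed
 have Sk: "S k (%x. u x + \<kappa> * (Lop q p c u x + f x)) x = S k u x + \<kappa> * X k + \<kappa> * (\<kappa> * Y k)" for k
 proof -
  have "D \<mu> (%x. u x + \<kappa> * (Lop q p c u x + f x)) x = D \<mu> u x + \<kappa> * g \<mu>" for \<mu>
   using D_lin[OF su smooth_add[OF sL sf], of \<mu> 1 \<kappa>] D_add[OF sL sf, of \<mu>] by (simp add: g_def)
  then show ?thesis
   unfolding grad_sq_def X_def Y_def
   by (simp add: power2_sum sum.distrib sum_distrib_left power2_eq_square algebra_simps)
 qed
 have bz: "bt ^ j >= 0" for j using bt1 by simp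
 have bX: "(\<Sum>k\<le>n. bt ^ (n - k) * X k) <= Lop q p (%_. 0) (w n u) x - 2 * c x * w n u x + (\<Sum>k\<le>n. bt ^ (n - k) * Z k)"
 proof -
  have "(\<Sum>k\<le>n. bt ^ (n - k) * X k) <= (\<Sum>k\<le>n. bt ^ (n - k) * (Lop q p (%_. 0) (S k u) x - 2 * c x * S k u x + (- \<delta> * Q k + (if k = 0 then 0 else K * Q (k - 1))) + Z k))"
   using X bz by (intro sum_mono mult_left_mono) auto
  also have "... = (\<Sum>k\<le>n. bt ^ (n - k) * Lop q p (%_. 0) (S k u) x) - (\<Sum>k\<le>n. bt ^ (n - k) * (2 * c x * S k u x))
    + (\<Sum>k\<le>n. bt ^ (n - k) * (- \<delta> * Q k + (if k = 0 then 0 else K * Q (k - 1)))) + (\<Sum>k\<le>n. bt ^ (n - k) * Z k)"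
   by (simp only: distrib_left right_diff_distrib sum.distrib sum_subtractf)
  also have "(\<Sum>k\<le>n. bt ^ (n - k) * Lop q p (%_. 0) (S k u) x) = Lop q p (%_. 0) (w n u) x"
   unfolding w_def[abs_def] by (rule L0_lin[OF ok, symmetric])
  also have "(\<Sum>k\<le>n. bt ^ (n - k) * (2 * c x * S k u x)) = 2 * c x * w n u x"
   by (simp add: w_def sum_distrib_left mult_ac)
  also have "(\<Sum>k\<le>n. bt ^ (n - k) * (- \<delta> * Q k + (if k = 0 then 0 else K * Q (k - 1)))) = - \<delta> * Q n" by (rule telescope)
  also have "- \<delta> * Q n <= 0" using d0 QS_nonneg[OF ok] by (simp add: Q_def mult_nonneg_nonneg)
  finally show ?thesis by simp
 qed
 define YY where "YY = (2 * Mx + K + 1) * (Wm * A\<^sup>2) + Wm * (EE A)\<^sup>2"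
 have Zlow: "bt ^ (n - k) * Z k <= bt ^ m * YY * B\<^sup>2" if k: "k < n" for k
 proof -
  have "(1 - \<delta>) * c x <= 1 * Mx" using d0 d1 cx c0pos by (intro mult_mono) auto
  then have "2 * ((1 - \<delta>) * c x) * (Wm * A\<^sup>2 * B\<^sup>2) <= 2 * (1 * Mx) * (Wm * A\<^sup>2 * B\<^sup>2)"
   using WAB0 by (intro mult_right_mono mult_left_mono) auto
  then have "Z k <= YY * B\<^sup>2"
   unfolding Z_def Sb_def \<gamma>_def YY_def using k Slow[OF k, of x] by (simp add: algebra_simps power_mult_distrib)
  moreover have "0 <= YY * B\<^sup>2" unfolding YY_def using Mx K1 Wm1 by simp
  ultimately have "bt ^ (n - k) * Z k <= bt ^ m * (YY * B\<^sup>2)"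
   using bt_pow[of k n] k nm bz by (intro order_trans[OF mult_left_mono[of "Z k" "YY * B\<^sup>2"] mult_right_mono]) auto
  then show ?thesis by (simp add: mult.assoc)
 qed
 have "(\<Sum>k\<le>n. bt ^ (n - k) * Z k) = (\<Sum>k<n. bt ^ (n - k) * Z k) + Z n"
  by (simp add: lessThan_Suc_atMost[symmetric])
 also have "(\<Sum>k<n. bt ^ (n - k) * Z k) <= real (card {..<n}) * (bt ^ m * YY * B\<^sup>2)"
  by (rule sum_bounded_above) (use Zlow in auto)
 also have "... <= real m * (bt ^ m * YY * B\<^sup>2)"
  using nm bz Mx K1 Wm1 by (intro mult_right_mono mult_nonneg_nonneg) (auto simp: YY_def)
 finally have bZ1: "(\<Sum>k\<le>n. bt ^ (n - k) * Z k) <= real m * (bt ^ m * YY * B\<^sup>2) + Z n" by simp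
 have "Z n <= 2 * (1 - \<delta>) * c x * R + \<delta> * c0 * R + (K * (Wm * A\<^sup>2) + Wm * (EE A)\<^sup>2 / (\<delta> * c0)) * B\<^sup>2"
  unfolding Z_def Sb_def \<gamma>_def using mult_left_mono[OF Sn[of x], of "\<delta> * c0"] dc
  by (simp add: algebra_simps power_mult_distrib)
 with bZ1 have bZ: "(\<Sum>k\<le>n. bt ^ (n - k) * Z k) <= 2 * (1 - \<delta>) * c x * R + \<delta> * c0 * R + PP A * B\<^sup>2"
  unfolding PP_def Pcst_def YY_def EE_def by (simp add: algebra_simps)
 have bY: "(\<Sum>k\<le>n. bt ^ (n - k) * Y k) <= real (m + 1) * (bt ^ m * (Wm * hb\<^sup>2)) * B\<^sup>2"
 proof -
  have "bt ^ (n - k) * Y k <= bt ^ m * (Wm * hb\<^sup>2 * B\<^sup>2)" if k: "k <= n" for k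
  proof -
   have "0 <= Y k" unfolding Y_def by (simp add: sum_nonneg)
   then show ?thesis using bt_pow[OF k nm] Y[OF k] bz by (intro mult_mono) auto
  qed
  then have "(\<Sum>k\<le>n. bt ^ (n - k) * Y k) <= real (card {..n}) * (bt ^ m * (Wm * hb\<^sup>2 * B\<^sup>2))"
   by (intro sum_bounded_above) auto
  also have "... <= real (m + 1) * (bt ^ m * (Wm * hb\<^sup>2 * B\<^sup>2))"
   using nm bz Wm1 by (intro mult_right_mono mult_nonneg_nonneg) auto
  finally show ?thesis by (simp add: mult.assoc)
 qed
 define t1 t2 where "t1 = 2 * Mx + (1 + h) * Mx * sqrt (real (card V)) / h\<^sup>2" and "t2 = real (m + 1) * (bt ^ m * (Wm * hb\<^sup>2))"
 have Xi: "Xi n A = t1 + t2" by (simp add: Xi_def t1_def t2_def hb_def a_def)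
 have "t1 >= 0" unfolding t1_def using Mx hpos by simp
 have "t2 >= 0" unfolding t2_def using Wm1 bz by simp
 have "\<kappa> * t1 + \<kappa> * t2 <= 1" using \<kappa>(2) by (simp add: Xi distrib_left)
 then have kt1: "\<kappa> * t1 <= 1" and kt2: "\<kappa> * t2 <= 1" using \<kappa>(1) \<open>t1 >= 0\<close> \<open>t2 >= 0\<close>
  by (smt (verit) mult_nonneg_nonneg)+
 have ms: "w n u x + \<kappa> * (Lop q p (%_. 0) (w n u) x - 2 * c x * w n u x) <= (1 - 2 * \<kappa> * c x) * R"
  using wR \<kappa>(1) kt1 by (intro max_step) (auto simp: R_def t1_def)
 have kY: "\<kappa> * (\<Sum>k\<le>n. bt ^ (n - k) * Y k) <= B\<^sup>2"
 proof -
  have "\<kappa> * (\<Sum>k\<le>n. bt ^ (n - k) * Y k) <= \<kappa> * (t2 * B\<^sup>2)" using bY \<kappa>(1) by (intro mult_left_mono) (auto simp: t2_def)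
  also have "... <= 1 * B\<^sup>2" using kt2 by (simp only: mult.assoc[symmetric]) (intro mult_right_mono, auto)
  finally show ?thesis by simp
 qed
 have "w n (%x. u x + \<kappa> * (Lop q p c u x + f x)) x = w n u x + \<kappa> * (\<Sum>k\<le>n. bt ^ (n - k) * X k) + \<kappa> * (\<kappa> * (\<Sum>k\<le>n. bt ^ (n - k) * Y k))"
  unfolding w_def Sk by (simp add: distrib_left sum.distrib sum_distrib_left mult_ac)
 also have "... <= w n u x + \<kappa> * (Lop q p (%_. 0) (w n u) x - 2 * c x * w n u x + (2 * (1 - \<delta>) * c x * R + \<delta> * c0 * R + PP A * B\<^sup>2)) + \<kappa> * B\<^sup>2"
  using bX bZ kY \<kappa>(1) by (intro add_mono add_left_mono mult_left_mono) auto
 also have "... <= (1 - 2 * \<kappa> * c x) * R + \<kappa> * (2 * (1 - \<delta>) * c x * R + \<delta> * c0 * R + PP A * B\<^sup>2) + \<kappa> * B\<^sup>2"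
  using ms by (simp add: algebra_simps)
 also have "... = R + \<kappa> * (\<delta> * c0 * R - 2 * \<delta> * c x * R + (PP A + 1) * B\<^sup>2)" by (simp add: algebra_simps)
 also have "... <= R + \<kappa> * 0"
 \<comment> \<open>Of the damping 2 \<delta> c R one half compensates the Young term \<delta> c0 R,
   the other dominates (P + 1) B^2.\<close>
 proof (intro add_left_mono mult_left_mono)
  have "(PP A + 1) * B\<^sup>2 <= (\<delta> * c0 * RR A) * B\<^sup>2"
   using RR_ge(1)[OF A0] dc by (intro mult_right_mono) (auto simp: field_simps)
  moreover have "\<delta> * c0 * R <= \<delta> * c x * R" using cx d0 R0 by (intro mult_right_mono mult_left_mono) auto
  ultimately show "\<delta> * c0 * R - 2 * \<delta> * c x * R + (PP A + 1) * B\<^sup>2 <= 0" by (simp add: R_def algebra_simps)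
 qed (use \<kappa> in auto)
 finally show ?thesis by (simp add: R_def)
qed

end

section \<open>Iteration of the Euler step\<close>

definition euler where
 "euler J q p c f g \<kappa> u \<longleftrightarrow> u 0 = g \<and> smooth g \<and>
   (\<forall>j<J. coef_ok (q j) (p j) (c j) \<and> smooth (f j) \<and> u (Suc j) = (%x. u j x + \<kappa> * (Lop (q j) (p j) (c j) (u j) x + f j x)))"

lemma euler_smooth:
 assumes "euler J q p c f g \<kappa> u" "j <= J" shows "smooth (u j)"
 using assms(2)
proof (induction j)
 case 0 then show ?case using assms(1) by (simp add: euler_def)
next
 case (Suc j)
 then have "u (Suc j) = (%x. u j x + \<kappa> * (Lop (q j) (p j) (c j) (u j) x + f j x))" "coef_ok (q j) (p j) (c j)" "smooth (f j)" "smooth (u j)"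
  using assms(1) by (auto simp: euler_def)
 then show ?case by (auto intro!: smooth_add smooth_cmult smooth_Lop sm(1))
qed

text \<open>The set where w is at most RR A times B^2 contains the initial data and is invariant
  under Euler steps, so the number of steps does not enter the bound.\<close>

lemma euler_level:
 assumes E: "euler J q p c f g \<kappa> u" and nm: "n <= m" and B: "B >= 0" and A: "A >= 1"
  and nf: "!!j k. j < J ==> k <= n ==> nb k B (f j)" and ng: "!!k. k <= n ==> nb k B g"
  and low: "!!j k. j <= J ==> k < n ==> nb k (A * B) (u j)" and \<kappa>: "\<kappa> > 0" "\<kappa> * Xi n A <= 1"
  and j: "j <= J"
 shows "nb n (sqrt (RR A) / \<tau>0 ^ n * B) (u j)"
proof -
 have "w n (u j) x <= RR A * B\<^sup>2" for x
  using j
 proof (induction j arbitrary: x)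
  case 0
  have "bt ^ (n - k) * S k g x <= bt ^ m * (Wm * B\<^sup>2)" if "k <= n" for k
   using S_bound[OF _ ng[OF that] _ B, of x] E that nm bt_pow[OF that nm] bt1 S_nonneg
   by (intro mult_mono) (auto simp: euler_def)
  then have "w n g x <= real (card {..n}) * (bt ^ m * (Wm * B\<^sup>2))"
   unfolding w_def by (intro sum_bounded_above) auto
  also have "... <= real (m + 1) * (bt ^ m * (Wm * B\<^sup>2))"
   using nm bt1 Wm1 by (intro mult_right_mono) auto
  also have "... <= RR A * B\<^sup>2"
   using mult_right_mono[OF RR_ge(2)[of A], of "B\<^sup>2"] A by (simp add: mult.assoc)
  finally show ?case using E by (simp add: euler_def)
 next
  case (Suc j)
  then have jJ: "j < J" "j <= J" by auto
  have st: "u (Suc j) = (%x. u j x + \<kappa> * (Lop (q j) (p j) (c j) (u j) x + f j x))" "coef_ok (q j) (p j) (c j)" "smooth (f j)"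
   using E jJ by (auto simp: euler_def)
  show ?case unfolding st(1)
   by (rule step_point[OF st(2) euler_smooth[OF E jJ(2)] st(3) nm B A low[OF jJ(2)] nf[OF jJ(1)] Suc.IH[OF jJ(2)] \<kappa>])
 qed
 then have "S n (u j) y <= RR A * B\<^sup>2" for y using w_ge order_trans by blast
 from nb_of_S[OF euler_smooth[OF E j] this] show ?thesis using B by (simp add: real_sqrt_mult)
qed

lemma BB1: "BB n >= 1"
proof (induction n)
 case 0
 show ?case using RR0[of 1] by (simp add: BB_def RR_def)
next
 case (Suc n)
 have "sqrt (RR (BB n)) / \<tau>0 ^ Suc n >= 0" using RR0[of "BB n"] Suc tau0 by simp
 then show ?case using Suc unfolding BB_def RR_def by simp
qed

lemma BB_Suc: "BB n <= BB (Suc n)"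
proof -
 have "sqrt (RR (BB n)) / \<tau>0 ^ Suc n >= 0" using RR0[of "BB n"] BB1[of n] tau0 by simp
 then show ?thesis unfolding BB_def RR_def by simp
qed

text \<open>Induction over the order n, the bounds of lower order being fed into the error terms of
  the next. The threshold \<kappa>0 is fixed before coefficients, data and number of steps; it
  depends on h through \<open>Xi\<close>, whereas \<open>BB\<close> does not.\<close>

theorem euler_bound:
 "n <= m ==> \<exists>\<kappa>0>0. \<forall>J q p c f g \<kappa> u B. euler J q p c f g \<kappa> u --> 0 < \<kappa> --> \<kappa> <= \<kappa>0 --> B >= 0 -->
   (\<forall>j<J. \<forall>k\<le>n. nb k B (f j)) --> (\<forall>k\<le>n. nb k B g) --> (\<forall>j\<le>J. \<forall>k\<le>n. nb k (BB n * B) (u j))"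
proof (induction n)
 case 0
 define \<kappa>0 where "\<kappa>0 = 1 / (1 + \<bar>Xi 0 1\<bar>)"
 have k0: "\<kappa>0 > 0" "\<kappa> * Xi 0 1 <= 1" if "0 < \<kappa>" "\<kappa> <= \<kappa>0" for \<kappa>
 proof -
  have "\<kappa> * Xi 0 1 <= \<kappa>0 * (1 + \<bar>Xi 0 1\<bar>)" using that by (intro order_trans[OF mult_left_mono mult_right_mono, of "Xi 0 1" "1 + \<bar>Xi 0 1\<bar>" \<kappa> \<kappa>0]) auto
  also have "... = 1" unfolding \<kappa>0_def by (simp add: add_nonneg_eq_0_iff)
  finally show "\<kappa> * Xi 0 1 <= 1" .
 qed (simp add: \<kappa>0_def add_pos_nonneg)
 have "nb 0 (BB 0 * B) (u j)" if "euler J q p c f g \<kappa> u" "0 < \<kappa>" "\<kappa> <= \<kappa>0" "B >= 0"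
   "\<forall>j<J. \<forall>k\<le>0. nb k B (f j)" "\<forall>k\<le>0. nb k B g" "j <= J" for J q p c f g \<kappa> u B j
 proof -
  have "nb 0 (sqrt (RR 1) / \<tau>0 ^ 0 * B) (u j)"
   by (rule euler_level[OF that(1) _ that(4) _ _ _ _ that(2) k0(2)[OF that(2,3)] that(7)]) (use that in auto)
  then show ?thesis
   by (rule nb_mono) (use that in \<open>auto simp: BB_def RR_def intro!: mult_right_mono\<close>)
 qed
 then show ?case by (intro exI[of _ \<kappa>0]) (auto simp: \<kappa>0_def add_pos_nonneg)
next
 case (Suc n)
 then obtain \<kappa>1 where k1: "\<kappa>1 > 0" "!!J q p c f g \<kappa> u B j k. euler J q p c f g \<kappa> u ==> 0 < \<kappa> ==> \<kappa> <= \<kappa>1 ==> B >= 0 ==>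
   (\<forall>j<J. \<forall>k\<le>n. nb k B (f j)) ==> (\<forall>k\<le>n. nb k B g) ==> j <= J ==> k <= n ==> nb k (BB n * B) (u j)" by auto
 define X where "X = Xi (Suc n) (BB n)"
 define \<kappa>0 where "\<kappa>0 = min \<kappa>1 (1 / (1 + \<bar>X\<bar>))"
 have k0: "\<kappa>0 > 0" unfolding \<kappa>0_def using k1(1) by (simp add: add_pos_nonneg)
 have kX: "\<kappa> * X <= 1" if "0 < \<kappa>" "\<kappa> <= \<kappa>0" for \<kappa>
 proof -
  have "\<kappa> * X <= (1 / (1 + \<bar>X\<bar>)) * (1 + \<bar>X\<bar>)"
   using that by (intro order_trans[OF mult_left_mono mult_right_mono, of X "1 + \<bar>X\<bar>" \<kappa>]) (auto simp: \<kappa>0_def)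
  also have "... = 1" by (simp add: add_nonneg_eq_0_iff)
  finally show ?thesis .
 qed
 have "nb k (BB (Suc n) * B) (u j)" if "euler J q p c f g \<kappa> u" "0 < \<kappa>" "\<kappa> <= \<kappa>0" "B >= 0"
   "\<forall>j<J. \<forall>k\<le>Suc n. nb k B (f j)" "\<forall>k\<le>Suc n. nb k B g" "j <= J" "k <= Suc n" for J q p c f g \<kappa> u B j k
 proof -
  have low: "nb k (BB n * B) (u j)" if "k <= n" "j <= J" for j k
   using k1(2)[OF \<open>euler J q p c f g \<kappa> u\<close> \<open>0 < \<kappa>\<close> _ \<open>B >= 0\<close>] \<open>\<kappa> <= \<kappa>0\<close> that
    \<open>\<forall>j<J. \<forall>k\<le>Suc n. nb k B (f j)\<close> \<open>\<forall>k\<le>Suc n. nb k B g\<close> by (simp add: \<kappa>0_def)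
  show ?thesis
  proof (cases "k <= n")
   case True
   show ?thesis by (rule nb_mono[OF low[OF True that(7)]]) (use BB_Suc that in \<open>auto intro: mult_right_mono\<close>)
  next
   case False
   then have k: "k = Suc n" using that by simp
   have "nb (Suc n) (sqrt (RR (BB n)) / \<tau>0 ^ Suc n * B) (u j)"
    by (rule euler_level[OF that(1) Suc.prems that(4) BB1 _ _ _ that(2) kX[OF that(2,3), unfolded X_def] that(7)])
      (use that low in auto)
   then show ?thesis unfolding k
   proof (rule nb_mono)
    show "sqrt (RR (BB n)) / \<tau>0 ^ Suc n * B <= BB (Suc n) * B"
     using BB1[of n] that(4) by (intro mult_right_mono) (auto simp: BB_def RR_def)
   qed
  qed
 qed
 then show ?case using k0 by (intro exI[of _ \<kappa>0]) auto
qed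

end

section \<open>The structural inequalities for averaged coefficients\<close>

lemma hb_le:
 assumes "has_bochner_integral M f (a::real)" "has_bochner_integral M g b" "!!w. w \<in> space M ==> f w <= g w"
 shows "a <= b"
 using assms by (metis has_bochner_integral_iff integral_mono)

text \<open>Positivity is applied to B - F, together with the bound for the image of 1. This lets
  suprema replace the operators \<K>.\<close>

lemma KK_le:
 assumes K: "in_KK \<K>" and F: "bdd_borel F" "!!x. F x <= B" and B: "B >= 0"
 shows "\<K> F x <= B"
proof -
 have one: "bdd_borel (%_::real^'a. 1)" by (simp add: bdd_borel_def)
 have d: "bdd_borel (%x. B * 1 + (-1) * F x)"
 proof -
  obtain C where "!!x. \<bar>F x\<bar> <= C" using F(1) unfolding bdd_borel_def bounded_iff by auto
  note C = this
  have "\<bar>B * 1 + (-1) * F x\<bar> <= B + C" for x using B C[of x] by linarith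
  then have "bounded (range (%x. B * 1 + (-1) * F x))" unfolding bounded_iff
   by (intro exI[of _ "B + C"]) auto
  then show ?thesis using F(1) by (auto simp: bdd_borel_def)
 qed
 have "\<K> (%x. B * 1 + (-1) * F x) = (%x. B * \<K> (%_. 1) x + (-1) * \<K> F x)"
  using K one F(1) unfolding in_KK_def by blast
 moreover have "\<forall>x. 0 <= \<K> (%x. B * 1 + (-1) * F x) x"
  using K d F(2) unfolding in_KK_def by (simp add: algebra_simps)
 ultimately have "0 <= B * \<K> (%_. 1) x + (-1) * \<K> F x" by metis
 moreover have "B * \<K> (%_. 1) x <= B * 1" using K B unfolding in_KK_def by (intro mult_left_mono) auto
 ultimately show ?thesis by simp
qed

lemma bdd_borel_sum: "finite X ==> (!!\<rho>. \<rho> \<in> X ==> bdd_borel (F \<rho>)) ==> bdd_borel (%x. \<Sum>\<rho>\<in>X. F \<rho> x)"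
proof (induction X rule: finite_induct)
 case (insert \<rho> X)
 then have "bdd_borel (F \<rho>)" "bdd_borel (%x. \<Sum>\<rho>\<in>X. F \<rho> x)" by auto
 then obtain C D where "!!x. \<bar>F \<rho> x\<bar> <= C" "!!x. \<bar>\<Sum>\<rho>\<in>X. F \<rho> x\<bar> <= D" "F \<rho> \<in> borel_measurable borel" "(%x. \<Sum>\<rho>\<in>X. F \<rho> x) \<in> borel_measurable borel"
  unfolding bdd_borel_def bounded_iff by auto
 then have "!!x. \<bar>F \<rho> x + (\<Sum>\<rho>\<in>X. F \<rho> x)\<bar> <= C + D" by (meson abs_triangle_ineq add_mono order_trans)
 moreover have "(%x. F \<rho> x + (\<Sum>\<rho>\<in>X. F \<rho> x)) \<in> borel_measurable borel"
  by (intro borel_measurable_add \<open>F \<rho> \<in> borel_measurable borel\<close> \<open>(%x. \<Sum>\<rho>\<in>X. F \<rho> x) \<in> borel_measurable borel\<close>)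
 ultimately show ?case using insert.hyps
  unfolding bdd_borel_def bounded_iff by (auto intro!: exI[of _ "C + D"])
qed (simp add: bdd_borel_def)

lemma KK_sum:
 assumes K: "in_KK \<K>" and X: "finite X" "!!\<rho>. \<rho> \<in> X ==> bdd_borel (F \<rho>)"
 shows "\<K> (%x. \<Sum>\<rho>\<in>X. F \<rho> x) x = (\<Sum>\<rho>\<in>X. \<K> (F \<rho>) x)"
 using X
proof (induction X rule: finite_induct)
 case empty
 have z: "bdd_borel (%_::real^'a. 0)" by (simp add: bdd_borel_def)
 have lin: "\<forall>F G a b. bdd_borel F \<and> bdd_borel G --> \<K> (%x. a * F x + b * G x) = (%x. a * \<K> F x + b * \<K> G x)"
  using K unfolding in_KK_def by blast
 show ?case using lin[rule_format, of "%_. 0" "%_. 0" 0 0] z by (simp add: fun_eq_iff)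
next
 case (insert \<rho> X)
 then have "bdd_borel (F \<rho>)" "bdd_borel (%x. \<Sum>\<rho>\<in>X. F \<rho> x)" by (auto intro: bdd_borel_sum)
 then have "\<K> (%x. 1 * F \<rho> x + 1 * (\<Sum>\<rho>\<in>X. F \<rho> x)) = (%x. 1 * \<K> (F \<rho>) x + 1 * \<K> (%x. \<Sum>\<rho>\<in>X. F \<rho> x) x)"
  using K unfolding in_KK_def by blast
 then show ?case using insert by (simp add: fun_eq_iff)
qed

section \<open>Translation, averaging and mollification of admissible coefficients\<close>

context scheme
begin

lemma AFz_translate: "smooth \<phi> ==> AFz q p (%y. \<phi> (y + a)) x z = AFz q p \<phi> x (z + a)"
 by (simp add: AFz_def D_shift T_eq fdiff_shift) (simp add: fdiff_def add_ac)

lemma QFz_translate: "QFz q p (%y. \<phi> (y + a)) x z = QFz q p \<phi> x (z + a)"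
 by (simp add: QFz_def fdiff_shift)

lemma QOz_translate: "QOz q \<mu> (T \<mu> (%y. \<phi> (y + a))) x z = QOz q \<mu> (T \<mu> \<phi>) x (z + a)"
 by (simp add: QOz_def T_eq fdiff_def add_ac)

lemma S_translate: "smooth \<phi> ==> S k (%y. \<phi> (y + a)) x = S k \<phi> (x + a)"
 by (simp add: grad_sq_def D_shift)

lemma S_measurable: "smooth \<phi> ==> S k \<phi> \<in> borel_measurable borel"
 unfolding grad_sq_def[abs_def]
 by (intro borel_measurable_continuous_onI continuous_on_sum continuous_on_power continuous_on_rabs smooth_continuous smooth_D)

lemma S_bdd_borel: "smooth \<phi> ==> (!!y. S k \<phi> y <= B) ==> bdd_borel (S k \<phi>) \<and> bounded (range (S k \<phi>))"
 unfolding bdd_borel_def bounded_iff using S_measurable S_nonneg by (auto intro!: exI[of _ B])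

lemma QFz_nonneg: "(!!v. v \<in> V ==> q v x + h * p v x >= 0) ==> QFz q p \<phi> x z >= 0"
 unfolding QFz_def by (intro sum_nonneg mult_nonneg_nonneg) auto

text \<open>A supremum over the whole space does not notice a translation of \<phi>, so the
  evaluation point z of the test function may be moved to x before \<K> is bounded by
  \<open>KK_le\<close>.\<close>

lemma SI1_of_structural:
 assumes K: "in_KK \<K>" and m: "m >= 1"
  and st: "!!\<phi> x. smooth \<phi> ==> bounded (range (S 1 \<phi>)) ==>
    real m * A_form V \<tau> \<tau>0 e q p h \<phi> x <= (1 - \<delta>) * (\<Sum>\<mu>\<in>Wd 1. Q_form V q p h (D \<mu> \<phi>) x)
     + K * Q_form V q p h \<phi> x + 2 * (1 - \<delta>) * c x * \<K> (S 1 \<phi>) x"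
  and qp: "!!v x. v \<in> V ==> q v x + h * p v x >= 0" and c: "!!x. c x >= 0"
 shows "SI1 q p c"
 unfolding SI1_def
proof (intro allI impI)
 fix \<phi> B x z assume a: "smooth \<phi> \<and> (\<forall>y. S 1 \<phi> y <= B)"
 define \<psi> where "\<psi> y = \<phi> (y + (z - x))" for y
 have s: "smooth \<psi>" unfolding \<psi>_def using a by (intro smooth_shift) simp
 have SB: "S 1 \<psi> y <= B" for y unfolding \<psi>_def using a by (simp add: S_translate)
 have B: "B >= 0" using SB[of x] S_nonneg[of 1 \<psi> x] by linarith
 have bd: "bdd_borel (S 1 \<psi>)" "bounded (range (S 1 \<psi>))" using S_bdd_borel[OF s SB] by auto
 have KS: "\<K> (S 1 \<psi>) x <= B" by (rule KK_le[OF K bd(1) SB B])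
 have "real m * AFz q p \<psi> x x <= (1 - \<delta>) * (\<Sum>\<mu>\<in>Wd 1. QFz q p (D \<mu> \<psi>) x x) + K * QFz q p \<psi> x x + 2 * (1 - \<delta>) * c x * \<K> (S 1 \<psi>) x"
  unfolding AFz_eq QFz_eq by (rule st[OF s bd(2)])
 also have "... <= (1 - \<delta>) * (\<Sum>\<mu>\<in>Wd 1. QFz q p (D \<mu> \<psi>) x x) + K * QFz q p \<psi> x x + 2 * (1 - \<delta>) * c x * B"
  using KS c[of x] d1 by (intro add_left_mono mult_left_mono) auto
 finally have *: "real m * AFz q p \<psi> x x <= ..." .
 \<comment> \<open>Level 1 calls for the form without the factor m that the hypothesis carries; as
   the right side is nonnegative, dropping the factor is harmless whatever the sign of
   \<open>AFz\<close>.\<close>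
 have "0 <= (1 - \<delta>) * (\<Sum>\<mu>\<in>Wd 1. QFz q p (D \<mu> \<psi>) x x) + K * QFz q p \<psi> x x + 2 * (1 - \<delta>) * c x * B"
  using d1 K1 c[of x] B by (intro add_nonneg_nonneg mult_nonneg_nonneg sum_nonneg QFz_nonneg qp) auto
 moreover have "AFz q p \<psi> x x <= real m * AFz q p \<psi> x x" if "AFz q p \<psi> x x >= 0"
  using mult_right_mono[OF _ that, of 1 "real m"] m by simp
 ultimately have "AFz q p \<psi> x x <= (1 - \<delta>) * (\<Sum>\<mu>\<in>Wd 1. QFz q p (D \<mu> \<psi>) x x) + K * QFz q p \<psi> x x + 2 * (1 - \<delta>) * c x * B"
  using * by linarith
 then show "AFz q p \<phi> x z <= (1 - \<delta>) * (\<Sum>\<mu>\<in>Wd 1. QFz q p (D \<mu> \<phi>) x z) + K * QFz q p \<phi> x z + 2 * (1 - \<delta>) * c x * B"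
  unfolding \<psi>_def using a by (simp add: AFz_translate D_shift QFz_translate)
qed

text \<open>The inequalities are summed over the family before \<K> is bounded; additivity of \<K>
  then makes the supremum of the sum appear.\<close>

lemma SI2_of_structural:
 assumes K: "in_KK \<K>"
  and st: "!!\<phi> x. smooth \<phi> ==> bounded (range (S 1 \<phi>)) ==> bounded (range (S 2 \<phi>)) ==>
    real n * (\<Sum>\<nu>\<in>Wd 1. A_form V \<tau> \<tau>0 e q p h (D \<nu> \<phi>) x)
     + real n * (real n - 1) * (\<Sum>\<mu>\<in>Wd 2. D \<mu> \<phi> x * Q_op V \<tau> \<tau>0 e q h \<mu> (T \<mu> \<phi>) x)
    <= (1 - \<delta>) * (\<Sum>\<mu>\<in>Wd 2. Q_form V q p h (D \<mu> \<phi>) x) + K * (\<Sum>\<mu>\<in>Wd 1. Q_form V q p h (D \<mu> \<phi>) x)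
     + 2 * (1 - \<delta>) * c x * \<K> (S 2 \<phi>) x + K * \<K> (S 1 \<phi>) x"
  and c: "!!x. c x >= 0"
 shows "SI2 n q p c"
 unfolding SI2_def
proof (intro allI impI, elim conjE)
 fix X :: "(real^'d) list set" and \<phi> :: "(real^'d) list => 'd fn" and B1 B2 x z
 assume X: "finite X" and s\<phi>: "\<forall>\<rho>\<in>X. smooth (\<phi> \<rho>)" and B2: "\<forall>y. (\<Sum>\<rho>\<in>X. S 2 (\<phi> \<rho>) y) <= B2" and B1: "\<forall>y. (\<Sum>\<rho>\<in>X. S 1 (\<phi> \<rho>) y) <= B1"
 define \<psi> where "\<psi> \<rho> y = \<phi> \<rho> (y + (z - x))" for \<rho> y
 have s: "smooth (\<psi> \<rho>)" if "\<rho> \<in> X" for \<rho> unfolding \<psi>_def using s\<phi> that by (intro smooth_shift) simp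
 have SS: "(\<Sum>\<rho>\<in>X. S k (\<psi> \<rho>) y) = (\<Sum>\<rho>\<in>X. S k (\<phi> \<rho>) (y + (z - x)))" for k y
  unfolding \<psi>_def using s\<phi> by (intro sum.cong) (auto simp: S_translate)
 have B: "(\<Sum>\<rho>\<in>X. S 2 (\<psi> \<rho>) y) <= B2" "(\<Sum>\<rho>\<in>X. S 1 (\<psi> \<rho>) y) <= B1" for y unfolding SS using B1 B2 by auto
 have "(\<Sum>\<rho>\<in>X. S 2 (\<psi> \<rho>) x) >= 0" "(\<Sum>\<rho>\<in>X. S 1 (\<psi> \<rho>) x) >= 0" by (intro sum_nonneg S_nonneg)+
 then have B0: "B2 >= 0" "B1 >= 0" using B[of x] by linarith+
 have Sle: "S 2 (\<psi> \<rho>) y <= B2" "S 1 (\<psi> \<rho>) y <= B1" if "\<rho> \<in> X" for \<rho> y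
  using member_le_sum[OF that, of "%\<rho>. S 2 (\<psi> \<rho>) y", OF S_nonneg X]
   member_le_sum[OF that, of "%\<rho>. S 1 (\<psi> \<rho>) y", OF S_nonneg X] B[of y] by linarith+
 have bd2: "bdd_borel (S 2 (\<psi> \<rho>))" "bounded (range (S 2 (\<psi> \<rho>)))" if "\<rho> \<in> X" for \<rho> using S_bdd_borel[OF s[OF that] Sle(1)[OF that]] by auto
 have bd1: "bdd_borel (S 1 (\<psi> \<rho>))" "bounded (range (S 1 (\<psi> \<rho>)))" if "\<rho> \<in> X" for \<rho> using S_bdd_borel[OF s[OF that] Sle(2)[OF that]] by auto
 have K2: "(\<Sum>\<rho>\<in>X. \<K> (S 2 (\<psi> \<rho>)) x) <= B2"
  using KK_le[OF K bdd_borel_sum[OF X bd2(1)] B(1) B0(1)] KK_sum[OF K X bd2(1)] by simp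
 have K1': "(\<Sum>\<rho>\<in>X. \<K> (S 1 (\<psi> \<rho>)) x) <= B1"
  using KK_le[OF K bdd_borel_sum[OF X bd1(1)] B(2) B0(2)] KK_sum[OF K X bd1(1)] by simp
 have "(\<Sum>\<rho>\<in>X. real n * (\<Sum>\<nu>\<in>Wd 1. AFz q p (D \<nu> (\<psi> \<rho>)) x x)
    + real n * (real n - 1) * (\<Sum>\<mu>\<in>Wd 2. D \<mu> (\<psi> \<rho>) x * QOz q \<mu> (T \<mu> (\<psi> \<rho>)) x x))
   <= (\<Sum>\<rho>\<in>X. (1 - \<delta>) * (\<Sum>\<mu>\<in>Wd 2. QFz q p (D \<mu> (\<psi> \<rho>)) x x) + K * (\<Sum>\<mu>\<in>Wd 1. QFz q p (D \<mu> (\<psi> \<rho>)) x x)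
    + 2 * (1 - \<delta>) * c x * \<K> (S 2 (\<psi> \<rho>)) x + K * \<K> (S 1 (\<psi> \<rho>)) x)"
  unfolding AFz_eq QFz_eq QOz_eq by (intro sum_mono st s bd1 bd2)
 also have "... = (\<Sum>\<rho>\<in>X. (1 - \<delta>) * (\<Sum>\<mu>\<in>Wd 2. QFz q p (D \<mu> (\<psi> \<rho>)) x x) + K * (\<Sum>\<mu>\<in>Wd 1. QFz q p (D \<mu> (\<psi> \<rho>)) x x))
    + 2 * (1 - \<delta>) * c x * (\<Sum>\<rho>\<in>X. \<K> (S 2 (\<psi> \<rho>)) x) + K * (\<Sum>\<rho>\<in>X. \<K> (S 1 (\<psi> \<rho>)) x)"
  by (simp only: sum.distrib sum_distrib_left)
 also have "... <= (\<Sum>\<rho>\<in>X. (1 - \<delta>) * (\<Sum>\<mu>\<in>Wd 2. QFz q p (D \<mu> (\<psi> \<rho>)) x x) + K * (\<Sum>\<mu>\<in>Wd 1. QFz q p (D \<mu> (\<psi> \<rho>)) x x))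
    + 2 * (1 - \<delta>) * c x * B2 + K * B1"
  using K2 K1' c[of x] d1 K1 by (intro add_mono order_refl mult_left_mono) auto
 finally have "(\<Sum>\<rho>\<in>X. real n * (\<Sum>\<nu>\<in>Wd 1. AFz q p (D \<nu> (\<psi> \<rho>)) x x)
    + real n * (real n - 1) * (\<Sum>\<mu>\<in>Wd 2. D \<mu> (\<psi> \<rho>) x * QOz q \<mu> (T \<mu> (\<psi> \<rho>)) x x)) <= ..." .
 moreover have "(\<Sum>\<rho>\<in>X. real n * (\<Sum>\<nu>\<in>Wd 1. AFz q p (D \<nu> (\<psi> \<rho>)) x x)
    + real n * (real n - 1) * (\<Sum>\<mu>\<in>Wd 2. D \<mu> (\<psi> \<rho>) x * QOz q \<mu> (T \<mu> (\<psi> \<rho>)) x x)) =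
   (\<Sum>\<rho>\<in>X. real n * (\<Sum>\<nu>\<in>Wd 1. AFz q p (D \<nu> (\<phi> \<rho>)) x z)
    + real n * (real n - 1) * (\<Sum>\<mu>\<in>Wd 2. D \<mu> (\<phi> \<rho>) z * QOz q \<mu> (T \<mu> (\<phi> \<rho>)) x z))"
  by (rule sum.cong[OF refl]) (use s\<phi> in \<open>simp add: \<psi>_def[abs_def] AFz_translate QOz_translate D_shift smooth_D\<close>)
 moreover have "(\<Sum>\<rho>\<in>X. (1 - \<delta>) * (\<Sum>\<mu>\<in>Wd 2. QFz q p (D \<mu> (\<psi> \<rho>)) x x) + K * (\<Sum>\<mu>\<in>Wd 1. QFz q p (D \<mu> (\<psi> \<rho>)) x x))
   = (\<Sum>\<rho>\<in>X. (1 - \<delta>) * (\<Sum>\<mu>\<in>Wd 2. QFz q p (D \<mu> (\<phi> \<rho>)) x z) + K * (\<Sum>\<mu>\<in>Wd 1. QFz q p (D \<mu> (\<phi> \<rho>)) x z))"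
  by (rule sum.cong[OF refl]) (use s\<phi> in \<open>simp add: \<psi>_def[abs_def] QFz_translate D_shift\<close>)
 ultimately show "(\<Sum>\<rho>\<in>X. real n * (\<Sum>\<nu>\<in>Wd 1. AFz q p (D \<nu> (\<phi> \<rho>)) x z)
    + real n * (real n - 1) * (\<Sum>\<mu>\<in>Wd 2. D \<mu> (\<phi> \<rho>) z * QOz q \<mu> (T \<mu> (\<phi> \<rho>)) x z))
   <= (\<Sum>\<rho>\<in>X. (1 - \<delta>) * (\<Sum>\<mu>\<in>Wd 2. QFz q p (D \<mu> (\<phi> \<rho>)) x z) + K * (\<Sum>\<mu>\<in>Wd 1. QFz q p (D \<mu> (\<phi> \<rho>)) x z))
    + 2 * (1 - \<delta>) * c x * B2 + K * B1" by simp
qed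

lemma Xc_Dv:
 assumes X: "Xc n C \<phi>" and n: "2 <= n"
 shows "Xc (n - 1) (\<bar>\<tau> v / h\<bar> * (2 * C) + \<bar>\<tau>0\<bar> * C) (Dv v \<phi>)"
proof -
 have C: "C >= 0" by (rule Xc_nonneg[OF X])
 have "Xc n (\<bar>\<tau> v / h\<bar> * (C + C)) (%x. \<tau> v / h * (\<phi> (x + h *\<^sub>R v) - \<phi> x))"
  by (intro Xc_cmult Xc_diff Xc_shift X)
 then have 1: "Xc (n - 1) (\<bar>\<tau> v / h\<bar> * (2 * C) + \<bar>\<tau>0\<bar> * C) (%x. \<tau> v / h * (\<phi> (x + h *\<^sub>R v) - \<phi> x))"
  by (rule Xc_le[OF Xc_mono]) (use C in auto)
 have "Xc (n - 1) (\<bar>\<tau>0\<bar> * C) (%x. \<tau>0 * D1 (inv e v) \<phi> x)"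
  using Xc_D1[of "n - 1" C \<phi>] X n by (intro Xc_cmult) simp
 then have 2: "Xc (n - 1) (\<bar>\<tau> v / h\<bar> * (2 * C) + \<bar>\<tau>0\<bar> * C) (%x. \<tau>0 * D1 (inv e v) \<phi> x)"
  by (rule Xc_mono) (use C in auto)
 show ?thesis unfolding bdiff1_def using 1 2 by simp
qed

lemma Dv_shift_X: "Xc n C \<phi> ==> 2 <= n ==> Dv v (%x. \<phi> (x + a)) = (%x. Dv v \<phi> (x + a))"
 unfolding bdiff1_def by (auto simp: D1_shift add_ac)

lemma words_le_2: "length \<mu> <= 2 ==> \<mu> = [] \<or> (\<exists>v. \<mu> = [v]) \<or> (\<exists>v w. \<mu> = [v, w])"
 by (cases \<mu>; cases "tl \<mu>") auto

text \<open>The forms act on the coefficients by words of length at most two, and three orders of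
  differences keep the derivatives involved continuous, hence compatible with translation at every
  point.\<close>

lemma D_shift_X:
 assumes X: "Xc 3 C \<phi>" and \<mu>: "length \<mu> <= 2"
 shows "D \<mu> (%x. \<phi> (x + a)) x = D \<mu> \<phi> (x + a)"
proof -
 have 1: "Dv v (%x. \<phi> (x + a)) = (%x. Dv v \<phi> (x + a))" for v by (rule Dv_shift_X[OF X]) simp
 have "Xc 2 (\<bar>\<tau> v / h\<bar> * (2 * C) + \<bar>\<tau>0\<bar> * C) (Dv v \<phi>)" for v using Xc_Dv[OF X] by simp
 then have "Dv u (%x. Dv v \<phi> (x + a)) = (%x. Dv u (Dv v \<phi>) (x + a))" for u v by (rule Dv_shift_X) simp
 with 1 show ?thesis using words_le_2[OF \<mu>] by auto
qed

lemma avg_Dv: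
 assumes M: "prob_space M" and i: "!!x. integrable M (%w. \<Phi> w x)"
  and X: "!!w. w \<in> space M ==> Xc n C (\<Phi> w)" and n: "2 <= n"
 shows "integrable M (%w. Dv v (\<Phi> w) x)" "Dv v (%x. \<integral>w. \<Phi> w x \<partial>M) x = (\<integral>w. Dv v (\<Phi> w) x \<partial>M)"
 using D1_avg[OF M i X n, of "inv e v" x] i unfolding bdiff1_def by (cases "v \<in> V"; simp)+

lemma avg_D:
 assumes M: "prob_space M" and i: "!!x. integrable M (%w. \<Phi> w x)"
  and X: "!!w. w \<in> space M ==> Xc 3 C (\<Phi> w)" and \<mu>: "length \<mu> <= 2"
 shows "has_bochner_integral M (%w. D \<mu> (\<Phi> w) x) (D \<mu> (%x. \<integral>w. \<Phi> w x \<partial>M) x)"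
proof -
 consider "\<mu> = []" | v where "\<mu> = [v]" | v u where "\<mu> = [v, u]" using words_le_2[OF \<mu>] by blast
 then show ?thesis
 proof cases
  case 1 then show ?thesis using i by (simp add: has_bochner_integral_iff)
 next
  case (2 v)
  show ?thesis using avg_Dv[OF M i X, of v x] by (simp add: 2 has_bochner_integral_iff)
 next
  case (3 v u)
  have i': "integrable M (%w. Dv u (\<Phi> w) x)" and e: "Dv u (%x. \<integral>w. \<Phi> w x \<partial>M) x = (\<integral>w. Dv u (\<Phi> w) x \<partial>M)" for x
   using avg_Dv[OF M i X, of u x] by auto
  have X': "Xc 2 (\<bar>\<tau> u / h\<bar> * (2 * C) + \<bar>\<tau>0\<bar> * C) (Dv u (\<Phi> w))" if "w \<in> space M" for w
   using Xc_Dv[OF X[OF that]] by simp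
  have "Dv u (%x. \<integral>w. \<Phi> w x \<partial>M) = (%x. \<integral>w. Dv u (\<Phi> w) x \<partial>M)" using e by blast
  then show ?thesis using avg_Dv[OF M i' X', of v x] by (simp add: 3 has_bochner_integral_iff)
 qed
qed

text \<open>The conditions of \<open>coef_ok\<close> with difference bounds in place of smoothness:
  they hold for the given coefficients at a fixed time and are stable under translation and
  averaging.\<close>

definition rough_ok where
 "rough_ok q p c \<longleftrightarrow>
  (\<forall>s. (\<Sum>v\<in>V. (s v)\<^sup>2) <= 1 --> Xc m Mx (%x. \<Sum>v\<in>V. s v * q v x) \<and> Xc m Mx (%x. \<Sum>v\<in>V. s v * p v x)) \<and>
  Xc m Mx c \<and> (\<forall>x i. (\<Sum>v\<in>V. v $ i * q v x) = 0) \<and>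
  (\<forall>v\<in>V. \<forall>x. q v x + h * p v x >= 0) \<and> (\<forall>x. c x >= c0) \<and> SI1 q p c \<and> (\<forall>n\<in>{2..m}. SI2 n q p c)"

lemma rough_single:
 assumes "rough_ok q p c" "v \<in> V"
 shows "Xc m Mx (q v)" "Xc m Mx (p v)"
proof -
 define s where "s u = (if u = v then 1 else 0 :: real)" for u
 have "(\<Sum>u\<in>V. (s u)\<^sup>2) = (\<Sum>u\<in>V. if u = v then 1 else 0)" by (intro sum.cong) (auto simp: s_def)
 then have "(\<Sum>u\<in>V. (s u)\<^sup>2) <= 1" using assms fin by simp
 note s = this
 have e: "(%x. \<Sum>u\<in>V. s u * r u x) = r v" for r :: "real^'d => 'd fn"
 proof
  fix x
  have "(\<Sum>u\<in>V. s u * r u x) = (\<Sum>u\<in>V. if u = v then r v x else 0)" by (intro sum.cong) (auto simp: s_def)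
  then show "(\<Sum>u\<in>V. s u * r u x) = r v x" using assms fin by simp
 qed
 have "\<forall>s. (\<Sum>v\<in>V. (s v)\<^sup>2) <= 1 --> Xc m Mx (%x. \<Sum>v\<in>V. s v * q v x) \<and> Xc m Mx (%x. \<Sum>v\<in>V. s v * p v x)"
  using assms(1) unfolding rough_ok_def by blast
 from this[rule_format, OF s] show "Xc m Mx (q v)" "Xc m Mx (p v)" unfolding e by auto
qed

lemma rough_shift:
 assumes r: "rough_ok q p c" and m: "3 <= m"
 shows "rough_ok (%v x. q v (x + a)) (%v x. p v (x + a)) (%x. c (x + a))"
proof -
 have X3: "Xc 3 Mx (q v)" "Xc 3 Mx (p v)" if "v \<in> V" for v
  using rough_single[OF r that] m by (auto intro: Xc_le)
 have A: "AFz (%v x. q v (x + a)) (%v x. p v (x + a)) \<phi> x z = AFz q p \<phi> (x + a) z" for \<phi> x z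
  unfolding AFz_def by (auto simp: D_shift_X[OF X3(1)] D_shift_X[OF X3(2)] words_length intro!: sum.cong)
 have Q: "QFz (%v x. q v (x + a)) (%v x. p v (x + a)) \<phi> x z = QFz q p \<phi> (x + a) z" for \<phi> x z
  unfolding QFz_def ..
 have O: "\<mu> \<in> Wd 2 ==> QOz (%v x. q v (x + a)) \<mu> \<psi> x z = QOz q \<mu> \<psi> (x + a) z" for \<psi> x z \<mu>
  unfolding QOz_def by (auto simp: D_shift_X[OF X3(1)] words_length intro!: sum.cong)
 have "SI1 (%v x. q v (x + a)) (%v x. p v (x + a)) (%x. c (x + a))"
  using r unfolding rough_ok_def SI1_def A Q by blast
 moreover have "SI2 n (%v x. q v (x + a)) (%v x. p v (x + a)) (%x. c (x + a))" if n: "n \<in> {2..m}" for n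
 proof -
  have S: "SI2 n q p c" using r n by (simp add: rough_ok_def)
  show ?thesis unfolding SI2_def A Q using S unfolding SI2_def by (simp add: O cong: sum.cong)
 qed
 moreover have "Xc m Mx (%x. \<Sum>v\<in>V. s v * q v (x + a)) \<and> Xc m Mx (%x. \<Sum>v\<in>V. s v * p v (x + a))"
  if "(\<Sum>v\<in>V. (s v)\<^sup>2) <= 1" for s
 proof -
  have "Xc m Mx (%x. \<Sum>v\<in>V. s v * q v x)" "Xc m Mx (%x. \<Sum>v\<in>V. s v * p v x)"
   using r that unfolding rough_ok_def by blast+
  from Xc_shift[OF this(1), of a] Xc_shift[OF this(2), of a] show ?thesis by blast
 qed
 moreover have "Xc m Mx (%x. c (x + a))" using r unfolding rough_ok_def by (intro Xc_shift) blast
 moreover have "\<forall>x i. (\<Sum>v\<in>V. v $ i * q v (x + a)) = 0" "\<forall>v\<in>V. \<forall>x. q v (x + a) + h * p v (x + a) >= 0" "\<forall>x. c (x + a) >= c0"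
  using r unfolding rough_ok_def by blast+
 ultimately show ?thesis unfolding rough_ok_def by blast
qed

text \<open>With x, z and the test functions fixed, every clause is linear or convex in the
  coefficients, hence is preserved by integration against a probability measure. This serves twice:
  for time averages over a slot and for mollification in x.\<close>

lemma rough_avg:
 assumes M: "prob_space M" and m: "3 <= m"
  and r: "!!w. w \<in> space M ==> rough_ok (Q w) (P w) (C w)"
  and q: "!!v x. v \<in> V ==> has_bochner_integral M (%w. Q w v x) (q v x)"
  and p: "!!v x. v \<in> V ==> has_bochner_integral M (%w. P w v x) (p v x)"
  and c: "!!x. has_bochner_integral M (%w. C w x) (c x)"
 shows "rough_ok q p c"
proof -
 interpret prob_space M by fact
 have cst: "has_bochner_integral M (%w. a) a" for a :: real
  by (simp add: has_bochner_integral_iff prob_space)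
 have X3: "Xc 3 Mx (Q w v)" "Xc 3 Mx (P w v)" if "v \<in> V" "w \<in> space M" for v w
  using rough_single[OF r[OF that(2)] that(1)] m by (auto intro: Xc_le)
 have qe: "q v = (%x. \<integral>w. Q w v x \<partial>M)" and qi: "integrable M (%w. Q w v x)"
  and pe: "p v = (%x. \<integral>w. P w v x \<partial>M)" and pi: "integrable M (%w. P w v x)" if "v \<in> V" for v x
  using q[OF that] p[OF that] by (auto simp: has_bochner_integral_iff)
 have Dq: "has_bochner_integral M (%w. D \<mu> (Q w v) x) (D \<mu> (q v) x)"
  and Dp: "has_bochner_integral M (%w. D \<mu> (P w v) x) (D \<mu> (p v) x)" if "v \<in> V" "length \<mu> <= 2" for \<mu> v x
  unfolding qe[OF that(1)] pe[OF that(1)] using X3[OF that(1)] qi[OF that(1)] pi[OF that(1)] that(2)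
  by (auto intro!: avg_D[OF M])
 have A: "has_bochner_integral M (%w. AFz (Q w) (P w) \<phi> x z) (AFz q p \<phi> x z)" for \<phi> x z
  unfolding AFz_def
  by (intro has_bochner_integral_mult_right has_bochner_integral_sum has_bochner_integral_mult_left
    has_bochner_integral_add has_bochner_integral_divide Dq Dp) (auto simp: words_length)
 have F: "has_bochner_integral M (%w. QFz (Q w) (P w) \<phi> x z) (QFz q p \<phi> x z)" for \<phi> x z
  unfolding QFz_def
  by (intro has_bochner_integral_mult_right has_bochner_integral_sum has_bochner_integral_mult_left
    has_bochner_integral_add q p)
 have O: "\<mu> \<in> Wd 2 ==> has_bochner_integral M (%w. QOz (Q w) \<mu> \<psi> x z) (QOz q \<mu> \<psi> x z)" for \<psi> x z \<mu>
  unfolding QOz_def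
  by (intro has_bochner_integral_sum has_bochner_integral_mult_left has_bochner_integral_divide Dq) (auto simp: words_length)
 have "SI1 q p c" unfolding SI1_def
 proof (intro allI impI)
  fix \<phi> B x z assume a: "smooth \<phi> \<and> (\<forall>y. S 1 \<phi> y <= B)"
  show "AFz q p \<phi> x z <= (1 - \<delta>) * (\<Sum>\<mu>\<in>Wd 1. QFz q p (D \<mu> \<phi>) x z) + K * QFz q p \<phi> x z + 2 * (1 - \<delta>) * c x * B"
  proof (rule hb_le[OF A])
   show "has_bochner_integral M (%w. (1 - \<delta>) * (\<Sum>\<mu>\<in>Wd 1. QFz (Q w) (P w) (D \<mu> \<phi>) x z) + K * QFz (Q w) (P w) \<phi> x z + 2 * (1 - \<delta>) * C w x * B)
    ((1 - \<delta>) * (\<Sum>\<mu>\<in>Wd 1. QFz q p (D \<mu> \<phi>) x z) + K * QFz q p \<phi> x z + 2 * (1 - \<delta>) * c x * B)"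
    by (intro has_bochner_integral_add has_bochner_integral_mult_left has_bochner_integral_mult_right has_bochner_integral_sum F c)
   fix w assume w: "w \<in> space M"
   have "SI1 (Q w) (P w) (C w)" using r[OF w] by (simp add: rough_ok_def)
   then show "AFz (Q w) (P w) \<phi> x z <= (1 - \<delta>) * (\<Sum>\<mu>\<in>Wd 1. QFz (Q w) (P w) (D \<mu> \<phi>) x z) + K * QFz (Q w) (P w) \<phi> x z + 2 * (1 - \<delta>) * C w x * B"
    using a unfolding SI1_def by blast
  qed
 qed
 moreover have "SI2 n q p c" if n: "n \<in> {2..m}" for n unfolding SI2_def
 proof (intro allI impI)
  fix X :: "(real^'d) list set" and \<phi> :: "(real^'d) list => 'd fn" and B1 B2 x z
  assume a: "finite X \<and> (\<forall>\<rho>\<in>X. smooth (\<phi> \<rho>)) \<and> (\<forall>y. (\<Sum>\<rho>\<in>X. S 2 (\<phi> \<rho>) y) <= B2) \<and> (\<forall>y. (\<Sum>\<rho>\<in>X. S 1 (\<phi> \<rho>) y) <= B1)"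
  show "(\<Sum>\<rho>\<in>X. real n * (\<Sum>\<nu>\<in>Wd 1. AFz q p (D \<nu> (\<phi> \<rho>)) x z)
    + real n * (real n - 1) * (\<Sum>\<mu>\<in>Wd 2. D \<mu> (\<phi> \<rho>) z * QOz q \<mu> (T \<mu> (\<phi> \<rho>)) x z))
   <= (\<Sum>\<rho>\<in>X. (1 - \<delta>) * (\<Sum>\<mu>\<in>Wd 2. QFz q p (D \<mu> (\<phi> \<rho>)) x z) + K * (\<Sum>\<mu>\<in>Wd 1. QFz q p (D \<mu> (\<phi> \<rho>)) x z))
    + 2 * (1 - \<delta>) * c x * B2 + K * B1"
  proof (rule hb_le)
   show "has_bochner_integral M (%w. \<Sum>\<rho>\<in>X. real n * (\<Sum>\<nu>\<in>Wd 1. AFz (Q w) (P w) (D \<nu> (\<phi> \<rho>)) x z)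
    + real n * (real n - 1) * (\<Sum>\<mu>\<in>Wd 2. D \<mu> (\<phi> \<rho>) z * QOz (Q w) \<mu> (T \<mu> (\<phi> \<rho>)) x z))
    (\<Sum>\<rho>\<in>X. real n * (\<Sum>\<nu>\<in>Wd 1. AFz q p (D \<nu> (\<phi> \<rho>)) x z)
    + real n * (real n - 1) * (\<Sum>\<mu>\<in>Wd 2. D \<mu> (\<phi> \<rho>) z * QOz q \<mu> (T \<mu> (\<phi> \<rho>)) x z))"
    by (intro has_bochner_integral_add has_bochner_integral_mult_right has_bochner_integral_sum A O)
   show "has_bochner_integral M (%w. (\<Sum>\<rho>\<in>X. (1 - \<delta>) * (\<Sum>\<mu>\<in>Wd 2. QFz (Q w) (P w) (D \<mu> (\<phi> \<rho>)) x z) + K * (\<Sum>\<mu>\<in>Wd 1. QFz (Q w) (P w) (D \<mu> (\<phi> \<rho>)) x z))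
    + 2 * (1 - \<delta>) * C w x * B2 + K * B1)
    ((\<Sum>\<rho>\<in>X. (1 - \<delta>) * (\<Sum>\<mu>\<in>Wd 2. QFz q p (D \<mu> (\<phi> \<rho>)) x z) + K * (\<Sum>\<mu>\<in>Wd 1. QFz q p (D \<mu> (\<phi> \<rho>)) x z))
    + 2 * (1 - \<delta>) * c x * B2 + K * B1)"
    by (intro has_bochner_integral_add has_bochner_integral_mult_left has_bochner_integral_mult_right has_bochner_integral_sum F c cst)
   fix w assume w: "w \<in> space M"
   have "SI2 n (Q w) (P w) (C w)" using r[OF w] n by (simp add: rough_ok_def)
   then show "(\<Sum>\<rho>\<in>X. real n * (\<Sum>\<nu>\<in>Wd 1. AFz (Q w) (P w) (D \<nu> (\<phi> \<rho>)) x z)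
    + real n * (real n - 1) * (\<Sum>\<mu>\<in>Wd 2. D \<mu> (\<phi> \<rho>) z * QOz (Q w) \<mu> (T \<mu> (\<phi> \<rho>)) x z))
    <= (\<Sum>\<rho>\<in>X. (1 - \<delta>) * (\<Sum>\<mu>\<in>Wd 2. QFz (Q w) (P w) (D \<mu> (\<phi> \<rho>)) x z) + K * (\<Sum>\<mu>\<in>Wd 1. QFz (Q w) (P w) (D \<mu> (\<phi> \<rho>)) x z))
    + 2 * (1 - \<delta>) * C w x * B2 + K * B1" using a unfolding SI2_def by blast
  qed
 qed
 moreover have "Xc m Mx (%x. \<Sum>v\<in>V. s v * q v x) \<and> Xc m Mx (%x. \<Sum>v\<in>V. s v * p v x)" if s: "(\<Sum>v\<in>V. (s v)\<^sup>2) <= 1" for s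
 proof -
  have "has_bochner_integral M (%w. \<Sum>v\<in>V. s v * Q w v x) (\<Sum>v\<in>V. s v * q v x)"
   "has_bochner_integral M (%w. \<Sum>v\<in>V. s v * P w v x) (\<Sum>v\<in>V. s v * p v x)" for x
   by (intro has_bochner_integral_mult_right has_bochner_integral_sum q p; assumption)+
  then have e: "(%x. \<Sum>v\<in>V. s v * q v x) = (%x. \<integral>w. (\<Sum>v\<in>V. s v * Q w v x) \<partial>M)" "!!x. integrable M (%w. \<Sum>v\<in>V. s v * Q w v x)"
   "(%x. \<Sum>v\<in>V. s v * p v x) = (%x. \<integral>w. (\<Sum>v\<in>V. s v * P w v x) \<partial>M)" "!!x. integrable M (%w. \<Sum>v\<in>V. s v * P w v x)"
   by (auto simp: has_bochner_integral_iff)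
  show ?thesis unfolding e(1,3) using r s by (intro conjI Xc_avg[OF M] e) (auto simp: rough_ok_def)
 qed
 moreover have "Xc m Mx c"
 proof -
  have "c = (%x. \<integral>w. C w x \<partial>M)" "!!x. integrable M (%w. C w x)" using c by (auto simp: has_bochner_integral_iff)
  then show ?thesis using r by (auto intro!: Xc_avg[OF M] simp: rough_ok_def)
 qed
 moreover have "(\<Sum>v\<in>V. v $ i * q v x) = 0" for x i
 proof -
  have "has_bochner_integral M (%w. \<Sum>v\<in>V. v $ i * Q w v x) (\<Sum>v\<in>V. v $ i * q v x)"
   by (intro has_bochner_integral_mult_right has_bochner_integral_sum q)
  then have "has_bochner_integral M (%w. 0::real) (\<Sum>v\<in>V. v $ i * q v x)"
   by (rule has_bochner_integral_cong[THEN iffD1, OF refl _ refl, rotated]) (use r in \<open>auto simp: rough_ok_def\<close>)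
  then show ?thesis by (simp add: has_bochner_integral_iff)
 qed
 moreover have "q v x + h * p v x >= 0" if v: "v \<in> V" for v x
 proof (rule hb_le[OF cst])
  show "has_bochner_integral M (%w. Q w v x + h * P w v x) (q v x + h * p v x)"
   by (intro has_bochner_integral_add has_bochner_integral_mult_right q p v)
 qed (use r v in \<open>auto simp: rough_ok_def\<close>)
 moreover have "c x >= c0" for x by (rule hb_le[OF cst c]) (use r in \<open>auto simp: rough_ok_def\<close>)
 ultimately show ?thesis unfolding rough_ok_def by blast
qed

text \<open>Mollification is the average of translates under \<open>moll_measure\<close>, and
  translates of admissible coefficients are admissible.\<close>

lemma rough_conv:
 assumes r: "rough_ok q p c" and m: "3 <= m" and e: "\<epsilon> > 0"
 shows "coef_ok (%v. conv (moll \<epsilon>) (q v)) (%v. conv (moll \<epsilon>) (p v)) (conv (moll \<epsilon>) c)"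
proof -
 have c1: "continuous_on UNIV (q v)" "continuous_on UNIV (p v)" if "v \<in> V" for v
  by (rule Xc_continuous[OF rough_single(1)[OF r that]] Xc_continuous[OF rough_single(2)[OF r that]]; use m in simp)+
 have c2: "continuous_on UNIV c" 
 proof (rule Xc_continuous)
  show "Xc m Mx c" using r unfolding rough_ok_def by blast
 qed (use m in simp)
 have hb: "has_bochner_integral (moll_measure \<epsilon>) (%w. \<phi> (x + (- w))) (conv (moll \<epsilon>) \<phi> x)" if "continuous_on UNIV \<phi>" for \<phi> :: "'d fn" and x
  using integrable_moll_measure[OF e that] conv_moll_measure[OF e that] by (simp add: has_bochner_integral_iff)
 have R: "rough_ok (%v. conv (moll \<epsilon>) (q v)) (%v. conv (moll \<epsilon>) (p v)) (conv (moll \<epsilon>) c)"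
 proof (rule rough_avg[OF prob_space_moll[OF e] m, where Q="%w v x. q v (x + - w)" and P="%w v x. p v (x + - w)" and C="%w x. c (x + - w)"])
  show "rough_ok (%v x. q v (x + - w)) (%v x. p v (x + - w)) (%x. c (x + - w))" for w by (rule rough_shift[OF r m])
 qed (intro hb c1 c2; assumption)+
 have s: "smooth_coef (%v. conv (moll \<epsilon>) (q v)) (%v. conv (moll \<epsilon>) (p v)) (conv (moll \<epsilon>) c)"
  unfolding smooth_coef_def using c1 c2 smooth_conv[OF moll_smooth[OF e] moll_supp[OF e]] by auto
 have s1: "smooth (%x. \<Sum>v\<in>V. s v * conv (moll \<epsilon>) (q v) x)" "smooth (%x. \<Sum>v\<in>V. s v * conv (moll \<epsilon>) (p v) x)" for s
  using s by (intro smooth_sum smooth_cmult; simp add: smooth_coef_def)+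
 show ?thesis using R s unfolding coef_ok_def rough_ok_def
  by (auto simp: Xc_def smooth_coef_def intro!: dbd_imp_nb s1)
qed

end

section \<open>Convergence of the Euler scheme\<close>

text \<open>The uniform distribution on [a, b], so that a time average over one Euler step is an
  expectation.\<close>

definition slot :: "real => real => real measure" where
 "slot a b = density (restrict_space lborel {a..b}) (%_. ennreal (1 / (b - a)))"

lemma space_slot [simp]: "space (slot a b) = {a..b}"
 by (simp add: slot_def space_restrict_space)

lemma prob_space_slot: "a < b ==> prob_space (slot a b)"
proof
 assume ab: "a < b"
 have "emeasure (slot a b) (space (slot a b)) = ennreal (1 / (b - a)) * emeasure (restrict_space lborel {a..b}) {a..b}"
  unfolding space_slot unfolding slot_def
  by (subst emeasure_density) (simp_all add: nn_integral_cmult emeasure_restrict_space space_restrict_space nn_integral_indicator sets_restrict_space_iff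
    cong: nn_integral_cong_simp)
 also have "... = 1"
  using ab by (simp add: emeasure_restrict_space ennreal_mult[symmetric])
 finally show "emeasure (slot a b) (space (slot a b)) = 1" .
qed

lemma slot_hb:
 fixes f :: "real => real"
 assumes "a < b" "set_integrable lborel {a..b} f"
 shows "has_bochner_integral (slot a b) f ((LINT s:{a..b}|lborel. f s) / (b - a))"
proof -
 have i: "integrable (restrict_space lborel {a..b}) f"
  using assms(2) by (simp add: integrable_restrict_space set_integrable_def)
 then have m: "f \<in> borel_measurable (restrict_space lborel {a..b})" by simp
 have "integrable (slot a b) f"
  unfolding slot_def using i m assms(1) by (subst integrable_density) auto
 moreover have "(\<integral>s. f s \<partial>slot a b) = (LINT s:{a..b}|lborel. f s) / (b - a)"
  unfolding slot_def using m assms(1)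
  by (subst integral_density) (auto simp: integral_restrict_space set_lebesgue_integral_def)
 ultimately show ?thesis by (simp add: has_bochner_integral_iff)
qed

lemma set_integral_singleton: "(LINT \<rho>:{r}|lborel. G \<rho>) = (0::real)" for r :: real
 unfolding set_lebesgue_integral_def
 by (rule integral_eq_zero_AE) (rule eventually_mono[OF AE_lborel_singleton[of r]], simp)

lemma conv_moll_lip:
 fixes \<phi> :: "'d::finite fn"
 assumes e: "\<epsilon> > 0" and d: "dbd 1 C \<phi>"
 shows "\<bar>conv (moll \<epsilon>) \<phi> x - \<phi> x\<bar> <= C * real CARD('d) * \<epsilon>"
proof (rule conv_moll_approx[OF e dbd1_continuous[OF d]])
 fix y assume y: "norm (y - x) <= \<epsilon>"
 have C: "C >= 0" using dbdD[OF d, of "[(1, undefined)]" 0] by simp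
 have "\<bar>\<phi> (x + (y - x)) - \<phi> x\<bar> <= C * real CARD('d) * norm (y - x)" by (rule dbd1_lipschitz[OF d])
 also have "... <= C * real CARD('d) * \<epsilon>" using y C by (intro mult_left_mono) auto
 finally show "\<bar>\<phi> y - \<phi> x\<bar> <= C * real CARD('d) * \<epsilon>" by simp
qed

text \<open>Time integrals are taken at fixed x, so measurability is recorded separately for each
  x.\<close>

definition tmeas :: "real => (real => 'd::finite fn) => bool" where
 "tmeas T1 F \<longleftrightarrow> (\<forall>x. set_borel_measurable lborel {0..T1} (%s. F s x))"

lemma tmeas_integrable:
 assumes m: "tmeas T1 F" and b: "!!s. s \<in> {0..T1} ==> \<bar>F s x\<bar> <= B" and ab: "0 <= a" "b <= T1"
 shows "set_integrable lborel {a..b} (%s. F s x)"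
proof (rule set_integrable_subset)
 have "integrable lborel (%s. indicator {0..T1} s *\<^sub>R B)"
  by (intro borel_integrable_compact continuous_intros) auto
 then show "set_integrable lborel {0..T1} (%s. F s x)"
  unfolding set_integrable_def
  by (rule Bochner_Integration.integrable_bound)
    (use m in \<open>auto simp: tmeas_def set_borel_measurable_def indicator_def intro!: AE_I2 order_trans[OF b]\<close>)
qed (use ab in auto)

section \<open>Comparison of approximate solutions with Euler iterates\<close>

context scheme
begin

definition "CL = real (card V) * ((1 / h + 1) * (2 / h)) + 1"

lemma CL0: "CL >= 0" unfolding CL_def using hpos by simp

lemma Lop_bound:
 assumes "!!v. v \<in> V ==> \<bar>q v x\<bar> <= b" "!!v. v \<in> V ==> \<bar>p v x\<bar> <= b" "\<bar>c x\<bar> <= b" and E: "!!y. \<bar>\<psi> y\<bar> <= E"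
 shows "\<bar>Lop q p c \<psi> x\<bar> <= CL * b * E"
proof -
 have b: "b >= 0" and E0: "E >= 0" using assms(3) E[of x] by linarith+
 have "\<bar>(q v x / h + p v x) * fdiff h v \<psi> x\<bar> <= (b / h + b) * (2 / h * E)" if "v \<in> V" for v
 proof -
  have "\<bar>q v x / h + p v x\<bar> <= b / h + b"
   using divide_right_mono[OF assms(1)[OF that], of h] assms(2)[OF that] hpos abs_triangle_ineq[of "q v x / h" "p v x"]
   by (simp add: abs_divide)
  moreover have "\<bar>fdiff h v \<psi> x\<bar> <= 2 / h * E" by (rule fdiff_bound0) (simp add: nb0 E)
  ultimately show ?thesis unfolding abs_mult using b hpos by (intro mult_mono) auto
 qed
 then have "\<bar>\<Sum>v\<in>V. (q v x / h + p v x) * fdiff h v \<psi> x\<bar> <= real (card V) * ((b / h + b) * (2 / h * E))"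
  by (intro order_trans[OF sum_abs] sum_bounded_above) auto
 moreover have "\<bar>c x * \<psi> x\<bar> <= b * E" unfolding abs_mult using assms(3) E[of x] b by (intro mult_mono) auto
 ultimately have "\<bar>Lop q p c \<psi> x\<bar> <= real (card V) * ((b / h + b) * (2 / h * E)) + b * E"
  unfolding Lop_eq by linarith
 also have "... = CL * b * E" by (simp add: CL_def algebra_simps add_divide_distrib)
 finally show ?thesis .
qed

lemma Lop_diff: "Lop q p c (%y. \<psi> y - \<omega> y) x = Lop q p c \<psi> x - Lop q p c \<omega> x"
proof -
 have "fdiff h v (%y. \<psi> y - \<omega> y) x = fdiff h v \<psi> x - fdiff h v \<omega> x" for v
  by (simp add: fdiff_def diff_divide_distrib)
 then show ?thesis by (simp add: Lop_eq right_diff_distrib sum_subtractf)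
qed

lemma Lop_coef_diff:
 "Lop q p c \<psi> x - Lop q' p' c' \<psi> x = Lop (%v x. q v x - q' v x) (%v x. p v x - p' v x) (%x. c x - c' x) \<psi> x"
proof -
 have "(\<Sum>v\<in>V. (q v x / h + p v x) * fdiff h v \<psi> x) - (\<Sum>v\<in>V. (q' v x / h + p' v x) * fdiff h v \<psi> x)
   = (\<Sum>v\<in>V. ((q v x - q' v x) / h + (p v x - p' v x)) * fdiff h v \<psi> x)"
  unfolding sum_subtractf[symmetric] by (intro sum.cong refl) (simp add: algebra_simps diff_divide_distrib)
 then show ?thesis unfolding Lop_eq by (simp add: left_diff_distrib)
qed

text \<open>The estimate of \<open>max_step\<close>, applied to F and to -F, contains 2 c where the
  operator contains c; adding \<kappa> c F back costs at most \<kappa> c E. Errors of the scheme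
  therefore accumulate without amplification.\<close>

lemma euler_step_contract:
 assumes ok: "coef_ok q p c" and F: "!!y. \<bar>F y\<bar> <= E" and \<kappa>: "0 <= \<kappa>" "\<kappa> * (2 * Mx + (1 + h) * Mx * sqrt (real (card V)) / h\<^sup>2) <= 1"
 shows "\<bar>F x + \<kappa> * Lop q p c F x\<bar> <= E"
proof -
 have E: "E >= 0" using F[of x] by linarith
 have cx: "c x >= 0" using ok c0pos by (auto simp: coef_ok_def intro: order_trans[OF less_imp_le])
 have half: "G x + \<kappa> * Lop q p c G x <= E" if G: "!!y. \<bar>G y\<bar> <= E" for G
 proof -
  have GE: "G y <= E" for y using G[of y] by linarith
  have "G x + \<kappa> * (Lop q p (%_. 0) G x - 2 * c x * G x) <= (1 - 2 * \<kappa> * c x) * E"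
   by (rule max_step[OF ok GE \<kappa>])
  moreover have "\<kappa> * c x * G x <= \<kappa> * c x * E" using GE[of x] \<kappa> cx by (intro mult_left_mono) auto
  moreover have "\<kappa> * Lop q p c G x = \<kappa> * Lop q p (%_. 0) G x - \<kappa> * (c x * G x)" by (simp add: Lop_eq algebra_simps)
  moreover have "0 <= \<kappa> * c x * E" using \<kappa> cx E by simp
  ultimately show ?thesis by (simp add: algebra_simps)
 qed
 have "Lop q p c (%y. 0 - F y) x = 0 - Lop q p c F x" unfolding Lop_diff by (simp add: Lop_eq fdiff_def)
 then show ?thesis using half[of F] half[of "%y. 0 - F y"] F by (simp add: abs_le_iff)
qed

context
 fixes T1 :: real and q p :: "real^'d => real => 'd fn" and c :: "real => 'd fn"
 assumes m3: "3 <= m"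
  and rough: "!!t. t \<in> {0..T1} ==> rough_ok (%v. q v t) (%v. p v t) (c t)"
  and tq: "!!v. v \<in> V ==> tmeas T1 (q v)" and tp: "!!v. v \<in> V ==> tmeas T1 (p v)" and tc: "tmeas T1 c"
begin

abbreviation Lt where "Lt s \<equiv> Lop (%v. q v s) (%v. p v s) (c s)"

lemma coef_bounds:
 assumes "s \<in> {0..T1}"
 shows "v \<in> V ==> \<bar>q v s x\<bar> <= Mx" "v \<in> V ==> \<bar>p v s x\<bar> <= Mx" "\<bar>c s x\<bar> <= Mx"
 using rough_single[OF rough[OF assms], THEN Xc_bound] Xc_bound[of m Mx "c s" x] rough[OF assms] by (auto simp: rough_ok_def)

lemma Lt_bound: "s \<in> {0..T1} ==> (!!y. \<bar>\<psi> y\<bar> <= E) ==> \<bar>Lt s \<psi> x\<bar> <= CL * Mx * E"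
 by (rule Lop_bound) (use coef_bounds in auto)

lemma slot_coefs:
 assumes ab: "0 <= a" "a < b" "b <= T1" and ee: "\<epsilon> > 0"
 obtains qb pb cb where "rough_ok qb pb cb"
  "!!\<psi> x. has_bochner_integral (slot a b) (%s. Lt s \<psi> x) (Lop qb pb cb \<psi> x)"
proof -
 define qb where "qb v x = (LINT s:{a..b}|lborel. q v s x) / (b - a)" for v x
 define pb where "pb v x = (LINT s:{a..b}|lborel. p v s x) / (b - a)" for v x
 define cb where "cb x = (LINT s:{a..b}|lborel. c s x) / (b - a)" for x
 have q: "has_bochner_integral (slot a b) (%s. q v s x) (qb v x)" if "v \<in> V" for v x
  unfolding qb_def using ab coef_bounds(1)[OF _ that] by (intro slot_hb tmeas_integrable[OF tq[OF that]]) auto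
 have p: "has_bochner_integral (slot a b) (%s. p v s x) (pb v x)" if "v \<in> V" for v x
  unfolding pb_def using ab coef_bounds(2)[OF _ that] by (intro slot_hb tmeas_integrable[OF tp[OF that]]) auto
 have c: "has_bochner_integral (slot a b) (%s. c s x) (cb x)" for x
  unfolding cb_def using ab coef_bounds(3) by (intro slot_hb tmeas_integrable[OF tc]) auto
 have "rough_ok qb pb cb"
  by (rule rough_avg[OF prob_space_slot[OF ab(2)] m3 rough _ _ c])
    (use ab q p in auto)
 moreover have "has_bochner_integral (slot a b) (%s. Lt s \<psi> x) (Lop qb pb cb \<psi> x)" for \<psi> x
  unfolding Lop_eq by (intro has_bochner_integral_diff has_bochner_integral_sum has_bochner_integral_mult_left
    has_bochner_integral_add has_bochner_integral_divide q p c)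
 ultimately show ?thesis using that by blast
qed

text \<open>The approximate solution is compared with Euler iterates whose coefficients are averaged
  over the slots and mollified in x, and the iterates obey \<open>euler_bound\<close>. Per unit of
  time the comparison loses \<eta> plus terms vanishing with the step and the mollification radius;
  so \<open>T1\<close> affects the distance but not the bound on v. C' and Bw enter only the
  vanishing terms, C1 and C2 only the bound.\<close>

lemma approx_bound:
 assumes n: "n <= m" and FX: "!!s. s \<in> {0..T1} ==> Xc n C1 (F s)" "!!s. s \<in> {0..T1} ==> Xc 1 C' (F s)" and Fm: "tmeas T1 F"
  and C1: "C1 >= 0" and gX: "Xc n C2 g" "Xc 1 C' g"
  and wb: "!!t x. t \<in> {0..T1} ==> \<bar>ww t x\<bar> <= Bw"
  and wi: "!!x. set_integrable lborel {0..T1} (%s. Lt s (ww s) x)"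
  and weq: "!!s t x. 0 <= s ==> s <= t ==> t <= T1 ==> \<bar>ww t x - ww s x - (LINT r:{s..t}|lborel. Lt r (ww r) x + F r x)\<bar> <= \<eta> * (t - s)"
  and w0: "!!x. \<bar>ww 0 x - g x\<bar> <= \<eta>" and \<eta>: "\<eta> >= 0" and t: "t \<in> {0..T1}" and ee: "ee > 0"
 shows "\<exists>v. Xc n (BB n * (C1 + C2)) v \<and> (\<forall>x. \<bar>ww t x - v x\<bar> <= \<eta> * (1 + T1) + ee)"
proof (cases "t = 0")
 case True
 have C2: "C2 >= 0" by (rule Xc_nonneg[OF gX(1)])
 have "1 * C2 <= BB n * (C1 + C2)" using BB1[of n] C1 C2 by (intro mult_mono) auto
 moreover have "\<eta> <= \<eta> * (1 + T1)" using \<eta> t by (simp add: distrib_left)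
 ultimately show ?thesis using True gX(1) w0 ee
  by (intro exI[of _ g] conjI allI Xc_mono[OF gX(1)]) (auto intro: order_trans[OF w0])
next
 case False
 then have t0: "0 < t" "t <= T1" using t by auto
 define dm where "dm = real CARD('d)"
 have C2: "C2 >= 0" and C': "C' >= 0" by (rule Xc_nonneg[OF gX(1)], rule Xc_nonneg[OF gX(2)])
 have Bw: "Bw >= 0" using wb[OF t, of 0] by linarith
 \<comment> \<open>Lipschitz constant of ww in time, read off from the equation with its
   defect.\<close>
 define Cw where "Cw = CL * Mx * Bw + C' + \<eta>"
 have Cw0: "Cw >= 0" unfolding Cw_def using CL0 Mx Bw C' \<eta> by simp
 obtain \<kappa>0 where \<kappa>0: "\<kappa>0 > 0" and EB: "!!J q p c f g \<kappa> u B j k. euler J q p c f g \<kappa> u ==> 0 < \<kappa> ==> \<kappa> <= \<kappa>0 ==> B >= 0 ==>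
   (\<forall>j<J. \<forall>k\<le>n. nb k B (f j)) ==> (\<forall>k\<le>n. nb k B g) ==> j <= J ==> k <= n ==> nb k (BB n * B) (u j)"
  using euler_bound[OF n] by (elim exE conjE) (rule that, assumption, simp)
 define t1 where "t1 = 2 * Mx + (1 + h) * Mx * sqrt (real (card V)) / h\<^sup>2"
 have t1: "t1 >= 0" unfolding t1_def using Mx hpos by simp
 define a1 where "a1 = CL * Mx * Cw" 
 define a2 where "a2 = CL * (Mx * dm) * Bw + C' * dm"
 have a12: "a1 >= 0" "a2 >= 0" unfolding a1_def a2_def dm_def using CL0 Mx Cw0 Bw C' by simp_all
 \<comment> \<open>The three constraints are the validity of the derivative bound, contractivity of
   the step, and a total time discretization error of at most half of ee.\<close>
 define \<kappa>1 where "\<kappa>1 = min \<kappa>0 (min (1 / (1 + t1)) (ee / (2 * (1 + T1) * (1 + a1))))"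
 have \<kappa>1: "\<kappa>1 > 0" unfolding \<kappa>1_def using \<kappa>0 t1 ee a12 t0 by (simp add: add_pos_nonneg)
 obtain N :: nat where N: "t / \<kappa>1 < real N" using reals_Archimedean2 by blast
 define J where "J = Suc N"
 define \<kappa> where "\<kappa> = t / real J"
 have \<kappa>p: "\<kappa> > 0" using t0 by (simp add: \<kappa>_def J_def)
 have "\<kappa> <= \<kappa>1"
 proof -
  have "t / \<kappa>1 <= real J" using N by (simp add: J_def)
  then have "t <= real J * \<kappa>1" using \<kappa>1 by (simp add: field_simps)
  then show ?thesis by (simp add: \<kappa>_def J_def field_simps)
 qed
 then have k0: "\<kappa> <= \<kappa>0" and k1: "\<kappa> <= 1 / (1 + t1)" and k2: "\<kappa> <= ee / (2 * (1 + T1) * (1 + a1))" by (auto simp: \<kappa>1_def)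
 have kt1: "\<kappa> * t1 <= 1"
 proof -
  have "\<kappa> * (1 + t1) <= 1" using k1 t1 by (simp add: field_simps)
  then show ?thesis using \<kappa>p by (simp add: algebra_simps)
 qed
 define \<epsilon> where "\<epsilon> = ee / (2 * (1 + T1) * (1 + a2))"
 have \<epsilon>: "\<epsilon> > 0" unfolding \<epsilon>_def using ee t0 a12 by simp
 have tJ: "real J * \<kappa> = t" by (simp add: \<kappa>_def J_def)
 define A where "A j = real j * \<kappa>" for j
 have Arange: "A j \<in> {0..T1}" if "j <= J" for j
 proof -
  have "real j * \<kappa> <= real J * \<kappa>" using that \<kappa>p by (intro mult_right_mono) auto
  then show ?thesis using \<kappa>p t0 tJ by (simp add: A_def)
 qed
 have ASuc: "A (Suc j) = A j + \<kappa>" for j by (simp add: A_def algebra_simps)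
 \<comment> \<open>One triple of averaged coefficients per slot, packed into a tuple so that a
   single choice fixes all three.\<close>
 define R where "R j z \<longleftrightarrow> rough_ok (fst z) (fst (snd z)) (snd (snd z)) \<and>
   (\<forall>\<psi> x. has_bochner_integral (slot (A j) (A (Suc j))) (%s. Lt s \<psi> x) (Lop (fst z) (fst (snd z)) (snd (snd z)) \<psi> x))" for j z
 have ex: "\<exists>z. R j z" if "j < J" for j
 proof -
  note True = that
  then have "0 <= A j" "A j < A (Suc j)" "A (Suc j) <= T1" using Arange[of j] Arange[of "Suc j"] \<kappa>p by (auto simp: ASuc)
  then obtain q0 p0 c0 where "rough_ok q0 p0 c0"
   "!!\<psi> x. has_bochner_integral (slot (A j) (A (Suc j))) (%s. Lt s \<psi> x) (Lop q0 p0 c0 \<psi> x)"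
   using slot_coefs[OF _ _ _ \<epsilon>] by blast
  then have "R j (q0, p0, c0)" by (simp add: R_def)
  then show ?thesis by blast
 qed
 define z where "z j = (SOME z. R j z)" for j
 have z: "R j (z j)" if "j < J" for j unfolding z_def by (rule someI_ex[OF ex[OF that]])
 define qb pb cb where "qb j = fst (z j)" and "pb j = fst (snd (z j))" and "cb j = snd (snd (z j))" for j
 have qpc: "rough_ok (qb j) (pb j) (cb j)"
  "!!\<psi> x. has_bochner_integral (slot (A j) (A (Suc j))) (%s. Lt s \<psi> x) (Lop (qb j) (pb j) (cb j) \<psi> x)" if "j < J" for j
  using z[OF that] by (simp_all add: R_def qb_def pb_def cb_def)
 define fb where "fb j x = (LINT s:{A j..A (Suc j)}|lborel. F s x) / \<kappa>" for j x
 have slotj: "0 <= A j" "A j < A (Suc j)" "A (Suc j) <= T1" "{A j..A (Suc j)} \<subseteq> {0..T1}" if "j < J" for j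
  using Arange[of j] Arange[of "Suc j"] that \<kappa>p by (auto simp: ASuc)
 have Fi: "set_integrable lborel {a..b} (%s. F s x)" if "0 <= a" "b <= T1" for a b x
  using Xc_bound[OF FX(2)] that by (intro tmeas_integrable[OF Fm]) auto
 have fbh: "has_bochner_integral (slot (A j) (A (Suc j))) (%s. F s x) (fb j x)" if "j < J" for j x
  using slot_hb[OF slotj(2)[OF that] Fi[OF slotj(1,3)[OF that]], of x] by (simp add: fb_def ASuc)
 have fbX: "Xc n C1 (fb j)" "Xc 1 C' (fb j)" if "j < J" for j
 proof -
  have "fb j = (%x. \<integral>s. F s x \<partial>slot (A j) (A (Suc j)))" "!!x. integrable (slot (A j) (A (Suc j))) (%s. F s x)"
   using fbh[OF that] by (auto simp: has_bochner_integral_iff)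
  then show "Xc n C1 (fb j)" "Xc 1 C' (fb j)"
   using FX slotj(4)[OF that] by (auto intro!: Xc_avg[OF prob_space_slot[OF slotj(2)[OF that]]])
 qed
 have cont: "continuous_on UNIV \<phi>" if "Xc 1 C \<phi>" for \<phi> :: "'d fn" and C by (rule Xc_continuous[OF that]) simp
 let ?m = "conv (moll \<epsilon>) :: ('d fn) => 'd fn"
 have sm: "smooth (?m \<phi>)" if "Xc 1 C \<phi>" for \<phi> C by (rule smooth_conv[OF moll_smooth[OF \<epsilon>] moll_supp[OF \<epsilon>] cont[OF that]])
 define qe where "qe j = (%v. ?m (qb j v))" for j
 define pe where "pe j = (%v. ?m (pb j v))" for j
 define ce where "ce j = ?m (cb j)" for j
 define fe where "fe j = ?m (fb j)" for j
 define u where "u = rec_nat (?m g) (%j uj x. uj x + \<kappa> * (Lop (qe j) (pe j) (ce j) uj x + fe j x))"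
 have ok: "coef_ok (qe j) (pe j) (ce j)" if "j < J" for j
  unfolding qe_def pe_def ce_def by (rule rough_conv[OF qpc(1)[OF that] m3 \<epsilon>])
 have eu: "euler J qe pe ce fe (?m g) \<kappa> u"
  unfolding euler_def using ok sm[OF fbX(2)] sm[OF gX(2)] by (auto simp: u_def fe_def)
 have nbX: "nb k C (?m \<phi>)" if "Xc n C \<phi>" "Xc 1 D1c \<phi>" "k <= n" for \<phi> C D1c k
  by (rule dbd_imp_nb[OF sm[OF that(2)] XcD[OF Xc_conv_moll[OF \<epsilon> cont[OF that(2)] that(1)] that(3)]])
 have U: "nb k (BB n * (C1 + C2)) (u J)" if "k <= n" for k
 proof (rule EB[OF eu \<kappa>p k0 _ _ _ _ that])
  show "\<forall>j<J. \<forall>k\<le>n. nb k (C1 + C2) (fe j)"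
   unfolding fe_def using C2 by (intro allI impI nb_mono[OF nbX[OF fbX]]) simp_all
  show "\<forall>k\<le>n. nb k (C1 + C2) (?m g)"
   using C1 by (intro allI impI nb_mono[OF nbX[OF gX]]) simp_all
 qed (use C1 C2 in auto)
 have su: "smooth (u J)" by (rule euler_smooth[OF eu order_refl])
 have X: "Xc n (BB n * (C1 + C2)) (u J)" unfolding Xc_def using nb_imp_dbd[OF su U] by blast
 \<comment> \<open>Local error per unit of time: the defect, the freezing of ww within a slot (a1),
   and the mollification of coefficients and free term (a2).\<close>
 define \<theta> where "\<theta> = \<eta> + a1 * \<kappa> + a2 * \<epsilon>"
 have lip: "\<bar>ww r x - ww s x\<bar> <= Cw * (r - s)" if "0 <= s" "s <= r" "r <= T1" for r s x
 proof -
  have i1: "set_integrable lborel {s..r} (%\<rho>. Lt \<rho> (ww \<rho>) x + F \<rho> x)"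
   using set_integrable_subset[OF wi, of "{s..r}" x] Fi[of s r x] that by (intro set_integral_add) auto
  have "\<bar>LINT \<rho>:{s..r}|lborel. Lt \<rho> (ww \<rho>) x + F \<rho> x\<bar> <= (CL * Mx * Bw + C') * (r - s)"
  proof (cases "s = r")
   case False
   then have sr: "s < r" using that by simp
   interpret P: prob_space "slot s r" by (rule prob_space_slot[OF sr])
   have hb: "has_bochner_integral (slot s r) (%\<rho>. Lt \<rho> (ww \<rho>) x + F \<rho> x) ((LINT \<rho>:{s..r}|lborel. Lt \<rho> (ww \<rho>) x + F \<rho> x) / (r - s))"
    by (rule slot_hb[OF sr i1])
   have cst: "has_bochner_integral (slot s r) (%\<rho>. a) a" for a :: real by (simp add: has_bochner_integral_iff P.prob_space del: space_slot)
   have bd: "\<bar>Lt \<rho> (ww \<rho>) x + F \<rho> x\<bar> <= CL * Mx * Bw + C'" if "\<rho> \<in> space (slot s r)" for \<rho>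
   proof -
    have \<rho>: "\<rho> \<in> {0..T1}" using that \<open>0 <= s\<close> \<open>r <= T1\<close> by auto
    show ?thesis using Lt_bound[where \<psi>="ww \<rho>" and E=Bw and s=\<rho> and x=x, OF \<rho> wb[OF \<rho>]] Xc_bound[OF FX(2)[OF \<rho>], of x] by linarith
   qed
   have "(LINT \<rho>:{s..r}|lborel. Lt \<rho> (ww \<rho>) x + F \<rho> x) / (r - s) <= CL * Mx * Bw + C'"
    by (rule hb_le[OF hb cst]) (use bd in \<open>auto simp: abs_le_iff\<close>)
   moreover have "- (CL * Mx * Bw + C') <= (LINT \<rho>:{s..r}|lborel. Lt \<rho> (ww \<rho>) x + F \<rho> x) / (r - s)"
   proof (rule hb_le[OF cst hb])
    show "- (CL * Mx * Bw + C') <= Lt \<rho> (ww \<rho>) x + F \<rho> x" if "\<rho> \<in> space (slot s r)" for \<rho> using bd[OF that] by linarith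
   qed
   ultimately have "\<bar>(LINT \<rho>:{s..r}|lborel. Lt \<rho> (ww \<rho>) x + F \<rho> x) / (r - s)\<bar> <= CL * Mx * Bw + C'" by linarith
   then show ?thesis using sr by (simp add: abs_divide pos_divide_le_eq)
  next
   case True
   then show ?thesis by (simp del: set_integral_add add: set_integral_singleton)
  qed
  then show ?thesis using weq[OF that, of x] unfolding Cw_def by (simp add: algebra_simps)
 qed
 \<comment> \<open>The initial error is carried along without amplification, and each step adds
   \<kappa> \<theta>.\<close>
 have err: "\<bar>ww (A j) x - u j x\<bar> <= (\<eta> + C' * dm * \<epsilon>) + real j * \<kappa> * \<theta>" if "j <= J" for j x
  using that
 proof (induction j arbitrary: x)
  case 0
  show ?case using w0[of x] conv_moll_lip[OF \<epsilon> XcD[OF gX(2) order_refl], of x] by (simp add: A_def u_def dm_def)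
 next
  case (Suc j)
  then have jJ: "j < J" and jJ': "j <= J" by auto
  define E where "E = (\<eta> + C' * dm * \<epsilon>) + real j * \<kappa> * \<theta>"
  define wa where "wa = ww (A j)"
  note sl = slotj[OF jJ]
  interpret P: prob_space "slot (A j) (A (Suc j))" by (rule prob_space_slot[OF sl(2)])
  have cst: "has_bochner_integral (slot (A j) (A (Suc j))) (%\<rho>. a) a" for a :: real by (simp add: has_bochner_integral_iff P.prob_space del: space_slot)
  have ie: "\<bar>wa y - u j y\<bar> <= E" for y unfolding E_def wa_def by (rule Suc.IH[OF jJ'])
  have Li: "set_integrable lborel {A j..A (Suc j)} (%s. Lt s (ww s) x)" by (rule set_integrable_subset[OF wi]) (use sl in auto)
  define I1 where "I1 = (LINT s:{A j..A (Suc j)}|lborel. Lt s (ww s) x) / \<kappa>"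
  have I1: "has_bochner_integral (slot (A j) (A (Suc j))) (%s. Lt s (ww s) x) I1"
   using slot_hb[OF sl(2) Li] by (simp add: I1_def ASuc)
  have d1: "\<bar>Lt s (ww s) x - Lt s wa x\<bar> <= a1 * \<kappa>" if "s \<in> space (slot (A j) (A (Suc j)))" for s
  proof -
   have s: "s \<in> {0..T1}" "A j <= s" "s <= A j + \<kappa>" using that sl ASuc by auto
   have "\<bar>ww s y - wa y\<bar> <= Cw * \<kappa>" for y
   proof -
    have "\<bar>ww s y - wa y\<bar> <= Cw * (s - A j)" unfolding wa_def using lip[of "A j" s y] s sl by simp
    also have "... <= Cw * \<kappa>" using s Cw0 by (intro mult_left_mono) auto
    finally show ?thesis .
   qed
   then have "\<bar>Lt s (%y. ww s y - wa y) x\<bar> <= CL * Mx * (Cw * \<kappa>)" by (rule Lt_bound[OF s(1)])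
   then show ?thesis unfolding Lop_diff by (simp add: a1_def mult.assoc)
  qed
  have hd: "has_bochner_integral (slot (A j) (A (Suc j))) (%s. Lt s (ww s) x - Lt s wa x) (I1 - Lop (qb j) (pb j) (cb j) wa x)"
   by (rule has_bochner_integral_diff[OF I1 qpc(2)[OF jJ]])
  have "I1 - Lop (qb j) (pb j) (cb j) wa x <= a1 * \<kappa>"
   by (rule hb_le[OF hd cst]) (use d1 in \<open>auto simp: abs_le_iff\<close>)
  moreover have "- (a1 * \<kappa>) <= I1 - Lop (qb j) (pb j) (cb j) wa x"
  proof (rule hb_le[OF cst hd])
   show "- (a1 * \<kappa>) <= Lt s (ww s) x - Lt s wa x" if "s \<in> space (slot (A j) (A (Suc j)))" for s using d1[OF that] by linarith
  qed
  ultimately have e1: "\<bar>I1 - Lop (qb j) (pb j) (cb j) wa x\<bar> <= a1 * \<kappa>" by linarith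
  have moll_err: "\<bar>\<phi> x - ?m \<phi> x\<bar> <= Mx * dm * \<epsilon>" if "Xc m Mx \<phi>" for \<phi>
   using conv_moll_lip[OF \<epsilon> XcD[OF that, of 1], of x] m3 by (simp add: dm_def abs_minus_commute)
  have "\<bar>Lop (%v x. qb j v x - qe j v x) (%v x. pb j v x - pe j v x) (%x. cb j x - ce j x) wa x\<bar> <= CL * (Mx * dm * \<epsilon>) * Bw"
  proof (rule Lop_bound)
   show "\<bar>wa y\<bar> <= Bw" for y unfolding wa_def by (rule wb) (use sl in auto)
  qed (use moll_err rough_single[OF qpc(1)[OF jJ]] qpc(1)[OF jJ] in \<open>auto simp: qe_def pe_def ce_def rough_ok_def\<close>)
  then have e2: "\<bar>Lop (qb j) (pb j) (cb j) wa x - Lop (qe j) (pe j) (ce j) wa x\<bar> <= CL * (Mx * dm * \<epsilon>) * Bw"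
   unfolding Lop_coef_diff .
  have e3: "\<bar>fb j x - fe j x\<bar> <= C' * dm * \<epsilon>"
   using conv_moll_lip[OF \<epsilon> XcD[OF fbX(2)[OF jJ] order_refl], of x] by (simp add: fe_def dm_def abs_minus_commute)
  have "(LINT r:{A j..A (Suc j)}|lborel. Lt r (ww r) x + F r x) = \<kappa> * (I1 + fb j x)"
   using set_integral_add(2)[OF Li Fi[OF sl(1,3)]] \<kappa>p by (simp add: I1_def fb_def field_simps)
  then have e4: "\<bar>ww (A (Suc j)) x - wa x - \<kappa> * (I1 + fb j x)\<bar> <= \<eta> * \<kappa>"
   using weq[OF sl(1) less_imp_le[OF sl(2)] sl(3), of x] by (simp add: wa_def ASuc)
  define \<rho> where "\<rho> = (I1 + fb j x) - (Lop (qe j) (pe j) (ce j) wa x + fe j x)"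
  have "\<bar>\<rho>\<bar> <= a1 * \<kappa> + CL * (Mx * dm * \<epsilon>) * Bw + C' * dm * \<epsilon>" unfolding \<rho>_def using e1 e2 e3 by linarith
  then have \<rho>: "\<bar>\<kappa> * \<rho>\<bar> <= \<kappa> * (a1 * \<kappa> + CL * (Mx * dm * \<epsilon>) * Bw + C' * dm * \<epsilon>)"
   unfolding abs_mult using \<kappa>p by simp
  have con: "\<bar>(wa x - u j x) + \<kappa> * Lop (qe j) (pe j) (ce j) (%y. wa y - u j y) x\<bar> <= E"
   by (rule euler_step_contract[OF ok[OF jJ] ie less_imp_le[OF \<kappa>p] kt1[unfolded t1_def]])
  have uS: "u (Suc j) x = u j x + \<kappa> * (Lop (qe j) (pe j) (ce j) (u j) x + fe j x)" by (simp add: u_def)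
  have "ww (A (Suc j)) x - u (Suc j) x = (ww (A (Suc j)) x - wa x - \<kappa> * (I1 + fb j x)) + \<kappa> * \<rho>
    + ((wa x - u j x) + \<kappa> * Lop (qe j) (pe j) (ce j) (%y. wa y - u j y) x)"
   unfolding uS \<rho>_def Lop_diff by (simp add: algebra_simps)
  then have "\<bar>ww (A (Suc j)) x - u (Suc j) x\<bar> <= \<eta> * \<kappa> + \<kappa> * (a1 * \<kappa> + CL * (Mx * dm * \<epsilon>) * Bw + C' * dm * \<epsilon>) + E"
   using e4 \<rho> con by linarith
  also have "... = (\<eta> + C' * dm * \<epsilon>) + real (Suc j) * \<kappa> * \<theta>"
   by (simp add: E_def \<theta>_def a2_def algebra_simps)
  finally show ?case .
 qed
 have "\<bar>ww t x - u J x\<bar> <= \<eta> * (1 + T1) + ee" for x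
 proof -
  have "\<bar>ww t x - u J x\<bar> <= (\<eta> + C' * dm * \<epsilon>) + t * \<theta>" using err[OF order_refl, of x] by (simp add: A_def tJ)
  also have "... <= (\<eta> + a2 * \<epsilon>) + T1 * \<theta>"
  proof (intro add_mono order_refl mult_right_mono)
   show "C' * dm <= a2" unfolding a2_def dm_def using CL0 Mx Bw by simp
   show "\<theta> >= 0" unfolding \<theta>_def using \<eta> a12 \<kappa>p \<epsilon> by simp
  qed (use t0 \<epsilon> in auto)
  also have "... = \<eta> * (1 + T1) + ((1 + T1) * (a2 * \<epsilon>) + T1 * (a1 * \<kappa>))" by (simp add: \<theta>_def algebra_simps)
  also have "... <= \<eta> * (1 + T1) + ee"
  proof -
   have T0: "T1 >= 0" using t0 by simp
   have hf: "(1 + T1) * ((1 + a) * (ee / (2 * (1 + T1) * (1 + a)))) = ee / 2" if "a >= 0" for a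
   proof -
    have gen: "y * (z * (ee / (2 * y * z))) = ee / 2" if "y \<noteq> 0" "z \<noteq> 0" for y z :: real
     using that by simp
    show ?thesis by (rule gen) (use T0 that in auto)
   qed
   have "(1 + T1) * (a2 * \<epsilon>) <= (1 + T1) * ((1 + a2) * \<epsilon>)" using \<epsilon> T0 by (intro mult_left_mono mult_right_mono) auto
   also have "... = ee / 2" unfolding \<epsilon>_def by (rule hf[OF a12(2)])
   finally have 1: "(1 + T1) * (a2 * \<epsilon>) <= ee / 2" .
   have "T1 * (a1 * \<kappa>) <= (1 + T1) * ((1 + a1) * \<kappa>)" using \<kappa>p T0 a12 by (intro mult_mono) auto
   also have "... <= (1 + T1) * ((1 + a1) * (ee / (2 * (1 + T1) * (1 + a1))))" using k2 a12 T0 by (intro mult_left_mono) auto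
   also have "... = ee / 2" by (rule hf[OF a12(1)])
   finally show ?thesis using 1 by linarith
  qed
  finally show ?thesis .
 qed
 then show ?thesis using X by blast
qed

end

end

section \<open>Taylor expansion of difference quotients\<close>

lemma Xc_ddir:
 fixes \<phi> :: "'d::finite fn"
 assumes X: "Xc (Suc n) C \<phi>" and n: "1 <= n"
 shows "Xc n (real CARD('d) * norm v * C) (ddir v \<phi>)"
proof -
 have C: "C >= 0" by (rule Xc_nonneg[OF X])
 have "Xc n (norm v * C) (%x. v $ i * D1 i \<phi> x)" for i
  by (rule Xc_mono[OF Xc_cmult[OF Xc_D1[OF X n]]]) (intro mult_right_mono component_le_norm_cart C)
 then have "Xc n (\<Sum>i\<in>(UNIV::'d set). norm v * C) (%x. \<Sum>i\<in>UNIV. v $ i * D1 i \<phi> x)"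
  by (intro Xc_sum)
 then show ?thesis unfolding ddir_def[abs_def] by (simp add: mult.assoc)
qed

lemma Xc_ddirs:
 fixes \<phi> :: "'d::finite fn"
 assumes "1 <= n" "Xc (n + r) C \<phi>"
 shows "Xc n ((real CARD('d) * norm v) ^ r * C) ((ddir v ^^ r) \<phi>)"
 using assms
proof (induction r arbitrary: n)
 case (Suc r)
 have "Xc (Suc n) ((real CARD('d) * norm v) ^ r * C) ((ddir v ^^ r) \<phi>)"
  by (rule Suc.IH) (use Suc.prems in auto)
 from Xc_ddir[OF this Suc.prems(1), of v] show ?case by (simp add: mult_ac)
qed simp

lemma conv_add:
 fixes u v :: "'d::finite fn"
 assumes "smooth k" "supp_in r k" "locally_integrable u" "locally_integrable v"
 shows "conv k (%x. u x + v x) x = conv k u x + conv k v x"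
 using integrable_supp_mult[OF assms(3) smooth_continuous assms(2)] integrable_supp_mult[OF assms(4) smooth_continuous assms(2)] assms(1)
 by (simp add: conv_def distrib_left)

lemma conv_cmult: "conv k (%x. a * u x) x = a * conv k u x"
 unfolding conv_def by (simp add: mult.left_commute)

lemma conv_zero: "conv k (%x. 0) x = 0" by (simp add: conv_def)

lemma locally_integrable_add:
 "locally_integrable u ==> locally_integrable v ==> locally_integrable (%x. u x + v x)"
 unfolding locally_integrable_def by (auto intro: set_integral_add)

lemma locally_integrable_zero: "locally_integrable (%x. 0)"
 by (rule locally_integrable_continuous) simp

lemma locally_integrable_sum:
 "finite A ==> (!!j. j \<in> A ==> locally_integrable (F j)) ==> locally_integrable (%x. \<Sum>j\<in>A. F j x)"
 by (induction A rule: finite_induct) (auto intro: locally_integrable_add locally_integrable_zero)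

lemma conv_sum:
 fixes F :: "'a => 'd::finite fn"
 assumes "smooth k" "supp_in r k" "finite A" "!!j. j \<in> A ==> locally_integrable (F j)"
 shows "conv k (%x. \<Sum>j\<in>A. F j x) x = (\<Sum>j\<in>A. conv k (F j) x)"
 using assms(3,4)
proof (induction A rule: finite_induct)
 case (insert j A)
 then have "conv k (%x. F j x + (\<Sum>j\<in>A. F j x)) x = conv k (F j) x + conv k (%x. \<Sum>j\<in>A. F j x) x"
  by (intro conv_add[OF assms(1,2)] locally_integrable_sum) auto
 then show ?case using insert by simp
qed (simp add: conv_zero)

lemma ddir_conv_moll:
 fixes \<phi> :: "'d::finite fn"
 assumes r: "r > 0" and X: "Xc n C \<phi>" "2 <= n"
 shows "ddir v (conv (moll r) \<phi>) = conv (moll r) (ddir v \<phi>)"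
proof
 fix x
 have X1: "Xc 1 C (D1 i \<phi>)" for i by (rule Xc_D1[OF Xc_le[OF X(1)]]) (use X(2) in auto)
 have s: "smooth (conv (moll r) \<phi>)"
  by (rule smooth_conv[OF moll_smooth[OF r] moll_supp[OF r]]) (use Xc_continuous[OF X(1)] X(2) in auto)
 have li: "locally_integrable (%x. v $ i * D1 i \<phi> x)" for i
  by (intro locally_integrable_continuous continuous_intros Xc_continuous[OF X1]) simp
 have "ddir v (conv (moll r) \<phi>) x = (\<Sum>i\<in>UNIV. v $ i * conv (moll r) (D1 i \<phi>) x)"
  unfolding ddir_def D1_smooth[OF s] pdiff_conv_moll[OF r X] ..
 also have "... = conv (moll r) (ddir v \<phi>) x"
  unfolding ddir_def[abs_def] by (subst conv_sum[OF moll_smooth[OF r] moll_supp[OF r]]) (auto intro: li simp: conv_cmult)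
 finally show "ddir v (conv (moll r) \<phi>) x = conv (moll r) (ddir v \<phi>) x" .
qed

lemma ddirs_conv_moll:
 fixes \<phi> :: "'d::finite fn"
 assumes r: "r > 0" and X: "Xc (Suc j) C \<phi>"
 shows "(ddir v ^^ j) (conv (moll r) \<phi>) = conv (moll r) ((ddir v ^^ j) \<phi>)"
 using X
proof (induction j)
 case (Suc j)
 have "Xc 2 ((real CARD('d) * norm v) ^ j * C) ((ddir v ^^ j) \<phi>)"
  by (rule Xc_ddirs) (use Suc.prems in \<open>auto\<close>)
 from ddir_conv_moll[OF r this, of v] Suc.IH[OF Xc_le[OF Suc.prems]] show ?case by simp
qed simp

lemma ddir_dif:
 fixes \<phi> :: "'d::finite fn"
 assumes X: "Xc n C \<phi>" "2 <= n"
 shows "ddir v (dif p \<phi>) = dif p (ddir v \<phi>)"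
proof
 fix x
 have "D1 i (dif p \<phi>) x = D1 i \<phi> (x + fst p *\<^sub>R axis (snd p) 1) - D1 i \<phi> x" for i
  using D1_lin[OF X(1) Xc_shift[OF X(1), of "fst p *\<^sub>R axis (snd p) 1"] X(2), of i "-1" x] D1_shift[OF X, of i "fst p *\<^sub>R axis (snd p) 1" x]
  by (simp add: dif_def[abs_def])
 then show "ddir v (dif p \<phi>) x = dif p (ddir v \<phi>) x"
  by (simp add: ddir_def dif_def right_diff_distrib sum_subtractf)
qed

lemma ddirs_dif:
 fixes \<phi> :: "'d::finite fn"
 assumes X: "Xc (Suc j) C \<phi>"
 shows "(ddir v ^^ j) (dif p \<phi>) = dif p ((ddir v ^^ j) \<phi>)"
 using X
proof (induction j)
 case (Suc j)
 have "Xc 2 ((real CARD('d) * norm v) ^ j * C) ((ddir v ^^ j) \<phi>)"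
  by (rule Xc_ddirs) (use Suc.prems in \<open>auto\<close>)
 from ddir_dif[OF this, of v p] Suc.IH[OF Xc_le[OF Suc.prems]] show ?case by simp
qed simp

text \<open>Remainder of the Taylor expansion of the difference quotient along v after the term of
  order h^s.\<close>

definition tay :: "nat => real => real^'d::finite => ('d fn) => 'd fn" where
 "tay s h v \<phi> x = fdiff h v \<phi> x - (\<Sum>i\<le>s. h ^ i / fact (i + 1) * (ddir v ^^ (i + 1)) \<phi> x)"

lemma smooth_ddir: "smooth \<phi> ==> smooth (ddir v \<phi>)"
 unfolding ddir_def[abs_def] by (intro smooth_sum smooth_cmult) (simp add: D1_smooth smooth_pdiff)

lemma smooth_ddirs: "smooth \<phi> ==> smooth ((ddir v ^^ j) \<phi>)"
 by (induction j) (auto intro: smooth_ddir)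

lemma tay_smooth:
 fixes \<phi> :: "'d::finite fn"
 assumes s: "smooth \<phi>" and X: "Xc (s + 2) C \<phi>" and h: "h > 0"
 shows "\<bar>tay s h v \<phi> x\<bar> <= (real CARD('d) * norm v) ^ (s + 2) * C * h ^ (s + 1)"
proof -
 define D where "D j \<sigma> = (ddir v ^^ j) \<phi> (x + \<sigma> *\<^sub>R v)" for j \<sigma>
 have D: "(D j has_real_derivative D (Suc j) \<sigma>) (at \<sigma>)" for j \<sigma>
  unfolding D_def[abs_def] using DERIV_line[of "(ddir v ^^ j) \<phi>" x \<sigma> v] smoothD[OF smooth_ddirs[OF s]]
  by (simp add: ddir_def D1_smooth[OF smooth_ddirs[OF s]])
 have "\<exists>t>0. t < h \<and> D 0 h = (\<Sum>m<s + 2. D m 0 / fact m * h ^ m) + D (s + 2) t / fact (s + 2) * h ^ (s + 2)"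
  by (rule Maclaurin[OF h]) (use D in auto)
 then obtain t where t: "D 0 h = (\<Sum>m<s + 2. D m 0 / fact m * h ^ m) + D (s + 2) t / fact (s + 2) * h ^ (s + 2)"
  by blast
 have "(\<Sum>m<Suc (Suc s). G m) = G 0 + (\<Sum>i\<le>s. G (Suc i))" for G :: "nat => real"
  by (subst sum.lessThan_Suc_shift) (simp only: lessThan_Suc_atMost)
 from this[of "%m. D m 0 / fact m * h ^ m"]
 have "(\<Sum>m<s + 2. D m 0 / fact m * h ^ m) = D 0 0 + (\<Sum>i\<le>s. D (Suc i) 0 / fact (Suc i) * h ^ Suc i)"
  by (simp del: fact_Suc power_Suc sum.lessThan_Suc)
 also have "(\<Sum>i\<le>s. D (Suc i) 0 / fact (Suc i) * h ^ Suc i) = h * (\<Sum>i\<le>s. h ^ i / fact (i + 1) * D (Suc i) 0)"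
  by (simp add: sum_distrib_left mult_ac del: fact_Suc)
 finally have "D 0 h - D 0 0 = h * (\<Sum>i\<le>s. h ^ i / fact (i + 1) * D (Suc i) 0) + D (s + 2) t / fact (s + 2) * h ^ (s + 2)"
  using t by simp
 then have "fdiff h v \<phi> x = (\<Sum>i\<le>s. h ^ i / fact (i + 1) * D (Suc i) 0) + D (s + 2) t / fact (s + 2) * h ^ (s + 1)"
  using h by (simp add: fdiff_def D_def divide_eq_eq distrib_left distrib_right mult_ac del: fact_Suc)
 then have eq: "tay s h v \<phi> x = D (s + 2) t / fact (s + 2) * h ^ (s + 1)"
  by (simp add: tay_def D_def del: fact_Suc)
 have "\<bar>(ddir v ^^ j) \<psi> y\<bar> <= (real CARD('d) * norm v) ^ j * C" if "smooth \<psi>" "nb j C \<psi>" for j \<psi> y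
  using that
 proof (induction j arbitrary: \<psi> C)
  case 0 then show ?case by (simp add: nb_def)
 next
  case (Suc j)
  have C: "C >= 0" using Suc.prems(2)[unfolded nb_def, rule_format, of "replicate (Suc j) undefined" y] by simp
  have "nb j (real CARD('d) * norm v * C) (ddir v \<psi>)"
  proof (unfold nb_def, intro allI impI)
   fix "is" :: "'d list" and z assume l: "length is = j"
   have "pds is (ddir v \<psi>) z = (\<Sum>i\<in>UNIV. v $ i * pds (is @ [i]) \<psi> z)"
    unfolding ddir_def[abs_def] D1_smooth[OF Suc.prems(1)]
    by (subst pds_sum) (auto intro!: smooth_cmult smooth_pdiff Suc.prems(1) simp: pds_cmult smooth_pdiff[OF Suc.prems(1)])
   also have "\<bar>...\<bar> <= (\<Sum>i\<in>(UNIV::'d set). norm v * C)"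
   proof (intro order_trans[OF sum_abs] sum_mono)
     fix i
     have "length (is @ [i]) = Suc j" using l by simp
     then have "\<bar>pds (is @ [i]) \<psi> z\<bar> <= C" using Suc.prems(2)[unfolded nb_def] by blast
     then show "\<bar>v $ i * pds (is @ [i]) \<psi> z\<bar> <= norm v * C"
      unfolding abs_mult by (intro mult_mono component_le_norm_cart) auto
    qed
   finally show "\<bar>pds is (ddir v \<psi>) z\<bar> <= real CARD('d) * norm v * C" by (simp add: mult.assoc)
  qed
  from Suc.IH[OF smooth_ddir[OF Suc.prems(1)] this] show ?case by (simp add: funpow_swap1 mult_ac)
 qed
 from this[OF s dbd_imp_nb[OF s XcD[OF X order_refl]]]
 have b: "\<bar>D (s + 2) t\<bar> <= (real CARD('d) * norm v) ^ (s + 2) * C" by (simp add: D_def)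
 have "\<bar>tay s h v \<phi> x\<bar> = \<bar>D (s + 2) t\<bar> / fact (s + 2) * h ^ (s + 1)"
  unfolding eq using h by (simp add: abs_mult del: fact_Suc)
 also have "... <= \<bar>D (s + 2) t\<bar> / 1 * h ^ (s + 1)"
  using h by (intro mult_right_mono divide_left_mono fact_ge_1) auto
 also have "... <= (real CARD('d) * norm v) ^ (s + 2) * C * h ^ (s + 1)"
  using b h by (intro mult_right_mono) auto
 finally show ?thesis .
qed

text \<open>Reduction to smooth functions: the directional derivatives involved have order at most s
  + 1, one below the order of the bound, so they commute with mollification and converge
  pointwise.\<close>

lemma tay_bound:
 fixes \<phi> :: "'d::finite fn"
 assumes X: "Xc (s + 2) C \<phi>" and h: "h > 0"
 shows "\<bar>tay s h v \<phi> x\<bar> <= (real CARD('d) * norm v) ^ (s + 2) * C * h ^ (s + 1)"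
proof (rule LIMSEQ_le_const2)
 let ?m = "%n. conv (moll (1 / real (Suc n)))"
 have c: "continuous_on UNIV \<phi>" by (rule Xc_continuous[OF X]) simp
 have r: "1 / real (Suc n) > 0" for n by simp
 have "(%n. (ddir v ^^ (i + 1)) (?m n \<phi>) x) \<longlonglongrightarrow> (ddir v ^^ (i + 1)) \<phi> x" if "i <= s" for i
 proof -
  have "Xc (Suc (i + 1)) C \<phi>" by (rule Xc_le[OF X]) (use that in simp)
  then have eq: "(ddir v ^^ (i + 1)) (?m n \<phi>) = ?m n ((ddir v ^^ (i + 1)) \<phi>)" for n
   by (rule ddirs_conv_moll[OF r])
  have "Xc 1 ((real CARD('d) * norm v) ^ (i + 1) * C) ((ddir v ^^ (i + 1)) \<phi>)"
   by (rule Xc_ddirs[OF order_refl Xc_le[OF X]]) (use that in simp)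
  then show ?thesis unfolding eq by (intro conv_moll_tendsto Xc_continuous[of 1]) auto
 qed
 then show "(%n. \<bar>tay s h v (?m n \<phi>) x\<bar>) \<longlonglongrightarrow> \<bar>tay s h v \<phi> x\<bar>"
  unfolding tay_def fdiff_def using h by (intro tendsto_intros conv_moll_tendsto c) auto
 have "\<bar>tay s h v (?m n \<phi>) x\<bar> <= (real CARD('d) * norm v) ^ (s + 2) * C * h ^ (s + 1)" for n
  by (rule tay_smooth[OF smooth_conv[OF moll_smooth[OF r] moll_supp[OF r] c] Xc_conv_moll[OF r c X] h])
 then show "\<exists>N. \<forall>n\<ge>N. \<bar>tay s h v (?m n \<phi>) x\<bar> <= (real CARD('d) * norm v) ^ (s + 2) * C * h ^ (s + 1)" by blast
qed

text \<open>Differences commute with the remainder operator; applying one to \<phi> uses up one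
  order of the hypothesis, so the bound of order k reduces to the sup bound.\<close>

lemma Xc_tay:
 fixes \<phi> :: "'d::finite fn"
 assumes X: "Xc (l + s + 2) C \<phi>" and h: "h > 0"
 shows "Xc l ((real CARD('d) * norm v) ^ (s + 2) * C * h ^ (s + 1)) (tay s h v \<phi>)"
proof -
 have "dbd k ((real CARD('d) * norm v) ^ (s + 2) * C * h ^ (s + 1)) (tay s h v \<psi>)" if "Xc (k + s + 2) C \<psi>" for k \<psi> C
  using that
 proof (induction k arbitrary: \<psi> C)
  case 0
  then show ?case using tay_bound[OF _ h, of s C \<psi> v] by (simp add: dbd0)
 next
  case (Suc k)
  show ?case unfolding dbd_Suc
  proof
   fix p
   have eq: "(ddir v ^^ (i + 1)) (dif p \<psi>) = dif p ((ddir v ^^ (i + 1)) \<psi>)" if "i <= s" for i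
    by (rule ddirs_dif[OF Xc_le[OF Suc.prems]]) (use that in simp)
   then have "(ddir v ^^ (i + 1)) (dif p \<psi>) x = (ddir v ^^ (i + 1)) \<psi> (x + fst p *\<^sub>R axis (snd p) 1) - (ddir v ^^ (i + 1)) \<psi> x" if "i <= s" for i x
    using fun_cong[OF eq[OF that], of x] by (simp only: dif_def)
   then have "(\<Sum>i\<le>s. h ^ i / fact (i + 1) * (ddir v ^^ (i + 1)) (dif p \<psi>) x) =
     (\<Sum>i\<le>s. h ^ i / fact (i + 1) * (ddir v ^^ (i + 1)) \<psi> (x + fst p *\<^sub>R axis (snd p) 1)) - (\<Sum>i\<le>s. h ^ i / fact (i + 1) * (ddir v ^^ (i + 1)) \<psi> x)" for x
    unfolding sum_subtractf[symmetric] by (intro sum.cong refl) (simp only: atMost_iff right_diff_distrib)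
   moreover have "fdiff h v (dif p \<psi>) x = fdiff h v \<psi> (x + fst p *\<^sub>R axis (snd p) 1) - fdiff h v \<psi> x" for x
    by (simp add: fdiff_def dif_def add_ac diff_divide_distrib)
   ultimately have "dif p (tay s h v \<psi>) = tay s h v (dif p \<psi>)"
    by (intro ext) (simp add: tay_def dif_def del: fact_Suc funpow.simps)
   moreover have "dbd k ((real CARD('d) * norm v) ^ (s + 2) * (C * \<bar>fst p\<bar>) * h ^ (s + 1)) (tay s h v (dif p \<psi>))"
    by (rule Suc.IH[OF Xc_dif]) (use Suc.prems in simp)
   ultimately show "dbd k ((real CARD('d) * norm v) ^ (s + 2) * C * h ^ (s + 1) * \<bar>fst p\<bar>) (dif p (tay s h v \<psi>))"
    by (simp add: mult_ac)
  qed
 qed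
 then have "\<forall>k\<le>l. dbd k ((real CARD('d) * norm v) ^ (s + 2) * C * h ^ (s + 1)) (tay s h v \<phi>)"
  using Xc_le[OF X] by simp
 then show ?thesis by (simp only: Xc_def)
qed

section \<open>The operators on functions with bounded difference quotients\<close>

text \<open>Consistency error of the difference operator against its formal expansion up to order
  h^r.\<close>

definition Rem where
 "Rem V q p c r h t \<phi> x = L_h V q p c h t \<phi> x - L_op V q p c t \<phi> x
   - (\<Sum>i=1..r. h ^ i / fact i * L_coef V q p i t \<phi> x)"

lemma atMost_split1: "(\<Sum>i\<le>r. G i) = G 0 + (\<Sum>i=1..r. G i)" for G :: "nat => real"
proof -
 have "{..r} = insert 0 {1..r}" by auto
 then show ?thesis by simp
qed

lemma atMost_split2: "(\<Sum>i\<le>Suc r. G i) = G 0 + G 1 + (\<Sum>i=1..r. G (Suc i))" for G :: "nat => real"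
proof -
 have "(\<Sum>i\<le>Suc r. G i) = G 0 + (\<Sum>i\<le>r. G (Suc i))" by (rule sum.atMost_Suc_shift)
 then show ?thesis unfolding atMost_split1[of "%i. G (Suc i)"] by simp
qed

text \<open>The first-order part with q vanishes by the cancellation condition, so after division by
  h the q part is a Taylor expansion carried one order further than the p part. The coefficients
  agree because h^i/(i+2)! is h^i/i! divided by (i+1)(i+2).\<close>

lemma Rem_eq:
 fixes q p :: "real^'d::finite => real => 'd fn"
 assumes zero: "!!i. (\<Sum>v\<in>V. v $ i * q v t x) = 0" and h: "h > 0"
 shows "Rem V q p c r h t \<phi> x =
  (\<Sum>v\<in>V. q v t x * (1 / h * tay (Suc r) h v \<phi> x)) + (\<Sum>v\<in>V. p v t x * tay r h v \<phi> x)"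
proof -
 define d where "d i v = (ddir v ^^ i) \<phi> x" for i v
 have "(\<Sum>v\<in>V. q v t x * d 1 v) = (\<Sum>v\<in>V. \<Sum>i\<in>UNIV. D1 i \<phi> x * (v $ i * q v t x))"
  by (simp add: d_def ddir_def sum_distrib_left mult_ac)
 also have "... = 0" by (subst sum.swap) (simp add: sum_distrib_left[symmetric] zero)
 finally have z: "(\<Sum>v\<in>V. q v t x * d 1 v) = 0" .
 have A: "q v t x * (1 / h * tay (Suc r) h v \<phi> x) = 1 / h * (q v t x * fdiff h v \<phi> x) - 1 / h * (q v t x * d 1 v) - 1 / 2 * (q v t x * d 2 v)
   - (\<Sum>i=1..r. h ^ i / fact i * (1 / (real (i + 1) * real (i + 2)) * (q v t x * d (i + 2) v)))" for v
 proof -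
  have "(\<Sum>i\<le>Suc r. h ^ i / fact (i + 1) * d (i + 1) v) = d 1 v + h / 2 * d 2 v + (\<Sum>i=1..r. h ^ Suc i / fact (i + 2) * d (i + 2) v)"
   unfolding atMost_split2 by (simp add: numeral_2_eq_2)
  moreover have "(\<Sum>i=1..r. h ^ Suc i / fact (i + 2) * d (i + 2) v) = h * (\<Sum>i=1..r. h ^ i / fact i * (1 / (real (i + 1) * real (i + 2)) * d (i + 2) v))"
   unfolding sum_distrib_left by (intro sum.cong refl) (simp add: field_simps)
  ultimately have "tay (Suc r) h v \<phi> x = fdiff h v \<phi> x - d 1 v - h / 2 * d 2 v
    - h * (\<Sum>i=1..r. h ^ i / fact i * (1 / (real (i + 1) * real (i + 2)) * d (i + 2) v))"
   unfolding tay_def d_def[symmetric] by linarith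
  then have "1 / h * tay (Suc r) h v \<phi> x = 1 / h * fdiff h v \<phi> x - 1 / h * d 1 v - 1 / 2 * d 2 v
    - (\<Sum>i=1..r. h ^ i / fact i * (1 / (real (i + 1) * real (i + 2)) * d (i + 2) v))"
   using h by (simp add: field_simps)
  then show ?thesis by (simp add: right_diff_distrib sum_distrib_left mult_ac)
 qed
 have B: "p v t x * tay r h v \<phi> x = p v t x * fdiff h v \<phi> x - p v t x * d 1 v
   - (\<Sum>i=1..r. h ^ i / fact i * (1 / real (i + 1) * (p v t x * d (i + 1) v)))" for v
 proof -
  have "(\<Sum>i\<le>r. h ^ i / fact (i + 1) * d (i + 1) v) = d 1 v + (\<Sum>i=1..r. h ^ i / fact i * (1 / real (i + 1) * d (i + 1) v))"
   unfolding atMost_split1 by (simp add: mult_ac)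
  then show ?thesis unfolding tay_def d_def[symmetric]
   by (simp add: right_diff_distrib distrib_left sum_distrib_left mult_ac)
 qed
 have q: "(\<Sum>v\<in>V. q v t x * (1 / h * tay (Suc r) h v \<phi> x)) = 1 / h * (\<Sum>v\<in>V. q v t x * fdiff h v \<phi> x)
   - 1 / 2 * (\<Sum>v\<in>V. q v t x * d 2 v) - (\<Sum>i=1..r. h ^ i / fact i * (1 / (real (i + 1) * real (i + 2)) * (\<Sum>v\<in>V. q v t x * d (i + 2) v)))"
  unfolding A sum_subtractf sum_distrib_left[symmetric] z
  by (subst sum.swap) (simp only: sum_distrib_left[symmetric] mult_zero_right diff_zero)
 have p: "(\<Sum>v\<in>V. p v t x * tay r h v \<phi> x) = (\<Sum>v\<in>V. p v t x * fdiff h v \<phi> x)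
   - (\<Sum>v\<in>V. p v t x * d 1 v) - (\<Sum>i=1..r. h ^ i / fact i * (1 / real (i + 1) * (\<Sum>v\<in>V. p v t x * d (i + 1) v)))"
  unfolding B sum_subtractf
  by (subst sum.swap) (simp only: sum_distrib_left[symmetric])
 have d1: "ddir v \<phi> x = d 1 v" for v by (simp add: d_def)
 have "Rem V q p c r h t \<phi> x = 1 / h * (\<Sum>v\<in>V. q v t x * fdiff h v \<phi> x) + (\<Sum>v\<in>V. p v t x * fdiff h v \<phi> x)
   - 1 / 2 * (\<Sum>v\<in>V. q v t x * d 2 v) - (\<Sum>v\<in>V. p v t x * d 1 v)
   - (\<Sum>i=1..r. h ^ i / fact i * (1 / (real (i + 1) * real (i + 2)) * (\<Sum>v\<in>V. q v t x * d (i + 2) v))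
    + h ^ i / fact i * (1 / real (i + 1) * (\<Sum>v\<in>V. p v t x * d (i + 1) v)))"
  unfolding Rem_def L_h_def L_op_def L_coef_def d_def[symmetric] d1 distrib_left by simp
 then show ?thesis unfolding q p sum.distrib by linarith
qed

section \<open>Mapping properties of the operators and parity\<close>

context
 fixes V :: "(real^'d::finite) set" and q p :: "real^'d => real => 'd fn" and c :: "real => 'd fn"
  and t :: real and m :: nat and M s1 :: real
 assumes fin: "finite V" and s1: "s1 >= 0" "(\<Sum>v\<in>V. (norm v)\<^sup>2) <= s1\<^sup>2"
  and qX: "!!s. (\<Sum>v\<in>V. (s v)\<^sup>2) <= 1 ==> Xc m M (%x. \<Sum>v\<in>V. s v * q v t x)"
  and pX: "!!s. (\<Sum>v\<in>V. (s v)\<^sup>2) <= 1 ==> Xc m M (%x. \<Sum>v\<in>V. s v * p v t x)"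
  and cX: "Xc m M (c t)" and zero: "!!x i. (\<Sum>v\<in>V. v $ i * q v t x) = 0"
begin

lemma M_nonneg: "M >= 0" by (rule Xc_nonneg[OF cX])

text \<open>The dependence of the second factors on v is a power of its norm, which
  \<open>sqrt_sum_power_le\<close> sums, so that only s1 appears in the constant.\<close>

lemma Xc_wsum:
 assumes a: "!!s. (\<Sum>v\<in>V. (s v)\<^sup>2) <= 1 ==> Xc m M (%x. \<Sum>v\<in>V. s v * a v x)"
  and n: "n <= m" and r: "1 <= r" and C: "C >= 0"
  and b: "!!v. v \<in> V ==> Xc n ((real CARD('d) * norm v) ^ r * C) (b v)"
 shows "Xc n (2 ^ m * M * ((real CARD('d) * s1) ^ r * C)) (%x. \<Sum>v\<in>V. a v x * b v x)"
proof (rule Xc_mono)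
 show "Xc n (2 ^ n * (M * sqrt (\<Sum>v\<in>V. ((real CARD('d) * norm v) ^ r * C)\<^sup>2))) (%x. \<Sum>v\<in>V. a v x * b v x)"
  using b by (intro Xc_prod fin Xc_le[OF a n])
 have "sqrt (\<Sum>v\<in>V. ((real CARD('d) ^ r * C) * norm v ^ r)\<^sup>2) <= (real CARD('d) ^ r * C) * s1 ^ r"
  by (rule sqrt_sum_power_le[OF fin s1(2,1) _ r]) (use C in simp)
 then have *: "sqrt (\<Sum>v\<in>V. ((real CARD('d) * norm v) ^ r * C)\<^sup>2) <= (real CARD('d) * s1) ^ r * C"
  by (simp add: power_mult_distrib mult_ac)
 have "2 ^ n * (M * sqrt (\<Sum>v\<in>V. ((real CARD('d) * norm v) ^ r * C)\<^sup>2)) <= 2 ^ m * (M * ((real CARD('d) * s1) ^ r * C))"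
  using * n M_nonneg by (intro mult_mono power_increasing mult_left_mono mult_nonneg_nonneg real_sqrt_ge_zero sum_nonneg) auto
 then show "2 ^ n * (M * sqrt (\<Sum>v\<in>V. ((real CARD('d) * norm v) ^ r * C)\<^sup>2)) <= 2 ^ m * M * ((real CARD('d) * s1) ^ r * C)"
  by (simp add: mult.assoc)
qed

lemma Xc_Rem:
 assumes h: "h > 0" and l: "l <= m" and X: "Xc (l + r + 3) C \<phi>"
 shows "Xc l (2 ^ m * M * ((real CARD('d) * s1) ^ (r + 3) + (real CARD('d) * s1) ^ (r + 2)) * (C * h ^ (r + 1))) (Rem V q p c r h t \<phi>)"
proof -
 have C: "C >= 0" by (rule Xc_nonneg[OF X])
 have 1: "Xc l (2 ^ m * M * ((real CARD('d) * s1) ^ (r + 3) * (C * h ^ (r + 1)))) (%x. \<Sum>v\<in>V. q v t x * (1 / h * tay (Suc r) h v \<phi> x))"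
 proof (rule Xc_wsum[OF qX l])
  fix v
  have "Xc l ((real CARD('d) * norm v) ^ (Suc r + 2) * C * h ^ (Suc r + 1)) (tay (Suc r) h v \<phi>)"
   by (rule Xc_tay[OF _ h]) (use X in \<open>simp add: numeral_3_eq_3\<close>)
  from Xc_cmult[OF this, of "1 / h"]
  show "Xc l ((real CARD('d) * norm v) ^ (r + 3) * (C * h ^ (r + 1))) (%x. 1 / h * tay (Suc r) h v \<phi> x)"
   using h by (simp add: numeral_3_eq_3 mult_ac)
 qed (use h C in auto)
 have 2: "Xc l (2 ^ m * M * ((real CARD('d) * s1) ^ (r + 2) * (C * h ^ (r + 1)))) (%x. \<Sum>v\<in>V. p v t x * tay r h v \<phi> x)"
 proof (rule Xc_wsum[OF pX l])
  fix v
  have "Xc l ((real CARD('d) * norm v) ^ (r + 2) * C * h ^ (r + 1)) (tay r h v \<phi>)"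
   by (rule Xc_tay[OF Xc_le[OF X] h]) simp
  then show "Xc l ((real CARD('d) * norm v) ^ (r + 2) * (C * h ^ (r + 1))) (%x. tay r h v \<phi> x)"
   by (simp add: mult.assoc)
 qed (use h C in auto)
 have "Rem V q p c r h t \<phi> = (%x. (\<Sum>v\<in>V. q v t x * (1 / h * tay (Suc r) h v \<phi> x)) + (\<Sum>v\<in>V. p v t x * tay r h v \<phi> x))"
  by (rule ext) (rule Rem_eq[where q=q and t=t, OF zero h])
 then show ?thesis using Xc_add[OF 1 2] by (simp add: algebra_simps)
qed

lemma Xc_qpart:
 assumes n: "1 <= n" "n <= m" and r: "1 <= r" and X: "Xc (n + r) C \<phi>"
 shows "Xc n (2 ^ m * M * ((real CARD('d) * s1) ^ r * C)) (%x. \<Sum>v\<in>V. q v t x * (ddir v ^^ r) \<phi> x)"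
  and "Xc n (2 ^ m * M * ((real CARD('d) * s1) ^ r * C)) (%x. \<Sum>v\<in>V. p v t x * (ddir v ^^ r) \<phi> x)"
 by (rule Xc_wsum[OF qX n(2) r Xc_nonneg[OF X] Xc_ddirs[OF n(1) X]], assumption)
  (rule Xc_wsum[OF pX n(2) r Xc_nonneg[OF X] Xc_ddirs[OF n(1) X]])

lemma Xc_L_op:
 assumes n: "1 <= n" "n <= m" and X: "Xc (n + 2) C \<phi>"
 shows "Xc n (2 ^ m * M * ((real CARD('d) * s1)\<^sup>2 + real CARD('d) * s1 + 1) * C) (L_op V q p c t \<phi>)"
proof -
 have C: "C >= 0" by (rule Xc_nonneg[OF X])
 have P: "2 ^ m * M * ((real CARD('d) * s1)\<^sup>2 * C) >= 0" using C M_nonneg by simp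
 have 1: "Xc n (2 ^ m * M * ((real CARD('d) * s1)\<^sup>2 * C)) (%x. (1 / 2) * (\<Sum>v\<in>V. q v t x * (ddir v ^^ 2) \<phi> x))"
  by (rule Xc_mono[OF Xc_cmult[OF Xc_qpart(1)[OF n _ X]]]) (use P C M_nonneg in \<open>auto intro!: mult_nonneg_nonneg\<close>)
 have 2: "Xc n (2 ^ m * M * ((real CARD('d) * s1) ^ 1 * C)) (%x. \<Sum>v\<in>V. p v t x * (ddir v ^^ 1) \<phi> x)"
  by (rule Xc_qpart(2)[OF n order_refl Xc_le[OF X]]) simp
 have 3: "Xc n (2 ^ m * M * C) (%x. c t x * \<phi> x)"
 proof (rule Xc_mono[OF Xc_mult[OF Xc_le[OF cX n(2)] Xc_le[OF X]]])
  show "2 ^ n * (M * C) <= 2 ^ m * M * C"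
   unfolding mult.assoc using n C M_nonneg by (intro mult_right_mono power_increasing) auto
 qed simp
 have "Xc n (2 ^ m * M * ((real CARD('d) * s1)\<^sup>2 * C) + 2 ^ m * M * ((real CARD('d) * s1) ^ 1 * C) + 2 ^ m * M * C)
   (%x. (1 / 2) * (\<Sum>v\<in>V. q v t x * (ddir v ^^ 2) \<phi> x) + (\<Sum>v\<in>V. p v t x * (ddir v ^^ 1) \<phi> x) - c t x * \<phi> x)"
  by (rule Xc_diff[OF Xc_add[OF 1 2] 3])
 then show ?thesis unfolding L_op_def[abs_def] by (simp add: algebra_simps)
qed

text \<open>The constant degenerates as h tends to 0; the bound serves integrability and continuity
  at fixed h, not the final estimate.\<close>

lemma Xc_L_h:
 assumes n: "n <= m" and h: "h > 0" and X: "Xc n C \<phi>"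
 shows "Xc n (2 ^ m * M * sqrt (real (card V)) * (2 / h\<^sup>2 + 2 / h) * C + 2 ^ m * M * C) (L_h V q p c h t \<phi>)"
proof -
 have C: "C >= 0" by (rule Xc_nonneg[OF X])
 have fd: "Xc n (2 / h * C) (fdiff h v \<phi>)" for v
 proof -
  have "Xc n (\<bar>1 / h\<bar> * (C + C)) (%x. 1 / h * (\<phi> (x + h *\<^sub>R v) - \<phi> x))"
   by (intro Xc_cmult Xc_diff Xc_shift X)
  then show ?thesis using h by (simp add: fdiff_def[abs_def])
 qed
 have ws: "Xc n (2 ^ m * M * (sqrt (real (card V)) * (2 / h * C))) (%x. \<Sum>v\<in>V. a v x * fdiff h v \<phi> x)"
  if a: "!!s. (\<Sum>v\<in>V. (s v)\<^sup>2) <= 1 ==> Xc m M (%x. \<Sum>v\<in>V. s v * a v x)" for a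
 proof (rule Xc_mono[OF Xc_prod[OF fin Xc_le[OF a n] fd]])
  have "sqrt (\<Sum>v\<in>V. (2 / h * C)\<^sup>2) = sqrt (real (card V)) * (2 / h * C)"
   using h C by (simp add: real_sqrt_mult)
  then show "2 ^ n * (M * sqrt (\<Sum>v\<in>V. (2 / h * C)\<^sup>2)) <= 2 ^ m * M * (sqrt (real (card V)) * (2 / h * C))"
   unfolding mult.assoc using n C h M_nonneg by (intro mult_mono power_increasing) auto
 qed
 have 1: "Xc n (\<bar>1 / h\<bar> * (2 ^ m * M * (sqrt (real (card V)) * (2 / h * C)))) (%x. (1 / h) * (\<Sum>v\<in>V. q v t x * fdiff h v \<phi> x))"
  by (rule Xc_cmult[OF ws[OF qX]])
 have 3: "Xc n (2 ^ m * M * C) (%x. c t x * \<phi> x)"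
 proof (rule Xc_mono[OF Xc_mult[OF Xc_le[OF cX n] X]])
  show "2 ^ n * (M * C) <= 2 ^ m * M * C"
   unfolding mult.assoc using n C M_nonneg by (intro mult_right_mono power_increasing) auto
 qed
 have "Xc n (\<bar>1 / h\<bar> * (2 ^ m * M * (sqrt (real (card V)) * (2 / h * C))) + 2 ^ m * M * (sqrt (real (card V)) * (2 / h * C)) + 2 ^ m * M * C)
   (L_h V q p c h t \<phi>)"
  unfolding L_h_def[abs_def] by (rule Xc_diff[OF Xc_add[OF 1 ws[OF pX]] 3])
 then show ?thesis using h by (simp add: algebra_simps power2_eq_square)
qed

lemma ddirs_minus: "(ddir (- v) ^^ j) \<phi> = (%x. (-1) ^ j * (ddir v ^^ j) \<phi> x)" if "Xc (Suc j) C \<phi>" for v :: "real^'d" and \<phi> C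
 using that
proof (induction j)
 case (Suc j)
 have IH: "(ddir (- v) ^^ j) \<phi> = (%x. (-1) ^ j * (ddir v ^^ j) \<phi> x)" by (rule Suc.IH[OF Xc_le[OF Suc.prems]]) simp
 have X: "Xc 2 ((real CARD('d) * norm v) ^ j * C) ((ddir v ^^ j) \<phi>)" by (rule Xc_ddirs[OF _ Xc_le[OF Suc.prems]]) auto
 have "D1 i (%x. (-1) ^ j * (ddir v ^^ j) \<phi> x) x = (-1) ^ j * D1 i ((ddir v ^^ j) \<phi>) x" for i x
  using D1_lin[OF X Xc_zero[OF order_refl] order_refl, of i "(-1) ^ j" x] by simp
 then show ?case by (simp add: IH) (simp add: ddir_def fun_eq_iff sum_distrib_left mult_ac sum_negf)
qed simp

text \<open>Reindexing by v -> -v turns the sum into its own negative.\<close>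

lemma sym_qpart:
 assumes sym: "uminus ` V = V" "!!v. v \<in> V ==> a (- v) x = - ((-1) ^ r) * a v x"
  and X: "!!v. (ddir (- v) ^^ r) \<phi> = (%x. (-1) ^ r * (ddir v ^^ r) \<phi> x)"
 shows "(\<Sum>v\<in>V. a v x * (ddir v ^^ r) \<phi> x) = (0::real)"
proof -
 have "(\<Sum>v\<in>V. a v x * (ddir v ^^ r) \<phi> x) = (\<Sum>v\<in>uminus ` V. a v x * (ddir v ^^ r) \<phi> x)" by (simp add: sym)
 also have "... = (\<Sum>v\<in>V. a (- v) x * (ddir (- v) ^^ r) \<phi> x)" by (subst sum.reindex) (auto simp: inj_on_def)
 also have "... = (\<Sum>v\<in>V. - (a v x * (ddir v ^^ r) \<phi> x))"
 proof (rule sum.cong[OF refl])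
  fix v assume v: "v \<in> V"
  have "(-1) ^ r * ((-1) ^ r :: real) = 1" by simp
  then have "- ((-1) ^ r) * a v x * ((-1) ^ r * (ddir v ^^ r) \<phi> x) = - (a v x * (ddir v ^^ r) \<phi> x)"
   by (metis (no_types, lifting) mult.assoc mult.commute mult_1 mult_minus_left)
  then show "a (- v) x * (ddir (- v) ^^ r) \<phi> x = - (a v x * (ddir v ^^ r) \<phi> x)"
   unfolding X sym(2)[OF v] .
 qed
 finally show ?thesis by (simp add: sum_negf)
qed

text \<open>The outermost derivative changes sign by the very definition of \<open>ddir\<close>, so
  one order of differences fewer is required than in \<open>ddirs_minus\<close>. This makes the
  third-order part available when only \<open>Xc 3\<close> is known.\<close>

lemma ddirs_minus_odd:
 fixes v :: "real^'d"
 assumes "even j" "Xc (Suc j) C \<phi>"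
 shows "(ddir (- v) ^^ Suc j) \<phi> = (%x. (-1) ^ Suc j * (ddir v ^^ Suc j) \<phi> x)"
proof -
 have "(ddir (- v) ^^ j) \<phi> = (ddir v ^^ j) \<phi>" using ddirs_minus[OF assms(2), of v] assms(1) by simp
 then show ?thesis using assms(1) by (simp add: ddir_def[abs_def] sum_negf)
qed

lemma qpart_odd:
 assumes sym: "uminus ` V = V" "!!v x. v \<in> V ==> q v t x = q (- v) t x"
  and r: "odd r" and X: "Xc r C \<phi>"
 shows "(\<Sum>v\<in>V. q v t x * (ddir v ^^ r) \<phi> x) = 0"
proof -
 obtain j where j: "r = Suc j" "even j" using r by (cases r) auto
 show ?thesis unfolding j(1)
  by (rule sym_qpart[OF sym(1), where a="%v. q v t"]) (use sym(2) j X ddirs_minus_odd in auto)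
qed

lemma ppart_even:
 assumes sym: "uminus ` V = V" "!!v x. v \<in> V ==> p (- v) t x = - p v t x"
  and r: "even r" and X: "Xc (Suc r) C \<phi>"
 shows "(\<Sum>v\<in>V. p v t x * (ddir v ^^ r) \<phi> x) = 0"
 by (rule sym_qpart[OF sym(1), where a="%v. p v t"]) (use sym(2) r ddirs_minus[OF X] in auto)

text \<open>The operator of index i has order i + 2, which is at most 3 i. Under symmetry 2 i orders
  suffice: for i >= 2 because i + 2 <= 2 i, and for i = 1 because the third-order part
  vanishes.\<close>

lemma Xc_L_coef:
 assumes n: "1 <= n" "n <= m" and i: "1 <= i" and X: "Xc (n + \<rho> * i) C \<phi>"
  and \<rho>: "\<rho> = 3 \<or> \<rho> = 2 \<and> uminus ` V = V \<and> (\<forall>v\<in>V. \<forall>x. q v t x = q (- v) t x)"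
 shows "Xc n (2 ^ m * M * ((real CARD('d) * s1) ^ (i + 2) + (real CARD('d) * s1) ^ (i + 1)) * C) (L_coef V q p i t \<phi>)"
proof -
 have C: "C >= 0" by (rule Xc_nonneg[OF X])
 have P: "0 <= 2 ^ m * M * ((real CARD('d) * s1) ^ r * C)" for r using C M_nonneg s1 by simp
 have sc: "Xc n A (%x. a * F x)" if "Xc n A F" "0 <= a" "a <= 1" for A a and F :: "'d fn"
  by (rule Xc_mono[OF Xc_cmult[OF that(1)]]) (use that Xc_nonneg[OF that(1)] in \<open>simp add: mult_left_le_one_le\<close>)
 have le: "Xc (n + (i + 2)) C \<phi>" if "\<not> (\<rho> = 2 \<and> i = 1)"
  by (rule Xc_le[OF X]) (use \<rho> that i in auto)
 have 1: "Xc n (2 ^ m * M * ((real CARD('d) * s1) ^ (i + 2) * C)) (%x. \<Sum>v\<in>V. q v t x * (ddir v ^^ (i + 2)) \<phi> x)"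
 proof (cases "\<rho> = 2 \<and> i = 1")
  case True
  then have "(\<Sum>v\<in>V. q v t x * (ddir v ^^ (i + 2)) \<phi> x) = 0" for x
   using \<rho> n by (intro qpart_odd[OF _ _ _ Xc_le[OF X]]) auto
  then show ?thesis using Xc_zero[OF P, of n "i + 2"] by (simp only:)
 next
  case False
  then show ?thesis by (intro Xc_qpart(1)[OF n _ le]) auto
 qed
 have 2: "Xc n (2 ^ m * M * ((real CARD('d) * s1) ^ (i + 1) * C)) (%x. \<Sum>v\<in>V. p v t x * (ddir v ^^ (i + 1)) \<phi> x)"
  by (rule Xc_qpart(2)[OF n _ Xc_le[OF X]]) (use \<rho> i in auto)
 have "real (i + 1) * real (i + 2) >= 1 * 1" by (intro mult_mono) auto
 then have "Xc n (2 ^ m * M * ((real CARD('d) * s1) ^ (i + 2) * C) + 2 ^ m * M * ((real CARD('d) * s1) ^ (i + 1) * C)) (L_coef V q p i t \<phi>)"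
  unfolding L_coef_def[abs_def] by (intro Xc_add sc[OF 1] sc[OF 2]) auto
 then show ?thesis by (simp add: algebra_simps)
qed

text \<open>For odd i the q part has odd order i + 2 and the p part even order i + 1; symmetry of q
  and antisymmetry of p kill both.\<close>

lemma L_coef_zero:
 assumes i: "odd i" and X: "Xc (i + 2) C \<phi>" and sym: "uminus ` V = V" "!!v x. v \<in> V ==> q v t x = q (- v) t x"
  "!!v x. v \<in> V ==> p (- v) t x = - p v t x"
 shows "L_coef V q p i t \<phi> x = 0"
 unfolding L_coef_def using qpart_odd[OF sym(1,2), of "i + 2"] ppart_even[OF sym(1,3), of "i + 1"] X i by simp

end

section \<open>The spaces of the theorem\<close>

lemma finite_mi: "finite {\<alpha> :: 'd::finite => nat. mi_order \<alpha> <= m}"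
proof (rule finite_subset)
 show "{\<alpha> :: 'd => nat. mi_order \<alpha> <= m} \<subseteq> count_list ` {is. set is \<subseteq> UNIV \<and> length is <= m}"
 proof
  fix \<alpha> :: "'d => nat" assume "\<alpha> \<in> {\<alpha>. mi_order \<alpha> <= m}"
  moreover obtain "is" where "count_list is = \<alpha>" "length is = mi_order \<alpha>" by (rule ex_count_list)
  ultimately show "\<alpha> \<in> count_list ` {is. set is \<subseteq> UNIV \<and> length is <= m}" by auto
 qed
qed (intro finite_imageI finite_lists_length_le finite)

lemma xsup_AE:
 assumes "xsup T F <= ereal B" "t \<in> {0..T}"
 shows "AE x in lborel. F t x <= B"
proof -
 have "esssup lborel (%x. ereal (F t x)) <= ereal B"
  using assms unfolding xsup_def by (meson SUP_upper order_trans)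
 then show ?thesis using esssup_AE[where M=lborel and f="%x. ereal (F t x)"]
  by (auto elim!: eventually_mono dest: order_trans)
qed

lemma xsup_finite:
 assumes "xsup T F < \<infinity>" shows "\<exists>B\<ge>0. xsup T F <= ereal B"
proof (cases "xsup T F")
 case (real r)
 then show ?thesis by (intro exI[of _ "max 0 r"]) auto
qed (use assms in \<open>auto intro: exI[of _ 0]\<close>)

lemma xsup_le:
 assumes "!!t. t \<in> {0..T} ==> F t \<in> borel_measurable borel" "!!t. t \<in> {0..T} ==> AE x in lborel. F t x <= B"
 shows "xsup T F <= ereal B"
 unfolding xsup_def using assms by (intro SUP_least esssup_I) auto

lemma in_B_gen_deriv_bound:
 fixes \<psi> :: "real => 'd::finite fn"
 assumes B: "in_B T m \<psi>"
 shows "\<exists>C\<ge>0. \<forall>\<alpha>. mi_order \<alpha> <= m --> (\<forall>t\<in>{0..T}. AE x in lborel. \<bar>gen_deriv \<alpha> (\<psi> t) x\<bar> <= C)"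
proof -
 have "\<exists>C. mi_order \<alpha> <= m --> C >= 0 \<and> (\<forall>t\<in>{0..T}. AE x in lborel. \<bar>gen_deriv \<alpha> (\<psi> t) x\<bar> <= C)" for \<alpha>
  using xsup_finite[of T "%t x. \<bar>gen_deriv \<alpha> (\<psi> t) x\<bar>"] xsup_AE[of T "%t x. \<bar>gen_deriv \<alpha> (\<psi> t) x\<bar>"] B
  unfolding in_B_def by metis
 then obtain C where C: "!!\<alpha>. mi_order \<alpha> <= m ==> C \<alpha> >= 0 \<and> (\<forall>t\<in>{0..T}. AE x in lborel. \<bar>gen_deriv \<alpha> (\<psi> t) x\<bar> <= C \<alpha>)"
  by metis
 have le: "C \<alpha> <= (\<Sum>\<alpha> | mi_order \<alpha> <= m. C \<alpha>)" if "mi_order \<alpha> <= m" for \<alpha>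
  by (rule member_le_sum) (use that C finite_mi in auto)
 show ?thesis
 proof (intro exI[of _ "\<Sum>\<alpha> | mi_order \<alpha> <= m. C \<alpha>"] conjI allI impI ballI)
  show "0 <= (\<Sum>\<alpha> | mi_order \<alpha> <= m. C \<alpha>)" using C by (intro sum_nonneg) auto
  fix \<alpha> :: "'d => nat" and t assume a: "mi_order \<alpha> <= m" "t \<in> {0..T}"
  have "AE x in lborel. \<bar>gen_deriv \<alpha> (\<psi> t) x\<bar> <= C \<alpha>" using C[OF a(1)] a(2) by blast
  then show "AE x in lborel. \<bar>gen_deriv \<alpha> (\<psi> t) x\<bar> <= (\<Sum>\<alpha> | mi_order \<alpha> <= m. C \<alpha>)"
   using le[OF a(1)] by (auto elim!: eventually_mono)
 qed
qed

lemma Xc_gen_deriv: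
 fixes \<phi> :: "'d::finite fn"
 assumes c: "continuous_on UNIV \<phi>"
  and w: "!!\<alpha>. mi_order \<alpha> <= m ==> has_gen_deriv \<alpha> \<phi>" "!!\<alpha>. mi_order \<alpha> <= m ==> AE x in lborel. \<bar>gen_deriv \<alpha> \<phi> x\<bar> <= C"
 shows "Xc m C \<phi>"
 unfolding Xc_def
proof (intro allI impI dbd_weak[OF c])
 fix k and "is" :: "'d list" assume "k <= m" "length is = k"
 then have "mi_order (count_list is) <= m" by (simp add: mi_order_count_list)
 then show "\<exists>v. weak_deriv (count_list is) \<phi> v \<and> (AE x in lborel. \<bar>v x\<bar> <= C)"
  using weak_deriv_gen_deriv[OF w(1)] w(2) by blast
qed

lemma in_B_Xc:
 fixes \<psi> :: "real => 'd::finite fn"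
 assumes "in_B T m \<psi>"
 shows "\<exists>C\<ge>0. \<forall>t\<in>{0..T}. Xc m C (\<psi> t)"
proof -
 obtain C where C: "C >= 0" "!!\<alpha> t. mi_order \<alpha> <= m ==> t \<in> {0..T} ==> AE x in lborel. \<bar>gen_deriv \<alpha> (\<psi> t) x\<bar> <= C"
  using in_B_gen_deriv_bound[OF assms] by blast
 have "Xc m C (\<psi> t)" if "t \<in> {0..T}" for t
  by (rule Xc_gen_deriv) (use assms that C(2) in \<open>auto simp: in_B_def\<close>)
 then show ?thesis using C(1) by blast
qed

text \<open>Finiteness of the essential supremum has to be secured first, because
  \<open>norm_B\<close> passes through \<open>real_of_ereal\<close>, which would send an infinite
  value to 0.\<close>

lemma in_B_norm:
 fixes \<psi> :: "real => 'd::finite fn"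
 assumes B: "in_B T m \<psi>" and t: "t \<in> {0..T}"
 shows "Xc m (norm_B T m \<psi>) (\<psi> t)"
proof -
 let ?S = "%t x. \<Sum>\<alpha> | mi_order \<alpha> <= m. (gen_deriv \<alpha> (\<psi> t) x)\<^sup>2"
 obtain C where C: "C >= 0" "!!\<alpha> t. mi_order \<alpha> <= m ==> t \<in> {0..T} ==> AE x in lborel. \<bar>gen_deriv \<alpha> (\<psi> t) x\<bar> <= C"
  using in_B_gen_deriv_bound[OF B] by blast
 have hg: "has_gen_deriv \<alpha> (\<psi> t)" if "mi_order \<alpha> <= m" "t \<in> {0..T}" for \<alpha> t
  using B that unfolding in_B_def by blast
 have meas: "gen_deriv \<alpha> (\<psi> t) \<in> borel_measurable borel" if "mi_order \<alpha> <= m" "t \<in> {0..T}" for \<alpha> t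
  using weak_deriv_gen_deriv[OF hg[OF that]] locally_integrable_borel unfolding weak_deriv_def by blast
 have sq: "AE x in lborel. (gen_deriv \<alpha> (\<psi> t) x)\<^sup>2 <= C\<^sup>2" if "\<alpha> \<in> {\<alpha>. mi_order \<alpha> <= m}" "t \<in> {0..T}" for \<alpha> t
 proof (rule eventually_mono)
  show "AE x in lborel. \<bar>gen_deriv \<alpha> (\<psi> t) x\<bar> <= C" using C(2) that by blast
  show "!!x. \<bar>gen_deriv \<alpha> (\<psi> t) x\<bar> <= C ==> (gen_deriv \<alpha> (\<psi> t) x)\<^sup>2 <= C\<^sup>2"
   using C(1) by (simp add: abs_le_square_iff[symmetric])
 qed
 have "AE x in lborel. \<forall>\<alpha>\<in>{\<alpha>. mi_order \<alpha> <= m}. (gen_deriv \<alpha> (\<psi> t) x)\<^sup>2 <= C\<^sup>2" if "t \<in> {0..T}" for t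
  by (intro AE_finite_allI finite_mi sq that)
 note all = this
 have ae: "AE x in lborel. ?S t x <= real (card {\<alpha> :: 'd => nat. mi_order \<alpha> <= m}) * C\<^sup>2" if "t \<in> {0..T}" for t
  by (rule eventually_mono[OF all[OF that]]) (auto intro!: sum_bounded_above)
 have fin: "xsup T ?S <= ereal (real (card {\<alpha> :: 'd => nat. mi_order \<alpha> <= m}) * C\<^sup>2)"
  by (rule xsup_le[OF _ ae]) (auto intro!: borel_measurable_sum borel_measurable_power meas)
 have "0 <= esssup lborel (%x. ereal (?S t x))"
 proof -
  have "esssup (lborel :: (real^'d) measure) (%x. 0) <= esssup lborel (%x. ereal (?S t x))"
   by (rule esssup_mono) (auto intro!: sum_nonneg)
  then show ?thesis by (simp add: esssup_const)
 qed
 also have "... <= xsup T ?S" unfolding xsup_def by (rule SUP_upper[OF t])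
 finally obtain R where R: "xsup T ?S = ereal R" "R >= 0" using fin by (cases "xsup T ?S") auto
 have nB: "norm_B T m \<psi> = sqrt R" unfolding norm_B_def R by simp
 have S: "AE x in lborel. ?S t x <= R" by (rule xsup_AE[OF _ t]) (simp add: R)
 have "AE x in lborel. \<bar>gen_deriv \<alpha> (\<psi> t) x\<bar> <= sqrt R" if a: "mi_order \<alpha> <= m" for \<alpha>
  using S
 proof (rule eventually_mono)
  fix x assume "?S t x <= R"
  moreover have "(gen_deriv \<alpha> (\<psi> t) x)\<^sup>2 <= ?S t x" by (rule member_le_sum) (use a finite_mi in auto)
  ultimately show "\<bar>gen_deriv \<alpha> (\<psi> t) x\<bar> <= sqrt R" by (intro real_le_rsqrt) simp
 qed
 then show ?thesis unfolding nB using B t hg[OF _ t] unfolding in_B_def by (intro Xc_gen_deriv) auto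
qed

lemma borel_on_tmeas:
 fixes \<psi> :: "real => 'd::finite fn"
 assumes b: "borel_on I \<psi>" and I: "{0..T} \<subseteq> I"
 shows "tmeas T \<psi>"
 unfolding tmeas_def set_borel_measurable_def
proof
 fix x :: "real^'d"
 have "(%s. (s, x)) \<in> restrict_space borel {0..T} \<rightarrow>\<^sub>M restrict_space borel (I \<times> UNIV)"
  by (intro measurable_restrict_space3 borel_measurable_continuous_onI) (use I in \<open>auto intro!: continuous_intros\<close>)
 from measurable_compose[OF this b[unfolded borel_on_def]]
 have "(%s. \<psi> s x) \<in> borel_measurable (restrict_space borel {0..T})" by simp
 then show "(%s. indicator {0..T} s *\<^sub>R \<psi> s x) \<in> borel_measurable lborel"
  by (subst (asm) borel_measurable_restrict_space_iff) auto
qed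

text \<open>By Cauchy-Schwarz the square-sum bound controls all combinations with unit coefficient
  vectors; the sum of the absolute values of the M k serves as one constant for all orders.\<close>

lemma regularity_coefs:
 fixes q p :: "real^'d::finite => real => 'd fn"
 assumes reg: "regularity T V q p c f g m M" and fin: "finite V" and t: "t \<in> {0..T}"
 shows "(\<Sum>v\<in>V. (s v)\<^sup>2) <= 1 ==> Xc m (\<Sum>k\<le>m. \<bar>M k\<bar>) (%x. \<Sum>v\<in>V. s v * q v t x)"
  and "(\<Sum>v\<in>V. (s v)\<^sup>2) <= 1 ==> Xc m (\<Sum>k\<le>m. \<bar>M k\<bar>) (%x. \<Sum>v\<in>V. s v * p v t x)"
  and "Xc m (\<Sum>k\<le>m. \<bar>M k\<bar>) (c t)"
proof -
 have Mk: "\<bar>M k\<bar> <= (\<Sum>k\<le>m. \<bar>M k\<bar>)" if "k <= m" for k by (rule member_le_sum) (use that in auto)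
 have D: "AE x in lborel. (\<Sum>v\<in>V. Dk_sq k (q v t) x + Dk_sq k (p v t) x) + Dk_sq k (c t) x <= (M k)\<^sup>2" if "k <= m" for k
  by (rule xsup_AE[where F="%t x. (\<Sum>v\<in>V. Dk_sq k (q v t) x + Dk_sq k (p v t) x) + Dk_sq k (c t) x", OF _ t])
    (use reg that in \<open>auto simp: regularity_def\<close>)
 have Dn: "Dk_sq k u x >= 0" for k and u :: "'d fn" and x by (simp add: Dk_sq_def sum_nonneg)
 have g: "(gen_deriv \<alpha> u x)\<^sup>2 <= Dk_sq (mi_order \<alpha>) u x" for \<alpha> and u :: "'d fn" and x
  unfolding Dk_sq_def by (rule member_le_sum) (auto intro: finite_subset[OF _ finite_mi[of "mi_order \<alpha>"]])
 have B: "in_B T m (q v)" "in_B T m (p v)" if "v \<in> V" for v using reg that by (auto simp: regularity_def)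
 have Bc: "in_B T m c" using reg by (simp add: regularity_def)
 have hg: "has_gen_deriv \<alpha> (\<psi> t)" "continuous_on UNIV (\<psi> t)" if "in_B T m \<psi>" "mi_order \<alpha> <= m" for \<alpha> \<psi>
  using that t unfolding in_B_def by auto
 show "Xc m (\<Sum>k\<le>m. \<bar>M k\<bar>) (c t)"
 proof (rule Xc_gen_deriv)
  fix \<alpha> :: "'d => nat" assume a: "mi_order \<alpha> <= m"
  show "AE x in lborel. \<bar>gen_deriv \<alpha> (c t) x\<bar> <= (\<Sum>k\<le>m. \<bar>M k\<bar>)"
   using D[OF a]
  proof (rule eventually_mono)
   fix x assume *: "(\<Sum>v\<in>V. Dk_sq (mi_order \<alpha>) (q v t) x + Dk_sq (mi_order \<alpha>) (p v t) x) + Dk_sq (mi_order \<alpha>) (c t) x <= (M (mi_order \<alpha>))\<^sup>2"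
   have "0 <= (\<Sum>v\<in>V. Dk_sq (mi_order \<alpha>) (q v t) x + Dk_sq (mi_order \<alpha>) (p v t) x)" by (intro sum_nonneg add_nonneg_nonneg Dn)
   then have "(gen_deriv \<alpha> (c t) x)\<^sup>2 <= (M (mi_order \<alpha>))\<^sup>2" using * g[of \<alpha> "c t" x] by linarith
   then show "\<bar>gen_deriv \<alpha> (c t) x\<bar> <= (\<Sum>k\<le>m. \<bar>M k\<bar>)" using Mk[OF a] by (simp add: abs_le_square_iff[symmetric])
  qed
 qed (use hg[OF Bc, of "%_. 0"] hg(1)[OF Bc] in \<open>auto simp: mi_order_def\<close>)
 have comb: "Xc m (\<Sum>k\<le>m. \<bar>M k\<bar>) (%x. \<Sum>v\<in>V. s v * a v t x)"
  if s: "(\<Sum>v\<in>V. (s v)\<^sup>2) <= 1" and aB: "!!v. v \<in> V ==> in_B T m (a v)"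
   and ale: "!!k v x. v \<in> V ==> Dk_sq k (a v t) x <= Dk_sq k (q v t) x + Dk_sq k (p v t) x" for a
  unfolding Xc_def
 proof (intro allI impI dbd_weak)
  show "continuous_on UNIV (%x. \<Sum>v\<in>V. s v * a v t x)"
   by (intro continuous_intros hg(2)[OF aB, of _ "%_. 0"]) (auto simp: mi_order_def)
  fix k and "is" :: "'d list" assume k: "k <= m" and is1: "length is = k"
  let ?\<alpha> = "count_list is"
  have ok: "mi_order ?\<alpha> = k" by (simp add: mi_order_count_list is1)
  have w: "weak_deriv ?\<alpha> (%x. \<Sum>v\<in>V. s v * a v t x) (%x. \<Sum>v\<in>V. s v * gen_deriv ?\<alpha> (a v t) x)"
   by (rule weak_deriv_sum[OF fin]) (use hg(1)[OF aB] ok k in \<open>auto intro!: weak_deriv_gen_deriv\<close>)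
  have "AE x in lborel. \<bar>\<Sum>v\<in>V. s v * gen_deriv ?\<alpha> (a v t) x\<bar> <= (\<Sum>k\<le>m. \<bar>M k\<bar>)"
   using D[OF k]
  proof (rule eventually_mono)
   fix x assume *: "(\<Sum>v\<in>V. Dk_sq k (q v t) x + Dk_sq k (p v t) x) + Dk_sq k (c t) x <= (M k)\<^sup>2"
   have "(\<Sum>v\<in>V. (gen_deriv ?\<alpha> (a v t) x)\<^sup>2) <= (\<Sum>v\<in>V. Dk_sq k (q v t) x + Dk_sq k (p v t) x)"
    using g[of ?\<alpha>] unfolding ok by (intro sum_mono order_trans[OF _ ale]) auto
   then have 1: "(\<Sum>v\<in>V. (gen_deriv ?\<alpha> (a v t) x)\<^sup>2) <= (M k)\<^sup>2" using * Dn[of k "c t" x] by linarith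
   have "(\<Sum>v\<in>V. s v * gen_deriv ?\<alpha> (a v t) x)\<^sup>2 <= (\<Sum>v\<in>V. (s v)\<^sup>2) * (\<Sum>v\<in>V. (gen_deriv ?\<alpha> (a v t) x)\<^sup>2)"
    by (rule Cauchy_Schwarz_ineq_sum)
   also have "... <= 1 * (M k)\<^sup>2" using s 1 by (intro mult_mono) (auto intro: sum_nonneg)
   finally show "\<bar>\<Sum>v\<in>V. s v * gen_deriv ?\<alpha> (a v t) x\<bar> <= (\<Sum>k\<le>m. \<bar>M k\<bar>)"
    using Mk[OF k] by (simp add: abs_le_square_iff[symmetric])
  qed
  then show "\<exists>v. weak_deriv ?\<alpha> (%x. \<Sum>v\<in>V. s v * a v t x) v \<and> (AE x in lborel. \<bar>v x\<bar> <= (\<Sum>k\<le>m. \<bar>M k\<bar>))"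
   using w by blast
 qed
 show "Xc m (\<Sum>k\<le>m. \<bar>M k\<bar>) (%x. \<Sum>v\<in>V. s v * q v t x)" if "(\<Sum>v\<in>V. (s v)\<^sup>2) <= 1"
  by (rule comb[OF that B(1)]) (use Dn in auto)
 show "Xc m (\<Sum>k\<le>m. \<bar>M k\<bar>) (%x. \<Sum>v\<in>V. s v * p v t x)" if "(\<Sum>v\<in>V. (s v)\<^sup>2) <= 1"
  by (rule comb[OF that B(2)]) (use Dn in auto)
qed

section \<open>A priori estimates for the equations\<close>

lemma set_integral_split:
 fixes F :: "real => real"
 assumes st: "0 <= s" "s <= t" and i: "set_integrable lborel {0..t} F"
 shows "(LINT r:{0..t}|lborel. F r) - (LINT r:{0..s}|lborel. F r) = (LINT r:{s..t}|lborel. F r)"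
proof -
 have "(LINT r:{0..s} \<union> {s..t}|lborel. F r) = (LINT r:{0..s}|lborel. F r) + (LINT r:{s..t}|lborel. F r)"
  by (rule set_integral_Un_AE)
    (use st in \<open>auto intro!: set_integrable_subset[OF i] eventually_mono[OF AE_lborel_singleton[of s]]\<close>)
 moreover have "{0..s} \<union> {s..t} = {0..t}" using st by auto
 ultimately show ?thesis by simp
qed

lemma set_integral_abs_le:
 fixes F :: "real => real"
 assumes i: "set_integrable lborel {s..t} F" and b: "!!r. r \<in> {s..t} ==> \<bar>F r\<bar> <= C" and st: "s <= t"
 shows "\<bar>LINT r:{s..t}|lborel. F r\<bar> <= C * (t - s)"
proof -
 have c: "integrable lborel (%r. indicator {s..t} r *\<^sub>R C)"
  by (intro borel_integrable_compact continuous_intros) auto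
 have "\<bar>LINT r:{s..t}|lborel. F r\<bar> <= (LBINT r. indicator {s..t} r *\<^sub>R C)"
  unfolding set_lebesgue_integral_def real_norm_def[symmetric]
  by (rule Bochner_Integration.integral_norm_bound_integral[OF i[unfolded set_integrable_def] c]) (use b in \<open>auto simp: indicator_def\<close>)
 also have "... = C * (t - s)" using st by simp
 finally show ?thesis .
qed

lemma tmeas_add: "tmeas T F ==> tmeas T G ==> tmeas T (%s x. F s x + G s x)"
 unfolding tmeas_def set_borel_measurable_def by (auto simp: distrib_left intro: borel_measurable_add)

lemma tmeas_mult:
 assumes F: "tmeas T F" and G: "tmeas T G" shows "tmeas T (%s x. F s x * G s x)"
 unfolding tmeas_def set_borel_measurable_def
proof
 fix x
 have "(%s. (indicator {0..T} s *\<^sub>R F s x) * (indicator {0..T} s *\<^sub>R G s x)) \<in> borel_measurable lborel"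
  using F G unfolding tmeas_def set_borel_measurable_def by (intro borel_measurable_times) auto
 moreover have "(%s. (indicator {0..T} s *\<^sub>R F s x) * (indicator {0..T} s *\<^sub>R G s x)) = (%s. indicator {0..T} s *\<^sub>R (F s x * G s x))"
  by (auto simp: indicator_def)
 ultimately show "(%s. indicator {0..T} s *\<^sub>R (F s x * G s x)) \<in> borel_measurable lborel" by simp
qed

lemma tmeas_continuous:
 assumes "!!x. continuous_on {0..T} (%s. F s x)" shows "tmeas T F"
 unfolding tmeas_def set_borel_measurable_def
 using borel_measurable_continuous_on_indicator[OF _ assms] by (auto simp del: real_scaleR_def)

lemma tmeas_cmult: "tmeas T F ==> tmeas T (%s x. a x * F s x)"
 by (rule tmeas_mult) (auto intro: tmeas_continuous)

lemma tmeas_diff: "tmeas T F ==> tmeas T G ==> tmeas T (%s x. F s x - G s x)"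
 using tmeas_add[OF _ tmeas_cmult[of T G "%_. -1"], of F] by simp

lemma tmeas_zero: "tmeas T (%s x. 0)"
 unfolding tmeas_def set_borel_measurable_def by simp

lemma tmeas_sum: "(!!v. v \<in> A ==> tmeas T (F v)) ==> tmeas T (%s x. \<Sum>v\<in>A. F v s x)"
 by (induction A rule: infinite_finite_induct) (auto intro: tmeas_add tmeas_zero)

lemma tmeas_shift: "tmeas T F ==> tmeas T (%s x. F s (x + a))"
 unfolding tmeas_def by auto

lemma tmeas_cong:
 assumes F: "tmeas T F" and e: "!!s x. s \<in> {0..T} ==> F s x = G s x" shows "tmeas T G"
proof -
 have "(%s. indicator {0..T} s *\<^sub>R G s x) = (%s. indicator {0..T} s *\<^sub>R F s x)" for x
  using e by (auto simp: indicator_def)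
 then show ?thesis using F unfolding tmeas_def set_borel_measurable_def by metis
qed

lemma locally_integrable_mult:
 fixes z a :: "'d::finite fn"
 assumes z: "locally_integrable z" and a: "a \<in> borel_measurable borel" "!!x. \<bar>a x\<bar> <= A"
 shows "locally_integrable (%x. a x * z x)"
 unfolding locally_integrable_def
proof (intro allI impI)
 fix C :: "(real^'d) set" assume C: "compact C"
 have i: "integrable lborel (%x. A * (indicator C x *\<^sub>R z x))"
  using z C unfolding locally_integrable_def set_integrable_def by (intro integrable_mult_right) simp
 have m: "(%x. indicator C x *\<^sub>R (a x * z x)) \<in> borel_measurable lborel"
  using a(1) locally_integrable_borel[OF z] borel_closed[OF compact_imp_closed[OF C]]
  by (intro borel_measurable_scaleR borel_measurable_times borel_measurable_indicator) auto
 show "set_integrable lborel C (%x. a x * z x)"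
  unfolding set_integrable_def
 proof (rule Bochner_Integration.integrable_bound[OF i m], rule AE_I2)
  fix x
  have "\<bar>a x\<bar> * \<bar>z x\<bar> <= \<bar>A\<bar> * \<bar>z x\<bar>" using a(2)[of x] by (intro mult_right_mono) auto
  then show "norm (indicator C x *\<^sub>R (a x * z x)) <= norm (A * (indicator C x *\<^sub>R z x))"
   by (auto simp: indicator_def abs_mult)
 qed
qed

text \<open>Commutator estimate: on the support of the kernel the Lipschitz factor a differs from
  its value at x by order r. The factor r is gained although z is merely bounded.\<close>

lemma conv_moll_mult:
 fixes a z :: "'d::finite fn"
 assumes r: "r > 0" and a: "Xc 1 A a" and z: "locally_integrable z" "AE x in lborel. \<bar>z x\<bar> <= B"
 shows "\<bar>conv (moll r) (%y. a y * z y) x - a x * conv (moll r) z x\<bar> <= A * real CARD('d) * r * B"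
proof -
 define E where "E = A * real CARD('d) * r"
 \<comment> \<open>Truncation keeps the factor within E everywhere and changes nothing on the
   support of the kernel.\<close>
 define b where "b y = max (- E) (min E (a y - a x))" for y
 have A: "A >= 0" by (rule Xc_nonneg[OF a])
 have E: "E >= 0" unfolding E_def using A r by simp
 have cont: "continuous_on UNIV a" by (rule Xc_continuous[OF a]) simp
 have bm: "b \<in> borel_measurable borel"
  unfolding b_def[abs_def] by (intro borel_measurable_continuous_onI continuous_intros cont)
 have bE: "\<bar>b y\<bar> <= E" for y using E by (auto simp: b_def)
 have sm: "continuous_on UNIV (moll r :: 'd fn)" by (rule moll_continuous[OF r])
 have eq: "moll r (x - y) * (b y * z y) = moll r (x - y) * (a y * z y) - a x * (moll r (x - y) * z y)" for y
 proof (cases "norm (x - y) <= r")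
  case True
  have "\<bar>a (x + (y - x)) - a x\<bar> <= A * real CARD('d) * norm (y - x)"
   by (rule dbd1_lipschitz[OF XcD[OF a order_refl]])
  also have "... <= E" unfolding E_def using True A by (intro mult_left_mono) (auto simp: norm_minus_commute)
  finally have "b y = a y - a x" by (auto simp: b_def)
  then show ?thesis by (simp only:) (simp add: algebra_simps)
 next
  case False
  then have "moll r (x - y) = 0" using moll_supp[OF r] unfolding supp_in_def by (metis linorder_not_less)
  then show ?thesis by simp
 qed
 have "locally_integrable (%y. a y * z y)"
  by (rule locally_integrable_mult[OF z(1) borel_measurable_continuous_onI[OF cont] Xc_bound[OF a]])
 then have "conv (moll r) (%y. b y * z y) x = conv (moll r) (%y. a y * z y) x - a x * conv (moll r) z x"
  unfolding conv_def eq
  by (subst Bochner_Integration.integral_diff) (auto intro!: integrable_mult_right integrable_supp_mult z(1) sm moll_supp[OF r])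
 moreover have "\<bar>conv (moll r) (%y. b y * z y) x\<bar> <= E * B"
 proof (rule conv_moll_bound[OF r])
  show "locally_integrable (%y. b y * z y)" by (rule locally_integrable_mult[OF z(1) bm bE])
  show "AE y in lborel. \<bar>b y * z y\<bar> <= E * B"
   using z(2) by (rule eventually_mono) (auto simp: abs_mult intro!: mult_mono bE E)
 qed
 ultimately show ?thesis by (simp add: E_def)
qed

text \<open>The first derivatives are Lipschitz, so the second directional derivative exists only as
  a weak one. It is reached through the generalized derivatives of order 2, bounded by
  \<open>weak_deriv_lipschitz_AE\<close>, and commutes with mollification.\<close>

lemma ddir2_weak:
 fixes u :: "'d::finite fn"
 assumes X: "Xc 2 C u" and g: "!!\<alpha>. mi_order \<alpha> <= 2 ==> has_gen_deriv \<alpha> u"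
 shows "locally_integrable ((ddir v ^^ 2) u)"
  and "AE x in lborel. \<bar>(ddir v ^^ 2) u x\<bar> <= (real CARD('d) * norm v)\<^sup>2 * C"
  and "r > 0 ==> conv (moll r) ((ddir v ^^ 2) u) = (ddir v ^^ 2) (conv (moll r) u)"
proof -
 define w where "w = ddir v u"
 have wX: "Xc 1 (real CARD('d) * norm v * C) w"
  unfolding w_def by (rule Xc_ddir) (use X in \<open>simp_all add: numeral_2_eq_2\<close>)
 have C: "C >= 0" by (rule Xc_nonneg[OF X])
 have DX: "Xc 1 C (D1 j u)" for j by (rule Xc_D1) (use X in \<open>simp_all add: numeral_2_eq_2\<close>)
 have Dw: "weak_deriv (unit_index j) u (D1 j u)" for j by (rule Xc_D1_weak[OF X order_refl])
 have hw: "weak_deriv (unit_index i) (D1 j u) (gen_deriv (count_list [i, j]) u)" for i j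
 proof -
  have "mi_order (count_list [i, j]) <= 2" unfolding mi_order_count_list by simp
  then have W: "weak_deriv (count_list [i, j]) u (gen_deriv (count_list [i, j]) u)"
   by (intro weak_deriv_gen_deriv g)
  have "weak_deriv (count_list [i]) (D1 j u) (gen_deriv (count_list [i, j]) u)"
  proof (rule weak_derivI)
   show "locally_integrable (D1 j u)" by (intro locally_integrable_continuous Xc_continuous[OF DX]) simp
   show "locally_integrable (gen_deriv (count_list [i, j]) u)" using W by (simp add: weak_deriv_def)
   fix k s assume k: "smooth k" "supp_in s (k :: 'd fn)"
   have "(LBINT x. u x * pds [j] (pds [i] k) x) = (-1) ^ length [j] * (LBINT x. D1 j u x * pds [i] k x)"
    by (rule weak_derivD[OF _ smooth_pds[OF k(1)] supp_in_pds[OF k(2)]]) (simp only: count_list_single Dw)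
   moreover have "(LBINT x. u x * pds [i, j] k x) = (-1) ^ length [i, j] * (LBINT x. gen_deriv (count_list [i, j]) u x * k x)"
    by (rule weak_derivD[OF W k])
   moreover have "pds [i, j] k = pds [j] (pds [i] k)" using pdiff_commute[OF k(1), of i j] by simp
   ultimately show "(LBINT x. D1 j u x * pds [i] k x) = (-1) ^ length [i] * (LBINT x. gen_deriv (count_list [i, j]) u x * k x)"
    by simp
  qed
  then show ?thesis by (simp only: count_list_single)
 qed
 have "weak_deriv (unit_index i) w (%x. \<Sum>j\<in>UNIV. v $ j * gen_deriv (count_list [i, j]) u x)" for i
  unfolding w_def ddir_def[abs_def] by (rule weak_deriv_sum) (auto intro: hw simp del: count_list.simps)
 then have gw: "weak_deriv (unit_index i) w (D1 i w)" for i
  unfolding D1_def by (intro weak_deriv_gen_deriv) (auto simp: has_gen_deriv_def)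
 have li: "locally_integrable (D1 i w)" for i using gw by (simp add: weak_deriv_def)
 have e: "(ddir v ^^ 2) u = (%x. \<Sum>i\<in>UNIV. v $ i * D1 i w x)"
  by (simp add: numeral_2_eq_2 w_def ddir_def[abs_def])
 have lic: "locally_integrable (%x. v $ i * D1 i w x)" for i
  by (rule locally_integrable_mult[OF li, of _ "\<bar>v $ i\<bar>"]) auto
 show "locally_integrable ((ddir v ^^ 2) u)" unfolding e by (intro locally_integrable_sum lic) simp
 have ae: "AE x in lborel. \<bar>D1 i w x\<bar> <= real CARD('d) * norm v * C" for i
  by (rule weak_deriv_lipschitz_AE[OF XcD[OF wX order_refl] gw])
 have "AE x in lborel. \<forall>i\<in>UNIV. \<bar>D1 i w x\<bar> <= real CARD('d) * norm v * C" by (intro AE_finite_allI ae) simp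
 then show "AE x in lborel. \<bar>(ddir v ^^ 2) u x\<bar> <= (real CARD('d) * norm v)\<^sup>2 * C"
 proof (rule eventually_mono)
  fix x assume b: "\<forall>i\<in>UNIV. \<bar>D1 i w x\<bar> <= real CARD('d) * norm v * C"
  have "\<bar>(ddir v ^^ 2) u x\<bar> <= (\<Sum>i\<in>(UNIV::'d set). norm v * (real CARD('d) * norm v * C))"
   unfolding e by (intro order_trans[OF sum_abs] sum_mono) (use b in \<open>auto simp: abs_mult intro!: mult_mono component_le_norm_cart\<close>)
  then show "\<bar>(ddir v ^^ 2) u x\<bar> <= (real CARD('d) * norm v)\<^sup>2 * C" by (simp add: power2_eq_square mult_ac)
 qed
 assume r: "r > 0"
 have sw: "smooth (conv (moll r) w)"
  by (rule smooth_conv[OF moll_smooth[OF r] moll_supp[OF r]]) (rule Xc_continuous[OF wX order_refl])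
 have cp: "conv (moll r) (D1 i w) = pdiff i (conv (moll r) w)" for i
  using pds_conv_weak[of "[i]" w "D1 i w" "moll r" r, OF _ Xc_continuous[OF wX order_refl] moll_smooth[OF r] moll_supp[OF r]] gw[of i]
  by (simp only: count_list_single) simp
 have cw: "conv (moll r) w = ddir v (conv (moll r) u)" unfolding w_def by (rule ddir_conv_moll[OF r X order_refl, symmetric])
 show "conv (moll r) ((ddir v ^^ 2) u) = (ddir v ^^ 2) (conv (moll r) u)"
 proof
  fix x
  have "conv (moll r) ((ddir v ^^ 2) u) x = (\<Sum>i\<in>UNIV. v $ i * conv (moll r) (D1 i w) x)"
   unfolding e by (subst conv_sum[OF moll_smooth[OF r] moll_supp[OF r]]) (auto intro: lic simp: conv_cmult)
  also have "... = (ddir v ^^ 2) (conv (moll r) u) x"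
   unfolding cp numeral_2_eq_2 by (simp add: cw[symmetric] ddir_def D1_smooth[OF sw])
  finally show "conv (moll r) ((ddir v ^^ 2) u) x = (ddir v ^^ 2) (conv (moll r) u) x" .
 qed
qed

text \<open>The derivatives fall on the kernel, so a sup bound alone gives bounds up to any order k,
  with a constant depending on r.\<close>

lemma Xc_conv_bounded:
 fixes C :: real
 assumes r: "r > 0"
 shows "\<exists>B\<ge>0. \<forall>\<phi> :: 'd::finite fn. continuous_on UNIV \<phi> \<and> (\<forall>x. \<bar>\<phi> x\<bar> <= C) --> Xc k B (conv (moll r) \<phi>)"
proof -
 let ?L = "{is :: 'd list. set is \<subseteq> UNIV \<and> length is <= k}"
 have fin: "finite ?L" by (rule finite_lists_length_le) simp
 define I where "I is = (LBINT x. \<bar>pds is (moll r :: 'd fn) x\<bar>)" for "is"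
 define B where "B = (\<Sum>is\<in>?L. I is) * \<bar>C\<bar>"
 have I0: "I is >= 0" for "is" unfolding I_def by simp
 have B0: "B >= 0" unfolding B_def using I0 by (simp add: sum_nonneg)
 have "Xc k B (conv (moll r) \<phi>)" if \<phi>: "continuous_on UNIV \<phi>" "!!x. \<bar>\<phi> x\<bar> <= C" for \<phi> :: "'d fn"
 proof -
  have s: "smooth (conv (moll r) \<phi>)" by (rule smooth_conv[OF moll_smooth[OF r] moll_supp[OF r] \<phi>(1)])
  have "nb j B (conv (moll r) \<phi>)" if "j <= k" for j
   unfolding nb_def
  proof (intro allI impI)
   fix "is" :: "'d list" and x assume l: "length is = j"
   let ?k = "pds is (moll r :: 'd fn)"
   have ck: "continuous_on UNIV ?k" by (rule smooth_continuous[OF smooth_pds[OF moll_smooth[OF r]]])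
   have sk: "supp_in r ?k" by (rule supp_in_pds[OF moll_supp[OF r]])
   have ik: "integrable lborel (%y. ?k y * 1)"
    by (rule integrable_supp[OF _ ck sk]) (intro locally_integrable_continuous continuous_intros)
   have C: "C >= 0" using \<phi>(2)[of x] by linarith
   have m: "?k \<in> borel_measurable borel" "\<phi> \<in> borel_measurable borel" using ck \<phi>(1) by (auto intro: borel_measurable_continuous_onI)
   have "pds is (conv (moll r) \<phi>) x = (LBINT y. ?k y * \<phi> (x - y))"
    unfolding pds_conv[OF moll_smooth[OF r] moll_supp[OF r] \<phi>(1)] by (rule conv_commute) (use m in auto)
   also have "\<bar>...\<bar> <= (LBINT y. \<bar>?k y\<bar> * C)"
   proof (rule integral_abs_bound_integral)
    show "integrable lborel (%y. \<bar>?k y\<bar> * C)" using ik by (intro integrable_mult_left integrable_abs) simp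
    then show "integrable lborel (%y. ?k y * \<phi> (x - y))"
     by (rule Bochner_Integration.integrable_bound)
       (use m \<phi>(2) in \<open>auto simp: abs_mult intro!: mult_mono order_trans[OF \<phi>(2)]\<close>)
    show "\<bar>?k y * \<phi> (x - y)\<bar> <= \<bar>?k y\<bar> * C" for y unfolding abs_mult using \<phi>(2) by (intro mult_left_mono) auto
   qed
   also have "... = I is * C" by (simp add: I_def)
   also have "... <= B"
   proof -
    have "I is <= (\<Sum>is\<in>?L. I is)" by (rule member_le_sum) (use that l I0 fin in auto)
    then show ?thesis unfolding B_def using C by (simp add: mult_right_mono)
   qed
   finally show "\<bar>pds is (conv (moll r) \<phi>) x\<bar> <= B" .
  qed
  then show ?thesis unfolding Xc_def using nb_imp_dbd[OF s] by blast
 qed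
 then show ?thesis using B0 by blast
qed

section \<open>The common setting for all mesh sizes\<close>

locale problem =
 fixes T1 h0 :: real and V :: "(real^'d::finite) set" and \<tau> :: "'d fn" and \<tau>0 :: real and e :: "'d => real^'d"
  and q p :: "real^'d => real => 'd fn" and c :: "real => 'd fn"
  and \<delta> K c0 s1 W2 Mx :: real and m :: nat
 assumes m3: "3 <= m" and T0: "T1 > 0" and h0: "h0 > 0"
  and sch: "!!h. h \<in> {0<..h0} ==> scheme V \<tau> \<tau>0 e h \<delta> K c0 s1 W2 Mx"
  and rough: "!!h t. h \<in> {0<..h0} ==> t \<in> {0..T1} ==>
   scheme.rough_ok V \<tau> \<tau>0 e h \<delta> K c0 Mx m (%v. q v t) (%v. p v t) (c t)"
  and tq: "!!v. v \<in> V ==> tmeas T1 (q v)" and tp: "!!v. v \<in> V ==> tmeas T1 (p v)" and tc: "tmeas T1 c"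
begin

definition "BC n = Bcst (real CARD('d)) m \<delta> K \<tau>0 c0 s1 W2 Mx n"

abbreviation "Lh \<equiv> L_h V q p c"
abbreviation "Lo \<equiv> L_op V q p c"
abbreviation "Lc \<equiv> L_coef V q p"

lemma h0_in: "h0 \<in> {0<..h0}" using h0 by simp

lemma BC1: "BC n >= 1"
 unfolding BC_def using scheme.BB1[OF sch[OF h0_in], of m n, unfolded scheme.BB_def[OF sch[OF h0_in]]] .

lemma finL1: "finite V" and s1nn: "s1 >= 0" and s1sq: "(\<Sum>v\<in>V. (norm v)\<^sup>2) <= s1\<^sup>2" and Mx0: "Mx >= 0"
 using sch[OF h0_in] unfolding scheme_def scheme_axioms_def fdops_def by auto

lemma
 assumes t: "t \<in> {0..T1}"
 shows qX: "!!s. (\<Sum>v\<in>V. (s v)\<^sup>2) <= 1 ==> Xc m Mx (%x. \<Sum>v\<in>V. s v * q v t x)"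
  and pX: "!!s. (\<Sum>v\<in>V. (s v)\<^sup>2) <= 1 ==> Xc m Mx (%x. \<Sum>v\<in>V. s v * p v t x)"
  and cX: "Xc m Mx (c t)" and zero: "!!x i. (\<Sum>v\<in>V. v $ i * q v t x) = 0"
 using rough[OF h0_in t] unfolding scheme.rough_ok_def[OF sch[OF h0_in]] by auto

lemma qvX: "t \<in> {0..T1} ==> v \<in> V ==> Xc m Mx (q v t)" and pvX: "t \<in> {0..T1} ==> v \<in> V ==> Xc m Mx (p v t)"
 using scheme.rough_single[OF sch[OF h0_in] rough[OF h0_in]] by auto

lemma Rem_Xc:
 assumes t: "t \<in> {0..T1}" and "h > 0" "l <= m" "Xc (l + r + 3) C \<phi>"
 shows "Xc l (2 ^ m * Mx * ((real CARD('d) * s1) ^ (r + 3) + (real CARD('d) * s1) ^ (r + 2)) * (C * h ^ (r + 1))) (Rem V q p c r h t \<phi>)"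
 by (rule Xc_Rem[where q=q and p=p and c=c and t=t, OF finL1 s1nn s1sq qX[OF t] pX[OF t] cX[OF t] zero[OF t]]) (use assms in auto)

lemma Lo_Xc:
 assumes t: "t \<in> {0..T1}" and "1 <= n" "n <= m" "Xc (n + 2) C \<phi>"
 shows "Xc n (2 ^ m * Mx * ((real CARD('d) * s1)\<^sup>2 + real CARD('d) * s1 + 1) * C) (Lo t \<phi>)"
 by (rule Xc_L_op[where q=q and p=p and c=c and t=t, OF finL1 s1nn s1sq qX[OF t] pX[OF t] cX[OF t] zero[OF t]]) (use assms in auto)

lemma Lh_Xc:
 assumes t: "t \<in> {0..T1}" and "n <= m" "h > 0" "Xc n C \<phi>"
 shows "Xc n (2 ^ m * Mx * sqrt (real (card V)) * (2 / h\<^sup>2 + 2 / h) * C + 2 ^ m * Mx * C) (Lh h t \<phi>)"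
 by (rule Xc_L_h[where q=q and p=p and c=c and t=t, OF finL1 s1nn s1sq qX[OF t] pX[OF t] cX[OF t] zero[OF t]]) (use assms in auto)

lemma Lc_Xc:
 assumes t: "t \<in> {0..T1}" and "1 <= n" "n <= m" "1 <= i" "Xc (n + \<rho> * i) C \<phi>"
  "\<rho> = 3 \<or> \<rho> = 2 \<and> uminus ` V = V \<and> (\<forall>v\<in>V. \<forall>x. q v t x = q (- v) t x)"
 shows "Xc n (2 ^ m * Mx * ((real CARD('d) * s1) ^ (i + 2) + (real CARD('d) * s1) ^ (i + 1)) * C) (Lc i t \<phi>)"
 by (rule Xc_L_coef[where q=q and p=p and c=c and t=t, OF finL1 s1nn s1sq qX[OF t] pX[OF t] cX[OF t] zero[OF t] assms(2-6)])

lemma Lc_zero: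
 assumes t: "t \<in> {0..T1}" and "odd i" "Xc (i + 2) C \<phi>" "uminus ` V = V" "!!v x. v \<in> V ==> q v t x = q (- v) t x"
  "!!v x. v \<in> V ==> p (- v) t x = - p v t x"
 shows "Lc i t \<phi> x = 0"
 by (rule L_coef_zero[where q=q and p=p and c=c and t=t, OF finL1 s1nn s1sq qX[OF t] pX[OF t] cX[OF t] zero[OF t] assms(2-6)])

lemma tmeas_Lh:
 assumes "tmeas T1 w" shows "tmeas T1 (%s. Lh h s (w s))"
 unfolding L_h_def fdiff_def divide_inverse mult.commute[of _ "inverse h"]
 by (intro tmeas_diff tmeas_add tmeas_cmult tmeas_sum tmeas_mult tmeas_shift assms tq tp tc)

lemma approx:
 assumes h: "h \<in> {0<..h0}" and n: "n <= m" and FX: "!!s. s \<in> {0..T1} ==> Xc n C1 (F s)" "!!s. s \<in> {0..T1} ==> Xc 1 C' (F s)" and Fm: "tmeas T1 F"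
  and C1: "C1 >= 0" and gX: "Xc n C2 g" "Xc 1 C' g"
  and wb: "!!t x. t \<in> {0..T1} ==> \<bar>w t x\<bar> <= Bw"
  and wi: "!!x. set_integrable lborel {0..T1} (%s. Lh h s (w s) x)"
  and weq: "!!s t x. 0 <= s ==> s <= t ==> t <= T1 ==> \<bar>w t x - w s x - (LINT r:{s..t}|lborel. Lh h r (w r) x + F r x)\<bar> <= \<eta> * (t - s)"
  and w0: "!!x. \<bar>w 0 x - g x\<bar> <= \<eta>" and \<eta>: "\<eta> >= 0" and t: "t \<in> {0..T1}" and ee: "ee > 0"
 shows "\<exists>v. Xc n (BC n * (C1 + C2)) v \<and> (\<forall>x. \<bar>w t x - v x\<bar> <= \<eta> * (1 + T1) + ee)"
proof -
 have fd: "fdops V \<tau> \<tau>0 e h" using sch[OF h] by (simp add: scheme_def)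
 have L: "fdops.Lop V h (%v. q v s) (%v. p v s) (c s) \<phi> x = Lh h s \<phi> x" for s \<phi> x
  by (simp add: fdops.Lop_def[OF fd] L_h_def)
 show ?thesis
  by (rule scheme.approx_bound[OF sch[OF h] m3 rough[OF h] tq tp tc n FX Fm C1 gX, unfolded L scheme.BB_def[OF sch[OF h]] BC_def[symmetric],
     OF _ _ _ _ _ wb wi weq w0 \<eta> t ee])
qed

lemma Xc_limI:
 assumes "!!j. \<exists>v. Xc n C v \<and> (\<forall>x. \<bar>\<phi> x - v x\<bar> <= A / real (Suc j))"
 shows "Xc n C \<phi>"
proof -
 obtain v where v: "!!j. Xc n C (v j)" "!!j x. \<bar>\<phi> x - v j x\<bar> <= A / real (Suc j)" using assms by metis
 show ?thesis
 proof (rule Xc_lim[of n C v])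
  fix x
  have "(%j. A / real (Suc j)) \<longlonglongrightarrow> 0" by (rule LIMSEQ_Suc[OF lim_const_over_n])
  then have "(%j. \<phi> x - v j x) \<longlonglongrightarrow> 0" by (rule Lim_null_comparison[rotated]) (use v(2) in auto)
  then show "(%j. v j x) \<longlonglongrightarrow> \<phi> x" using tendsto_diff[OF tendsto_const, of "%j. \<phi> x - v j x" 0 sequentially "\<phi> x"] by simp
 qed (rule v(1))
qed

text \<open>An exact solution is an approximate one with defect 0; the remaining error ee tends to 0
  while the bound, free of \<open>T1\<close> and h, persists in the limit.\<close>

lemma fd_bound:
 assumes h: "h \<in> {0<..h0}" and n: "n <= m" and FX: "!!s. s \<in> {0..T1} ==> Xc n C1 (F s)" "!!s. s \<in> {0..T1} ==> Xc 1 C' (F s)" and Fm: "tmeas T1 F"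
  and C1: "C1 >= 0" and gX: "Xc n C2 g" "Xc 1 C' g"
  and wb: "bounded_HT T1 w"
  and weq: "!!t x. t \<in> {0..T1} ==> set_integrable lborel {0..t} (%s. Lh h s (w s) x + F s x) \<and>
    w t x = g x + (LINT s:{0..t}|lborel. Lh h s (w s) x + F s x)"
  and t: "t \<in> {0..T1}"
 shows "Xc n (BC n * (C1 + C2)) (w t)"
proof (rule Xc_limI[where A=1])
 fix j
 obtain Bw where Bw: "!!t x. t \<in> {0..T1} ==> \<bar>w t x\<bar> <= Bw" using wb unfolding bounded_HT_def by blast
 have TT: "T1 \<in> {0..T1}" using T0 by simp
 have Fi: "set_integrable lborel {0..T1} (%s. F s x)" for x
  by (rule tmeas_integrable[OF Fm Xc_bound[OF FX(2)]]) auto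
 have "set_integrable lborel {0..T1} (%s. Lh h s (w s) x)" for x
  using set_integral_diff(1)[OF weq[OF TT, of x, THEN conjunct1] Fi[of x]] by simp
 note wi = this
 have "\<bar>w t x - w s x - (LINT r:{s..t}|lborel. Lh h r (w r) x + F r x)\<bar> <= 0 * (t - s)" if "0 <= s" "s <= t" "t <= T1" for s t x
 proof -
  have "t \<in> {0..T1}" "s \<in> {0..T1}" using that by auto
  then show ?thesis using weq[of t x] weq[of s x] set_integral_split[OF that(1,2)] by simp
 qed
 moreover have "\<bar>w 0 x - g x\<bar> <= 0" for x
  using weq[of 0 x] T0 set_integral_singleton[of 0] by simp
 ultimately have "\<exists>v. Xc n (BC n * (C1 + C2)) v \<and> (\<forall>x. \<bar>w t x - v x\<bar> <= 0 * (1 + T1) + 1 / real (Suc j))"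
  by (intro approx[OF h n FX Fm C1 gX Bw wi _ _ order_refl t]) auto
 then show "\<exists>v. Xc n (BC n * (C1 + C2)) v \<and> (\<forall>x. \<bar>w t x - v x\<bar> <= 1 / real (Suc j))" by simp
qed

text \<open>Mollified solutions of the differential equation nearly solve the difference equation.
  The commutators are of order \<epsilon> with A fixed; the consistency error involves third
  derivatives of the mollification and costs B h with B depending on \<epsilon>. The order of the
  quantifiers allows h to be chosen after \<epsilon>.\<close>

lemma weak_consistency:
 fixes u :: "real => 'd fn" and F :: "real => 'd fn"
 assumes uB: "in_B T1 2 u" and uX: "!!s. s \<in> {0..T1} ==> Xc 2 C (u s)" and FX: "!!s. s \<in> {0..T1} ==> Xc 1 C' (F s)"
 shows "\<exists>A\<ge>0. \<forall>\<epsilon>>0. \<exists>B\<ge>0. \<forall>h>0. \<forall>s\<in>{0..T1}. \<forall>x.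
  \<bar>conv (moll \<epsilon>) (%y. Lo s (u s) y + F s y) x - (Lh h s (conv (moll \<epsilon>) (u s)) x + F s x)\<bar> <= A * \<epsilon> + B * h"
proof -
 define dm where "dm = real CARD('d)"
 define A where "A = (\<Sum>v\<in>V. Mx * dm * ((dm * norm v)\<^sup>2 * C)) + (\<Sum>v\<in>V. Mx * dm * (dm * norm v * C)) + Mx * dm * C + C' * dm"
 have TT: "0 \<in> {0..T1}" using T0 by simp
 have C: "C >= 0" "C' >= 0" using Xc_nonneg[OF uX[OF TT]] Xc_nonneg[OF FX[OF TT]] by auto
 have dm: "dm >= 0" by (simp add: dm_def)
 have A0: "A >= 0" unfolding A_def using C dm Mx0 by (intro add_nonneg_nonneg sum_nonneg mult_nonneg_nonneg) auto
 have part1: "\<bar>conv (moll \<epsilon>) (%y. Lo s (u s) y + F s y) x - (Lo s (conv (moll \<epsilon>) (u s)) x + F s x)\<bar> <= A * \<epsilon>"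
  if eps: "\<epsilon> > 0" and s: "s \<in> {0..T1}" for \<epsilon> s x
 proof -
  let ?m = "conv (moll \<epsilon>)"
  note cl = moll_smooth[OF eps] moll_supp[OF eps]
  have hg: "has_gen_deriv \<alpha> (u s)" if "mi_order \<alpha> <= 2" for \<alpha> using uB s that unfolding in_B_def by blast
  note w2 = ddir2_weak[OF uX[OF s] hg]
  have q1: "Xc 1 Mx (q v s)" "Xc 1 Mx (p v s)" if "v \<in> V" for v
   using Xc_le[OF qvX[OF s that]] Xc_le[OF pvX[OF s that]] m3 by auto
  have c1: "Xc 1 Mx (c s)" using Xc_le[OF cX[OF s]] m3 by auto
  have dX: "Xc 1 (dm * norm v * C) (ddir v (u s))" for v
   unfolding dm_def by (rule Xc_ddir) (use uX[OF s] in \<open>simp_all add: numeral_2_eq_2\<close>)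
  have u1: "Xc 1 C (u s)" by (rule Xc_le[OF uX[OF s]]) simp
  have li: "locally_integrable \<phi>" if "Xc 1 D \<phi>" for \<phi> :: "'d fn" and D
   by (rule locally_integrable_continuous[OF Xc_continuous[OF that order_refl]])
  have bm: "\<phi> \<in> borel_measurable borel" if "Xc 1 D \<phi>" for \<phi> :: "'d fn" and D
   by (rule borel_measurable_continuous_onI[OF Xc_continuous[OF that order_refl]])
  have lm: "locally_integrable (%x. a x * z x)" if "Xc 1 D a" "locally_integrable z" for a z :: "'d fn" and D
   by (rule locally_integrable_mult[OF that(2) bm[OF that(1)] Xc_bound[OF that(1)]])
  define G where "G v = (%y. 1 / 2 * (q v s y * (ddir v ^^ 2) (u s) y) + p v s y * ddir v (u s) y)" for v
  have liq: "locally_integrable (%y. q v s y * (ddir v ^^ 2) (u s) y)" "locally_integrable (%y. p v s y * ddir v (u s) y)" if "v \<in> V" for v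
   using lm[OF q1(1)[OF that] w2(1)] lm[OF q1(2)[OF that] li[OF dX]] by blast+
  have lih: "locally_integrable (%y. 1 / 2 * (q v s y * (ddir v ^^ 2) (u s) y))" if "v \<in> V" for v
   by (rule locally_integrable_mult[OF liq(1)[OF that], of _ "1"]) auto
  have liG: "locally_integrable (G v)" if "v \<in> V" for v
   unfolding G_def by (rule locally_integrable_add[OF lih[OF that] liq(2)[OF that]])
  have lic: "locally_integrable (%y. (-1) * (c s y * u s y))"
   by (rule locally_integrable_mult[OF lm[OF c1 li[OF u1]], of _ 1]) auto
  have LG: "Lo s (u s) y = (\<Sum>v\<in>V. G v y) + (-1) * (c s y * u s y)" for y
   by (simp add: L_op_def G_def sum.distrib sum_distrib_left)
  have "?m (%y. Lo s (u s) y + F s y) x = ?m (%y. ((\<Sum>v\<in>V. G v y) + (-1) * (c s y * u s y)) + F s y) x" unfolding LG ..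
  also have "... = ?m (%y. (\<Sum>v\<in>V. G v y) + (-1) * (c s y * u s y)) x + ?m (F s) x"
   by (intro conv_add[OF cl] locally_integrable_add locally_integrable_sum finL1 liG lic li[OF FX[OF s]])
  also have "?m (%y. (\<Sum>v\<in>V. G v y) + (-1) * (c s y * u s y)) x = ?m (%y. \<Sum>v\<in>V. G v y) x + ?m (%y. (-1) * (c s y * u s y)) x"
   by (intro conv_add[OF cl] locally_integrable_sum finL1 liG lic)
  also have "?m (%y. \<Sum>v\<in>V. G v y) x = (\<Sum>v\<in>V. ?m (G v) x)" by (rule conv_sum[OF cl finL1 liG])
  also have "(\<Sum>v\<in>V. ?m (G v) x) = (\<Sum>v\<in>V. 1 / 2 * ?m (%y. q v s y * (ddir v ^^ 2) (u s) y) x + ?m (%y. p v s y * ddir v (u s) y) x)"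
   unfolding G_def by (intro sum.cong refl) (simp only: conv_add[OF cl lih liq(2)] conv_cmult)
  also have "?m (%y. (-1) * (c s y * u s y)) x = (-1) * ?m (%y. c s y * u s y) x" by (rule conv_cmult)
  finally have E: "?m (%y. Lo s (u s) y + F s y) x =
   (\<Sum>v\<in>V. 1 / 2 * ?m (%y. q v s y * (ddir v ^^ 2) (u s) y) x + ?m (%y. p v s y * ddir v (u s) y) x) + (-1) * ?m (%y. c s y * u s y) x + ?m (F s) x" .
  have dc: "?m ((ddir v ^^ 2) (u s)) = (ddir v ^^ 2) (?m (u s))" "?m (ddir v (u s)) = ddir v (?m (u s))" for v
   using w2(3)[OF _ eps] w2(3) eps ddir_conv_moll[OF eps uX[OF s] order_refl] by auto
  have E': "Lo s (?m (u s)) x = (\<Sum>v\<in>V. 1 / 2 * (q v s x * ?m ((ddir v ^^ 2) (u s)) x) + p v s x * ?m (ddir v (u s)) x) + (-1) * (c s x * ?m (u s) x)"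
   by (simp add: L_op_def dc sum.distrib sum_distrib_left)
  have bq: "\<bar>?m (%y. q v s y * (ddir v ^^ 2) (u s) y) x - q v s x * ?m ((ddir v ^^ 2) (u s)) x\<bar> <= Mx * dm * \<epsilon> * ((dm * norm v)\<^sup>2 * C)" if "v \<in> V" for v
   unfolding dm_def by (rule conv_moll_mult[OF eps q1(1)[OF that] w2(1,2)])
  have bp: "\<bar>?m (%y. p v s y * ddir v (u s) y) x - p v s x * ?m (ddir v (u s)) x\<bar> <= Mx * dm * \<epsilon> * (dm * norm v * C)" if "v \<in> V" for v
   unfolding dm_def by (rule conv_moll_mult[OF eps q1(2)[OF that] li[OF dX]]) (use Xc_bound[OF dX[of v]] in \<open>simp add: dm_def\<close>)
  have bc: "\<bar>?m (%y. c s y * u s y) x - c s x * ?m (u s) x\<bar> <= Mx * dm * \<epsilon> * C"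
   unfolding dm_def by (rule conv_moll_mult[OF eps c1 li[OF u1]]) (use Xc_bound[OF u1] in simp)
  have bF: "\<bar>?m (F s) x - F s x\<bar> <= C' * dm * \<epsilon>"
   unfolding dm_def by (rule conv_moll_lip[OF eps XcD[OF FX[OF s] order_refl]])
  have "\<bar>(\<Sum>v\<in>V. 1 / 2 * ?m (%y. q v s y * (ddir v ^^ 2) (u s) y) x + ?m (%y. p v s y * ddir v (u s) y) x)
    - (\<Sum>v\<in>V. 1 / 2 * (q v s x * ?m ((ddir v ^^ 2) (u s)) x) + p v s x * ?m (ddir v (u s)) x)\<bar>
   <= (\<Sum>v\<in>V. Mx * dm * \<epsilon> * ((dm * norm v)\<^sup>2 * C) + Mx * dm * \<epsilon> * (dm * norm v * C))"
   unfolding sum_subtractf[symmetric]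
  proof (intro order_trans[OF sum_abs] sum_mono)
   fix v assume v: "v \<in> V"
   show "\<bar>1 / 2 * ?m (%y. q v s y * (ddir v ^^ 2) (u s) y) x + ?m (%y. p v s y * ddir v (u s) y) x
     - (1 / 2 * (q v s x * ?m ((ddir v ^^ 2) (u s)) x) + p v s x * ?m (ddir v (u s)) x)\<bar>
    <= Mx * dm * \<epsilon> * ((dm * norm v)\<^sup>2 * C) + Mx * dm * \<epsilon> * (dm * norm v * C)"
    using bq[OF v] bp[OF v] by linarith
  qed
  then have "\<bar>?m (%y. Lo s (u s) y + F s y) x - (Lo s (?m (u s)) x + F s x)\<bar> <=
    (\<Sum>v\<in>V. Mx * dm * \<epsilon> * ((dm * norm v)\<^sup>2 * C) + Mx * dm * \<epsilon> * (dm * norm v * C)) + Mx * dm * \<epsilon> * C + C' * dm * \<epsilon>"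
   unfolding E E' using bc bF by linarith
  also have "... = A * \<epsilon>"
   unfolding A_def distrib_right sum_distrib_right sum.distrib by (simp only: mult_ac)
  finally show ?thesis .
 qed
 have part2: "\<exists>B\<ge>0. \<forall>h>0. \<forall>s\<in>{0..T1}. \<forall>x. \<bar>Lo s (conv (moll \<epsilon>) (u s)) x - Lh h s (conv (moll \<epsilon>) (u s)) x\<bar> <= B * h"
  if eps: "\<epsilon> > 0" for \<epsilon>
 proof -
  obtain B where B: "B >= 0" "!!\<phi> :: 'd fn. continuous_on UNIV \<phi> ==> (!!x. \<bar>\<phi> x\<bar> <= C) ==> Xc 3 B (conv (moll \<epsilon>) \<phi>)"
   using Xc_conv_bounded[OF eps, of C 3] by blast
  define B' where "B' = 2 ^ m * Mx * ((real CARD('d) * s1) ^ 3 + (real CARD('d) * s1) ^ 2) * B"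
  have "\<bar>Lo s (conv (moll \<epsilon>) (u s)) x - Lh h s (conv (moll \<epsilon>) (u s)) x\<bar> <= B' * h" if hs: "h > 0" "s \<in> {0..T1}" for h s x
  proof -
   have "Xc (0 + 0 + 3) B (conv (moll \<epsilon>) (u s))"
    using B(2)[OF Xc_continuous[OF uX[OF hs(2)]] Xc_bound[OF uX[OF hs(2)]]] by simp
   from Xc_bound[OF Rem_Xc[OF hs(2,1) _ this], of x]
   have "\<bar>Rem V q p c 0 h s (conv (moll \<epsilon>) (u s)) x\<bar> <= B' * h" by (simp only: B'_def mult_ac add_0 power_one_right)
   then show ?thesis by (simp add: Rem_def abs_minus_commute)
  qed
  moreover have "B' >= 0" unfolding B'_def using B(1) Mx0 s1nn by simp
  ultimately show ?thesis by blast
 qed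
 show ?thesis
 proof (rule exI[of _ A], intro conjI A0 allI impI)
  fix \<epsilon> :: real assume eps: "\<epsilon> > 0"
  obtain B where B: "B >= 0" "!!h s x. h > 0 ==> s \<in> {0..T1} ==> \<bar>Lo s (conv (moll \<epsilon>) (u s)) x - Lh h s (conv (moll \<epsilon>) (u s)) x\<bar> <= B * h"
   using part2[OF eps] by blast
  show "\<exists>B\<ge>0. \<forall>h>0. \<forall>s\<in>{0..T1}. \<forall>x. \<bar>conv (moll \<epsilon>) (%y. Lo s (u s) y + F s y) x - (Lh h s (conv (moll \<epsilon>) (u s)) x + F s x)\<bar> <= A * \<epsilon> + B * h"
  proof (rule exI[of _ B], intro conjI B(1) allI impI ballI)
   fix h s x assume hs: "(h::real) > 0" "s \<in> {0..T1}"
   show "\<bar>conv (moll \<epsilon>) (%y. Lo s (u s) y + F s y) x - (Lh h s (conv (moll \<epsilon>) (u s)) x + F s x)\<bar> <= A * \<epsilon> + B * h"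
    using part1[OF eps hs(2), of x] B(2)[OF hs, of x] by linarith
  qed
 qed
qed

lemma weak_mollified:
 assumes ws: "weak_solution T1 V q p c F v u" and t: "t \<in> {0..T1}" and eps: "\<epsilon> > 0"
 shows "set_integrable lborel {0..t} (%s. conv (moll \<epsilon>) (%y. Lo s (u s) y + F s y) x)"
  and "conv (moll \<epsilon>) (u t) x = conv (moll \<epsilon>) v x + (LINT s:{0..t}|lborel. conv (moll \<epsilon>) (%y. Lo s (u s) y + F s y) x)"
proof -
 have "test_function (%y. moll \<epsilon> (x - y))" by (rule moll_test[OF eps])
 note W = ws[unfolded weak_solution_def, THEN conjunct2, THEN conjunct2, rule_format, OF t this]
 show "set_integrable lborel {0..t} (%s. conv (moll \<epsilon>) (%y. Lo s (u s) y + F s y) x)"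
  unfolding conv_def by (rule W[THEN conjunct1])
 show "conv (moll \<epsilon>) (u t) x = conv (moll \<epsilon>) v x + (LINT s:{0..t}|lborel. conv (moll \<epsilon>) (%y. Lo s (u s) y + F s y) x)"
  unfolding conv_def by (rule W[THEN conjunct2])
qed

text \<open>The estimate is inherited from the difference equation: for a suitably small h the
  mollified solution solves it approximately, and the constant in \<open>approx\<close> is the same
  for every h. Since a weak solution is only assumed to lie in \<open>in_B T1 2\<close>, regularity
  of higher order is part of the conclusion.\<close>

lemma weak_bound:
 assumes ws: "weak_solution T1 V q p c F v u"
  and n: "n <= m" and FX: "!!s. s \<in> {0..T1} ==> Xc n C1 (F s)" "!!s. s \<in> {0..T1} ==> Xc 1 C' (F s)" and Fm: "tmeas T1 F"
  and C1: "C1 >= 0" and vX: "Xc n C2 v" "Xc 1 C' v" and t: "t \<in> {0..T1}"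
 shows "Xc n (BC n * (C1 + C2)) (u t)"
proof (rule Xc_limI[where A="3 + T1"])
 fix j
 have uB: "in_B T1 2 u" using ws by (simp add: weak_solution_def)
 obtain C where C: "C >= 0" and uX: "!!s. s \<in> {0..T1} ==> Xc 2 C (u s)" using in_B_Xc[OF uB] by blast
 obtain A where A': "A >= 0 \<and> (\<forall>\<epsilon>>0. \<exists>B\<ge>0. \<forall>h>0. \<forall>s\<in>{0..T1}. \<forall>x.
  \<bar>conv (moll \<epsilon>) (%y. Lo s (u s) y + F s y) x - (Lh h s (conv (moll \<epsilon>) (u s)) x + F s x)\<bar> <= A * \<epsilon> + B * h)"
  using weak_consistency[OF uB uX FX(2)] by (rule exE)
 note A = A'[THEN conjunct1] and AB = A'[THEN conjunct2, rule_format]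
 define dm where "dm = real CARD('d)"
 have dm: "dm >= 1" by (simp add: dm_def Suc_leI)
 have C': "C' >= 0" by (rule Xc_nonneg[OF vX(2)])
 define \<eta> where "\<eta> = 1 / real (Suc j)"
 have \<eta>: "\<eta> > 0" by (simp add: \<eta>_def)
 \<comment> \<open>Z is chosen so that the commutator error is at most half of \<eta> and the
   mollification errors of solution and data at most \<eta> each; the other half of \<eta> is kept
   for B h.\<close>
 define Z where "Z = 1 + 2 * A + (C + C') * dm"
 have Z: "Z >= 1" unfolding Z_def using A C C' dm by simp
 define \<epsilon> where "\<epsilon> = \<eta> / Z"
 have eps: "\<epsilon> > 0" unfolding \<epsilon>_def using \<eta> Z by simp
 have Ze: "Z * \<epsilon> = \<eta>" unfolding \<epsilon>_def using Z by simp
 have small: "2 * A * \<epsilon> <= \<eta>" "C * dm * \<epsilon> <= \<eta>" "C' * dm * \<epsilon> <= \<eta>"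
  unfolding Ze[symmetric] Z_def using eps A C C' dm by (auto intro!: mult_right_mono simp: distrib_right)
 obtain B where B': "B >= 0 \<and> (\<forall>h>0. \<forall>s\<in>{0..T1}. \<forall>x.
  \<bar>conv (moll \<epsilon>) (%y. Lo s (u s) y + F s y) x - (Lh h s (conv (moll \<epsilon>) (u s)) x + F s x)\<bar> <= A * \<epsilon> + B * h)"
  using AB[OF eps] by (rule exE)
 note B = B'[THEN conjunct1] and cons = B'[THEN conjunct2, rule_format]
 \<comment> \<open>Chosen after \<epsilon>, on which B depends.\<close>
 define h where "h = min h0 (\<eta> / (2 * (1 + B)))"
 have h: "h \<in> {0<..h0}" "h > 0" unfolding h_def using h0 \<eta> B by auto
 have Bh: "B * h <= \<eta> / 2"
 proof -
  have "B * h <= (1 + B) * (\<eta> / (2 * (1 + B)))" using B h unfolding h_def by (intro mult_mono) auto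
  also have "... = \<eta> / 2" using B by (simp add: field_simps)
  finally show ?thesis .
 qed
 define w where "w s = conv (moll \<epsilon>) (u s)" for s
 define G where "G s x = conv (moll \<epsilon>) (%y. Lo s (u s) y + F s y) x" for s x
 have cons': "\<bar>G s x - (Lh h s (w s) x + F s x)\<bar> <= \<eta>" if "s \<in> {0..T1}" for s x
  using cons[OF h(2) that, of x] small(1) Bh unfolding G_def w_def by linarith
 note mol = weak_mollified[OF ws _ eps, folded G_def w_def]
 have wX: "Xc 0 C (w s)" if "s \<in> {0..T1}" for s
  unfolding w_def by (rule Xc_conv_moll[OF eps Xc_continuous[OF uX[OF that]] Xc_le[OF uX[OF that]]]) auto
 \<comment> \<open>This bound degenerates with h; it serves only boundedness, integrability and
   continuity in time.\<close>
 define BL where "BL = 2 ^ m * Mx * sqrt (real (card V)) * (2 / h\<^sup>2 + 2 / h) * C + 2 ^ m * Mx * C"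
 have LhB: "\<bar>Lh h s (w s) x\<bar> <= BL" if "s \<in> {0..T1}" for s x
  unfolding BL_def by (rule Xc_bound[OF Lh_Xc[OF that _ h(2) wX[OF that]]]) simp
 have GB: "\<bar>G s x\<bar> <= BL + C' + \<eta>" if "s \<in> {0..T1}" for s x
  using cons'[OF that, of x] LhB[OF that, of x] Xc_bound[OF FX(2)[OF that], of x] by linarith
 have Gi: "set_integrable lborel {s..t} (%r. G r x)" if "0 <= s" "t <= T1" "s <= t" for s t x
  by (rule set_integrable_subset[OF mol(1)[of t]]) (use that in auto)
 have wG: "w t x - w s x = (LINT r:{s..t}|lborel. G r x)" if "0 <= s" "s <= t" "t <= T1" for s t x
 proof -
  have st: "s \<in> {0..T1}" "t \<in> {0..T1}" using that by auto
  show ?thesis unfolding mol(2)[OF st(1)] mol(2)[OF st(2)]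
   using set_integral_split[OF that(1,2) mol(1)[OF st(2)]] by simp
 qed
 have wL: "\<bar>w t x - w s x\<bar> <= (BL + C' + \<eta>) * (t - s)" if "0 <= s" "s <= t" "t <= T1" for s t x
  unfolding wG[OF that] by (rule set_integral_abs_le[OF Gi]) (use that GB in auto)
 have wc: "continuous_on {0..T1} (%s. w s x)" for x
 proof (rule lipschitz_on_continuous_on[of "\<bar>BL + C' + \<eta>\<bar>"], rule lipschitz_onI)
  fix s t assume st: "s \<in> {0..T1}" "t \<in> {0..T1}"
  have "\<bar>w t x - w s x\<bar> <= \<bar>BL + C' + \<eta>\<bar> * \<bar>t - s\<bar>" if "s <= t" "s \<in> {0..T1}" "t \<in> {0..T1}" for s t
   by (rule order_trans[OF wL]) (use that in \<open>auto intro!: mult_right_mono\<close>)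
  from this[of s t] this[of t s] st
  show "dist (w s x) (w t x) <= \<bar>BL + C' + \<eta>\<bar> * dist s t"
   by (cases "s <= t") (auto simp: dist_real_def abs_minus_commute)
 qed simp
 have Li: "set_integrable lborel {a..b} (%s. Lh h s (w s) x)" if "0 <= a" "b <= T1" for a b x
  by (rule tmeas_integrable[OF tmeas_Lh[OF tmeas_continuous[OF wc]] LhB]) (use that in auto)
 have Fi: "set_integrable lborel {a..b} (%s. F s x)" if "0 <= a" "b <= T1" for a b x
  by (rule tmeas_integrable[OF Fm Xc_bound[OF FX(2)]]) (use that in auto)
 have weq: "\<bar>w t x - w s x - (LINT r:{s..t}|lborel. Lh h r (w r) x + F r x)\<bar> <= \<eta> * (t - s)" if "0 <= s" "s <= t" "t <= T1" for s t x
 proof -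
  have LF: "set_integrable lborel {s..t} (%r. Lh h r (w r) x + F r x)" by (intro set_integral_add Li Fi that)
  have "w t x - w s x - (LINT r:{s..t}|lborel. Lh h r (w r) x + F r x) = (LINT r:{s..t}|lborel. G r x - (Lh h r (w r) x + F r x))"
   unfolding wG[OF that] by (rule set_integral_diff(2)[OF Gi LF, symmetric]) (use that in auto)
  also have "\<bar>...\<bar> <= \<eta> * (t - s)"
   by (rule set_integral_abs_le[OF set_integral_diff(1)[OF Gi LF]]) (use that cons' in auto)
  finally show ?thesis .
 qed
 have w0: "\<bar>w 0 x - v x\<bar> <= \<eta>" for x
 proof -
  have "w 0 x = conv (moll \<epsilon>) v x" using mol(2)[of 0 x] T0 set_integral_singleton[of 0] by simp
  then show ?thesis using conv_moll_lip[OF eps XcD[OF vX(2) order_refl], of x] small(3) by (simp add: dm_def)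
 qed
 have "\<exists>v'. Xc n (BC n * (C1 + C2)) v' \<and> (\<forall>x. \<bar>w t x - v' x\<bar> <= \<eta> * (1 + T1) + \<eta>)"
  by (rule approx[OF h(1) n FX Fm C1 vX Xc_bound[OF wX] Li weq w0 less_imp_le[OF \<eta>] t \<eta>]) auto
 then obtain v' where v': "Xc n (BC n * (C1 + C2)) v'" "!!x. \<bar>w t x - v' x\<bar> <= \<eta> * (1 + T1) + \<eta>" by blast
 have "\<bar>u t x - v' x\<bar> <= (3 + T1) / real (Suc j)" for x
 proof -
  have "\<bar>w t x - u t x\<bar> <= C * dm * \<epsilon>"
   unfolding w_def dm_def by (rule conv_moll_lip[OF eps XcD[OF uX[OF t]]]) simp
  then have "\<bar>u t x - v' x\<bar> <= \<eta> * (3 + T1)" using v'(2)[of x] small(2) by (simp add: algebra_simps)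
  then show ?thesis by (simp add: \<eta>_def)
 qed
 then show "\<exists>v'. Xc n (BC n * (C1 + C2)) v' \<and> (\<forall>x. \<bar>u t x - v' x\<bar> <= (3 + T1) / real (Suc j))" using v'(1) by blast
qed

text \<open>Testing with a mollifier centred at x gives the equation for mollified quantities; with
  a Lipschitz right-hand side the mollified data and integral differ from their limits by order
  \<epsilon>.\<close>

lemma weak_pointwise:
 assumes ws: "weak_solution T1 V q p c F v u" and GX: "!!s. s \<in> {0..T1} ==> Xc 1 C (%y. Lo s (u s) y + F s y)"
  and Gm: "tmeas T1 (%s y. Lo s (u s) y + F s y)" and vX: "Xc 1 C v" and t: "t \<in> {0..T1}"
 shows "set_integrable lborel {0..t} (%s. Lo s (u s) x + F s x)"
  and "u t x = v x + (LINT s:{0..t}|lborel. Lo s (u s) x + F s x)"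
proof -
 show Gi: "set_integrable lborel {0..t} (%s. Lo s (u s) x + F s x)"
  by (rule tmeas_integrable[OF Gm Xc_bound[OF GX]]) (use t in auto)
 have TT: "0 \<in> {0..T1}" using T0 by simp
 have C: "C >= 0" by (rule Xc_nonneg[OF vX])
 define R where "R = v x + (LINT s:{0..t}|lborel. Lo s (u s) x + F s x)"
 define d where "d = C * real CARD('d)"
 have ut: "continuous_on UNIV (u t)" using ws t unfolding weak_solution_def in_B_def by blast
 have "\<bar>conv (moll \<epsilon>) (u t) x - R\<bar> <= d * (1 + T1) * \<epsilon>" if eps: "\<epsilon> > 0" for \<epsilon>
 proof -
  note mol = weak_mollified[OF ws t eps]
  have "\<bar>(LINT s:{0..t}|lborel. conv (moll \<epsilon>) (%y. Lo s (u s) y + F s y) x) - (LINT s:{0..t}|lborel. Lo s (u s) x + F s x)\<bar> <= d * \<epsilon> * (t - 0)"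
   unfolding set_integral_diff(2)[OF mol(1) Gi, symmetric]
  proof (rule set_integral_abs_le[OF set_integral_diff(1)[OF mol(1) Gi]])
   fix s assume "s \<in> {0..t}"
   then have "s \<in> {0..T1}" using t by auto
   then show "\<bar>conv (moll \<epsilon>) (%y. Lo s (u s) y + F s y) x - (Lo s (u s) x + F s x)\<bar> <= d * \<epsilon>"
    unfolding d_def by (intro conv_moll_lip[OF eps XcD[OF GX]]) auto
  qed (use t in auto)
  moreover have "\<bar>conv (moll \<epsilon>) v x - v x\<bar> <= d * \<epsilon>"
   unfolding d_def by (rule conv_moll_lip[OF eps XcD[OF vX order_refl]])
  moreover have "d * \<epsilon> * (t - 0) <= d * \<epsilon> * T1" using t C eps by (intro mult_left_mono) (auto simp: d_def)
  ultimately show ?thesis unfolding R_def mol(2) by (simp add: algebra_simps)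
 qed
 from this[of "1 / real (Suc j)" for j]
 have b: "\<bar>conv (moll (1 / real (Suc j))) (u t) x - R\<bar> <= d * (1 + T1) / real (Suc j)" for j by simp
 have "(%j. d * (1 + T1) / real (Suc j)) \<longlonglongrightarrow> 0" by (rule LIMSEQ_Suc[OF lim_const_over_n])
 then have "(%j. conv (moll (1 / real (Suc j))) (u t) x - R) \<longlonglongrightarrow> 0" by (rule Lim_null_comparison[rotated]) (use b in auto)
 then have "(%j. conv (moll (1 / real (Suc j))) (u t) x) \<longlonglongrightarrow> R" by (simp add: LIM_zero_iff)
 then show "u t x = v x + (LINT s:{0..t}|lborel. Lo s (u s) x + F s x)"
  using conv_moll_tendsto[OF ut, of x] LIMSEQ_unique unfolding R_def by blast
qed

end

section \<open>The expansion\<close>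

text \<open>Common bound for the operators \<open>Lc\<close> and \<open>Rem\<close>, summing all
  powers of d s1 that can occur.\<close>

definition QC :: "real => nat => real => real => real" where "QC d m s1 Mx = 2 ^ m * Mx * (2 * (\<Sum>i\<le>m + 3. (d * s1) ^ i))"
definition "BS d m \<delta> K \<tau>0 c0 s1 W2 Mx = (\<Sum>n\<le>m. Bcst d m \<delta> K \<tau>0 c0 s1 W2 Mx n)"
text \<open>Growth factor from one coefficient of the expansion to the next: a priori constant times
  operator bound, 2^m dominating the sum of the binomial coefficients.\<close>

definition "AC d m \<delta> K \<tau>0 c0 s1 W2 Mx = 1 + BS d m \<delta> K \<tau>0 c0 s1 W2 Mx * (1 + 2 ^ m * QC d m s1 Mx)"
text \<open>A priori constant times the bound for the at most m + 1 consistency errors.\<close>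

definition "Ncst d m \<delta> K \<tau>0 c0 s1 W2 Mx =
 BS d m \<delta> K \<tau>0 c0 s1 W2 Mx * (real (m + 1) * (QC d m s1 Mx * AC d m \<delta> K \<tau>0 c0 s1 W2 Mx ^ (m + 1)))"

lemma set_integral_lincomb:
 fixes G :: "'j => real => real"
 assumes "finite J" "!!j. j \<in> J ==> set_integrable lborel A (G j)"
 shows "set_integrable lborel A (%s. \<Sum>j\<in>J. a j * G j s)"
  and "(LINT s:A|lborel. \<Sum>j\<in>J. a j * G j s) = (\<Sum>j\<in>J. a j * (LINT s:A|lborel. G j s))"
proof -
 have "set_integrable lborel A (%s. \<Sum>j\<in>J. a j * G j s) \<and>
  (LINT s:A|lborel. \<Sum>j\<in>J. a j * G j s) = (\<Sum>j\<in>J. a j * (LINT s:A|lborel. G j s))"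
  using assms
 proof (induction J rule: finite_induct)
  case empty
  then show ?case by (simp add: set_integrable_def set_lebesgue_integral_def)
 next
  case (insert j J)
  have 1: "set_integrable lborel A (%s. a j * G j s)" using insert.prems by (intro set_integrable_mult_right) auto
  have 2: "set_integrable lborel A (%s. \<Sum>j\<in>J. a j * G j s)" using insert by auto
  show ?case using insert set_integral_add[OF 1 2] by simp
 qed
 then show "set_integrable lborel A (%s. \<Sum>j\<in>J. a j * G j s)"
  "(LINT s:A|lborel. \<Sum>j\<in>J. a j * G j s) = (\<Sum>j\<in>J. a j * (LINT s:A|lborel. G j s))" by auto
qed

text \<open>Since (j choose i)/j! is 1/(i! (j - i)!), both sides are one Cauchy product summed in
  different orders. The binomial coefficients in the system for the u^(j) are there to make this
  match the Taylor coefficients.\<close>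

lemma expansion_reindex:
 fixes X :: "nat => nat => real"
 shows "(\<Sum>j=1..k. h ^ j / fact j * (\<Sum>i=1..j. real (j choose i) * X i (j - i))) =
  (\<Sum>j\<le>k. h ^ j / fact j * (\<Sum>i=1..k - j. h ^ i / fact i * X i j))"
proof -
 have "(\<Sum>j=1..k. h ^ j / fact j * (\<Sum>i=1..j. real (j choose i) * X i (j - i))) =
  (\<Sum>(j, i)\<in>(SIGMA j:{1..k}. {1..j}). h ^ j / fact j * (real (j choose i) * X i (j - i)))"
  by (simp add: sum_distrib_left sum.Sigma)
 also have "... = (\<Sum>(j, i)\<in>(SIGMA j:{..k}. {1..k - j}). h ^ j / fact j * (h ^ i / fact i * X i j))"
 proof (rule sum.reindex_bij_witness[of _ "%(j, i). (j + i, i)" "%(j, i). (j - i, i)"])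
  fix z assume "z \<in> (SIGMA j:{1..k}. {1..j})"
  then obtain j i where z: "z = (j, i)" and ij: "1 <= i" "i <= j" by auto
  have e: "h ^ j / fact j * real (j choose i) = (h ^ (j - i) / fact (j - i)) * (h ^ i / fact i)"
   using ij(2) by (simp add: binomial_fact power_add[symmetric] field_simps)
  show "(case case z of (j, i) => (j - i, i) of (j, i) => h ^ j / fact j * (h ^ i / fact i * X i j)) =
   (case z of (j, i) => h ^ j / fact j * (real (j choose i) * X i (j - i)))"
   unfolding z prod.case mult.assoc[symmetric] e ..
 qed auto
 also have "... = (\<Sum>j\<le>k. h ^ j / fact j * (\<Sum>i=1..k - j. h ^ i / fact i * X i j))"
  by (simp add: sum_distrib_left sum.Sigma)
 finally show ?thesis .
qed

lemma D1_joint: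
 fixes U :: "real => 'd::finite fn"
 assumes "continuous_on (A \<times> UNIV) (%(t, x). U t x)" "!!t. t \<in> A ==> Xc (Suc r) C (U t)"
 shows "continuous_on (A \<times> UNIV) (%(t, x). (ddir v ^^ r) (U t) x)"
 using assms
proof (induction r)
 case (Suc r)
 have IH: "continuous_on (A \<times> UNIV) (%(t, x). (ddir v ^^ r) (U t) x)"
  by (rule Suc.IH[OF Suc.prems(1) Xc_le[OF Suc.prems(2)]]) auto
 have "continuous_on (A \<times> UNIV) (%(t, x). D1 i ((ddir v ^^ r) (U t)) x)" for i
  by (rule D1_joint_continuous[OF IH Xc_ddirs[where n=2, OF _ Xc_le[OF Suc.prems(2)]]]) auto
 then have "continuous_on (A \<times> UNIV) (%z. \<Sum>i\<in>UNIV. v $ i * (%(t, x). D1 i ((ddir v ^^ r) (U t)) x) z)"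
  by (intro continuous_intros)
 then show ?case by (simp add: ddir_def[of v "(ddir v ^^ r) (U t)" for t] case_prod_unfold)
qed simp

lemma D1s_joint:
 fixes U :: "real => 'd::finite fn"
 assumes "continuous_on (A \<times> UNIV) (%(t, x). U t x)" "!!t. t \<in> A ==> Xc n C (U t)" "length is < n"
 shows "continuous_on (A \<times> UNIV) (%(t, x). D1s is (U t) x)"
 using assms(3)
proof (induction "is")
 case (Cons i "is")
 have IH: "continuous_on (A \<times> UNIV) (%(t, x). D1s is (U t) x)" by (rule Cons.IH) (use Cons.prems in simp)
 have "continuous_on (A \<times> UNIV) (%(t, x). D1 i (D1s is (U t)) x)"
  by (rule D1_joint_continuous[OF IH Xc_D1s[OF assms(2)]]) (use Cons.prems in auto)
 then show ?case by simp
qed (use assms(1) in simp)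

lemma joint_tmeas:
 assumes "continuous_on ({0..T} \<times> UNIV) (%(t, x). U t x)" shows "tmeas T U"
proof (rule tmeas_continuous)
 fix x
 have "continuous_on {0..T} ((%(t, x). U t x) \<circ> (%s. (s, x)))"
  by (rule continuous_on_compose) (auto intro!: continuous_intros continuous_on_subset[OF assms])
 then show "continuous_on {0..T} (%s. U s x)" by (simp add: o_def)
qed

lemma D1_cong_zero: "ddir v (%x. 0) = (%x. 0)"
 by (simp add: ddir_def[abs_def])

lemma ddirs_zero: "(ddir v ^^ r) (%x. 0) = (%x. 0)"
 by (induction r) (simp_all add: D1_cong_zero)

lemma L_zero: "L_op V q p c t (%x. 0) = (%x. 0)" "L_coef V q p i t (%x. 0) = (%x. 0)"
 by (simp_all add: L_op_def[abs_def] L_coef_def[abs_def] ddirs_zero D1_cong_zero del: funpow.simps)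

lemma L_h_diff: "L_h V q p c h t (%x. a x - b x) x = L_h V q p c h t a x - L_h V q p c h t b x"
proof -
 have f: "fdiff h v (%x. a x - b x) x = fdiff h v a x - fdiff h v b x" for v
  by (simp add: fdiff_def diff_divide_distrib)
 show ?thesis unfolding L_h_def f by (simp add: right_diff_distrib sum_subtractf)
qed

lemma L_h_lincomb: "finite J ==> L_h V q p c h t (%x. \<Sum>j\<in>J. a j * b j x) x = (\<Sum>j\<in>J. a j * L_h V q p c h t (b j) x)"
proof (induction J rule: finite_induct)
 case empty
 then show ?case by (simp add: L_h_def fdiff_def)
next
 case (insert j J)
 have f: "fdiff h v (%x. a j * b j x + (\<Sum>j\<in>J. a j * b j x)) x = a j * fdiff h v (b j) x + fdiff h v (%x. \<Sum>j\<in>J. a j * b j x) x" for v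
  by (simp add: fdiff_def diff_divide_distrib add_divide_distrib right_diff_distrib)
 have "L_h V q p c h t (%x. a j * b j x + (\<Sum>j\<in>J. a j * b j x)) x = a j * L_h V q p c h t (b j) x + L_h V q p c h t (%x. \<Sum>j\<in>J. a j * b j x) x"
  unfolding L_h_def f by (simp add: algebra_simps sum.distrib sum_distrib_left)
 then show ?case using insert by simp
qed

section \<open>Estimates for the coefficients of the expansion\<close>

context problem
begin

definition "qc = QC (real CARD('d)) m s1 Mx"
definition "bs = BS (real CARD('d)) m \<delta> K \<tau>0 c0 s1 W2 Mx"
definition "ac = AC (real CARD('d)) m \<delta> K \<tau>0 c0 s1 W2 Mx"
definition "nc = Ncst (real CARD('d)) m \<delta> K \<tau>0 c0 s1 W2 Mx"

lemma ac_eq: "ac = 1 + bs * (1 + 2 ^ m * qc)"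
 by (simp add: ac_def bs_def qc_def AC_def)

lemma nc_eq: "nc = bs * (real (m + 1) * (qc * ac ^ (m + 1)))"
 by (simp add: nc_def ac_def bs_def qc_def Ncst_def)

lemma qc_ge:
 assumes "i + 2 <= m + 3"
 shows "2 ^ m * Mx * ((real CARD('d) * s1) ^ (i + 2) + (real CARD('d) * s1) ^ (i + 1)) <= qc"
proof -
 have "(real CARD('d) * s1) ^ j <= (\<Sum>i\<le>m + 3. (real CARD('d) * s1) ^ i)" if "j <= m + 3" for j
  by (rule member_le_sum) (use that s1nn in auto)
 from this[of "i + 2"] this[of "i + 1"] assms
 show ?thesis unfolding qc_def QC_def using Mx0 by (intro mult_left_mono) auto
qed

lemma qc0: "qc >= 0" unfolding qc_def QC_def using Mx0 s1nn by (simp add: sum_nonneg)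

lemma BC_le: "n <= m ==> BC n <= bs"
 unfolding bs_def BS_def BC_def[symmetric] by (rule member_le_sum) (use BC1 order_trans[OF zero_le_one] in auto)

lemma bs1: "bs >= 1" using BC_le[of m] BC1[of m] by simp

lemma ac_ge: "bs <= ac" "bs * (2 ^ m * qc) <= ac" "1 <= ac"
 using bs1 qc0 unfolding ac_eq by (auto simp: distrib_left)

text \<open>Uniformity in time with an unspecified constant, for the places where only the existence
  of a bound matters.\<close>

definition uX where "uX n G \<longleftrightarrow> (\<exists>C. \<forall>s\<in>{0..T1}. Xc n C (G s))"

lemma uXI: "(!!s. s \<in> {0..T1} ==> Xc n C (G s)) ==> uX n G"
 unfolding uX_def by blast

lemma uXE:
 assumes "uX n G" obtains C where "!!s. s \<in> {0..T1} ==> Xc n C (G s)"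
 using assms unfolding uX_def by blast

lemma uX_diff:
 assumes F: "uX n F" and G: "uX n G" shows "uX n (%s x. F s x - G s x)"
proof -
 obtain C D where "!!s. s \<in> {0..T1} ==> Xc n C (F s)" "!!s. s \<in> {0..T1} ==> Xc n D (G s)"
  using uXE[OF F] uXE[OF G] by metis
 then show ?thesis by (intro uXI[of n "C + D"] Xc_diff)
qed

lemma uX_cmult:
 assumes F: "uX n F" shows "uX n (%s x. a * F s x)"
proof -
 obtain C where "!!s. s \<in> {0..T1} ==> Xc n C (F s)" using uXE[OF F] by metis
 then show ?thesis by (intro uXI[of n "\<bar>a\<bar> * C"] Xc_cmult)
qed

lemma uX_add:
 assumes F: "uX n F" and G: "uX n G" shows "uX n (%s x. F s x + G s x)"
 using uX_diff[OF F uX_cmult[OF G, of "-1"]] by simp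

lemma uX_zero: "uX n (%s x. 0)"
 unfolding uX_def by (auto intro: exI[of _ 0] Xc_zero)

lemma uX_sum: "finite J ==> (!!j. j \<in> J ==> uX n (F j)) ==> uX n (%s x. \<Sum>j\<in>J. F j s x)"
 by (induction J rule: finite_induct) (auto intro: uX_add uX_zero)

text \<open>\<rho> is the number of derivatives lost with each further coefficient: 3 in general, 2
  under symmetry of q. \<open>km\<close> leaves two orders for the last coefficient.\<close>

context
 fixes f :: "real => 'd fn" and g :: "'d fn" and U :: "nat => real => 'd fn"
  and k \<rho> :: nat and Bf Bg :: real
 assumes fX: "!!s. s \<in> {0..T1} ==> Xc m Bf (f s)" and fm: "tmeas T1 f" and gX: "Xc m Bg g"
  and rho: "\<rho> = 3 \<or> \<rho> = 2 \<and> uminus ` V = V \<and> (\<forall>t\<in>{0..T1}. \<forall>v\<in>V. \<forall>x. q v t x = q (- v) t x)"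
  and km: "\<rho> * k + 2 <= m"
  and U0: "weak_solution T1 V q p c f g (U 0)"
  and Uj: "!!j. j \<in> {1..k} ==> weak_solution T1 V q p c (%s x. \<Sum>i=1..j. real (j choose i) * Lc i s (U (j - i) s) x) (%_. 0) (U j)"
begin

definition FF where "FF j s x = (if j = 0 then f s x else \<Sum>i=1..j. real (j choose i) * Lc i s (U (j - i) s) x)"

lemma Bfg: "Bf >= 0" "Bg >= 0" using Xc_nonneg[OF fX[of 0]] Xc_nonneg[OF gX] T0 by auto

lemma jm: "j <= k ==> \<rho> * j + 2 <= m" by (meson km add_le_mono1 mult_le_mono2 order_trans)

lemma k_le_m: "k <= m" using km rho by auto

lemma U_joint: "j <= k ==> continuous_on ({0..T1} \<times> UNIV) (%(t, x). U j t x)"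
 using U0 Uj[of j] unfolding weak_solution_def by (cases "j = 0") auto

lemma tmeas_ddirs:
 assumes "j <= k" "!!t. t \<in> {0..T1} ==> Xc (Suc r) C (U j t)"
 shows "tmeas T1 (%s. (ddir v ^^ r) (U j s))"
 by (rule joint_tmeas[OF D1_joint[OF U_joint[OF assms(1)] assms(2)]])

lemma tmeas_Lc:
 assumes "j <= k" "!!t. t \<in> {0..T1} ==> Xc (i + 3) C (U j t)"
 shows "tmeas T1 (%s. Lc i s (U j s))"
proof -
 have 1: "tmeas T1 (%s. (ddir v ^^ r) (U j s))" if "Suc r <= i + 3" for v r
  by (rule tmeas_ddirs[OF assms(1) Xc_le[OF assms(2) that]])
 show ?thesis unfolding L_coef_def by (intro tmeas_add tmeas_cmult tmeas_sum tmeas_mult tq tp 1) auto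
qed

lemma tmeas_Lo:
 assumes "j <= k" "!!t. t \<in> {0..T1} ==> Xc 3 C (U j t)"
 shows "tmeas T1 (%s. Lo s (U j s))"
proof -
 have 1: "tmeas T1 (%s. (ddir v ^^ r) (U j s))" if "Suc r <= 3" for v r
  by (rule tmeas_ddirs[OF assms(1) Xc_le[OF assms(2) that]])
 have 2: "tmeas T1 (%s. ddir v (U j s))" for v using 1[of 1 v] by simp
 show ?thesis unfolding L_op_def by (intro tmeas_add tmeas_diff tmeas_cmult tmeas_sum tmeas_mult tq tp tc 1 2 joint_tmeas U_joint assms(1)) auto
qed

lemma Lc_U:
 assumes U: "!!t. t \<in> {0..T1} ==> Xc (m - \<rho> * j') C (U j' t)" and i: "1 <= i" and ij: "i + j' <= k" and s: "s \<in> {0..T1}"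
 shows "Xc (m - \<rho> * (i + j')) (qc * C) (Lc i s (U j' s))"
proof (rule Xc_mono[OF Lc_Xc[OF s, where \<rho>=\<rho> and C=C]])
 have *: "\<rho> * (i + j') + 2 <= m" by (rule jm[OF ij])
 have e: "m - \<rho> * (i + j') + \<rho> * i = m - \<rho> * j'" using * by (simp add: distrib_left)
 show "Xc (m - \<rho> * (i + j') + \<rho> * i) C (U j' s)" unfolding e by (rule U[OF s])
 show "1 <= m - \<rho> * (i + j')" using * by linarith
 show "2 ^ m * Mx * ((real CARD('d) * s1) ^ (i + 2) + (real CARD('d) * s1) ^ (i + 1)) * C <= qc * C"
  by (rule mult_right_mono[OF qc_ge Xc_nonneg[OF U[OF s]]]) (use ij k_le_m in simp)
qed (use i rho s in auto)

lemma tmeas_Lc_U: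
 assumes U: "!!t. t \<in> {0..T1} ==> Xc (m - \<rho> * j') C (U j' t)" and i: "1 <= i" and ij: "i + j' <= k"
 shows "tmeas T1 (%s. Lc i s (U j' s))"
proof (rule tmeas_Lc)
 have "\<rho> * (i + j') + 2 <= m" by (rule jm[OF ij])
 moreover have "\<rho> * i >= i + 1" using rho i by auto
 ultimately have "i + 3 <= m - \<rho> * j'" by (simp add: distrib_left)
 then show "Xc (i + 3) C (U j' t)" if "t \<in> {0..T1}" for t by (rule Xc_le[OF U[OF that]])
qed (use ij in simp)

text \<open>Strong induction: \<open>Lc i\<close> applied to the coefficient of index j - i uses up
  \<rho> i of the orders still available, so all terms of the right side share the order m - \<rho>
  j. Each stage multiplies the constant by at most \<open>ac\<close>.\<close>

lemma U_Xc: "j <= k ==> t \<in> {0..T1} ==> Xc (m - \<rho> * j) (ac ^ (j + 1) * (Bf + Bg)) (U j t)"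
proof (induction j arbitrary: t rule: less_induct)
 case (less j)
 let ?B = "Bf + Bg"
 have B: "?B >= 0" using Bfg by simp
 show ?case
 proof (cases "j = 0")
  case True
  have "Xc m (BC m * (Bf + Bg)) (U 0 t)"
  proof (rule weak_bound[OF U0 order_refl fX _ fm Bfg(1) gX _ less.prems(2)])
   show "Xc 1 ?B (f s)" if "s \<in> {0..T1}" for s
    by (rule Xc_mono[OF Xc_le[OF fX[OF that]]]) (use m3 Bfg in auto)
   show "Xc 1 ?B g" by (rule Xc_mono[OF Xc_le[OF gX]]) (use m3 Bfg in auto)
  qed auto
  moreover have "BC m * ?B <= ac ^ (j + 1) * ?B"
   using BC_le[of m] ac_ge(1) B True by (intro mult_right_mono) auto
  ultimately show ?thesis using True by (auto intro: Xc_mono)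
 next
  case False
  then have j: "j \<in> {1..k}" using less.prems by simp
  have IH: "Xc (m - \<rho> * (j - i)) (ac ^ j * ?B) (U (j - i) s)" if "i \<in> {1..j}" "s \<in> {0..T1}" for i s
  proof (rule Xc_mono[OF less.IH])
   have "ac ^ (j - i + 1) <= ac ^ j" by (rule power_increasing) (use that ac_ge in auto)
   then show "ac ^ (j - i + 1) * ?B <= ac ^ j * ?B" using B by (rule mult_right_mono)
  qed (use that less.prems in auto)
  have n1: "1 <= m - \<rho> * j" using jm[OF less.prems(1)] by linarith
  define C1 where "C1 = 2 ^ m * qc * (ac ^ j * ?B)"
  have C1: "C1 >= 0" unfolding C1_def using qc0 ac_ge(3) B by simp
  have FX: "Xc (m - \<rho> * j) C1 (%x. \<Sum>i=1..j. real (j choose i) * Lc i s (U (j - i) s) x)" if s: "s \<in> {0..T1}" for s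
  proof (rule Xc_mono[OF Xc_sum])
   fix i assume i: "i \<in> {1..j}"
   have "Xc (m - \<rho> * (i + (j - i))) (qc * (ac ^ j * ?B)) (Lc i s (U (j - i) s))"
    by (rule Lc_U[OF IH[OF i]]) (use i s less.prems in auto)
   then show "Xc (m - \<rho> * j) (\<bar>real (j choose i)\<bar> * (qc * (ac ^ j * ?B))) (%x. real (j choose i) * Lc i s (U (j - i) s) x)"
    using i by (intro Xc_cmult) simp
  next
   have "(\<Sum>i=1..j. \<bar>real (j choose i)\<bar> * (qc * (ac ^ j * ?B))) = real (\<Sum>i=1..j. j choose i) * (qc * (ac ^ j * ?B))"
    by (simp add: sum_distrib_right)
   also have "... <= 2 ^ m * (qc * (ac ^ j * ?B))"
   proof (rule mult_right_mono)
    have "(\<Sum>i=1..j. j choose i) <= (\<Sum>i\<le>j. j choose i)" by (rule sum_mono2) auto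
    also have "... <= 2 ^ m" unfolding choose_row_sum using less.prems(1) k_le_m by (intro power_increasing) auto
    finally have "real (\<Sum>i=1..j. j choose i) <= real (2 ^ m)" by (simp only: of_nat_le_iff)
    then show "real (\<Sum>i=1..j. j choose i) <= 2 ^ m" by simp
   qed (use qc0 ac_ge(3) B in simp)
   finally show "(\<Sum>i=1..j. \<bar>real (j choose i)\<bar> * (qc * (ac ^ j * ?B))) <= C1" by (simp add: C1_def mult.assoc)
  qed
  have Fm: "tmeas T1 (%s x. \<Sum>i=1..j. real (j choose i) * Lc i s (U (j - i) s) x)"
   by (intro tmeas_sum tmeas_cmult tmeas_Lc_U[OF IH]) (use less.prems in auto)
  have "Xc (m - \<rho> * j) (BC (m - \<rho> * j) * (C1 + 0)) (U j t)"
   by (rule weak_bound[OF Uj[OF j] _ FX Xc_le[OF FX n1] Fm C1 Xc_zero Xc_zero less.prems(2)]) (use C1 in auto)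
  moreover have "BC (m - \<rho> * j) * (C1 + 0) <= ac ^ (j + 1) * ?B"
  proof -
   have "BC (m - \<rho> * j) * (C1 + 0) <= bs * C1" using BC_le[of "m - \<rho> * j"] C1 by (simp add: mult_right_mono)
   also have "... = bs * (2 ^ m * qc) * (ac ^ j * ?B)" by (simp add: C1_def)
   also have "... <= ac * (ac ^ j * ?B)" using ac_ge B by (intro mult_right_mono) auto
   finally show ?thesis by (simp add: mult.assoc)
  qed
  ultimately show ?thesis by (rule Xc_mono)
 qed
qed

lemma FF_uX: "j <= k ==> uX 1 (FF j)" and FF_tmeas: "j <= k ==> tmeas T1 (FF j)"
proof -
 assume j: "j <= k"
 have L1: "uX 1 (%s. Lc i s (U (j - i) s))" if "i \<in> {1..j}" for i
 proof -
  have "Xc 1 (qc * (ac ^ (j - i + 1) * (Bf + Bg))) (Lc i s (U (j - i) s))" if s: "s \<in> {0..T1}" for s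
   by (rule Xc_le[OF Lc_U[OF U_Xc]]) (use \<open>i \<in> {1..j}\<close> s j jm[OF j] in auto)
  then show ?thesis unfolding uX_def by blast
 qed
 show "uX 1 (FF j)"
 proof (cases "j = 0")
  case True
  have "uX 1 f" unfolding uX_def using fX Xc_le m3 by (intro exI[of _ Bf]) fastforce
  then show ?thesis using True by (simp add: FF_def[abs_def])
 next
  case False
  then show ?thesis unfolding FF_def[abs_def] by (simp only: if_False) (intro uX_sum uX_cmult L1, auto)
 qed
 show "tmeas T1 (FF j)"
 proof (cases "j = 0")
  case True
  then show ?thesis using fm by (simp add: FF_def[abs_def])
 next
  case False
  then show ?thesis unfolding FF_def[abs_def] by (simp only: if_False) (intro tmeas_sum tmeas_cmult tmeas_Lc_U[OF U_Xc], use j in auto)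
 qed
qed

lemma FF_solution: "j <= k ==> weak_solution T1 V q p c (FF j) (if j = 0 then g else (%_. 0)) (U j)"
 using U0 Uj[of j] unfolding FF_def[abs_def] by (cases "j = 0") (simp_all only: if_True if_False, auto)

text \<open>For odd j a term of the right side has either an odd i, where \<open>Lc i\<close>
  vanishes by parity, or an even i and hence an odd smaller index j - i, zero by induction. With
  zero data the a priori estimate has constant 0, which acts as a uniqueness result.\<close>

lemma U_odd_zero:
 assumes sym: "uminus ` V = V" "!!t v x. t \<in> {0..T1} ==> v \<in> V ==> q v t x = q (- v) t x"
  and anti: "!!t v x. t \<in> {0..T1} ==> v \<in> V ==> p (- v) t x = - p v t x"
 shows "odd j ==> j <= k ==> t \<in> {0..T1} ==> U j t = (%x. 0)"
proof (induction j arbitrary: t rule: less_induct)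
 case (less j)
 have j: "j \<noteq> 0" using less.prems(1) by (cases j) auto
 have z: "Lc i s (U (j - i) s) x = 0" if i: "i \<in> {1..j}" and s: "s \<in> {0..T1}" for i s x
 proof (cases "odd i")
  case True
  have "i + 2 <= m - \<rho> * (j - i)" using jm[OF less.prems(2)] i rho by (auto simp: diff_mult_distrib2)
  then have "Xc (i + 2) (ac ^ (j - i + 1) * (Bf + Bg)) (U (j - i) s)"
   by (intro Xc_le[OF U_Xc]) (use less.prems s in auto)
  then show ?thesis by (rule Lc_zero[OF s True]) (use sym anti s in auto)
 next
  case False
  then have "U (j - i) s = (%x. 0)" using less.prems i s by (intro less.IH) auto
  then show ?thesis by (simp add: L_zero)
 qed
 have F0: "FF j s = (%x. 0)" if "s \<in> {0..T1}" for s using z[OF _ that] j by (intro ext) (simp add: FF_def)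
 have "Xc 0 (BC 0 * (0 + 0)) (U j t)"
  using weak_bound[OF FF_solution[OF less.prems(2)] _ _ _ FF_tmeas[OF less.prems(2)] _ _ _ less.prems(3), of 0 0 0 0] j F0
  by (simp add: Xc_zero)
 then show "U j t = (%x. 0)" using Xc_bound by fastforce
qed

text \<open>\<open>UY\<close> is isolated as an assumption because it has two sources: the plain
  count of derivatives, and in the antisymmetric case the vanishing of the last coefficient.\<close>

context
 fixes l :: nat
 assumes UY: "!!j t. j <= k ==> t \<in> {0..T1} ==> Xc (l + (k - j) + 3) (ac ^ (j + 1) * (Bf + Bg)) (U j t)"
  and lm: "l + 2 <= m"
begin

lemma Lo_uX: "j <= k ==> uX 1 (%s. Lo s (U j s))"
 by (rule uXI[OF Lo_Xc[OF _ order_refl _ Xc_le[OF UY]]]) (use m3 in auto)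

lemma GG_uX: "j <= k ==> uX 1 (%s y. Lo s (U j s) y + FF j s y)"
 by (intro uX_add Lo_uX FF_uX)

lemma Lo_U_tmeas: "j <= k ==> tmeas T1 (%s. Lo s (U j s))"
 by (rule tmeas_Lo[OF _ Xc_le[OF UY]]) auto

lemma U_pointwise:
 assumes j: "j <= k" and t: "t \<in> {0..T1}"
 shows "set_integrable lborel {0..t} (%s. Lo s (U j s) x + FF j s x)"
  and "U j t x = (if j = 0 then g x else 0) + (LINT s:{0..t}|lborel. Lo s (U j s) x + FF j s x)"
proof -
 obtain C where C: "!!s. s \<in> {0..T1} ==> Xc 1 C (%y. Lo s (U j s) y + FF j s y)"
  using GG_uX[OF j] unfolding uX_def by blast
 have C0: "C >= 0" using Xc_nonneg[OF C[of 0]] T0 by simp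
 have gm: "Xc 1 Bg g" by (rule Xc_le[OF gX]) (use m3 in simp)
 have vX: "Xc 1 (C + Bg) (if j = 0 then g else (%_. 0))"
  using Xc_mono[OF gm, of "C + Bg"] C0 Bfg by (auto intro: Xc_zero)
 have CX: "Xc 1 (C + Bg) (%y. Lo s (U j s) y + FF j s y)" if "s \<in> {0..T1}" for s
  by (rule Xc_mono[OF C[OF that]]) (use Bfg in simp)
 note * = weak_pointwise[OF FF_solution[OF j] CX tmeas_add[OF Lo_U_tmeas[OF j] FF_tmeas[OF j]] vX t]
 show "set_integrable lborel {0..t} (%s. Lo s (U j s) x + FF j s x)" by (rule *(1))
 show "U j t x = (if j = 0 then g x else 0) + (LINT s:{0..t}|lborel. Lo s (U j s) x + FF j s x)"
  using *(2)[of x] by (cases "j = 0") simp_all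
qed

section \<open>The remainder of the expansion\<close>

context
 fixes h :: real and u :: "real => 'd fn"
 assumes h: "h \<in> {0<..h0}" and ub: "bounded_HT T1 u"
  and ueq: "!!t x. t \<in> {0..T1} ==> set_integrable lborel {0..t} (%s. Lh h s (u s) x + f s x) \<and>
    u t x = g x + (LINT s:{0..t}|lborel. Lh h s (u s) x + f s x)"
begin

lemma u_Xc: "t \<in> {0..T1} ==> Xc m (BC m * (Bf + Bg)) (u t)"
 by (rule fd_bound[OF h order_refl fX _ fm Bfg(1) gX _ ub ueq, where C'="Bf + Bg"])
  (use m3 Bfg in \<open>auto intro: Xc_mono[OF Xc_le[OF fX]] Xc_mono[OF Xc_le[OF gX]]\<close>)

definition uh where "uh t x = u t x - (\<Sum>j\<le>k. h ^ j / fact j * U j t x)"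
text \<open>The coefficient of index j carries h^j and is expanded up to order k - j, so every
  summand is of size h^(k+1).\<close>

definition Fh where "Fh s x = (\<Sum>j\<le>k. h ^ j / fact j * Rem V q p c (k - j) h s (U j s) x)"

text \<open>When the difference operator hits the partial sum, the Taylor terms recombine by
  \<open>expansion_reindex\<close> into the right sides of the equations for the coefficients; only
  \<open>Fh\<close> is left.\<close>

lemma Lh_uh:
 assumes s: "s \<in> {0..T1}"
 shows "Lh h s (u s) x + f s x - (\<Sum>j\<le>k. h ^ j / fact j * (Lo s (U j s) x + FF j s x)) = Lh h s (uh s) x + Fh s x"
proof -
 have "Lh h s (uh s) x = Lh h s (u s) x - (\<Sum>j\<le>k. h ^ j / fact j * Lh h s (U j s) x)"
  unfolding uh_def[abs_def] L_h_diff by (subst L_h_lincomb) auto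
 moreover have "Fh s x = (\<Sum>j\<le>k. h ^ j / fact j * Lh h s (U j s) x) - (\<Sum>j\<le>k. h ^ j / fact j * Lo s (U j s) x)
   - (\<Sum>j\<le>k. h ^ j / fact j * (\<Sum>i=1..k - j. h ^ i / fact i * Lc i s (U j s) x))"
  unfolding Fh_def Rem_def right_diff_distrib sum_subtractf ..
 moreover have "(\<Sum>j\<le>k. h ^ j / fact j * FF j s x) = f s x + (\<Sum>j\<le>k. h ^ j / fact j * (\<Sum>i=1..k - j. h ^ i / fact i * Lc i s (U j s) x))"
 proof -
  have "(\<Sum>j=1..k. h ^ j / fact j * FF j s x) = (\<Sum>j=1..k. h ^ j / fact j * (\<Sum>i=1..j. real (j choose i) * Lc i s (U (j - i) s) x))"
   by (intro sum.cong refl) (simp add: FF_def)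
  also have "... = (\<Sum>j\<le>k. h ^ j / fact j * (\<Sum>i=1..k - j. h ^ i / fact i * Lc i s (U j s) x))"
   by (rule expansion_reindex[where X="%i j. Lc i s (U j s) x"])
  finally show ?thesis unfolding atMost_split1[of "%j. h ^ j / fact j * FF j s x"] by (simp add: FF_def)
 qed
 ultimately show ?thesis by (simp add: distrib_left sum.distrib)
qed

lemma uh_eq:
 assumes t: "t \<in> {0..T1}"
 shows "set_integrable lborel {0..t} (%s. Lh h s (uh s) x + Fh s x) \<and> uh t x = 0 + (LINT s:{0..t}|lborel. Lh h s (uh s) x + Fh s x)"
proof -
 let ?G = "%j s. Lo s (U j s) x + FF j s x"
 let ?P = "%s. Lh h s (u s) x + f s x"
 have P: "set_integrable lborel {0..t} ?P" using ueq[OF t] by simp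
 have G: "set_integrable lborel {0..t} (?G j)" if "j \<in> {..k}" for j by (rule U_pointwise(1)[OF _ t]) (use that in simp)
 note S = set_integral_lincomb[of "{..k}" "{0..t}" ?G "%j. h ^ j / fact j", OF finite_atMost G]
 have eq: "?P s - (\<Sum>j\<le>k. h ^ j / fact j * ?G j s) = Lh h s (uh s) x + Fh s x" if "s \<in> {0..t}" for s
  by (rule Lh_uh) (use that t in auto)
 have 1: "set_integrable lborel {0..t} (%s. Lh h s (uh s) x + Fh s x)"
  using set_integral_diff(1)[OF P S(1)] by (subst set_integrable_cong[OF refl refl eq[symmetric]]) auto
 have "(LINT s:{0..t}|lborel. Lh h s (uh s) x + Fh s x) = (LINT s:{0..t}|lborel. ?P s - (\<Sum>j\<le>k. h ^ j / fact j * ?G j s))"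
  by (rule set_lebesgue_integral_cong) (use eq in auto)
 also have "... = (LINT s:{0..t}|lborel. ?P s) - (\<Sum>j\<le>k. h ^ j / fact j * (LINT s:{0..t}|lborel. ?G j s))"
  using set_integral_diff(2)[OF P S(1)] S(2) by simp
 also have "(LINT s:{0..t}|lborel. ?P s) = u t x - g x" using ueq[OF t, of x] by simp
 also have "(\<Sum>j\<le>k. h ^ j / fact j * (LINT s:{0..t}|lborel. ?G j s)) = (\<Sum>j\<le>k. h ^ j / fact j * U j t x) - g x"
 proof -
  have "(\<Sum>j\<le>k. h ^ j / fact j * (LINT s:{0..t}|lborel. ?G j s)) = (\<Sum>j\<le>k. h ^ j / fact j * U j t x - (if j = 0 then g x else 0))"
  proof (rule sum.cong[OF refl])
   fix j assume "j \<in> {..k}"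
   then show "h ^ j / fact j * (LINT s:{0..t}|lborel. ?G j s) = h ^ j / fact j * U j t x - (if j = 0 then g x else 0)"
    using U_pointwise(2)[of j t x] t by (cases "j = 0") auto
  qed
  then show ?thesis by (simp add: sum_subtractf)
 qed
 finally show ?thesis using 1 by (simp add: uh_def[of t x])
qed

text \<open>The consistency error of order k - j gains h^(k-j+1) at the price of k - j + 3 further
  derivatives of U j, exactly what \<open>UY\<close> provides.\<close>

lemma Fh_Xc:
 assumes s: "s \<in> {0..T1}"
 shows "Xc l (real (m + 1) * (qc * ac ^ (m + 1)) * (Bf + Bg) * h ^ (k + 1)) (Fh s)"
proof -
 let ?B = "Bf + Bg"
 have hp: "h > 0" using h by simp
 have B: "?B >= 0" using Bfg by simp
 have "Xc l (qc * ac ^ (m + 1) * ?B * h ^ (k + 1)) (%x. h ^ j / fact j * Rem V q p c (k - j) h s (U j s) x)" if j: "j <= k" for j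
 proof (rule Xc_mono[OF Xc_cmult[OF Rem_Xc[OF s hp _ UY[OF j s]]]])
  define r where "r = k - j"
  define P where "P = 2 ^ m * Mx * ((real CARD('d) * s1) ^ (r + 3) + (real CARD('d) * s1) ^ (r + 2))"
  have Pq: "P <= qc" unfolding P_def using qc_ge[of "r + 1"] k_le_m by (simp add: r_def numeral_3_eq_3 numeral_2_eq_2)
  have P0: "P >= 0" unfolding P_def using Mx0 s1nn by simp
  have a: "ac ^ (j + 1) <= ac ^ (m + 1)" by (rule power_increasing) (use j k_le_m ac_ge in auto)
  have a0: "0 <= ac ^ (j + 1)" using ac_ge by simp
  have "h ^ j / fact j <= h ^ j / 1" by (rule divide_left_mono[OF fact_ge_1]) (use hp in auto)
  then have f1: "h ^ j / fact j <= h ^ j" by simp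
  have f0: "0 <= h ^ j / fact j" using hp by simp
  have "h ^ j / fact j * (P * (ac ^ (j + 1) * ?B * h ^ (r + 1))) <= h ^ j * (qc * (ac ^ (m + 1) * ?B * h ^ (r + 1)))"
   using Pq a a0 f1 f0 P0 qc0 B hp by (intro mult_mono mult_nonneg_nonneg mult_right_mono order_refl) auto
  also have "... = qc * ac ^ (m + 1) * ?B * (h ^ j * h ^ (r + 1))" by (simp only: mult_ac)
  also have "h ^ j * h ^ (r + 1) = h ^ (k + 1)" unfolding power_add[symmetric] r_def using j by simp
  finally show "\<bar>h ^ j / fact j\<bar> * (2 ^ m * Mx * ((real CARD('d) * s1) ^ (k - j + 3) + (real CARD('d) * s1) ^ (k - j + 2)) * (ac ^ (j + 1) * ?B * h ^ (k - j + 1)))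
    <= qc * ac ^ (m + 1) * ?B * h ^ (k + 1)"
   using f0 unfolding P_def r_def by (simp only: abs_of_nonneg)
 qed (use lm in simp)
 then have "Xc l (\<Sum>j\<le>k. qc * ac ^ (m + 1) * ?B * h ^ (k + 1)) (Fh s)"
  unfolding Fh_def[abs_def] by (intro Xc_sum) auto
 then show ?thesis
 proof (rule Xc_mono)
  have "(\<Sum>j\<le>k. qc * ac ^ (m + 1) * ?B * h ^ (k + 1)) = real (k + 1) * (qc * ac ^ (m + 1) * ?B * h ^ (k + 1))" by simp
  also have "... <= real (m + 1) * (qc * ac ^ (m + 1) * ?B * h ^ (k + 1))"
   using k_le_m qc0 ac_ge B hp by (intro mult_right_mono mult_nonneg_nonneg) auto
  finally show "(\<Sum>j\<le>k. qc * ac ^ (m + 1) * ?B * h ^ (k + 1)) <= real (m + 1) * (qc * ac ^ (m + 1)) * ?B * h ^ (k + 1)"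
   by (simp only: mult.assoc)
 qed
qed

lemma Lc_U_uX:
 assumes j: "j <= k" and i: "i \<in> {1..k - j}"
 shows "uX 1 (%s. Lc i s (U j s))" "tmeas T1 (%s. Lc i s (U j s))"
proof -
 have ij: "i + j <= k" "1 <= i" using i j by auto
 have "Xc 1 (qc * (ac ^ (j + 1) * (Bf + Bg))) (Lc i s (U j s))" if "s \<in> {0..T1}" for s
  by (rule Xc_le[OF Lc_U[OF U_Xc[OF j] ij(2,1) that]]) (use jm[OF ij(1)] in linarith)+
 then show "uX 1 (%s. Lc i s (U j s))" unfolding uX_def by blast
 show "tmeas T1 (%s. Lc i s (U j s))" by (rule tmeas_Lc_U[OF U_Xc[OF j] ij(2,1)])
qed

lemma Fh_uX: "uX 1 Fh" and Fh_tmeas: "tmeas T1 Fh"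
proof -
 have hp: "h > 0" using h by simp
 have Lhu: "uX 1 (%s. Lh h s (U j s))" if "j <= k" for j
  by (rule uXI[OF Lh_Xc[OF _ _ hp Xc_le[OF UY[OF that]]]]) (use m3 in auto)
 have Lht: "tmeas T1 (%s. Lh h s (U j s))" if "j <= k" for j
  by (rule tmeas_Lh[OF joint_tmeas[OF U_joint[OF that]]])
 show "uX 1 Fh"
  unfolding Fh_def[abs_def] Rem_def by (intro uX_sum uX_cmult uX_diff Lhu Lo_uX Lc_U_uX(1)) auto
 show "tmeas T1 Fh"
  unfolding Fh_def[abs_def] Rem_def by (intro tmeas_sum tmeas_cmult tmeas_diff Lht Lo_U_tmeas Lc_U_uX(2)) auto
qed

text \<open>The remainder solves the difference equation with zero initial value and free term
  \<open>Fh\<close>, so \<open>fd_bound\<close> carries the factor h^(k+1) over with a constant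
  depending neither on h nor on the length of the time interval.\<close>

lemma uh_Xc: "t \<in> {0..T1} ==> Xc l (nc * (Bf + Bg) * h ^ (k + 1)) (uh t)"
proof -
 assume t: "t \<in> {0..T1}"
 let ?C = "real (m + 1) * (qc * ac ^ (m + 1)) * (Bf + Bg) * h ^ (k + 1)"
 have C: "?C >= 0" using Xc_nonneg[OF Fh_Xc[OF t]] .
 obtain C' where C': "!!s. s \<in> {0..T1} ==> Xc 1 C' (Fh s)" using Fh_uX unfolding uX_def by blast
 have C'0: "C' >= 0" using Xc_nonneg[OF C'[OF t]] .
 have bd: "bounded_HT T1 uh"
  unfolding bounded_HT_def
 proof (intro exI ballI allI)
  fix s x assume s: "s \<in> {0..T1}"
  have "Xc 0 (BC m * (Bf + Bg) + (\<Sum>j\<le>k. \<bar>h ^ j / fact j\<bar> * (ac ^ (j + 1) * (Bf + Bg)))) (uh s)"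
   unfolding uh_def[abs_def] by (intro Xc_diff Xc_sum Xc_cmult Xc_le[OF u_Xc[OF s]] Xc_le[OF UY[OF _ s]]) auto
  then show "\<bar>uh s x\<bar> <= BC m * (Bf + Bg) + (\<Sum>j\<le>k. \<bar>h ^ j / fact j\<bar> * (ac ^ (j + 1) * (Bf + Bg)))" by (rule Xc_bound)
 qed
 have "Xc l (BC l * (?C + 0)) (uh t)"
  by (rule fd_bound[OF h _ Fh_Xc C' Fh_tmeas C Xc_zero Xc_zero bd uh_eq t]) (use lm C'0 in auto)
 then show "Xc l (nc * (Bf + Bg) * h ^ (k + 1)) (uh t)"
 proof (rule Xc_mono)
  have "BC l * (?C + 0) <= bs * ?C" using BC_le[of l] lm C by (simp add: mult_right_mono)
  then show "BC l * (?C + 0) <= nc * (Bf + Bg) * h ^ (k + 1)" unfolding nc_eq by (simp only: mult.assoc)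
 qed
qed

text \<open>Lipschitz in t by the equation, with a constant depending on h, and in x by the
  first-order bound. Joint continuity of the derivatives then follows from
  \<open>D1s_joint\<close>.\<close>

lemma u_joint: "continuous_on ({0..T1} \<times> UNIV) (%(t, x). u t x)"
proof -
 define B where "B = BC m * (Bf + Bg)"
 have B: "B >= 0" unfolding B_def using BC1[of m] Bfg by simp
 have hp: "h > 0" using h by simp
 define L where "L = (2 ^ m * Mx * sqrt (real (card V)) * (2 / h\<^sup>2 + 2 / h) * B + 2 ^ m * Mx * B) + Bf"
 have LB: "\<bar>Lh h s (u s) x + f s x\<bar> <= L" if s: "s \<in> {0..T1}" for s x
  using Xc_bound[OF Lh_Xc[OF s _ hp u_Xc[OF s]], of x] Xc_bound[OF fX[OF s], of x] unfolding L_def B_def by linarith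
 have L0: "L >= 0" using LB[of 0 0] T0 by simp
 have lt: "\<bar>u t x - u s x\<bar> <= L * \<bar>t - s\<bar>" if "s \<in> {0..T1}" "t \<in> {0..T1}" for s t x
 proof -
  have *: "\<bar>u t x - u s x\<bar> <= L * (t - s)" if st: "0 <= s" "s <= t" "t <= T1" for s t
  proof -
   have i: "set_integrable lborel {0..t} (%r. Lh h r (u r) x + f r x)" using ueq[of t x] st by simp
   have "u t x - u s x = (LINT r:{s..t}|lborel. Lh h r (u r) x + f r x)"
    using ueq[of t x] ueq[of s x] set_integral_split[OF st(1,2) i] st by simp
   then show ?thesis
    using set_integral_abs_le[OF set_integrable_subset[OF i] LB, of s t] st by simp
  qed
  show ?thesis using *[of s t] *[of t s] that by (cases "s <= t") (auto simp: abs_minus_commute)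
 qed
 define D where "D = B * real CARD('d)"
 have lx: "\<bar>u s y - u s x\<bar> <= D * norm (y - x)" if "s \<in> {0..T1}" for s x y
  unfolding D_def using dbd1_lipschitz[OF XcD[OF u_Xc[OF that], of 1], of x "y - x"] m3 by (simp add: B_def)
 have D0: "D >= 0" unfolding D_def using B by simp
 show ?thesis
 proof (rule lipschitz_on_continuous_on[of "L + D"], rule lipschitz_onI)
  fix z w :: "real \<times> (real^'d)" assume "z \<in> {0..T1} \<times> UNIV" "w \<in> {0..T1} \<times> UNIV"
  then obtain s x t y where z: "z = (s, x)" "s \<in> {0..T1}" and w: "w = (t, y)" "t \<in> {0..T1}" by auto
  have "\<bar>u s x - u t y\<bar> <= L * \<bar>s - t\<bar> + D * norm (x - y)" using lt[OF w(2) z(2), of x] lx[OF w(2), of x y] by linarith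
  also have "... <= L * dist z w + D * dist z w"
   using L0 D0 dist_fst_le[of z w] dist_snd_le[of z w] by (intro add_mono mult_left_mono) (auto simp: z w dist_real_def dist_norm)
  finally show "dist (case z of (t, x) => u t x) (case w of (t, x) => u t x) <= (L + D) * dist z w"
   by (simp add: z w dist_real_def distrib_right)
 qed (use L0 D0 in simp)
qed

definition rh where "rh t x = 1 / h ^ (k + 1) * uh t x"

text \<open>Below the top order all generalized derivatives are the continuous versions
  \<open>D1s\<close>, for which linearity holds at every point; the expansion of derivatives is then
  the definition of \<open>rh\<close> differentiated.\<close>

lemma expansion:
 assumes a: "mi_order \<alpha> <= l"
 shows "continuous_on ({0..T1} \<times> UNIV) (%(t, x). gen_deriv \<alpha> (u t) x)"
  and "t \<in> {0..T1} ==> has_gen_deriv \<alpha> (u t) \<and> has_gen_deriv \<alpha> (rh t)"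
  and "t \<in> {0..T1} ==> gen_deriv \<alpha> (u t) x = gen_deriv \<alpha> (U 0 t) x + (\<Sum>j=1..k. h ^ j / fact j * gen_deriv \<alpha> (U j t) x)
    + h ^ (k + 1) * gen_deriv \<alpha> (rh t) x"
  and "t \<in> {0..T1} ==> \<bar>gen_deriv \<alpha> (rh t) x\<bar> <= nc * (Bf + Bg)"
proof -
 obtain "is" where is1: "count_list is = \<alpha>" "length is = mi_order \<alpha>" by (rule ex_count_list)
 \<comment> \<open>Order m >= l + 2 is available for u and order l + 1 for the coefficients, so a
   derivative of order l is strictly below the top for both.\<close>
 have len: "length is < m" "length is < l + 1" using is1 a lm by auto
 have hp: "h ^ (k + 1) > 0" using h by simp
 have gu: "gen_deriv \<alpha> (u t) = D1s is (u t)" if "t \<in> {0..T1}" for t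
  unfolding is1(1)[symmetric] by (rule gen_deriv_D1s[OF u_Xc[OF that] len(1)])
 have "continuous_on ({0..T1} \<times> UNIV) (%(t, x). D1s is (u t) x)"
  by (rule D1s_joint[OF u_joint u_Xc len(1)])
 then show "continuous_on ({0..T1} \<times> UNIV) (%(t, x). gen_deriv \<alpha> (u t) x)"
  by (rule continuous_on_eq) (auto simp: gu)
 assume t: "t \<in> {0..T1}"
 have UX: "Xc (l + 1) (ac ^ (j + 1) * (Bf + Bg)) (U j t)" if "j <= k" for j by (rule Xc_le[OF UY[OF that t]]) simp
 have gU: "gen_deriv \<alpha> (U j t) = D1s is (U j t)" if "j <= k" for j
  unfolding is1(1)[symmetric] by (rule gen_deriv_D1s[OF UX[OF that] len(2)])
 have wu: "weak_deriv \<alpha> (u t) (D1s is (u t))" unfolding is1(1)[symmetric] by (rule D1s_weak[OF u_Xc[OF t] len(1)])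
 have wU: "weak_deriv \<alpha> (U j t) (D1s is (U j t))" if "j <= k" for j
  unfolding is1(1)[symmetric] by (rule D1s_weak[OF UX[OF that] len(2)])
 have cont: "continuous_on UNIV (D1s is \<phi>)" if "Xc n C \<phi>" "length is < n" for n C and \<phi> :: "'d fn"
  by (rule Xc_continuous[OF Xc_D1s[OF that]]) (use that in simp)
 \<comment> \<open>One order more than the quantitative bound, with a constant depending on h; it
   guarantees that derivatives of order l are continuous.\<close>
 have rX: "Xc (l + 1) (\<bar>1 / h ^ (k + 1)\<bar> * (BC m * (Bf + Bg) + (\<Sum>j\<le>k. \<bar>h ^ j / fact j\<bar> * (ac ^ (j + 1) * (Bf + Bg))))) (rh t)"
  unfolding rh_def[abs_def] uh_def
  by (intro Xc_cmult[of _ _ "%x. u t x - (\<Sum>j\<le>k. h ^ j / fact j * U j t x)"] Xc_diff Xc_sum Xc_cmult UX Xc_le[OF u_Xc[OF t]])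
   (use lm in auto)
 let ?a = "1 / h ^ (k + 1)"
 have req: "rh t = (%x. ?a * u t x + (\<Sum>j\<le>k. - ?a * (h ^ j / fact j) * U j t x))"
  unfolding rh_def[abs_def] uh_def by (intro ext) (simp add: right_diff_distrib sum_distrib_left sum_negf mult.assoc)
 have wr: "weak_deriv \<alpha> (rh t) (%x. ?a * D1s is (u t) x + (\<Sum>j\<le>k. - ?a * (h ^ j / fact j) * D1s is (U j t) x))"
  unfolding req by (intro weak_deriv_lin wu weak_deriv_sum wU) auto
 have gr: "gen_deriv \<alpha> (rh t) = (%x. ?a * D1s is (u t) x + (\<Sum>j\<le>k. - ?a * (h ^ j / fact j) * D1s is (U j t) x))"
 proof (rule gen_deriv_eqI[OF wr])
  show "continuous_on UNIV (%x. ?a * D1s is (u t) x + (\<Sum>j\<le>k. - ?a * (h ^ j / fact j) * D1s is (U j t) x))"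
   by (intro continuous_on_add continuous_on_mult continuous_on_const continuous_on_sum cont[OF u_Xc[OF t] len(1)] cont[OF UX len(2)]) auto
  show "continuous_on UNIV (rh t)" by (rule Xc_continuous[OF rX]) simp
 qed
 show "has_gen_deriv \<alpha> (u t) \<and> has_gen_deriv \<alpha> (rh t)" unfolding has_gen_deriv_def using wu wr by blast
 have "h ^ (k + 1) * gen_deriv \<alpha> (rh t) x = D1s is (u t) x - (\<Sum>j\<le>k. h ^ j / fact j * D1s is (U j t) x)"
 proof -
  have gen: "H * (1 / H * a + (\<Sum>j\<in>J. - (1 / H) * w j * d j)) = a - (\<Sum>j\<in>J. w j * d j)" if "H \<noteq> 0" for H a :: real and J :: "nat set" and w d :: "nat => real"
   using that by (simp add: right_diff_distrib sum_distrib_left sum_negf)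
  show ?thesis unfolding gr by (rule gen) (use h in simp)
 qed
 moreover have "(\<Sum>j\<le>k. h ^ j / fact j * D1s is (U j t) x) = D1s is (U 0 t) x + (\<Sum>j=1..k. h ^ j / fact j * D1s is (U j t) x)"
  unfolding atMost_split1 by simp
 moreover have "(\<Sum>j=1..k. h ^ j / fact j * gen_deriv \<alpha> (U j t) x) = (\<Sum>j=1..k. h ^ j / fact j * D1s is (U j t) x)"
  by (intro sum.cong refl) (simp add: gU)
 ultimately show "gen_deriv \<alpha> (u t) x = gen_deriv \<alpha> (U 0 t) x + (\<Sum>j=1..k. h ^ j / fact j * gen_deriv \<alpha> (U j t) x)
    + h ^ (k + 1) * gen_deriv \<alpha> (rh t) x"
  unfolding gu[OF t] gU[OF le0] by linarith
 have "Xc l (\<bar>?a\<bar> * (nc * (Bf + Bg) * h ^ (k + 1))) (rh t)" unfolding rh_def[abs_def] by (rule Xc_cmult[OF uh_Xc[OF t]])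
 moreover have "\<bar>?a\<bar> * (nc * (Bf + Bg) * h ^ (k + 1)) = nc * (Bf + Bg)" using h by simp
 ultimately have "Xc l (nc * (Bf + Bg)) (rh t)" by simp
 then have "dbd (length is + 0) (nc * (Bf + Bg)) (rh t)" by (rule XcD) (use len in simp)
 from D1s_bound[OF rX len(2) this] have "\<bar>D1s is (rh t) x\<bar> <= nc * (Bf + Bg)" by (simp add: dbd0)
 then show "\<bar>gen_deriv \<alpha> (rh t) x\<bar> <= nc * (Bf + Bg)"
  using gen_deriv_D1s[OF rX len(2)] is1(1) by simp
qed

lemma expansion_ex:
 "\<exists>r. \<forall>\<alpha>. mi_order \<alpha> <= l -->
   (\<forall>t\<in>{0..T1}. has_gen_deriv \<alpha> (u t) \<and> has_gen_deriv \<alpha> (r t)) \<and>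
   continuous_on ({0..T1} \<times> UNIV) (%(t, x). gen_deriv \<alpha> (u t) x) \<and>
   (\<forall>t\<in>{0..T1}. \<forall>x.
    gen_deriv \<alpha> (u t) x = gen_deriv \<alpha> (U 0 t) x + (\<Sum>j=1..k. h ^ j / fact j * gen_deriv \<alpha> (U j t) x)
     + h ^ (k + 1) * gen_deriv \<alpha> (r t) x \<and>
    \<bar>gen_deriv \<alpha> (r t) x\<bar> <= nc * (Bf + Bg))"
 by (rule exI[of _ rh]) (intro allI impI conjI ballI expansion(1,3,4) expansion(2)[THEN conjunct1] expansion(2)[THEN conjunct2])

end

end

end

end

section \<open>From the hypotheses of the statement to the estimates\<close>

lemma problemI:
 fixes V :: "(real^'d::finite) set" and q p :: "real^'d => real => 'd fn"
 assumes const: "3 <= m" "0 < \<delta>" "\<delta> <= 1" "K >= 1" "\<tau>0 > 0" "c0 > 0" and Th: "T > 0" "h0 > 0"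
  and fin: "finite V" and tau: "!!v. v \<in> V ==> \<tau> v >= 0" and e: "inj e" "range e \<inter> V = {}"
  and size1: "sqrt (\<Sum>v\<in>V. (norm v)\<^sup>2) = size1"
  and size1\<tau>: "sqrt (\<Sum>v\<in>V. (norm (\<tau> v *\<^sub>R v))\<^sup>2) = size1\<tau>"
  and bor: "!!v. v \<in> V ==> borel_on {0..} (q v)" "!!v. v \<in> V ==> borel_on {0..} (p v)" "borel_on {0..} c"
  and reg: "regularity T V q p c f g m M"
  and qp: "!!h v t x. h \<in> {0<..h0} ==> v \<in> V ==> t \<in> {0..T} ==> q v t x + h * p v t x >= 0"
  and zero: "!!t x. t \<in> {0..T} ==> (\<Sum>v\<in>V. q v t x *\<^sub>R v) = 0"
  and c: "!!t x. t \<in> {0..T} ==> c t x >= c0"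
  and st: "structural1 T h0 V \<tau> \<tau>0 e q p c \<delta> K m" "structural2 T h0 V \<tau> \<tau>0 e q p c \<delta> K m"
 shows "problem T h0 V \<tau> \<tau>0 e q p c \<delta> K c0 size1 ((real CARD('d))\<^sup>2 * size1\<tau>\<^sup>2 + real CARD('d) * \<tau>0\<^sup>2) (\<Sum>k\<le>m. \<bar>M k\<bar>) m"
proof -
 let ?W = "(real CARD('d))\<^sup>2 * size1\<tau>\<^sup>2 + real CARD('d) * \<tau>0\<^sup>2"
 let ?M = "\<Sum>k\<le>m. \<bar>M k\<bar>"
 have sq: "size1 >= 0" "size1\<^sup>2 = (\<Sum>v\<in>V. (norm v)\<^sup>2)" "size1\<tau>\<^sup>2 = (\<Sum>v\<in>V. (norm (\<tau> v *\<^sub>R v))\<^sup>2)"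
  unfolding size1[symmetric] size1\<tau>[symmetric] by (auto simp: sum_nonneg)
 have sch: "scheme V \<tau> \<tau>0 e h \<delta> K c0 size1 ?W ?M" if h: "h \<in> {0<..h0}" for h
 proof -
  have fd: "fdops V \<tau> \<tau>0 e h" unfolding fdops_def using fin tau const e h by auto
  \<comment> \<open>The differences contribute d^2 times the squared size of the weighted
    directions, the d derivatives \<tau>0^2 each.\<close>
  have "(\<Sum>v\<in>V \<union> range e. (fdops.wv V \<tau> \<tau>0 v)\<^sup>2) = (\<Sum>v\<in>V. (fdops.wv V \<tau> \<tau>0 v)\<^sup>2) + (\<Sum>v\<in>range e. (fdops.wv V \<tau> \<tau>0 v)\<^sup>2)"
   by (rule sum.union_disjoint) (use fin e in auto)
  also have "(\<Sum>v\<in>V. (fdops.wv V \<tau> \<tau>0 v)\<^sup>2) = (real CARD('d))\<^sup>2 * size1\<tau>\<^sup>2"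
   unfolding sq(3) sum_distrib_left by (intro sum.cong refl) (simp add: fdops.wv_def[OF fd] power_mult_distrib)
  also have "(\<Sum>v\<in>range e. (fdops.wv V \<tau> \<tau>0 v)\<^sup>2) = (\<Sum>v\<in>range e. \<tau>0\<^sup>2)"
   using e(2) by (intro sum.cong refl) (auto simp: fdops.wv_def[OF fd])
  also have "... = real CARD('d) * \<tau>0\<^sup>2" using card_image[OF e(1)] by simp
  finally have W: "(\<Sum>v\<in>V \<union> range e. (fdops.wv V \<tau> \<tau>0 v)\<^sup>2) <= ?W" by simp
  show ?thesis unfolding scheme_def scheme_axioms_def using fd const sq W by (simp add: sum_nonneg)
 qed
 have c0: "c t x >= 0" if "t \<in> {0..T}" for t x using c[OF that, of x] const by linarith
 show ?thesis
 proof (rule problem.intro)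
  fix h t assume h: "h \<in> {0<..h0}" and t: "t \<in> {0..T}"
  note S = sch[OF h]
  have "scheme.SI1 V \<tau> \<tau>0 e h \<delta> K (%v. q v t) (%v. p v t) (c t)"
  proof -
   show ?thesis
    using st(1)[unfolded structural1_def Let_def, rule_format, OF h]
    apply (elim exE)
    subgoal premises KK for KK
     by (rule scheme.SI1_of_structural[OF S KK[rule_format, OF t, THEN conjunct1] _ KK[rule_format, OF t, THEN conjunct2, rule_format]])
      (use const qp[OF h _ t] c0[OF t] in auto)
    done
  qed
  moreover have "scheme.SI2 V \<tau> \<tau>0 e h \<delta> K n (%v. q v t) (%v. p v t) (c t)" if n: "n \<in> {2..m}" for n
  proof -
   have n1: "n \<in> {1..m}" using n by auto
   show ?thesis
    using st(2)[unfolded structural2_def Let_def, rule_format, OF h n1]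
    apply (elim exE)
    subgoal premises KK for KK
     by (rule scheme.SI2_of_structural[OF S KK[rule_format, OF t, THEN conjunct1]
        KK[rule_format, OF t, THEN conjunct2, rule_format] c0[OF t]]) auto
    done
  qed
  moreover have "(\<Sum>v\<in>V. v $ i * q v t x) = 0" for x i
   using arg_cong[OF zero[OF t, of x], of "%w. w $ i"] by (simp add: mult.commute)
  ultimately show "scheme.rough_ok V \<tau> \<tau>0 e h \<delta> K c0 ?M m (%v. q v t) (%v. p v t) (c t)"
   unfolding scheme.rough_ok_def[OF S]
   using regularity_coefs[OF reg fin t] qp[OF h _ t] c[OF t] by auto
 qed (use const Th sch in \<open>auto intro: borel_on_tmeas[OF bor(1)] borel_on_tmeas[OF bor(2)] borel_on_tmeas[OF bor(3)]\<close>)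
qed

lemma expansion_main:
 fixes V :: "(real^'d::finite) set" and u :: "real => real => 'd fn"
 assumes P: "problem T h0 V \<tau> \<tau>0 e q p c \<delta> K c0 s1 W2 Mx m"
  and reg: "regularity T V q p c f g m M" and fb: "borel_on {0..T} f"
  and cases: "case_i m k l \<and> expansion_coeffs T V q p c f g m 3 k U \<or>
   case_ii T V q m k l \<and> expansion_coeffs T V q p c f g m 2 k U \<or>
   case_iii T V q p m k l \<and> expansion_coeffs T V q p c f g m 2 k U"
  and sol: "!!h. h \<in> {0<..h0} ==> fd_solution T V q p c f g h (u h)"
 shows "(\<exists>r :: real => real => 'd fn. \<forall>h\<in>{0<..h0}. \<forall>\<alpha>. mi_order \<alpha> <= l -->
    (\<forall>t\<in>{0..T}. has_gen_deriv \<alpha> (u h t) \<and> has_gen_deriv \<alpha> (r h t)) \<and>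
    continuous_on ({0..T} \<times> UNIV) (%(t, x). gen_deriv \<alpha> (u h t) x) \<and>
    (\<forall>t\<in>{0..T}. \<forall>x.
     gen_deriv \<alpha> (u h t) x = gen_deriv \<alpha> (U 0 t) x
      + (\<Sum>j=1..k. h ^ j / fact j * gen_deriv \<alpha> (U j t) x)
      + h ^ (k + 1) * gen_deriv \<alpha> (r h t) x \<and>
     \<bar>gen_deriv \<alpha> (r h t) x\<bar> <= Ncst (real CARD('d)) m \<delta> K \<tau>0 c0 s1 W2 Mx * (norm_B T m f + norm_B T m (%_. g)))) \<and>
  (case_iii T V q p m k l --> (\<forall>j\<in>{1..k}. odd j --> (\<forall>t\<in>{0..T}. \<forall>x. U j t x = 0)))"
proof -
 interpret P: problem T h0 V \<tau> \<tau>0 e q p c \<delta> K c0 s1 W2 Mx m by fact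
 define Bf where "Bf = norm_B T m f"
 define Bg where "Bg = norm_B T m (%_. g)"
 have fX: "Xc m Bf (f s)" if "s \<in> {0..T}" for s
  unfolding Bf_def using reg that by (intro in_B_norm) (auto simp: regularity_def)
 have TT: "0 \<in> {0..T}" using P.T0 by simp
 have gX: "Xc m Bg g" unfolding Bg_def using reg by (intro in_B_norm[OF _ TT, of m "%_. g"]) (auto simp: regularity_def)
 have fm: "tmeas T f" by (rule borel_on_tmeas[OF fb]) simp
 have sym: "uminus ` V = V \<and> (\<forall>t\<in>{0..T}. \<forall>v\<in>V. \<forall>x. q v t x = q (- v) t x)"
  if "case_ii T V q m k l \<or> case_iii T V q p m k l"
  using that unfolding case_ii_def case_iii_def sym_q_def by blast
 \<comment> \<open>The last clause keeps two alternatives apart: enough orders for the plain count,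
   or possibly one fewer in the antisymmetric case.\<close>
 obtain \<rho> where rho: "\<rho> = 3 \<or> \<rho> = 2 \<and> uminus ` V = V \<and> (\<forall>t\<in>{0..T}. \<forall>v\<in>V. \<forall>x. q v t x = q (- v) t x)"
  and ex: "expansion_coeffs T V q p c f g m \<rho> k U"
  and mkl: "\<rho> * k + 3 + l <= m \<or> \<rho> = 2 \<and> 2 * k + 2 + l <= m \<and> case_iii T V q p m k l"
  using cases
 proof (elim disjE conjE)
  assume "case_i m k l" "expansion_coeffs T V q p c f g m 3 k U"
  then show thesis by (intro that[of 3]) (auto simp: case_i_def)
 next
  assume a: "case_ii T V q m k l" "expansion_coeffs T V q p c f g m 2 k U"
  then show thesis using sym by (intro that[of 2]) (auto simp: case_ii_def)
 next
  assume a: "case_iii T V q p m k l" "expansion_coeffs T V q p c f g m 2 k U"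
  then have "2 * k + 2 + l <= m" by (simp add: case_iii_def)
  then show thesis using a sym by (intro that[of 2]) auto
 qed
 have km: "\<rho> * k + 2 <= m" using mkl by auto
 have U0: "weak_solution T V q p c f g (U 0)" using ex by (simp add: expansion_coeffs_def)
 have Uj: "weak_solution T V q p c (%s x. \<Sum>i=1..j. real (j choose i) * L_coef V q p i s (U (j - i) s) x) (%_. 0) (U j)" if "j \<in> {1..k}" for j
  using ex that by (simp add: expansion_coeffs_def)
 note hyps = fX fm gX rho km U0 Uj
 have odd0: "U j t = (%x. 0)" if c3: "case_iii T V q p m k l" and j: "odd j" "j <= k" "t \<in> {0..T}" for j t
  by (rule P.U_odd_zero[OF hyps _ _ _ j]) (use sym c3 in \<open>auto simp: case_iii_def antisym_p_def\<close>)
 have UY: "Xc (l + (k - j) + 3) (P.ac ^ (j + 1) * (Bf + Bg)) (U j t)" if j: "j <= k" and t: "t \<in> {0..T}" for j t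
 proof -
  note X = P.U_Xc[OF hyps j t]
  obtain i where i: "k = j + i" using j le_Suc_ex by blast
  show ?thesis
  proof (cases "\<rho> * k + 3 + l <= m")
   case True
   have "l + (k - j) + 3 <= m - \<rho> * j" using True rho unfolding i by (auto simp: distrib_left)
   from Xc_le[OF X this] show ?thesis .
  next
   \<comment> \<open>The missing order matters only for j = k, where parity makes the coefficient
     vanish since k is odd; for j < k the loss of 2 per index against 1 in the requirement leaves
     room.\<close>
   case False
   then have c3: "\<rho> = 2" "2 * k + 2 + l <= m" "case_iii T V q p m k l" using mkl by auto
   show ?thesis
   proof (cases "j = k")
    case True
    have "odd j" using c3(3) True by (simp add: case_iii_def)
    then have "U j t = (%x. 0)" by (rule odd0[OF c3(3) _ j t])
    then show ?thesis using Xc_zero[OF Xc_nonneg[OF X]] by simp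
   next
    case False
    then have "l + (k - j) + 3 <= m - \<rho> * j" using c3 j unfolding i by auto
    from Xc_le[OF X this] show ?thesis .
   qed
  qed
 qed
 have lm: "l + 2 <= m" using mkl by auto
 have step: "\<exists>r. \<forall>\<alpha>. mi_order \<alpha> <= l -->
   (\<forall>t\<in>{0..T}. has_gen_deriv \<alpha> (u h t) \<and> has_gen_deriv \<alpha> (r t)) \<and>
   continuous_on ({0..T} \<times> UNIV) (%(t, x). gen_deriv \<alpha> (u h t) x) \<and>
   (\<forall>t\<in>{0..T}. \<forall>x.
    gen_deriv \<alpha> (u h t) x = gen_deriv \<alpha> (U 0 t) x + (\<Sum>j=1..k. h ^ j / fact j * gen_deriv \<alpha> (U j t) x)
     + h ^ (k + 1) * gen_deriv \<alpha> (r t) x \<and>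
    \<bar>gen_deriv \<alpha> (r t) x\<bar> <= P.nc * (Bf + Bg))" if h: "h \<in> {0<..h0}" for h
 proof -
  have ub: "bounded_HT T (u h)" using sol[OF h] by (simp add: fd_solution_def)
  have ueq: "set_integrable lborel {0..t} (%s. L_h V q p c h s (u h s) x + f s x) \<and>
    u h t x = g x + (LINT s:{0..t}|lborel. L_h V q p c h s (u h s) x + f s x)" if "t \<in> {0..T}" for t x
   using sol[OF h] that unfolding fd_solution_def by blast
  show ?thesis by (rule P.expansion_ex[OF hyps UY lm h ub ueq])
 qed
 show ?thesis
  unfolding P.nc_def[symmetric] Bf_def[symmetric] Bg_def[symmetric]
 proof (rule conjI, rule bchoice, rule ballI, rule step, assumption, intro impI ballI allI)
  fix j t x assume "case_iii T V q p m k l" "j \<in> {1..k}" "odd j" "t \<in> {0..T}"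
  then show "U j t x = 0" using odd0[of j t] by simp
 qed
qed

theorem theorem2p7:
  fixes m :: nat and \<delta> K \<tau>0 c0 size1 size1\<tau> :: real and M :: "nat \<Rightarrow> real"
  assumes "m \<ge> 3" and "0 < \<delta>" and "\<delta> \<le> 1" and "K \<ge> 1" and "\<tau>0 > 0" and "c0 > 0"
  shows "\<exists>N::real. \<forall>(T::real) (h0::real) (\<Lambda>1 :: (real^'d::finite) set) (\<tau> :: real^'d \<Rightarrow> real)
      (e :: 'd \<Rightarrow> real^'d)
      (q :: real^'d \<Rightarrow> real \<Rightarrow> real^'d \<Rightarrow> real) (p :: real^'d \<Rightarrow> real \<Rightarrow> real^'d \<Rightarrow> real)
      (c :: real \<Rightarrow> real^'d \<Rightarrow> real) (f :: real \<Rightarrow> real^'d \<Rightarrow> real) (g :: real^'d \<Rightarrow> real)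
      (k::nat) (l::nat) (u :: real \<Rightarrow> real \<Rightarrow> real^'d \<Rightarrow> real) (U :: nat \<Rightarrow> real \<Rightarrow> real^'d \<Rightarrow> real).
    T > 0 \<and> h0 > 0 \<and>
    finite \<Lambda>1 \<and> 0 \<notin> \<Lambda>1 \<and> (\<forall>v\<in>\<Lambda>1. \<tau> v \<ge> 0) \<and>
    inj e \<and> range e \<inter> \<Lambda>1 = {} \<and>
    sqrt (\<Sum>v\<in>\<Lambda>1. (norm v)\<^sup>2) = size1 \<and>
    sqrt (\<Sum>v\<in>\<Lambda>1. (norm (\<tau> v *\<^sub>R v))\<^sup>2) = size1\<tau> \<and>
    (\<forall>v\<in>\<Lambda>1. borel_on {0..} (q v) \<and> borel_on {0..} (p v) \<and> (\<forall>t\<ge>0. \<forall>x. q v t x \<ge> 0)) \<and>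
    borel_on {0..} c \<and> borel_on {0..T} f \<and> g \<in> borel_measurable borel \<and>
    regularity T \<Lambda>1 q p c f g m M \<and>
    (\<forall>h\<in>{0<..h0}. \<forall>v\<in>\<Lambda>1. \<forall>t\<in>{0..T}. \<forall>x. q v t x + h * p v t x \<ge> 0) \<and>
    (\<forall>t\<in>{0..T}. \<forall>x. (\<Sum>v\<in>\<Lambda>1. q v t x *\<^sub>R v) = 0) \<and>
    (\<forall>t\<in>{0..T}. \<forall>x. c t x \<ge> c0) \<and>
    structural1 T h0 \<Lambda>1 \<tau> \<tau>0 e q p c \<delta> K m \<and>
    structural2 T h0 \<Lambda>1 \<tau> \<tau>0 e q p c \<delta> K m \<and>
    l \<le> m \<and>
    (case_i m k l \<and> expansion_coeffs T \<Lambda>1 q p c f g m 3 k U \<or>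
     case_ii T \<Lambda>1 q m k l \<and> expansion_coeffs T \<Lambda>1 q p c f g m 2 k U \<or>
     case_iii T \<Lambda>1 q p m k l \<and> expansion_coeffs T \<Lambda>1 q p c f g m 2 k U) \<and>
    (\<forall>h\<in>{0<..h0}. fd_solution T \<Lambda>1 q p c f g h (u h))
    \<longrightarrow>
    (\<exists>r :: real \<Rightarrow> real \<Rightarrow> real^'d \<Rightarrow> real. \<forall>h\<in>{0<..h0}. \<forall>\<alpha>. mi_order \<alpha> \<le> l \<longrightarrow>
       (\<forall>t\<in>{0..T}. has_gen_deriv \<alpha> (u h t) \<and> has_gen_deriv \<alpha> (r h t)) \<and>
       continuous_on ({0..T} \<times> UNIV) (\<lambda>(t, x). gen_deriv \<alpha> (u h t) x) \<and>
       (\<forall>t\<in>{0..T}. \<forall>x.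
          gen_deriv \<alpha> (u h t) x = gen_deriv \<alpha> (U 0 t) x
            + (\<Sum>j=1..k. h ^ j / fact j * gen_deriv \<alpha> (U j t) x)
            + h ^ (k + 1) * gen_deriv \<alpha> (r h t) x \<and>
          \<bar>gen_deriv \<alpha> (r h t) x\<bar> \<le> N * (norm_B T m f + norm_B T m (\<lambda>_. g)))) \<and>
    (case_iii T \<Lambda>1 q p m k l \<longrightarrow> (\<forall>j\<in>{1..k}. odd j \<longrightarrow> (\<forall>t\<in>{0..T}. \<forall>x. U j t x = 0)))"
\<comment> \<open>The weight bound \<open>W2\<close> is expressed through \<open>size1\<tau>\<close>
  and \<tau>0, so that the witness is fixed before \<open>T\<close>, \<open>h0\<close>, the
  directions and the coefficients.\<close>
proof (rule exI[of _ "Ncst (real CARD('d)) m \<delta> K \<tau>0 c0 size1 ((real CARD('d))\<^sup>2 * size1\<tau>\<^sup>2 + real CARD('d) * \<tau>0\<^sup>2) (\<Sum>k\<le>m. \<bar>M k\<bar>)"],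
  intro allI impI, elim conjE, rule expansion_main)
 fix T h0 :: real and V :: "(real^'d) set" and \<tau> :: "'d fn" and e :: "'d => real^'d"
  and q p :: "real^'d => real => 'd fn" and c f :: "real => 'd fn" and g :: "'d fn"
 assume "T > 0" "h0 > 0" "finite V" "\<forall>v\<in>V. \<tau> v >= 0" "inj e" "range e \<inter> V = {}"
  "sqrt (\<Sum>v\<in>V. (norm v)\<^sup>2) = size1" "sqrt (\<Sum>v\<in>V. (norm (\<tau> v *\<^sub>R v))\<^sup>2) = size1\<tau>"
  "\<forall>v\<in>V. borel_on {0..} (q v) \<and> borel_on {0..} (p v) \<and> (\<forall>t\<ge>0. \<forall>x. q v t x >= 0)" "borel_on {0..} c"
  "regularity T V q p c f g m M"
  "\<forall>h\<in>{0<..h0}. \<forall>v\<in>V. \<forall>t\<in>{0..T}. \<forall>x. q v t x + h * p v t x >= 0"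
  "\<forall>t\<in>{0..T}. \<forall>x. (\<Sum>v\<in>V. q v t x *\<^sub>R v) = 0" "\<forall>t\<in>{0..T}. \<forall>x. c t x >= c0"
  "structural1 T h0 V \<tau> \<tau>0 e q p c \<delta> K m" "structural2 T h0 V \<tau> \<tau>0 e q p c \<delta> K m"
 then show "problem T h0 V \<tau> \<tau>0 e q p c \<delta> K c0 size1
   ((real CARD('d))\<^sup>2 * size1\<tau>\<^sup>2 + real CARD('d) * \<tau>0\<^sup>2) (\<Sum>k\<le>m. \<bar>M k\<bar>) m"
  using assms by (intro problemI[where f=f and g=g]) auto
qed auto

end
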